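(* Let $k\ge 2$. Let $U=\{u,\partial_t u\}$, where $u$ is the (sufficiently regular) solution of the wave problem, let $U_{\tau,h}$ be the fully discrete solution with initial value $U_{0,h}:=\{R_h u_0,R_h u_1\}$, and let $L_\tau U_{\tau,h}$ be its lifting. Then the error $\widetilde E(t)=\{\widetilde e^{\,0}(t),\widetilde e^{\,1}(t)\}:=U(t)-L_\tau U_{\tau,h}(t)$ satisfies, for all $t\in\bar I$, $$\|\widetilde e^{\,0}(t)\|+\|\widetilde e^{\,1}(t)\|\lesssim \tau^{k+2}+h^{r+1}$$ and $$\|\nabla\widetilde e^{\,0}(t)\|\lesssim\tau^{k+2}+h^{r}.$$ Moreover, $$\|\widetilde e^{\,0}\|_{L^2(I;H)}+\|\widetilde e^{\,1}\|_{L^2(I;H)}\lesssim\tau^{k+2}+h^{r+1}\qquad\text{and}\qquad \|\nabla\widetilde e^{\,0}\|_{L^2(I;H)}\lesssim\tau^{k+2}+h^{r}.$$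
   Context: Setting. $\Omega\subset\mathbb R^d$, $d\in\{2,3\}$, is a bounded polygonal or polyhedral domain, $T>0$, $I=(0,T]$, $\bar I=[0,T]$, $H=L^2(\Omega)$, $V=H^1_0(\Omega)$. $\langle\cdot,\cdot\rangle$ and $\|\cdot\|$ are the inner product and norm of $L^2(\Omega)$, and $\langle\!\langle\cdot,\cdot\rangle\!\rangle$ is the inner product of $(L^2(\Omega))^2$. The wave problem is $\partial_t^2u-\Delta u=f$ in $\Omega\times(0,T]$, $u=0$ on $\partial\Omega\times(0,T]$, $u(\cdot,0)=u_0$, $\partial_tu(\cdot,0)=u_1$ in $\Omega$, with $f\in C^1([0,T];H)$. Put $F=\{0,f\}$. Regularity convention. The solution $u$ is assumed to satisfy all regularity conditions required by the analysis (smooth enough in time and space, depending on $k$ and $r$); this includes the corresponding implied assumptions on $f,u_0,u_1$ and $\partial\Omega$, so that in particular the standard approximation property $\|w-R_hw\|_{H^m(\Omega)}\le C h^{r+1-m}\|w\|_{H^{r+1}(\Omega)}$, $m\in\{0,1\}$ ($H^0=L^2$), of the elliptic projection $R_h$ defined below is available. The notation $a\lesssim b$ means $a\le Cb$ with a constant $C$ independent of the sizes of the space and time meshes; $C$ may depend on the shape regularity of the space mesh, the polynomial degrees $k,r$, and the data (including $\Omega,T$, and hence the exact solution). Time discretization. $0=t_0<t_1<\dots<t_N=T$, $I_n=(t_{n-1},t_n]$, $\tau_n=t_n-t_{n-1}$, $\tau=\max_n\tau_n$. $\mathbb P_k(I_n;B)$ is the space of polynomials in $t$ of degree at most $k$ with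 coefficients in $B$; $X_\tau^k(B)=\{w\in C(\bar I;B): w|_{I_n}\in\mathbb P_k(I_n;B)\ \forall n\}$. Values (also of derivatives) of $w|_{I_n}$ at the endpoints of $I_n$ are one-sided limits from the interior of $I_n$. $t_{n-1}=t_{n,0}<\dots<t_{n,k}=t_n$ are the $(k+1)$ Gauss–Lobatto points on $\bar I_n$ and $Q_n(g)=\frac{\tau_n}{2}\sum_{\mu=0}^k\hat\omega_\mu\, g|_{I_n}(t_{n,\mu})$ is the Gauss–Lobatto quadrature formula ($\hat\omega_\mu$: weights on $[-1,1]$). Space discretization. $\mathcal T_h$ is a shape-regular mesh of $\Omega$ of quadrilateral or hexahedral elements with mesh size $h$, and $V_h=\{v_h\in C(\bar\Omega): v_h|_K\in\mathbb Q_r(K)\ \forall K\in\mathcal T_h\}\cap H^1_0(\Omega)$, where $\mathbb Q_r(K)$ consists of the functions obtained via the reference mapping from polynomials of degree at most $r$ in each variable. $P_h:H\to V_h$ is the $L^2$-projection, $\mathcal P_h$ is its componentwise version; $R_h:V\to V_h$ is the elliptic projection, $\langle\nabla R_hw,\nabla v_h\rangle=\langle\nabla w,\nabla v_h\rangle$ for all $v_h\in V_h$. $A_h:V\to V_h$ is given by $\langle A_hw,v_h\rangle=\langle\nabla w,\nabla v_h\rangle$ for all $v_h\in V_h$, and $\mathcal A_h\{w^0,w^1\}:=\{-w^1,A_hw^0\}$. Fully discrete solution. Given $U_{0,h}\in V_h^2$, $U_{\tau,h}=\{u^0_{\tau,h},u^1_{\tau,h}\}\in(X^k_\tau(V_h))^2$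 satisfies $U_{\tau,h}(0)=U_{0,h}$ and, for $n=1,\dots,N$, $$\int_{I_n}\big(\langle\!\langle\partial_tU_{\tau,h},V_{\tau,h}\rangle\!\rangle+\langle\!\langle\mathcal A_hU_{\tau,h},V_{\tau,h}\rangle\!\rangle\big)\,dt=Q_n(\langle\!\langle F,V_{\tau,h}\rangle\!\rangle)\quad\forall V_{\tau,h}\in(\mathbb P_{k-1}(I_n;V_h))^2.$$ Lifting. Let $\vartheta_n\in\mathbb P_{k+1}(\bar I_n;\mathbb R)$ with $\vartheta_n(t_{n,\mu})=0$ for $\mu=0,\dots,k$ and $\vartheta_n'(t_{n-1})=1$. Acting componentwise, $L_\tau U_{\tau,h}(0)=U_{\tau,h}(0)$ and $L_\tau U_{\tau,h}(t)=U_{\tau,h}(t)-c_{n-1}\vartheta_n(t)$ for $t\in I_n$, where $\partial_tL_\tau U_{\tau,h}(0):=\mathcal P_hF(0)-\mathcal A_hU_{0,h}$, $c_0=\partial_tU_{\tau,h}|_{I_1}(0)-\partial_tL_\tau U_{\tau,h}(0)$ and $c_{n-1}=\partial_tU_{\tau,h}|_{I_n}(t_{n-1})-\partial_tL_\tau U_{\tau,h}|_{I_{n-1}}(t_{n-1})$ for $n>1$. Then $L_\tau U_{\tau,h}\in C^1(\bar I;V_h)^2$. *)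

theory Defs
  imports "HOL-Analysis.Analysis" "HOL-Computational_Algebra.Polynomial"
begin

section \<open>Function spaces on a domain\<close>

text \<open>Elements of \<open>L\<^sup>2(\<Omega>)\<close> and of the Sobolev spaces are represented by functions on the whole
  space that are considered on \<open>\<Omega>\<close> only, up to null sets; the norms below are therefore
  seminorms on representatives.\<close>

type_synonym 'n field = "real^'n \<Rightarrow> real"

definition L2 :: "(real^'n::finite) set \<Rightarrow> 'n field set" where
  "L2 \<Omega> = {w. w \<in> borel_measurable (lebesgue_on \<Omega>) \<and> integrable (lebesgue_on \<Omega>) (\<lambda>x. (w x)\<^sup>2)}"

definition l2_inner :: "(real^'n::finite) set \<Rightarrow> (real^'n \<Rightarrow> 'b::real_inner) \<Rightarrow> (real^'n \<Rightarrow> 'b) \<Rightarrow> real" where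
  "l2_inner \<Omega> v w = (LINT x|lebesgue_on \<Omega>. v x \<bullet> w x)"

definition l2_norm :: "(real^'n::finite) set \<Rightarrow> (real^'n \<Rightarrow> 'b::real_inner) \<Rightarrow> real" where
  "l2_norm \<Omega> w = sqrt (l2_inner \<Omega> w w)"

definition l2_inner2 :: "(real^'n::finite) set \<Rightarrow> 'n field \<times> 'n field \<Rightarrow> 'n field \<times> 'n field \<Rightarrow> real" where
  "l2_inner2 \<Omega> V W = l2_inner \<Omega> (fst V) (fst W) + l2_inner \<Omega> (snd V) (snd W)"

definition pderivative :: "'n::finite \<Rightarrow> 'n field \<Rightarrow> 'n field" where
  "pderivative i \<phi> x = frechet_derivative \<phi> (at x) (axis i 1)"

definition iter_pderivative :: "'n::finite list \<Rightarrow> 'n field \<Rightarrow> 'n field" where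
  "iter_pderivative is \<phi> = foldr pderivative is \<phi>"

text \<open>The space \<open>C\<^sub>c\<^sup>\<infinity>(\<Omega>)\<close>, extended by zero.\<close>

definition test_functions :: "(real^'n::finite) set \<Rightarrow> 'n field set" where
  "test_functions \<Omega> = {\<phi>. (\<forall>is x. iter_pderivative is \<phi> differentiable (at x)) \<and>
     (\<exists>K. compact K \<and> K \<subseteq> \<Omega> \<and> (\<forall>x. x \<notin> K \<longrightarrow> \<phi> x = 0))}"

definition has_weak_derivative ::
  "(real^'n::finite) set \<Rightarrow> 'n list \<Rightarrow> 'n field \<Rightarrow> 'n field \<Rightarrow> bool" where
  "has_weak_derivative \<Omega> is w g \<longleftrightarrow> (\<forall>\<phi>\<in>test_functions \<Omega>.
     l2_inner \<Omega> w (iter_pderivative is \<phi>) = (-1) ^ length is * l2_inner \<Omega> g \<phi>)"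

definition weak_derivative :: "(real^'n::finite) set \<Rightarrow> 'n list \<Rightarrow> 'n field \<Rightarrow> 'n field" where
  "weak_derivative \<Omega> is w = (SOME g. g \<in> L2 \<Omega> \<and> has_weak_derivative \<Omega> is w g)"

definition grad :: "(real^'n::finite) set \<Rightarrow> 'n field \<Rightarrow> real^'n \<Rightarrow> real^'n" where
  "grad \<Omega> w x = (\<chi> i. weak_derivative \<Omega> [i] w x)"

definition laplacian :: "(real^'n::finite) set \<Rightarrow> 'n field \<Rightarrow> 'n field" where
  "laplacian \<Omega> w x = (\<Sum>i\<in>UNIV. weak_derivative \<Omega> [i, i] w x)"

text \<open>The space \<open>H\<^sup>m(\<Omega>)\<close>. Derivatives of order \<open>j\<close> are indexed by \<open>j\<close>-tuples of coordinates, so the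
  norm is \<open>(\<Sum>\<^bsub>j\<le>m\<^esub> \<parallel>\<nabla>\<^sup>j w\<parallel>\<^sup>2)\<^bsup>1/2\<^esup>\<close> with the Frobenius norm of the tensor \<open>\<nabla>\<^sup>j w\<close>.\<close>

definition Sobolev :: "(real^'n::finite) set \<Rightarrow> nat \<Rightarrow> 'n field set" where
  "Sobolev \<Omega> m = {w \<in> L2 \<Omega>. \<forall>is. length is \<le> m \<longrightarrow> (\<exists>g\<in>L2 \<Omega>. has_weak_derivative \<Omega> is w g)}"

definition Sobolev_norm :: "(real^'n::finite) set \<Rightarrow> nat \<Rightarrow> 'n field \<Rightarrow> real" where
  "Sobolev_norm \<Omega> m w = sqrt (\<Sum>is | length is \<le> m. (l2_norm \<Omega> (weak_derivative \<Omega> is w))\<^sup>2)"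

definition H10 :: "(real^'n::finite) set \<Rightarrow> 'n field set" where
  "H10 \<Omega> = {w \<in> Sobolev \<Omega> 1. \<forall>\<epsilon>>0. \<exists>\<phi>\<in>test_functions \<Omega>. Sobolev_norm \<Omega> 1 (w - \<phi>) < \<epsilon>}"

definition polyhedral_domain :: "(real^'n::finite) set \<Rightarrow> bool" where
  "polyhedral_domain \<Omega> \<longleftrightarrow> open \<Omega> \<and> connected \<Omega> \<and> bounded \<Omega> \<and> \<Omega> \<noteq> {} \<and>
     (\<exists>\<P>. finite \<P> \<and> (\<forall>P\<in>\<P>. polytope P \<and> aff_dim P = int CARD('n) - 1) \<and> frontier \<Omega> = \<Union>\<P>)"


section \<open>Functions of time with values in a function space\<close>

definition continuous_in ::
  "'n field set \<Rightarrow> ('n field \<Rightarrow> real) \<Rightarrow> real set \<Rightarrow> (real \<Rightarrow> 'n field) \<Rightarrow> bool" where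
  "continuous_in B nrm S w \<longleftrightarrow>
     (\<forall>t\<in>S. w t \<in> B \<and> ((\<lambda>s. nrm (w s - w t)) \<longlongrightarrow> 0) (at t within S))"

definition has_time_derivative ::
  "'n field set \<Rightarrow> ('n field \<Rightarrow> real) \<Rightarrow> real set \<Rightarrow> (real \<Rightarrow> 'n field) \<Rightarrow> (real \<Rightarrow> 'n field) \<Rightarrow> bool" where
  "has_time_derivative B nrm S w w' \<longleftrightarrow>
     (\<forall>t\<in>S. w t \<in> B \<and> w' t \<in> B \<and>
       ((\<lambda>s. nrm (\<lambda>x. (w s x - w t x) / (s - t) - w' t x)) \<longlongrightarrow> 0) (at t within S))"

text \<open>\<open>C_in B nrm S m\<close> is the space \<open>C\<^sup>m(S; B)\<close>.\<close>

primrec C_in ::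
  "'n field set \<Rightarrow> ('n field \<Rightarrow> real) \<Rightarrow> real set \<Rightarrow> nat \<Rightarrow> (real \<Rightarrow> 'n field) \<Rightarrow> bool" where
  "C_in B nrm S 0 w \<longleftrightarrow> continuous_in B nrm S w"
| "C_in B nrm S (Suc m) w \<longleftrightarrow> (\<exists>w'. has_time_derivative B nrm S w w' \<and> C_in B nrm S m w')"

text \<open>\<open>u\<close> is a strong solution of the wave problem and \<open>v\<close> is its time derivative.\<close>

definition wave_solution ::
  "(real^'n::finite) set \<Rightarrow> real \<Rightarrow> (real \<Rightarrow> 'n field) \<Rightarrow> 'n field \<Rightarrow> 'n field \<Rightarrow>
   (real \<Rightarrow> 'n field) \<Rightarrow> (real \<Rightarrow> 'n field) \<Rightarrow> bool" where
  "wave_solution \<Omega> T f u0 u1 u v \<longleftrightarrow>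
     has_time_derivative (L2 \<Omega>) (l2_norm \<Omega>) {0..T} u v \<and>
     (\<exists>a. has_time_derivative (L2 \<Omega>) (l2_norm \<Omega>) {0..T} v a \<and>
       (\<forall>t\<in>{0<..T}. u t \<in> Sobolev \<Omega> 2 \<and>
          (AE x in lebesgue_on \<Omega>. a t x - laplacian \<Omega> (u t) x = f t x))) \<and>
     (\<forall>t\<in>{0<..T}. u t \<in> H10 \<Omega>) \<and>
     (AE x in lebesgue_on \<Omega>. u 0 x = u0 x) \<and>
     (AE x in lebesgue_on \<Omega>. v 0 x = u1 x)"

definition L2_time :: "(real^'n::finite) set \<Rightarrow> real \<Rightarrow> (real \<Rightarrow> real^'n \<Rightarrow> 'b::real_inner) \<Rightarrow> bool" where
  "L2_time \<Omega> T w \<longleftrightarrow> integrable (lebesgue_on {0<..T}) (\<lambda>t. (l2_norm \<Omega> (w t))\<^sup>2)"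

definition L2_time_norm :: "(real^'n::finite) set \<Rightarrow> real \<Rightarrow> (real \<Rightarrow> real^'n \<Rightarrow> 'b::real_inner) \<Rightarrow> real" where
  "L2_time_norm \<Omega> T w = sqrt (LINT t|lebesgue_on {0<..T}. (l2_norm \<Omega> (w t))\<^sup>2)"


section \<open>Space discretization\<close>

definition ref_cube :: "(real^'n::finite) set" where
  "ref_cube = cbox 0 1"

definition Q_ref :: "nat \<Rightarrow> 'n::finite field set" where
  "Q_ref r = {q. \<exists>c. \<forall>x. q x = (\<Sum>\<alpha> | \<forall>i. \<alpha> i \<le> r. c \<alpha> * (\<Prod>i\<in>UNIV. (x $ i) ^ \<alpha> i))}"

text \<open>A mesh of quadrilaterals or hexahedra is given by the set of its reference mappings, which
  are \<open>d\<close>-linear; the element belonging to \<open>F\<close> is \<open>F ` ref_cube\<close>. Two distinct elements meet in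
  a common proper face, which may be empty.\<close>

definition mesh :: "(real^'n::finite) set \<Rightarrow> (real^'n \<Rightarrow> real^'n) set \<Rightarrow> bool" where
  "mesh \<Omega> \<T> \<longleftrightarrow> finite \<T> \<and> \<T> \<noteq> {} \<and>
     (\<forall>F\<in>\<T>. (\<forall>j. (\<lambda>x. F x $ j) \<in> Q_ref 1) \<and> inj_on F ref_cube) \<and>
     (\<Union>F\<in>\<T>. F ` ref_cube) = closure \<Omega> \<and>
     (\<forall>F\<in>\<T>. \<forall>G\<in>\<T>. F \<noteq> G \<longrightarrow>
       (\<exists>S S'. S face_of ref_cube \<and> S \<noteq> ref_cube \<and> S' face_of ref_cube \<and> S' \<noteq> ref_cube \<and>
          F ` ref_cube \<inter> G ` ref_cube = F ` S \<and> F ` S = G ` S'))"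

definition mesh_size :: "(real^'n::finite \<Rightarrow> real^'n) set \<Rightarrow> real" where
  "mesh_size \<T> = Max ((\<lambda>F. diameter (F ` ref_cube)) ` \<T>)"

text \<open>With \<open>h\<^sub>K\<close> the diameter of \<open>K\<close>, the condition says \<open>\<parallel>DF\<^sub>K\<parallel> \<le> \<sigma> h\<^sub>K\<close> and
  \<open>\<parallel>(DF\<^sub>K)\<^bsup>-1\<^esup>\<parallel> \<le> \<sigma> / h\<^sub>K\<close> on the reference cube.\<close>

definition shape_regular :: "real \<Rightarrow> (real^'n::finite \<Rightarrow> real^'n) set \<Rightarrow> bool" where
  "shape_regular \<sigma> \<T> \<longleftrightarrow> (\<forall>F\<in>\<T>. \<forall>x\<in>ref_cube. \<forall>y.
     norm (frechet_derivative F (at x) y) \<le> \<sigma> * diameter (F ` ref_cube) * norm y \<and>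
     diameter (F ` ref_cube) * norm y \<le> \<sigma> * norm (frechet_derivative F (at x) y))"

text \<open>Functions on \<open>closure \<Omega>\<close> are extended by zero, so that a finite element function is
  determined as a function on the whole space.\<close>

definition V_h :: "(real^'n::finite) set \<Rightarrow> (real^'n \<Rightarrow> real^'n) set \<Rightarrow> nat \<Rightarrow> 'n field set" where
  "V_h \<Omega> \<T> r = {v. continuous_on (closure \<Omega>) v \<and> (\<forall>x. x \<notin> closure \<Omega> \<longrightarrow> v x = 0) \<and>
     (\<forall>F\<in>\<T>. \<exists>q\<in>Q_ref r. \<forall>y\<in>ref_cube. v (F y) = q y)} \<inter> H10 \<Omega>"

text \<open>The following operators take the finite element space \<open>Vh\<close> as an argument.\<close>

definition P_h :: "(real^'n::finite) set \<Rightarrow> 'n field set \<Rightarrow> 'n field \<Rightarrow> 'n field" where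
  "P_h \<Omega> Vh w = (SOME p. p \<in> Vh \<and> (\<forall>v\<in>Vh. l2_inner \<Omega> p v = l2_inner \<Omega> w v))"

definition R_h :: "(real^'n::finite) set \<Rightarrow> 'n field set \<Rightarrow> 'n field \<Rightarrow> 'n field" where
  "R_h \<Omega> Vh w = (SOME p. p \<in> Vh \<and>
     (\<forall>v\<in>Vh. l2_inner \<Omega> (grad \<Omega> p) (grad \<Omega> v) = l2_inner \<Omega> (grad \<Omega> w) (grad \<Omega> v)))"

definition A_h :: "(real^'n::finite) set \<Rightarrow> 'n field set \<Rightarrow> 'n field \<Rightarrow> 'n field" where
  "A_h \<Omega> Vh w = (SOME p. p \<in> Vh \<and>
     (\<forall>v\<in>Vh. l2_inner \<Omega> p v = l2_inner \<Omega> (grad \<Omega> w) (grad \<Omega> v)))"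

definition P_h2 :: "(real^'n::finite) set \<Rightarrow> 'n field set \<Rightarrow> 'n field \<times> 'n field \<Rightarrow> 'n field \<times> 'n field" where
  "P_h2 \<Omega> Vh W = (P_h \<Omega> Vh (fst W), P_h \<Omega> Vh (snd W))"

definition A_h2 :: "(real^'n::finite) set \<Rightarrow> 'n field set \<Rightarrow> 'n field \<times> 'n field \<Rightarrow> 'n field \<times> 'n field" where
  "A_h2 \<Omega> Vh W = (- snd W, A_h \<Omega> Vh (fst W))"

definition elliptic_approximation ::
  "(real^'n::finite) set \<Rightarrow> (real^'n \<Rightarrow> real^'n) set \<Rightarrow> nat \<Rightarrow> real \<Rightarrow> bool" where
  "elliptic_approximation \<Omega> \<T> r C \<longleftrightarrow> (\<forall>w \<in> H10 \<Omega> \<inter> Sobolev \<Omega> (r + 1). \<forall>m\<in>{0, 1}.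
     Sobolev_norm \<Omega> m (w - R_h \<Omega> (V_h \<Omega> \<T> r) w)
       \<le> C * mesh_size \<T> ^ (r + 1 - m) * Sobolev_norm \<Omega> (r + 1) w)"


section \<open>Time discretization\<close>

definition time_mesh :: "real \<Rightarrow> nat \<Rightarrow> (nat \<Rightarrow> real) \<Rightarrow> bool" where
  "time_mesh T N t \<longleftrightarrow> N \<ge> 1 \<and> t 0 = 0 \<and> t N = T \<and> (\<forall>n<N. t n < t (Suc n))"

definition step_size :: "nat \<Rightarrow> (nat \<Rightarrow> real) \<Rightarrow> real" where
  "step_size N t = Max ((\<lambda>n. t n - t (n - 1)) ` {1..N})"

text \<open>The Gauss--Lobatto formula with \<open>k + 1\<close> points on \<open>[-1, 1]\<close>: both endpoints are nodes and
  the degree of exactness is \<open>2k - 1\<close>. This determines nodes and weights for \<open>k \<ge> 1\<close>.\<close>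

definition gauss_lobatto :: "nat \<Rightarrow> (nat \<Rightarrow> real) \<Rightarrow> (nat \<Rightarrow> real) \<Rightarrow> bool" where
  "gauss_lobatto k \<xi> \<omega> \<longleftrightarrow> \<xi> 0 = -1 \<and> \<xi> k = 1 \<and> strict_mono_on {..k} \<xi> \<and>
     (\<forall>p :: real poly. degree p \<le> 2 * k - 1 \<longrightarrow>
        (\<Sum>\<mu>\<le>k. \<omega> \<mu> * poly p (\<xi> \<mu>)) = integral {-1..1} (poly p))"

definition gl_point :: "(nat \<Rightarrow> real) \<Rightarrow> (nat \<Rightarrow> real) \<Rightarrow> nat \<Rightarrow> nat \<Rightarrow> real" where
  "gl_point \<xi> t n \<mu> = (t (n - 1) + t n) / 2 + (t n - t (n - 1)) / 2 * \<xi> \<mu>"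

text \<open>This is used only for functions that are continuous on the closed interval, where the one-sided
  limit at the left endpoint is the value.\<close>

definition Q_n :: "nat \<Rightarrow> (nat \<Rightarrow> real) \<Rightarrow> (nat \<Rightarrow> real) \<Rightarrow> (nat \<Rightarrow> real) \<Rightarrow> nat \<Rightarrow> (real \<Rightarrow> real) \<Rightarrow> real" where
  "Q_n k \<xi> \<omega> t n g = (t n - t (n - 1)) / 2 * (\<Sum>\<mu>\<le>k. \<omega> \<mu> * g (gl_point \<xi> t n \<mu>))"

text \<open>Polynomials in time of degree at most \<open>k\<close> with coefficients in \<open>B\<close>.\<close>

definition time_polys :: "nat \<Rightarrow> 'n field set \<Rightarrow> (real \<Rightarrow> 'n field) set" where
  "time_polys k B = {w. \<exists>c. (\<forall>j\<le>k. c j \<in> B) \<and> (\<forall>s x. w s x = (\<Sum>j\<le>k. s ^ j * c j x))}"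

definition X_tau ::
  "(real^'n::finite) set \<Rightarrow> real \<Rightarrow> nat \<Rightarrow> (nat \<Rightarrow> real) \<Rightarrow> nat \<Rightarrow> 'n field set \<Rightarrow> (real \<Rightarrow> 'n field) set" where
  "X_tau \<Omega> T N t k B = {w. continuous_in B (l2_norm \<Omega>) {0..T} w \<and>
     (\<forall>n\<in>{1..N}. \<exists>p\<in>time_polys k B. \<forall>s\<in>{t (n - 1)<..t n}. w s = p s)}"

text \<open>The time derivative of a piecewise polynomial in time, taken pointwise in space, and its
  one-sided limits at the time mesh points.\<close>

definition dt :: "(real \<Rightarrow> 'n field) \<Rightarrow> real \<Rightarrow> 'n field" where
  "dt w s x = deriv (\<lambda>\<sigma>. w \<sigma> x) s"

definition dt_right :: "(real \<Rightarrow> 'n field) \<Rightarrow> real \<Rightarrow> 'n field" where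
  "dt_right w s x = Lim (at_right s) (\<lambda>\<sigma>. dt w \<sigma> x)"

definition dt_left :: "(real \<Rightarrow> 'n field) \<Rightarrow> real \<Rightarrow> 'n field" where
  "dt_left w s x = Lim (at_left s) (\<lambda>\<sigma>. dt w \<sigma> x)"


section \<open>Fully discrete solution and lifting\<close>

definition fully_discrete_solution ::
  "(real^'n::finite) set \<Rightarrow> real \<Rightarrow> 'n field set \<Rightarrow> nat \<Rightarrow> (nat \<Rightarrow> real) \<Rightarrow> (nat \<Rightarrow> real) \<Rightarrow>
   nat \<Rightarrow> (nat \<Rightarrow> real) \<Rightarrow> (real \<Rightarrow> 'n field) \<Rightarrow> 'n field \<times> 'n field \<Rightarrow>
   (real \<Rightarrow> 'n field \<times> 'n field) \<Rightarrow> bool" where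
  "fully_discrete_solution \<Omega> T Vh k \<xi> \<omega> N t f U0h U \<longleftrightarrow>
     (\<lambda>s. fst (U s)) \<in> X_tau \<Omega> T N t k Vh \<and>
     (\<lambda>s. snd (U s)) \<in> X_tau \<Omega> T N t k Vh \<and>
     U 0 = U0h \<and>
     (\<forall>n\<in>{1..N}. \<forall>V0\<in>time_polys (k - 1) Vh. \<forall>V1\<in>time_polys (k - 1) Vh.
        integral {t (n - 1)..t n} (\<lambda>s.
            l2_inner2 \<Omega> (dt (\<lambda>s. fst (U s)) s, dt (\<lambda>s. snd (U s)) s) (V0 s, V1 s)
          + l2_inner2 \<Omega> (A_h2 \<Omega> Vh (U s)) (V0 s, V1 s))
        = Q_n k \<xi> \<omega> t n (\<lambda>s. l2_inner2 \<Omega> (\<lambda>x. 0, f s) (V0 s, V1 s)))"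

definition lifting_polys ::
  "nat \<Rightarrow> (nat \<Rightarrow> real) \<Rightarrow> nat \<Rightarrow> (nat \<Rightarrow> real) \<Rightarrow> (nat \<Rightarrow> real poly) \<Rightarrow> bool" where
  "lifting_polys k \<xi> N t \<theta> \<longleftrightarrow> (\<forall>n\<in>{1..N}. degree (\<theta> n) \<le> k + 1 \<and>
     (\<forall>\<mu>\<le>k. poly (\<theta> n) (gl_point \<xi> t n \<mu>) = 0) \<and> poly (pderiv (\<theta> n)) (t (n - 1)) = 1)"

text \<open>The lifting of one component \<open>w\<close>, with \<open>d\<close> the prescribed time derivative at \<open>0\<close>.
  \<open>lift_slope t \<theta> w d n\<close> is the time derivative of the lifting at \<open>t n\<close>, taken from the left for
  \<open>n \<ge> 1\<close>, and \<open>lift_coeff t \<theta> w d n\<close> is the function \<open>c\<^sub>n\<close>, which is used on the interval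
  \<open>(t n, t (n + 1)]\<close>.\<close>

primrec lift_slope ::
  "(nat \<Rightarrow> real) \<Rightarrow> (nat \<Rightarrow> real poly) \<Rightarrow> (real \<Rightarrow> 'n field) \<Rightarrow> 'n field \<Rightarrow> nat \<Rightarrow> 'n field" where
  "lift_slope t \<theta> w d 0 = d"
| "lift_slope t \<theta> w d (Suc n) =
     dt_left (\<lambda>s x. w s x - (dt_right w (t n) - lift_slope t \<theta> w d n) x * poly (\<theta> (Suc n)) s) (t (Suc n))"

definition lift_coeff ::
  "(nat \<Rightarrow> real) \<Rightarrow> (nat \<Rightarrow> real poly) \<Rightarrow> (real \<Rightarrow> 'n field) \<Rightarrow> 'n field \<Rightarrow> nat \<Rightarrow> 'n field" where
  "lift_coeff t \<theta> w d n = dt_right w (t n) - lift_slope t \<theta> w d n"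

definition lift_comp ::
  "(nat \<Rightarrow> real) \<Rightarrow> (nat \<Rightarrow> real poly) \<Rightarrow> (real \<Rightarrow> 'n field) \<Rightarrow> 'n field \<Rightarrow> real \<Rightarrow> 'n field" where
  "lift_comp t \<theta> w d s = (if s \<le> 0 then w s
     else (let n = (LEAST n. s \<le> t n) in (\<lambda>x. w s x - lift_coeff t \<theta> w d (n - 1) x * poly (\<theta> n) s)))"

definition lifting ::
  "(real^'n::finite) set \<Rightarrow> 'n field set \<Rightarrow> (nat \<Rightarrow> real) \<Rightarrow> (nat \<Rightarrow> real poly) \<Rightarrow> (real \<Rightarrow> 'n field) \<Rightarrow>
   (real \<Rightarrow> 'n field \<times> 'n field) \<Rightarrow> real \<Rightarrow> 'n field \<times> 'n field" where
  "lifting \<Omega> Vh t \<theta> f U s =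
     (let d = P_h2 \<Omega> Vh (\<lambda>x. 0, f 0) - A_h2 \<Omega> Vh (U 0)
      in (lift_comp t \<theta> (\<lambda>s. fst (U s)) (fst d) s, lift_comp t \<theta> (\<lambda>s. snd (U s)) (snd d) s))"

end

theory Submission
  imports Defs "HOL-Library.Function_Algebras"
begin

text \<open>The finite element space has an \<open>L\<^sup>2\<close>-orthonormal basis of eigenfunctions
  \<open>\<phi>\<close> of the discrete Laplacian, with eigenvalues \<open>\<kappa> \<ge> c >
  0\<close> by the Poincare inequality. In this basis the fully discrete scheme and its lifting
  split into scalar problems for piecewise polynomials in time, one for each mode. If every mode is
  estimated by \<open>\<tau>\<^bsup>k+2\<^esup> A \<phi> + R \<phi>\<close>, where the amplitudes
  \<open>A\<close> and \<open>R\<close> are square summable with \<open>L\<^sup>2\<close>-sums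
  bounded by a constant and by a multiple of \<open>h\<^bsup>r+1\<^esup>\<close>, then Parseval's
  identity gives the distance from the lifted solution to the elliptic projection of the exact
  solution, and the approximation property of the projection gives the rest
  (\<open>error_norms\<close>).

  In one mode, let \<open>w\<^sub>0\<close> and \<open>w\<^sub>1\<close> be the coefficients of the
  elliptic projections of \<open>u\<close> and of its time derivative. They satisfy
  \<open>w\<^sub>0' = w\<^sub>1\<close> and \<open>w\<^sub>1' = f - \<kappa> w\<^sub>0 +
  \<rho>\<close>, where \<open>\<rho>\<close> is a coefficient of the projection error of the second
  time derivative. Replacing \<open>w\<^sub>0\<close> by \<open>w\<^sub>0 - \<rho> /
  \<kappa>\<close> moves this residual into the first equation as \<open>- \<rho>' /
  \<kappa>\<close>. The lifting, on the other hand, solves a differential equation exactly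
  (\<open>lifting_collocation\<close>): its derivative is the discrete solution in the first
  component, and the interpolated source minus \<open>\<kappa>\<close> times the discrete solution
  in the second; the discrete solution is the interpolant of the lifting at the Gauss--Lobatto
  points.

  The order \<open>k + 2\<close> comes from two facts. First, the reference solution is compared not
  with its interpolant, but with the integral of the interpolant of its derivative. For \<open>k
  \<ge> 2\<close> the exactness of the Gauss--Lobatto formula makes this comparison accurate to
  order \<open>k + 2\<close> at all times (\<open>integrated_interp_global_error\<close>), and the
  difference from the lifting has residuals of the same order, apart from that of the projection. An
  energy estimate, in which the coupling of the two components cancels, then gives the order
  \<open>k + 2\<close> at the time nodes (\<open>low_energy\<close>). Secondly, inside a step the
  error is obtained by integrating the differential equation, whose right-hand side contains
  \<open>\<kappa>\<close>. A second energy estimate, stronger by a factor \<open>\<kappa>\<close>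
  and weaker by one order (\<open>high_energy\<close>), controls it uniformly in the mode, and the
  length of the step returns the missing order (\<open>mode_error\<close>). Both estimates use
  stability of the scheme on one step (\<open>interior\<close>, \<open>endpoint\<close>) and a
  Gronwall argument.

  The additional powers of \<open>\<kappa>\<close> in the amplitudes are supplied by regularity in
  space: \<open>\<kappa>\<close> times a coefficient of the elliptic projection is a coefficient of
  the Laplacian of the solution by Green's formula, and Bessel's inequality sums them
  (\<open>\<alpha>_sum\<close>, \<open>\<rho>_sum\<close>). Suprema over time become summable by
  means of one more time derivative (\<open>family_sup_bound\<close>).

  The function spaces are developed from their definitions as far as this argument needs them: the
  fundamental lemma of the calculus of variations, weak derivatives, the Poincare inequality,
  Green's formula, and the passage from time derivatives with values in a function space to
  derivatives of coefficients.\<close>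

section \<open>Integrals of real polynomials\<close>

definition pint :: "real \<Rightarrow> real \<Rightarrow> real poly \<Rightarrow> real" where
  "pint a b p = integral {a..b} (poly p)"

lemma poly_integrable_on [simp]: "poly (p :: real poly) integrable_on {a..b}"
  by (intro integrable_continuous_real continuous_intros)

lemma pint_add: "pint a b (p + q) = pint a b p + pint a b q"
  unfolding pint_def poly_add by (rule integral_add) auto

lemma pint_diff: "pint a b (p - q) = pint a b p - pint a b q"
  unfolding pint_def poly_diff by (rule integral_diff) auto

lemma pint_smult: "pint a b (smult c p) = c * pint a b p"
  unfolding pint_def poly_smult by (rule integral_mult_right)

lemma pint_0 [simp]: "pint a b 0 = 0"
  using pint_smult[of a b 0 0] by simp

lemma pint_pderiv: "a \<le> b \<Longrightarrow> pint a b (pderiv p) = poly p b - poly p a"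
  unfolding pint_def
  by (rule integral_unique, rule fundamental_theorem_of_calculus)
     (auto simp: has_real_derivative_iff_has_vector_derivative[symmetric]
           intro: DERIV_subset[OF poly_DERIV])

lemma pint_nonneg: "(\<And>s. a \<le> s \<Longrightarrow> s \<le> b \<Longrightarrow> 0 \<le> poly p s) \<Longrightarrow> 0 \<le> pint a b p"
  unfolding pint_def by (rule integral_nonneg) auto

lemma pint_mono: "(\<And>s. a \<le> s \<Longrightarrow> s \<le> b \<Longrightarrow> poly p s \<le> poly q s) \<Longrightarrow> pint a b p \<le> pint a b q"
  unfolding pint_def by (rule integral_le) auto

lemma pint_bound:
  assumes "a \<le> b" "\<And>s. a \<le> s \<Longrightarrow> s \<le> b \<Longrightarrow> \<bar>poly p s\<bar> \<le> B"
  shows "\<bar>pint a b p\<bar> \<le> B * (b - a)"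
  using integral_bound[of a b "poly p" B] assms continuous_on_poly[OF continuous_on_id]
  by (auto simp: pint_def)

lemma pint_square_eq_0:
  assumes "a < b" "\<And>s. a \<le> s \<Longrightarrow> s \<le> b \<Longrightarrow> 0 \<le> poly w s" "w \<noteq> 0" "pint a b (w * (p * p)) = 0"
  shows "p = 0"
proof -
  have "\<forall>s\<in>{a..b}. poly (w * (p * p)) s = 0"
    by (subst integral_eq_0_iff[symmetric])
       (use assms in \<open>auto simp: pint_def intro!: continuous_intros\<close>)
  then have "{a..b} \<subseteq> {s. poly (w * (p * p)) s = 0}" by auto
  moreover have "infinite {a..b}" using assms(1) by (simp add: infinite_Icc)
  ultimately have "w * (p * p) = 0" using poly_roots_finite finite_subset by blast
  then show ?thesis using assms(3) by simp
qed

lemma pderiv_sum': "pderiv (sum f A) = (\<Sum>i\<in>A. pderiv (f i :: real poly))"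
  by (induction A rule: infinite_finite_induct) (auto simp: pderiv_add)

text \<open>Each coefficient is divided by its new exponent; the constant term is free and fixes the value at
  \<open>a\<close>.\<close>

lemma poly_antiderivative:
  fixes p :: "real poly"
  shows "\<exists>q. pderiv q = p \<and> degree q \<le> degree p + 1 \<and> poly q a = v"
proof -
  define q0 :: "real poly" where "q0 = (\<Sum>i\<le>degree p. monom (coeff p i / real (Suc i)) (Suc i))"
  have "pderiv q0 = (\<Sum>i\<le>degree p. monom (coeff p i) i)"
    by (simp add: q0_def pderiv_sum' pderiv_monom del: of_nat_Suc)
  then have 1: "pderiv q0 = p" by (simp add: poly_as_sum_of_monoms)
  have 2: "degree q0 \<le> degree p + 1"
    unfolding q0_def by (intro degree_sum_le) (auto intro: order_trans[OF degree_monom_le])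
  define q where "q = q0 + [:v - poly q0 a:]"
  have "pderiv q = p" by (simp add: q_def pderiv_add 1 pderiv_pCons)
  moreover have "degree q \<le> degree p + 1"
    unfolding q_def using 2 by (intro degree_add_le) auto
  moreover have "poly q a = v" by (simp add: q_def)
  ultimately show ?thesis by blast
qed

lemma degree_pderiv_le: "degree (p :: real poly) \<le> Suc n \<Longrightarrow> degree (pderiv p) \<le> n"
  by (simp add: degree_pderiv)

lemma degree_mult_le': "degree (p :: real poly) \<le> m \<Longrightarrow> degree q \<le> n \<Longrightarrow> degree (p * q) \<le> m + n"
  using degree_mult_le[of p q] by linarith

section \<open>Gauss--Lobatto interpolation and quadrature\<close>

locale gauss_lobatto_rule =
  fixes k :: nat and \<xi> \<omega> :: "nat \<Rightarrow> real"
  assumes k: "k \<ge> 2" and gl: "gauss_lobatto k \<xi> \<omega>"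
begin

lemma xi_0: "\<xi> 0 = -1" and xi_k: "\<xi> k = 1" and xi_mono: "strict_mono_on {..k} \<xi>"
  using gl by (auto simp: gauss_lobatto_def)

lemma xi_inj: "inj_on \<xi> {..k}"
  using xi_mono by (rule strict_mono_on_imp_inj_on)

lemma xi_range: "\<mu> \<le> k \<Longrightarrow> -1 \<le> \<xi> \<mu> \<and> \<xi> \<mu> \<le> 1"
proof -
  assume "\<mu> \<le> k"
  then have "\<xi> 0 \<le> \<xi> \<mu>" "\<xi> \<mu> \<le> \<xi> k"
    using strict_mono_on_leD[OF xi_mono, of 0 \<mu>] strict_mono_on_leD[OF xi_mono, of \<mu> k] by auto
  then show ?thesis by (simp add: xi_0 xi_k)
qed

text \<open>The Gauss--Lobatto points of \<open>[a, b]\<close>.\<close>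

definition node :: "real \<Rightarrow> real \<Rightarrow> nat \<Rightarrow> real" where
  "node a b \<mu> = (a + b) / 2 + (b - a) / 2 * \<xi> \<mu>"

lemma node_0: "node a b 0 = a" and node_k: "node a b k = b"
  by (simp_all add: node_def xi_0 xi_k field_simps)

lemma node_range:
  assumes "a \<le> b" "\<mu> \<le> k" shows "a \<le> node a b \<mu>" "node a b \<mu> \<le> b"
proof -
  have "\<bar>(b - a) / 2 * \<xi> \<mu>\<bar> \<le> (b - a) / 2 * 1"
    unfolding abs_mult using assms xi_range[of \<mu>] by (intro mult_mono) auto
  then show "a \<le> node a b \<mu>" "node a b \<mu> \<le> b"
    unfolding node_def by (auto simp: abs_le_iff field_simps)
qed

lemma node_inj: "a < b \<Longrightarrow> inj_on (node a b) {..k}"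
  using xi_inj by (auto simp: inj_on_def node_def)

lemma card_nodes: "a < b \<Longrightarrow> card (node a b ` {..k}) = Suc k"
  by (simp add: card_image node_inj)

lemma poly_eq_by_nodes:
  fixes p q :: "real poly"
  assumes "a < b" "degree p \<le> k" "degree q \<le> k" "\<And>\<mu>. \<mu> \<le> k \<Longrightarrow> poly p (node a b \<mu>) = poly q (node a b \<mu>)"
  shows "p = q"
  by (rule poly_eqI_degree[where A = "node a b ` {..k}"]) (use assms card_nodes in auto)

text \<open>The affine map of \<open>[a, b]\<close> onto the reference interval \<open>[-1, 1]\<close>. All
  interpolation constants are computed there.\<close>

definition to_ref :: "real \<Rightarrow> real \<Rightarrow> real poly" where
  "to_ref a b = [: - (a + b) / (b - a), 2 / (b - a) :]"

lemma poly_to_ref: "a < b \<Longrightarrow> poly (to_ref a b) s = (2 * s - a - b) / (b - a)"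
  by (simp add: to_ref_def diff_divide_distrib add_divide_distrib)

lemma poly_to_ref_node: "a < b \<Longrightarrow> poly (to_ref a b) (node a b \<mu>) = \<xi> \<mu>"
proof -
  assume "a < b"
  have "2 * node a b \<mu> - a - b = (b - a) * \<xi> \<mu>" by (simp add: node_def field_simps)
  with \<open>a < b\<close> show ?thesis by (simp add: poly_to_ref)
qed

lemma to_ref_range:
  assumes "a < b" "a \<le> s" "s \<le> b"
  shows "poly (to_ref a b) s \<in> {-1..1}"
  using assms by (auto simp: poly_to_ref field_simps)

definition lag :: "nat \<Rightarrow> real poly" where
  "lag \<mu> = (\<Prod>\<nu>\<in>{..k} - {\<mu>}. smult (1 / (\<xi> \<mu> - \<xi> \<nu>)) [: - \<xi> \<nu>, 1 :])"

lemma degree_lag: "\<mu> \<le> k \<Longrightarrow> degree (lag \<mu>) \<le> k"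
proof -
  assume "\<mu> \<le> k"
  have "degree (lag \<mu>) \<le> sum (degree \<circ> (\<lambda>\<nu>. smult (1 / (\<xi> \<mu> - \<xi> \<nu>)) [: - \<xi> \<nu>, 1 :])) ({..k} - {\<mu>})"
    unfolding lag_def by (rule degree_prod_sum_le) auto
  also have "\<dots> \<le> (\<Sum>\<nu>\<in>{..k} - {\<mu>}. 1)" by (intro sum_mono) auto
  finally show ?thesis using \<open>\<mu> \<le> k\<close> by simp
qed

lemma poly_lag_xi:
  assumes "\<mu> \<le> k" "\<nu> \<le> k"
  shows "poly (lag \<mu>) (\<xi> \<nu>) = (if \<mu> = \<nu> then 1 else 0)"
proof -
  have *: "poly (lag \<mu>) x = (\<Prod>\<nu>\<in>{..k} - {\<mu>}. (x - \<xi> \<nu>) / (\<xi> \<mu> - \<xi> \<nu>))" for x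
    by (simp add: lag_def poly_prod diff_divide_distrib)
  show ?thesis
  proof (cases "\<mu> = \<nu>")
    case True
    have "(\<Prod>\<nu>\<in>{..k} - {\<mu>}. (\<xi> \<mu> - \<xi> \<nu>) / (\<xi> \<mu> - \<xi> \<nu>)) = 1"
      using xi_inj assms by (intro prod.neutral) (auto simp: inj_on_def)
    then show ?thesis using True * by simp
  next
    case False
    then show ?thesis using assms unfolding * by (auto intro!: prod_zero bexI[of _ \<nu>])
  qed
qed

definition interp :: "real \<Rightarrow> real \<Rightarrow> (real \<Rightarrow> real) \<Rightarrow> real poly" where
  "interp a b g = (\<Sum>\<mu>\<le>k. smult (g (node a b \<mu>)) (pcompose (lag \<mu>) (to_ref a b)))"

lemma degree_interp: "degree (interp a b g) \<le> k"
proof -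
  have "degree (pcompose (lag \<mu>) (to_ref a b)) \<le> k" if "\<mu> \<le> k" for \<mu>
  proof -
    have "degree (to_ref a b) \<le> 1" by (simp add: to_ref_def)
    then have "degree (lag \<mu>) * degree (to_ref a b) \<le> k * 1"
      using degree_lag[OF that] by (intro mult_le_mono)
    then show ?thesis using degree_pcompose_le[of "lag \<mu>" "to_ref a b"] by linarith
  qed
  then show ?thesis unfolding interp_def
    by (intro degree_sum_le) (auto intro: order_trans[OF degree_smult_le])
qed

lemma poly_interp: "a < b \<Longrightarrow> poly (interp a b g) s = (\<Sum>\<mu>\<le>k. g (node a b \<mu>) * poly (lag \<mu>) (poly (to_ref a b) s))"
  by (simp add: interp_def poly_sum poly_pcompose)

lemma poly_interp_node: "a < b \<Longrightarrow> \<mu> \<le> k \<Longrightarrow> poly (interp a b g) (node a b \<mu>) = g (node a b \<mu>)"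
  by (simp add: poly_interp poly_to_ref_node poly_lag_xi if_distrib[of "(*) _"] cong: if_cong)

lemma interp_poly: "a < b \<Longrightarrow> degree p \<le> k \<Longrightarrow> interp a b (poly p) = p"
  by (rule poly_eq_by_nodes[of a b]) (auto simp: degree_interp poly_interp_node)

lemma interp_add: "interp a b (\<lambda>s. f s + g s) = interp a b f + interp a b g"
  by (simp add: interp_def smult_add_left sum.distrib)

lemma interp_diff: "interp a b (\<lambda>s. f s - g s) = interp a b f - interp a b g"
  by (simp add: interp_def smult_diff_left sum_subtractf)

lemma interp_cmult: "interp a b (\<lambda>s. c * f s) = smult c (interp a b f)"
proof -
  have "smult c (\<Sum>\<mu>\<le>k. h \<mu>) = (\<Sum>\<mu>\<le>k. smult c (h \<mu>))" for h :: "nat \<Rightarrow> real poly"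
    by (induction k) (auto simp: smult_add_right)
  then show ?thesis by (simp add: interp_def)
qed

lemma interp_cong: "(\<And>\<mu>. \<mu> \<le> k \<Longrightarrow> f (node a b \<mu>) = g (node a b \<mu>)) \<Longrightarrow> interp a b f = interp a b g"
  by (auto simp: interp_def intro!: sum.cong)

text \<open>The constant bounds the Lagrange basis and its derivatives on the reference interval; the affine map
  to \<open>[a, b]\<close> costs one factor \<open>1 / (b - a)\<close> for the derivative and
  nothing for the values.\<close>

lemma interp_bounds:
  "\<exists>\<Lambda>\<ge>1. \<forall>a b g B. a < b \<longrightarrow> (\<forall>\<mu>\<le>k. \<bar>g (node a b \<mu>)\<bar> \<le> B) \<longrightarrow>
     (\<forall>s\<in>{a..b}. \<bar>poly (interp a b g) s\<bar> \<le> \<Lambda> * B \<and> \<bar>poly (pderiv (interp a b g)) s\<bar> \<le> \<Lambda> * B / (b - a))"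
proof -
  have "\<exists>M. \<forall>x\<in>{-1..1}. \<bar>poly p x\<bar> \<le> M" for p :: "real poly"
  proof -
    have "compact (poly p ` {-1..1})" by (intro compact_continuous_image continuous_intros) auto
    then have "bounded (poly p ` {-1..1})" by (rule compact_imp_bounded)
    then show ?thesis unfolding bounded_iff by auto
  qed
  then obtain M where M: "\<And>p x. x \<in> {-1..1} \<Longrightarrow> \<bar>poly p x\<bar> \<le> M (p :: real poly)" by metis
  define \<Lambda> where "\<Lambda> = 1 + (\<Sum>\<mu>\<le>k. M (lag \<mu>)) + 2 * (\<Sum>\<mu>\<le>k. M (pderiv (lag \<mu>)))"
  have M0: "0 \<le> M p" for p using M[of 0 p] by auto
  have S0: "0 \<le> (\<Sum>\<mu>\<le>k. M (lag \<mu>))" "0 \<le> (\<Sum>\<mu>\<le>k. M (pderiv (lag \<mu>)))"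
    by (auto intro!: sum_nonneg M0)
  have "\<Lambda> \<ge> 1" using S0 by (simp add: \<Lambda>_def)
  moreover have "\<bar>poly (interp a b g) s\<bar> \<le> \<Lambda> * B \<and> \<bar>poly (pderiv (interp a b g)) s\<bar> \<le> \<Lambda> * B / (b - a)"
    if ab: "a < b" and B: "\<forall>\<mu>\<le>k. \<bar>g (node a b \<mu>)\<bar> \<le> B" and s: "s \<in> {a..b}" for a b g B s
  proof
    have B0: "B \<ge> 0" using B[rule_format, of 0] by linarith
    have r: "poly (to_ref a b) s \<in> {-1..1}" using to_ref_range ab s by auto
    have "\<bar>poly (interp a b g) s\<bar> \<le> (\<Sum>\<mu>\<le>k. \<bar>g (node a b \<mu>)\<bar> * \<bar>poly (lag \<mu>) (poly (to_ref a b) s)\<bar>)"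
      unfolding poly_interp[OF ab] abs_mult[symmetric] by (rule sum_abs)
    also have "\<dots> \<le> (\<Sum>\<mu>\<le>k. B * M (lag \<mu>))"
      by (intro sum_mono mult_mono) (use B M[OF r] B0 in auto)
    also have "\<dots> = (\<Sum>\<mu>\<le>k. M (lag \<mu>)) * B"  by (simp add: sum_distrib_left mult.commute)
    also have "\<dots> \<le> \<Lambda> * B" unfolding \<Lambda>_def using S0 B0 by (intro mult_right_mono) auto
    finally show "\<bar>poly (interp a b g) s\<bar> \<le> \<Lambda> * B" .
    have e: "poly (pderiv (interp a b g)) s =
       (\<Sum>\<mu>\<le>k. g (node a b \<mu>) * (poly (pderiv (lag \<mu>)) (poly (to_ref a b) s) * (2 / (b - a))))"
      by (simp add: interp_def pderiv_sum' pderiv_smult pderiv_pcompose poly_sum poly_pcompose to_ref_def pderiv_pCons mult_ac)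
    have "\<bar>poly (pderiv (interp a b g)) s\<bar> \<le>
       (\<Sum>\<mu>\<le>k. \<bar>g (node a b \<mu>)\<bar> * (\<bar>poly (pderiv (lag \<mu>)) (poly (to_ref a b) s)\<bar> * (2 / (b - a))))"
    proof -
      have "\<bar>2 / (b - a)\<bar> = 2 / (b - a)" using ab by simp
      then show ?thesis unfolding e using sum_abs[of "\<lambda>\<mu>. g (node a b \<mu>) * (poly (pderiv (lag \<mu>)) (poly (to_ref a b) s) * (2 / (b - a)))" "{..k}"]
        by (simp add: abs_mult)
    qed
    also have "\<dots> \<le> (\<Sum>\<mu>\<le>k. B * (M (pderiv (lag \<mu>)) * (2 / (b - a))))"
      by (intro sum_mono mult_mono) (use B M[OF r] M0 B0 ab in \<open>auto intro!: mult_nonneg_nonneg\<close>)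
    also have "\<dots> = 2 * (\<Sum>\<mu>\<le>k. M (pderiv (lag \<mu>))) * B / (b - a)"
      by (simp add: sum_distrib_left sum_distrib_right sum_divide_distrib mult_ac)
    also have "\<dots> \<le> \<Lambda> * B / (b - a)" unfolding \<Lambda>_def using S0 B0 ab
      by (intro divide_right_mono mult_right_mono) auto
    finally show "\<bar>poly (pderiv (interp a b g)) s\<bar> \<le> \<Lambda> * B / (b - a)" .
  qed
  ultimately show ?thesis by blast
qed

definition quad :: "real \<Rightarrow> real \<Rightarrow> (real \<Rightarrow> real) \<Rightarrow> real" where
  "quad a b g = (b - a) / 2 * (\<Sum>\<mu>\<le>k. \<omega> \<mu> * g (node a b \<mu>))"

lemma quad_poly:
  assumes ab: "a < b" and p: "degree p \<le> 2 * k - 1"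
  shows "quad a b (poly p) = pint a b p"
proof -
  define \<phi> where "\<phi> = [: (a + b) / 2, (b - a) / 2 :]"
  have "degree (pcompose p \<phi>) \<le> 2 * k - 1"
    using p degree_pcompose[of p \<phi>] ab by (simp add: \<phi>_def)
  then have 1: "(\<Sum>\<mu>\<le>k. \<omega> \<mu> * poly (pcompose p \<phi>) (\<xi> \<mu>)) = integral {-1..1} (poly (pcompose p \<phi>))"
    using gl by (simp add: gauss_lobatto_def)
  have 2: "poly (pcompose p \<phi>) (\<xi> \<mu>) = poly p (node a b \<mu>)" for \<mu>
    by (simp add: poly_pcompose \<phi>_def node_def field_simps)
  obtain q where q: "pderiv q = p" using poly_antiderivative by blast
  have "pderiv (pcompose q \<phi>) = smult ((b - a) / 2) (pcompose p \<phi>)"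
    by (simp add: pderiv_pcompose q \<phi>_def pderiv_pCons)
  then have "pint (-1) 1 (pcompose p \<phi>) * ((b - a) / 2) = pint (-1) 1 (pderiv (pcompose q \<phi>))"
    by (simp add: pint_smult)
  also have "\<dots> = poly q b - poly q a"
    by (simp add: pint_pderiv poly_pcompose \<phi>_def field_simps)
  also have "\<dots> = pint a b p" using pint_pderiv[of a b q] ab q by simp
  finally show ?thesis using 1 2 by (simp add: quad_def pint_def mult.commute)
qed

text \<open>Quadrature sees only the nodes, where \<open>g\<close> and its interpolant agree, and it is exact
  for the product of the interpolant with \<open>\<psi>\<close>, which has degree at most
  \<open>2 k - 1\<close>. So the discrete source term is the exact integral of the interpolated source.\<close>

lemma quad_interp:
  assumes "a < b" "degree \<psi> \<le> k - 1"
  shows "quad a b (\<lambda>s. g s * poly \<psi> s) = pint a b (interp a b g * \<psi>)"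
proof -
  have "degree (interp a b g * \<psi>) \<le> 2 * k - 1"
    using degree_mult_le'[OF degree_interp[of a b g] assms(2)] k by linarith
  then have "pint a b (interp a b g * \<psi>) = quad a b (poly (interp a b g * \<psi>))"
    using quad_poly assms by simp
  also have "\<dots> = quad a b (\<lambda>s. g s * poly \<psi> s)"
    using assms by (simp add: quad_def poly_interp_node)
  finally show ?thesis by simp
qed

text \<open>Integration by parts moves the derivative to \<open>\<psi>\<close>, as both endpoints are nodes. The
  product \<open>q \<psi>'\<close> has degree at most \<open>2 k - 1\<close>, so the quadrature formula
  integrates it exactly, and gives zero. Hence \<open>q'\<close> is a multiple of the Legendre
  polynomial of degree \<open>k\<close>.\<close>

lemma pderiv_orthogonal:
  assumes "a < b" "degree q \<le> k + 1" "\<And>\<mu>. \<mu> \<le> k \<Longrightarrow> poly q (node a b \<mu>) = 0" "degree \<psi> \<le> k - 1"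
  shows "pint a b (pderiv q * \<psi>) = 0"
proof -
  have d\<psi>: "degree (pderiv \<psi>) \<le> k - 2" using assms(4) by (simp add: degree_pderiv)
  have deg: "degree (q * pderiv \<psi>) \<le> 2 * k - 1"
    using degree_mult_le'[OF assms(2) d\<psi>] k by simp
  have "pint a b (pderiv (q * \<psi>)) = 0"
    using assms(1) assms(3)[of 0] assms(3)[of k] by (simp add: pint_pderiv node_0 node_k)
  moreover have "pint a b (q * pderiv \<psi>) = 0"
    using quad_poly[OF assms(1) deg] assms(3) by (simp add: quad_def)
  ultimately show ?thesis by (simp add: pderiv_mult pint_add mult.commute)
qed

end

section \<open>Stability of the Galerkin scheme for one mode\<close>

lemma poly_eq_by_values: "(\<And>s :: real. poly p s = poly q s) \<Longrightarrow> p = q"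
  by (metis ext poly_eq_poly_eq_iff)

text \<open>A weighted inequality of Young, applied pointwise. The weight \<open>W\<close> will be
  \<open>1\<close> or \<open>b - s\<close>.\<close>

lemma pint_cauchy:
  fixes \<epsilon> :: real
  assumes ab: "a \<le> b" and \<epsilon>: "\<epsilon> > 0" and W: "\<And>s. a \<le> s \<Longrightarrow> s \<le> b \<Longrightarrow> 0 \<le> poly W s \<and> poly W s \<le> K"
  shows "pint a b (W * (x * y)) \<le> \<epsilon> / 2 * pint a b (x * x) + K\<^sup>2 / (2 * \<epsilon>) * pint a b (y * y)"
proof -
  have "pint a b (W * (x * y)) \<le> pint a b (smult (\<epsilon> / 2) (x * x) + smult (K\<^sup>2 / (2 * \<epsilon>)) (y * y))"
  proof (rule pint_mono)
    fix s assume s: "a \<le> s" "s \<le> b"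
    define X Y w where "X = poly x s" and "Y = poly y s" and "w = poly W s"
    have w: "0 \<le> w" "w \<le> K" using W[OF s] by (auto simp: w_def)
    have "w\<^sup>2 \<le> K\<^sup>2" using w by (intro power_mono) auto
    have "0 \<le> (\<epsilon> * X - w * Y)\<^sup>2 / (2 * \<epsilon>)" using \<epsilon> by simp
    also have "(\<epsilon> * X - w * Y)\<^sup>2 / (2 * \<epsilon>) = \<epsilon> / 2 * (X * X) + w\<^sup>2 / (2 * \<epsilon>) * (Y * Y) - w * (X * Y)"
      using \<epsilon> by (simp add: field_simps power2_eq_square)
    also have "\<dots> \<le> \<epsilon> / 2 * (X * X) + K\<^sup>2 / (2 * \<epsilon>) * (Y * Y) - w * (X * Y)"
      using \<open>w\<^sup>2 \<le> K\<^sup>2\<close> \<epsilon> by (intro diff_right_mono add_left_mono mult_right_mono divide_right_mono) auto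
    finally show "poly (W * (x * y)) s \<le> poly (smult (\<epsilon> / 2) (x * x) + smult (K\<^sup>2 / (2 * \<epsilon>)) (y * y)) s"
      by (simp add: X_def Y_def w_def)
  qed
  then show ?thesis by (simp add: pint_add pint_smult)
qed

text \<open>\<open>P\<close> is a Legendre polynomial of the interval, up to a factor.\<close>

locale legendre =
  fixes k :: nat and a b :: real and P :: "real poly"
  assumes k_pos: "k \<ge> 1" and ab: "a < b"
    and deg_P: "degree P = k"
    and P_orth: "\<And>\<psi>. degree \<psi> \<le> k - 1 \<Longrightarrow> pint a b (P * \<psi>) = 0"
begin

lemma P_coeff: "coeff P k \<noteq> 0"
proof -
  have "P \<noteq> 0" using deg_P k_pos by auto
  then show ?thesis using deg_P leading_coeff_0_iff by blast
qed

definition top :: "real poly \<Rightarrow> real" where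
  "top p = coeff p k / coeff P k"

text \<open>The \<open>L\<^sup>2\<close>-projection of a polynomial of degree at most \<open>k\<close> to degree
  \<open>k - 1\<close>.\<close>

definition proj :: "real poly \<Rightarrow> real poly" where
  "proj p = p - smult (top p) P"

lemma proj_decomp: "p = proj p + smult (top p) P"
  by (simp add: proj_def)

lemma degree_proj: "degree p \<le> k \<Longrightarrow> degree (proj p) \<le> k - 1"
proof -
  assume p: "degree p \<le> k"
  have "degree (proj p) \<le> k" unfolding proj_def using p deg_P
    by (intro degree_diff_le) (auto intro: order_trans[OF degree_smult_le])
  moreover have "coeff (proj p) k = 0" using P_coeff by (simp add: proj_def top_def)
  ultimately have "degree (proj p) < k \<or> proj p = 0"
    by (metis le_neq_implies_less leading_coeff_0_iff)
  then show ?thesis using k_pos by auto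
qed

lemma pint_proj: "degree \<psi> \<le> k - 1 \<Longrightarrow> pint a b (proj p * \<psi>) = pint a b (p * \<psi>)"
  by (simp add: proj_def left_diff_distrib pint_diff P_orth pint_smult)

lemma pint_P: "degree q \<le> k \<Longrightarrow> pint a b (q * P) = top q * pint a b (P * P)"
proof -
  assume "degree q \<le> k"
  have "pint a b (q * P) = pint a b (P * proj q) + top q * pint a b (P * P)"
    by (subst proj_decomp[of q]) (simp add: algebra_simps pint_add pint_smult)
  then show ?thesis using P_orth[OF degree_proj[OF \<open>degree q \<le> k\<close>]] by simp
qed

lemma pint_PP: "pint a b (P * P) \<ge> 0"
  by (rule pint_nonneg) simp

lemma proj_le: "degree p \<le> k \<Longrightarrow> pint a b (proj p * proj p) \<le> pint a b (p * p)"
proof -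
  assume p: "degree p \<le> k"
  have "pint a b (p * p) = pint a b (proj p * proj p) + 2 * top p * pint a b (P * proj p) + (top p)\<^sup>2 * pint a b (P * P)"
  proof -
    have "p * p = proj p * proj p + smult (2 * top p) (P * proj p) + smult ((top p)\<^sup>2) (P * P)"
      by (rule poly_eq_by_values) (simp add: proj_def algebra_simps power2_eq_square)
    then show ?thesis by (simp add: pint_add pint_smult)
  qed
  then show ?thesis using P_orth[OF degree_proj[OF p]] pint_PP by simp
qed

lemma pint_unique:
  assumes "degree p \<le> k - 1" "degree q \<le> k - 1"
    and "\<And>\<psi>. degree \<psi> \<le> k - 1 \<Longrightarrow> pint a b (p * \<psi>) = pint a b (q * \<psi>)"
  shows "p = q"
proof -
  have "pint a b (1 * ((p - q) * (p - q))) = 0"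
    using assms(3)[of "p - q"] degree_diff_le[OF assms(1,2)] by (simp add: left_diff_distrib pint_diff)
  then have "p - q = 0" by (intro pint_square_eq_0[OF ab, where w = 1]) auto
  then show ?thesis by simp
qed

text \<open>The weight \<open>b - s\<close> produces control of the whole step from the value at
  \<open>a\<close>: without the projection, this is integration by parts of \<open>(b - s)
  (p\<^sup>2)' / 2\<close>. The projection removes \<open>top p\<close> times the Legendre
  polynomial from \<open>p\<close>. The resulting term has a sign, because the leading coefficient
  of \<open>(b - s) p'\<close> is \<open>- k\<close> times that of \<open>p\<close>.\<close>

lemma pint_weight_pderiv:
  assumes p: "degree p \<le> k"
  shows "pint a b ([:b, -1:] * (pderiv p * proj p)) \<ge> pint a b (p * p) / 2 - (b - a) / 2 * (poly p a)\<^sup>2"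
proof -
  let ?w = "[:b, -1:] :: real poly"
  have dp: "degree (?w * pderiv p) \<le> k"
    using degree_mult_le'[of ?w 1 "pderiv p" "k - 1"] degree_pderiv_le[of p "k - 1"] p k_pos by simp
  have cf: "coeff (?w * pderiv p) k = - real k * coeff p k"
  proof -
    obtain j where j: "k = Suc j" using k_pos by (metis Suc_le_D One_nat_def)
    have "coeff p (Suc k) = 0" using p by (intro coeff_eq_0) auto
    then show ?thesis by (simp add: j coeff_pderiv coeff_pCons algebra_simps)
  qed
  have e1: "pint a b ((?w * pderiv p) * P) = - real k * top p * pint a b (P * P)"
    using pint_P[OF dp] cf by (simp add: top_def)
  have "?w * (pderiv p * proj p) = ?w * (pderiv p * p) - smult (top p) ((?w * pderiv p) * P)"
    unfolding proj_def by (simp only: right_diff_distrib mult_smult_right mult.assoc)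
  then have "pint a b (?w * (pderiv p * proj p)) = pint a b (?w * (pderiv p * p)) + real k * (top p)\<^sup>2 * pint a b (P * P)"
    by (simp only: pint_diff pint_smult e1) (simp add: power2_eq_square)
  moreover have "real k * (top p)\<^sup>2 * pint a b (P * P) \<ge> 0" using pint_PP by simp
  moreover have "pint a b (?w * (pderiv p * p)) = pint a b (p * p) / 2 - (b - a) / 2 * (poly p a)\<^sup>2"
  proof -
    have "pderiv (?w * (p * p)) = smult 2 (?w * (pderiv p * p)) - p * p"
      unfolding pderiv_mult by (rule poly_eq_by_values) (simp add: pderiv_pCons algebra_simps)
    then have "2 * pint a b (?w * (pderiv p * p)) - pint a b (p * p) = - (b - a) * (poly p a)\<^sup>2"
      using pint_pderiv[of a b "?w * (p * p)"] ab
      by (simp only: pint_diff pint_smult) (simp add: power2_eq_square field_simps)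
    then show ?thesis by (simp add: field_simps)
  qed
  ultimately show ?thesis by linarith
qed

end

definition energy :: "real \<Rightarrow> real poly \<Rightarrow> real poly \<Rightarrow> real poly" where
  "energy \<kappa> p q = smult \<kappa> (p * p) + q * q"

lemma poly_energy: "poly (energy \<kappa> p q) s = \<kappa> * (poly p s)\<^sup>2 + (poly q s)\<^sup>2"
  by (simp add: energy_def power2_eq_square)

lemma pint_energy: "pint a b (energy \<kappa> p q) = \<kappa> * pint a b (p * p) + pint a b (q * q)"
  by (simp add: energy_def pint_add pint_smult)

lemma pint_energy_nonneg: "\<kappa> \<ge> 0 \<Longrightarrow> 0 \<le> pint a b (energy \<kappa> p q)"
  by (rule pint_nonneg) (simp add: poly_energy)

text \<open>One time step for one mode with eigenvalue \<open>\<kappa>\<close>: the system \<open>y0' = y1 +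
  d0\<close>, \<open>y1' = d1 - \<kappa> y0\<close>, tested with polynomials of degree \<open>k -
  1\<close>.\<close>

locale galerkin_step = legendre +
  fixes \<kappa> :: real and y0 y1 d0 d1 :: "real poly"
  assumes lam: "\<kappa> \<ge> 0"
    and deg: "degree y0 \<le> k" "degree y1 \<le> k" "degree d0 \<le> k" "degree d1 \<le> k"
    and gal0: "\<And>\<psi>. degree \<psi> \<le> k - 1 \<Longrightarrow> pint a b (pderiv y0 * \<psi>) = pint a b ((y1 + d0) * \<psi>)"
    and gal1: "\<And>\<psi>. degree \<psi> \<le> k - 1 \<Longrightarrow> pint a b (pderiv y1 * \<psi>) = pint a b ((d1 - smult \<kappa> y0) * \<psi>)"
begin

text \<open>The derivatives have degree \<open>k - 1\<close> themselves, so the tested equations hold pointwise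
  once the right-hand sides are projected.\<close>

lemma strong: "pderiv y0 = proj y1 + proj d0" "pderiv y1 = proj d1 - smult \<kappa> (proj y0)"
proof -
  have dd: "degree (pderiv y0) \<le> k - 1" "degree (pderiv y1) \<le> k - 1"
    using deg by (auto simp: degree_pderiv)
  show "pderiv y0 = proj y1 + proj d0"
    by (rule pint_unique)
       (use deg dd in \<open>auto intro!: degree_add_le degree_proj[unfolded One_nat_def] simp: gal0 distrib_right pint_add pint_proj\<close>)
  show "pderiv y1 = proj d1 - smult \<kappa> (proj y0)"
    by (rule pint_unique)
       (use deg dd in \<open>auto intro!: degree_diff_le degree_proj[unfolded One_nat_def] order_trans[OF degree_smult_le]
          simp: gal1 left_diff_distrib pint_diff pint_proj pint_smult\<close>)
qed

text \<open>The coupling of the two components is skew for the energy, so it disappears when the equations are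
  tested with the projection of the solution.\<close>

lemma cancel:
  "smult \<kappa> (pderiv y0 * proj y0) + pderiv y1 * proj y1 = smult \<kappa> (proj y0 * proj d0) + proj y1 * proj d1"
  by (simp add: strong algebra_simps smult_add_right)

lemma energy_cauchy:
  assumes "\<epsilon> > 0" "\<And>s. a \<le> s \<Longrightarrow> s \<le> b \<Longrightarrow> 0 \<le> poly W s \<and> poly W s \<le> K"
  shows "\<kappa> * pint a b (W * (pderiv y0 * proj y0)) + pint a b (W * (pderiv y1 * proj y1))
     \<le> \<epsilon> / 2 * pint a b (energy \<kappa> y0 y1) + K\<^sup>2 / (2 * \<epsilon>) * pint a b (energy \<kappa> d0 d1)"
proof -
  have A: "pint a b (W * (proj x * proj d)) \<le> \<epsilon> / 2 * pint a b (x * x) + K\<^sup>2 / (2 * \<epsilon>) * pint a b (d * d)"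
    if "degree x \<le> k" "degree d \<le> k" for x d
  proof -
    have "\<epsilon> / 2 * pint a b (proj x * proj x) \<le> \<epsilon> / 2 * pint a b (x * x)"
      "K\<^sup>2 / (2 * \<epsilon>) * pint a b (proj d * proj d) \<le> K\<^sup>2 / (2 * \<epsilon>) * pint a b (d * d)"
      using proj_le that assms by (auto intro!: mult_left_mono divide_right_mono)
    then show ?thesis using pint_cauchy[OF less_imp_le[OF ab] assms(1,2), of "proj x" "proj d"] by linarith
  qed
  have "smult \<kappa> (W * (pderiv y0 * proj y0)) + W * (pderiv y1 * proj y1)
      = W * (smult \<kappa> (pderiv y0 * proj y0) + pderiv y1 * proj y1)"
    by (simp add: algebra_simps)
  also have "\<dots> = smult \<kappa> (W * (proj y0 * proj d0)) + W * (proj y1 * proj d1)"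
    unfolding cancel by (simp add: algebra_simps)
  finally have "\<kappa> * pint a b (W * (pderiv y0 * proj y0)) + pint a b (W * (pderiv y1 * proj y1))
     = \<kappa> * pint a b (W * (proj y0 * proj d0)) + pint a b (W * (proj y1 * proj d1))"
    by (metis pint_add pint_smult)
  also have "\<dots> \<le> \<kappa> * (\<epsilon> / 2 * pint a b (y0 * y0) + K\<^sup>2 / (2 * \<epsilon>) * pint a b (d0 * d0)) +
      (\<epsilon> / 2 * pint a b (y1 * y1) + K\<^sup>2 / (2 * \<epsilon>) * pint a b (d1 * d1))"
    using A deg lam by (intro add_mono mult_left_mono) auto
  also have "\<dots> = \<epsilon> / 2 * pint a b (energy \<kappa> y0 y1) + K\<^sup>2 / (2 * \<epsilon>) * pint a b (energy \<kappa> d0 d1)"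
    by (simp add: pint_energy algebra_simps)
  finally show ?thesis .
qed

text \<open>Testing with \<open>b - s\<close> times the projection; the half of the integral on the right-hand
  side is absorbed by taking \<open>\<epsilon> = 1 / 2\<close>.\<close>

lemma interior:
  "pint a b (energy \<kappa> y0 y1) \<le> 2 * (b - a) * poly (energy \<kappa> y0 y1) a + 4 * (b - a)\<^sup>2 * pint a b (energy \<kappa> d0 d1)"
proof -
  have "\<kappa> * (pint a b (y0 * y0) / 2 - (b - a) / 2 * (poly y0 a)\<^sup>2) + (pint a b (y1 * y1) / 2 - (b - a) / 2 * (poly y1 a)\<^sup>2)
     \<le> \<kappa> * pint a b ([:b, -1:] * (pderiv y0 * proj y0)) + pint a b ([:b, -1:] * (pderiv y1 * proj y1))"
    using pint_weight_pderiv deg lam by (intro add_mono mult_left_mono) auto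
  also have "\<dots> \<le> (1 / 2) / 2 * pint a b (energy \<kappa> y0 y1) + (b - a)\<^sup>2 / (2 * (1 / 2)) * pint a b (energy \<kappa> d0 d1)"
    by (rule energy_cauchy) auto
  finally show ?thesis by (simp add: pint_energy poly_energy field_simps)
qed

text \<open>Testing with the projection itself, without a weight. The energy inside the step, which appears on
  the right-hand side, is bounded by \<open>interior\<close>.\<close>

lemma endpoint:
  "poly (energy \<kappa> y0 y1) b \<le> (1 + 2 * (b - a)) * poly (energy \<kappa> y0 y1) a + (1 + 4 * (b - a)\<^sup>2) * pint a b (energy \<kappa> d0 d1)"
proof -
  have y': "degree (pderiv y0) \<le> k - 1" "degree (pderiv y1) \<le> k - 1"
    using deg by (auto simp: degree_pderiv)
  have q: "2 * pint a b (1 * (pderiv y * proj y)) = (poly y b)\<^sup>2 - (poly y a)\<^sup>2" if "degree (pderiv y) \<le> k - 1" for y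
  proof -
    have "pint a b (pderiv y * proj y) = pint a b (y * pderiv y)"
      using pint_proj[OF that, of y] by (simp add: mult.commute)
    moreover have "pint a b (pderiv (y * y)) = 2 * pint a b (y * pderiv y)"
      by (simp only: pderiv_mult pint_add)
    ultimately show ?thesis using pint_pderiv[of a b "y * y"] ab by (simp add: power2_eq_square)
  qed
  have "poly (energy \<kappa> y0 y1) b - poly (energy \<kappa> y0 y1) a =
     2 * (\<kappa> * pint a b (1 * (pderiv y0 * proj y0)) + pint a b (1 * (pderiv y1 * proj y1)))"
    unfolding poly_energy distrib_left mult.left_commute[of 2 \<kappa>] q[OF y'(1)] q[OF y'(2)]
    by (simp add: algebra_simps)
  also have "\<dots> \<le> 2 * (1 / 2 * pint a b (energy \<kappa> y0 y1) + 1\<^sup>2 / (2 * 1) * pint a b (energy \<kappa> d0 d1))"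
    by (intro mult_left_mono energy_cauchy) auto
  finally show ?thesis using interior by (simp add: algebra_simps)
qed

end

text \<open>The discrete Gronwall inequality, by \<open>1 + x \<le> exp x\<close> in each step.\<close>

lemma gronwall_steps:
  fixes e d t :: "nat \<Rightarrow> real"
  assumes step: "\<And>n. n < N \<Longrightarrow> e (Suc n) \<le> (1 + 2 * (t (Suc n) - t n)) * e n + d (Suc n)"
    and mono: "\<And>n. n < N \<Longrightarrow> t n \<le> t (Suc n)"
    and d: "\<And>n. n \<in> {1..N} \<Longrightarrow> 0 \<le> d n" and e0: "0 \<le> e 0"
    and n: "n \<le> N"
  shows "e n \<le> exp (2 * (t n - t 0)) * (e 0 + (\<Sum>i=1..n. d i))"
  using n
proof (induction n)
  case 0
  then show ?case by simp
next
  case (Suc n)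
  let ?S = "e 0 + (\<Sum>i=1..n. d i)"
  have S: "0 \<le> ?S" using Suc.prems d e0 by (intro add_nonneg_nonneg sum_nonneg) auto
  have tau: "0 \<le> t (Suc n) - t n" using mono Suc.prems by simp
  have t0: "m \<le> N \<Longrightarrow> t 0 \<le> t m" for m
    by (induction m) (auto intro: order_trans mono simp: Suc_le_eq)
  have "e (Suc n) \<le> (1 + 2 * (t (Suc n) - t n)) * e n + d (Suc n)" using step Suc.prems by simp
  also have "\<dots> \<le> exp (2 * (t (Suc n) - t n)) * (exp (2 * (t n - t 0)) * ?S) + exp (2 * (t (Suc n) - t 0)) * d (Suc n)"
  proof (rule add_mono)
    have "(1 + 2 * (t (Suc n) - t n)) * e n \<le> (1 + 2 * (t (Suc n) - t n)) * (exp (2 * (t n - t 0)) * ?S)"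
      using Suc tau by (intro mult_left_mono) auto
    also have "\<dots> \<le> exp (2 * (t (Suc n) - t n)) * (exp (2 * (t n - t 0)) * ?S)"
      using S by (intro mult_right_mono exp_ge_add_one_self) auto
    finally show "(1 + 2 * (t (Suc n) - t n)) * e n \<le> exp (2 * (t (Suc n) - t n)) * (exp (2 * (t n - t 0)) * ?S)" .
    have "1 \<le> exp (2 * (t (Suc n) - t 0))" using t0[of "Suc n"] Suc.prems by simp
    then show "d (Suc n) \<le> exp (2 * (t (Suc n) - t 0)) * d (Suc n)"
      using d[of "Suc n"] Suc.prems mult_right_mono[of 1 "exp (2 * (t (Suc n) - t 0))" "d (Suc n)"] by simp
  qed
  also have "exp (2 * (t (Suc n) - t n)) * (exp (2 * (t n - t 0)) * ?S) = exp (2 * (t (Suc n) - t 0)) * ?S"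
  proof -
    have "exp (2 * (t (Suc n) - t n)) * exp (2 * (t n - t 0)) = exp (2 * (t (Suc n) - t 0))"
      by (simp add: exp_add[symmetric] algebra_simps)
    then show ?thesis by (simp only: mult.assoc[symmetric])
  qed
  finally show ?case by (simp add: algebra_simps)
qed

section \<open>Interpolation errors in time\<close>

text \<open>\<open>G j\<close> is the \<open>j\<close>-th derivative of \<open>G 0\<close>, one-sided at the
  ends of an interval.\<close>

definition derivs :: "real set \<Rightarrow> nat \<Rightarrow> (nat \<Rightarrow> real \<Rightarrow> real) \<Rightarrow> bool" where
  "derivs S m G \<longleftrightarrow> (\<forall>j<m. \<forall>s\<in>S. (G j has_real_derivative G (Suc j) s) (at s within S))"

lemma derivs_subset: "derivs S m G \<Longrightarrow> S' \<subseteq> S \<Longrightarrow> m' \<le> m \<Longrightarrow> derivs S' m' G"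
  unfolding derivs_def by (meson DERIV_subset order_less_le_trans subsetD)

lemma derivs_Suc: "derivs S (Suc m) G \<Longrightarrow> derivs S m (\<lambda>j. G (Suc j))"
  by (auto simp: derivs_def)

definition taylor :: "nat \<Rightarrow> (nat \<Rightarrow> real \<Rightarrow> real) \<Rightarrow> real \<Rightarrow> real poly" where
  "taylor n G a = (\<Sum>j<n. smult (G j a / fact j) ([:-a, 1:] ^ j))"

lemma degree_taylor: "degree (taylor (Suc n) G a) \<le> n"
  unfolding taylor_def
proof (rule degree_sum_le)
  fix j assume "j \<in> {..<Suc n}"
  moreover have "degree ([:-a, 1:] ^ j) \<le> j" using degree_power_le[of "[:-a, 1:]" j] by simp
  ultimately show "degree (smult (G j a / fact j) ([:-a, 1:] ^ j)) \<le> n"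
    using degree_smult_le[of "G j a / fact j" "[:-a, 1:] ^ j"] by (simp del: degree_smult_eq)
qed auto

lemma poly_taylor_start: "poly (taylor (Suc n) G a) a = G 0 a"
  by (simp add: taylor_def poly_sum lessThan_Suc_eq_insert_0 sum.reindex)

lemma pderiv_taylor: "pderiv (taylor (Suc n) G a) = taylor n (\<lambda>j. G (Suc j)) a"
proof -
  have "pderiv (smult (G (Suc j) a / fact (Suc j)) ([:-a, 1:] ^ Suc j)) = smult (G (Suc j) a / fact j) ([:-a, 1:] ^ j)" for j
    unfolding pderiv_smult pderiv_power_Suc
    by (simp add: pderiv_pCons)
  then show ?thesis
    by (simp add: taylor_def lessThan_Suc_eq_insert_0 sum.reindex pderiv_sum' pderiv_add pderiv_smult del: power_Suc fact_Suc)
qed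

lemma increment_bound:
  fixes h h' :: "real \<Rightarrow> real"
  assumes "\<And>s. s \<in> {a..b} \<Longrightarrow> (h has_real_derivative h' s) (at s within {a..b})"
    and "\<And>s. s \<in> {a..b} \<Longrightarrow> \<bar>h' s\<bar> \<le> B" and "s \<in> {a..b}"
  shows "\<bar>h s - h a\<bar> \<le> B * (s - a)"
proof -
  have "norm (h s - h a) \<le> B * norm (s - a)"
  proof (rule differentiable_bound[of "{a..b}" h "\<lambda>x. (*) (h' x)"])
    fix x assume x: "x \<in> {a..b}"
    show "onorm ((*) (h' x)) \<le> B"
      by (rule onorm_le) (use assms(2)[OF x] in \<open>auto simp: abs_mult intro: mult_right_mono\<close>)
  qed (use assms in \<open>auto simp: has_field_derivative_def\<close>)
  then show ?thesis using assms(3) by simp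
qed

lemma taylor_error:
  assumes "derivs {a..b} n G" "\<And>s. s \<in> {a..b} \<Longrightarrow> \<bar>G n s\<bar> \<le> S" "s \<in> {a..b}"
  shows "\<bar>G 0 s - poly (taylor n G a) s\<bar> \<le> S * (b - a) ^ n"
  using assms
proof (induction n arbitrary: G s)
  case 0
  then show ?case by (simp add: taylor_def)
next
  case (Suc n)
  have S: "S \<ge> 0" using Suc.prems by force
  let ?h = "\<lambda>s. G 0 s - poly (taylor (Suc n) G a) s"
  have "\<bar>?h s - ?h a\<bar> \<le> S * (b - a) ^ n * (s - a)"
  proof (rule increment_bound[where b = b])
    fix x assume x: "x \<in> {a..b}"
    show "(?h has_real_derivative G 1 x - poly (taylor n (\<lambda>j. G (Suc j)) a) x) (at x within {a..b})"
      using Suc.prems(1) x unfolding pderiv_taylor[symmetric]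
      by (auto simp: derivs_def intro!: derivative_eq_intros DERIV_subset[OF poly_DERIV])
    show "\<bar>G 1 x - poly (taylor n (\<lambda>j. G (Suc j)) a) x\<bar> \<le> S * (b - a) ^ n"
      using Suc.IH[of "\<lambda>j. G (Suc j)" x] Suc.prems x derivs_Suc by simp
  qed (use Suc.prems in auto)
  also have "\<dots> \<le> S * (b - a) ^ n * (b - a)"
    using Suc.prems S by (intro mult_left_mono) auto
  finally show ?case by (simp add: poly_taylor_start mult_ac)
qed

context gauss_lobatto_rule
begin

text \<open>A bound for the Lebesgue constant of the nodes that serves for derivatives of interpolants, too.\<close>

definition \<Lambda> :: real where
  "\<Lambda> = (SOME \<Lambda>. \<Lambda> \<ge> 1 \<and> (\<forall>a b g B. a < b \<longrightarrow> (\<forall>\<mu>\<le>k. \<bar>g (node a b \<mu>)\<bar> \<le> B) \<longrightarrow>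
     (\<forall>s\<in>{a..b}. \<bar>poly (interp a b g) s\<bar> \<le> \<Lambda> * B \<and> \<bar>poly (pderiv (interp a b g)) s\<bar> \<le> \<Lambda> * B / (b - a))))"

lemma \<Lambda>_ge_1: "\<Lambda> \<ge> 1"
  and \<Lambda>_interp: "a < b \<Longrightarrow> (\<And>s. s \<in> {a..b} \<Longrightarrow> \<bar>g s\<bar> \<le> B) \<Longrightarrow> s \<in> {a..b} \<Longrightarrow> \<bar>poly (interp a b g) s\<bar> \<le> \<Lambda> * B"
  and \<Lambda>_pderiv: "a < b \<Longrightarrow> (\<And>s. s \<in> {a..b} \<Longrightarrow> \<bar>g s\<bar> \<le> B) \<Longrightarrow> s \<in> {a..b} \<Longrightarrow> \<bar>poly (pderiv (interp a b g)) s\<bar> \<le> \<Lambda> * B / (b - a)"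
  using someI_ex[OF interp_bounds, folded \<Lambda>_def] node_range by auto

text \<open>Interpolation reproduces the Taylor polynomial, so only its remainder is interpolated.\<close>

lemma interp_error:
  assumes ab: "a < b" and G: "derivs {a..b} (k + 1) G" "\<And>s. s \<in> {a..b} \<Longrightarrow> \<bar>G (k + 1) s\<bar> \<le> S" and s: "s \<in> {a..b}"
  shows "\<bar>G 0 s - poly (interp a b (G 0)) s\<bar> \<le> (1 + \<Lambda>) * (S * (b - a) ^ (k + 1))"
proof -
  let ?q = "taylor (k + 1) G a"
  have e: "\<bar>G 0 x - poly ?q x\<bar> \<le> S * (b - a) ^ (k + 1)" if "x \<in> {a..b}" for x
    using taylor_error[OF G that] by simp
  have "interp a b (poly ?q) = ?q" using interp_poly[OF ab] degree_taylor[of k] by simp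
  then have "interp a b (\<lambda>s. G 0 s - poly ?q s) = interp a b (G 0) - ?q"
    by (simp add: interp_diff)
  then have "\<bar>poly (interp a b (G 0)) s - poly ?q s\<bar> \<le> \<Lambda> * (S * (b - a) ^ (k + 1))"
    using \<Lambda>_interp[OF ab, of "\<lambda>s. G 0 s - poly ?q s", OF e s] by simp
  with e[OF s] show ?thesis unfolding distrib_right by linarith
qed

text \<open>\<open>J\<close> integrates the interpolant of the derivative, so that at an inner point the error
  is the integral of an interpolation error. Over a whole step one order is gained: the increment of
  \<open>J\<close> is a Gauss--Lobatto sum, and a Taylor polynomial with one more term is still
  integrated exactly.\<close>

lemma integrated_interp_error:
  assumes ab: "a < b" and G: "derivs {a..b} (k + 3) G"
    and S: "\<And>s j. s \<in> {a..b} \<Longrightarrow> j \<in> {k + 2, k + 3} \<Longrightarrow> \<bar>G j s\<bar> \<le> S"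
    and J: "pderiv J = interp a b (G 1)"
  defines "\<eta> \<equiv> \<lambda>s. G 0 s - poly J s"
  shows "s \<in> {a..b} \<Longrightarrow> \<bar>\<eta> s - \<eta> a\<bar> \<le> (1 + \<Lambda>) * S * (b - a) ^ (k + 2)"
    and "\<bar>\<eta> b - \<eta> a\<bar> \<le> (1 + \<Lambda>) * S * (b - a) ^ (k + 3)"
proof -
  have S0: "S \<ge> 0" using S[of a "k + 2"] ab by auto
  assume s: "s \<in> {a..b}"
  have "\<bar>\<eta> s - \<eta> a\<bar> \<le> (1 + \<Lambda>) * (S * (b - a) ^ (k + 1)) * (s - a)"
  proof (rule increment_bound[where b = b])
    fix x assume x: "x \<in> {a..b}"
    show "(\<eta> has_real_derivative G 1 x - poly (interp a b (G 1)) x) (at x within {a..b})"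
      using G x unfolding \<eta>_def J[symmetric]
      by (auto simp: derivs_def intro!: derivative_eq_intros DERIV_subset[OF poly_DERIV])
    show "\<bar>G 1 x - poly (interp a b (G 1)) x\<bar> \<le> (1 + \<Lambda>) * (S * (b - a) ^ (k + 1))"
      using interp_error[of a b "\<lambda>j. G (Suc j)" S x] ab x S derivs_Suc[OF derivs_subset[OF G order.refl, of "Suc (k + 1)"]]
      by simp
  qed (use s in auto)
  also have "\<dots> \<le> (1 + \<Lambda>) * (S * (b - a) ^ (k + 1)) * (b - a)"
    using s S0 \<Lambda>_ge_1 by (intro mult_left_mono) auto
  finally show "\<bar>\<eta> s - \<eta> a\<bar> \<le> (1 + \<Lambda>) * S * (b - a) ^ (k + 2)" by (simp add: mult_ac)
next
  let ?q = "taylor (k + 3) G a"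
  have k3: "k + 3 = Suc (k + 2)" by simp
  have e0: "\<bar>G 0 b - poly ?q b\<bar> \<le> S * (b - a) ^ (k + 3)"
    using taylor_error[OF G, of S b] S ab by auto
  have e1: "\<bar>G 1 x - poly (pderiv ?q) x\<bar> \<le> S * (b - a) ^ (k + 2)" if "x \<in> {a..b}" for x
    using taylor_error[of a b "k + 2" "\<lambda>j. G (Suc j)" S x] that S derivs_Suc[of _ "k + 2" G] G
    by (simp add: k3 pderiv_taylor)
  have quad: "quad a b g = pint a b (interp a b g)" for g
    using quad_interp[OF ab, of 1 g] by simp
  have qa: "poly ?q a = G 0 a" unfolding k3 by (rule poly_taylor_start)
  \<comment> \<open>Here \<open>k + 1 \<le> 2 k - 1\<close> is used, that is \<open>k \<ge>
    2\<close>.\<close>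
  have "degree (pderiv ?q) \<le> 2 * k - 1"
    using degree_taylor[of "k + 2" G a] k by (simp add: degree_pderiv k3)
  then have q: "pint a b (interp a b (poly (pderiv ?q))) = poly ?q b - G 0 a"
    using quad_poly[OF ab] quad pint_pderiv[of a b ?q] ab qa by simp
  have "poly J b - poly J a = pint a b (interp a b (G 1))"
    using pint_pderiv[of a b J] ab J by simp
  also have "\<dots> = poly ?q b - G 0 a + pint a b (interp a b (\<lambda>s. G 1 s - poly (pderiv ?q) s))"
    by (simp add: interp_diff pint_diff q)
  finally have "\<eta> b - \<eta> a = (G 0 b - poly ?q b) - pint a b (interp a b (\<lambda>s. G 1 s - poly (pderiv ?q) s))"
    by (simp add: \<eta>_def)
  moreover have "\<bar>pint a b (interp a b (\<lambda>s. G 1 s - poly (pderiv ?q) s))\<bar> \<le> \<Lambda> * (S * (b - a) ^ (k + 2)) * (b - a)"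
    by (rule pint_bound) (use ab \<Lambda>_interp[OF ab e1] in auto)
  ultimately have "\<bar>\<eta> b - \<eta> a\<bar> \<le> S * (b - a) ^ (k + 3) + \<Lambda> * (S * (b - a) ^ (k + 2)) * (b - a)"
    using e0 by linarith
  then show "\<bar>\<eta> b - \<eta> a\<bar> \<le> (1 + \<Lambda>) * S * (b - a) ^ (k + 3)"
    by (simp add: algebra_simps power_add numeral_eq_Suc)
qed

text \<open>Interpolation and differentiation commute up to order \<open>k + 1\<close> when tested with degree
  \<open>k - 1\<close>: for polynomials of degree \<open>k + 1\<close> the commutator is orthogonal
  to the test functions.\<close>

lemma commutator_error:
  assumes ab: "a < b" and G: "derivs {a..b} (k + 2) G"
    and S: "\<And>s. s \<in> {a..b} \<Longrightarrow> \<bar>G (k + 2) s\<bar> \<le> S"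
  shows "\<exists>d. degree d \<le> k \<and> (\<forall>s\<in>{a..b}. \<bar>poly d s\<bar> \<le> 2 * \<Lambda> * (S * (b - a) ^ (k + 1))) \<and>
    (\<forall>\<psi>. degree \<psi> \<le> k - 1 \<longrightarrow> pint a b ((pderiv (interp a b (G 0)) - interp a b (G 1)) * \<psi>) = pint a b (d * \<psi>))"
proof -
  let ?q = "taylor (k + 2) G a"
  have k2: "k + 2 = Suc (k + 1)" by simp
  define \<delta> where "\<delta> = (\<lambda>s. G 0 s - poly ?q s)"
  define \<delta>' where "\<delta>' = (\<lambda>s. G 1 s - poly (pderiv ?q) s)"
  have e0: "\<bar>\<delta> x\<bar> \<le> S * (b - a) ^ (k + 2)" if "x \<in> {a..b}" for x
    using taylor_error[OF G S that] by (simp add: \<delta>_def)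
  have e1: "\<bar>\<delta>' x\<bar> \<le> S * (b - a) ^ (k + 1)" if "x \<in> {a..b}" for x
    using taylor_error[of a b "k + 1" "\<lambda>j. G (Suc j)" S x] that S derivs_Suc[of _ "k + 1" G] G
    by (simp add: k2 pderiv_taylor \<delta>'_def)
  define d where "d = pderiv (interp a b \<delta>) - interp a b \<delta>'"
  have dq: "degree ?q \<le> k + 1" using degree_taylor[of "k + 1"] by simp
  have iq': "interp a b (poly (pderiv ?q)) = pderiv ?q"
    using interp_poly[OF ab, of "pderiv ?q"] dq by (simp add: degree_pderiv)
  \<comment> \<open>The Taylor polynomial has degree \<open>k + 1\<close>: its derivative is
    interpolated exactly, and it differs from its own interpolant by a polynomial vanishing at the
    nodes.\<close>
  have split: "pderiv (interp a b (G 0)) - interp a b (G 1) = d + pderiv (interp a b (poly ?q) - ?q)"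
    unfolding d_def \<delta>_def \<delta>'_def interp_diff iq' by (simp add: pderiv_diff)
  have "degree d \<le> k" unfolding d_def
    by (intro degree_diff_le degree_interp) (metis degree_interp degree_pderiv diff_le_self order_trans)
  moreover have "\<bar>poly d s\<bar> \<le> 2 * \<Lambda> * (S * (b - a) ^ (k + 1))" if s: "s \<in> {a..b}" for s
  proof -
    have "\<bar>poly (pderiv (interp a b \<delta>)) s\<bar> \<le> \<Lambda> * (S * (b - a) ^ (k + 2)) / (b - a)"
      by (rule \<Lambda>_pderiv[OF ab e0 s])
    also have "\<dots> = \<Lambda> * (S * (b - a) ^ (k + 1))" using ab by simp
    finally show ?thesis using \<Lambda>_interp[OF ab, of \<delta>', OF e1 s] unfolding d_def by simp
  qed
  moreover have "pint a b ((pderiv (interp a b (G 0)) - interp a b (G 1)) * \<psi>) = pint a b (d * \<psi>)"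
    if "degree \<psi> \<le> k - 1" for \<psi>
  proof -
    have "pint a b (pderiv (interp a b (poly ?q) - ?q) * \<psi>) = 0"
    proof (rule pderiv_orthogonal[OF ab _ _ that])
      have "degree (interp a b (poly ?q)) \<le> k + 1" using degree_interp[of a b "poly ?q"] by simp
      then show "degree (interp a b (poly ?q) - ?q) \<le> k + 1"
        using dq by (intro degree_diff_le)
    qed (use ab poly_interp_node in auto)
    then show ?thesis unfolding split by (simp add: distrib_right pint_add)
  qed
  ultimately show ?thesis by blast
qed

end

section \<open>Error of one mode\<close>

text \<open>The endpoint values of one step are the initial values of the next one, so the estimates on single
  steps accumulate by the Gronwall inequality; a second use of the step estimate controls the
  interior.\<close>

lemma mesh_stability:
  fixes t :: "nat \<Rightarrow> real" and y0 y1 d0 d1 P :: "nat \<Rightarrow> real poly"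
  assumes mesh: "time_mesh T N t" and lam: "\<kappa> \<ge> 0"
    and step: "\<And>n. n < N \<Longrightarrow> galerkin_step k (t n) (t (Suc n)) (P n) \<kappa> (y0 n) (y1 n) (d0 n) (d1 n)"
    and cont: "\<And>n. Suc n < N \<Longrightarrow> poly (y0 n) (t (Suc n)) = poly (y0 (Suc n)) (t (Suc n))
      \<and> poly (y1 n) (t (Suc n)) = poly (y1 (Suc n)) (t (Suc n))"
    and bound: "\<And>n s. n < N \<Longrightarrow> s \<in> {t n..t (Suc n)} \<Longrightarrow> poly (energy \<kappa> (d0 n) (d1 n)) s \<le> B"
    and init: "poly (energy \<kappa> (y0 0) (y1 0)) (t 0) \<le> B0"
    and n: "n < N"
  shows "poly (energy \<kappa> (y0 n) (y1 n)) (t n) \<le> exp (2 * T) * (B0 + (1 + 4 * T\<^sup>2) * T * B)"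
    and "pint (t n) (t (Suc n)) (energy \<kappa> (y0 n) (y1 n))
      \<le> 2 * (t (Suc n) - t n) * (exp (2 * T) * (B0 + (1 + 4 * T\<^sup>2) * T * B)) + 4 * (t (Suc n) - t n)\<^sup>2 * ((t (Suc n) - t n) * B)"
proof -
  have lt: "t i < t (Suc i)" if "i < N" for i using mesh that by (simp add: time_mesh_def)
  have t0: "t 0 = 0" and tN: "t N = T" using mesh by (auto simp: time_mesh_def)
  have mono: "t i \<le> t j" if "i \<le> j" "j \<le> N" for i j
    using that by (induction j) (auto simp: le_Suc_eq Suc_le_eq intro: order_trans less_imp_le lt)
  have tT: "t i \<le> T" "0 \<le> t i" if "i \<le> N" for i using mono[of i N] mono[of 0 i] that t0 tN by auto
  have len: "t (Suc i) - t i \<le> T" if "i < N" for i using tT[of i] tT[of "Suc i"] that by auto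
  define E where "E i = (if i < N then poly (energy \<kappa> (y0 i) (y1 i)) (t i)
     else poly (energy \<kappa> (y0 (N - 1)) (y1 (N - 1))) (t N))" for i
  have E_end: "E (Suc i) = poly (energy \<kappa> (y0 i) (y1 i)) (t (Suc i))" if "i < N" for i
    using that cont[of i] unfolding E_def poly_energy
    by (cases "Suc i < N") (auto simp: not_less le_Suc_eq dest!: le_antisym)
  have E_pos: "0 \<le> poly (energy \<kappa> p q) s" for p q s using lam by (simp add: poly_energy)
  have B: "0 \<le> B" using bound[OF n, of "t n"] lt[OF n] E_pos[of "d0 n" "d1 n" "t n"] by auto
  have B0: "0 \<le> B0" using init E_pos[of "y0 0" "y1 0" "t 0"] by linarith
  have T: "0 \<le> T" using tT[of 0] by simp
  have pd: "pint (t i) (t (Suc i)) (energy \<kappa> (d0 i) (d1 i)) \<le> (t (Suc i) - t i) * B" if "i < N" for i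
  proof -
    have "pint (t i) (t (Suc i)) (energy \<kappa> (d0 i) (d1 i)) \<le> pint (t i) (t (Suc i)) [:B:]"
      by (rule pint_mono) (use bound[OF that] in auto)
    also have "\<dots> = (t (Suc i) - t i) * B"
      using pint_pderiv[of "t i" "t (Suc i)" "[:0, B:]"] lt[OF that] by (simp add: pderiv_pCons algebra_simps)
    finally show ?thesis .
  qed
  define D where "D i = (1 + 4 * T\<^sup>2) * ((t i - t (i - 1)) * B)" for i
  have Estep: "E (Suc i) \<le> (1 + 2 * (t (Suc i) - t i)) * E i + D (Suc i)" if i: "i < N" for i
  proof -
    have "E (Suc i) \<le> (1 + 2 * (t (Suc i) - t i)) * E i + (1 + 4 * (t (Suc i) - t i)\<^sup>2) * pint (t i) (t (Suc i)) (energy \<kappa> (d0 i) (d1 i))"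
      using galerkin_step.endpoint[OF step[OF i]] E_end[OF i] i by (simp add: E_def)
    also have "(1 + 4 * (t (Suc i) - t i)\<^sup>2) * pint (t i) (t (Suc i)) (energy \<kappa> (d0 i) (d1 i)) \<le> D (Suc i)"
    proof -
      have "(t (Suc i) - t i)\<^sup>2 \<le> T\<^sup>2" using len[OF i] lt[OF i] by (intro power_mono) auto
      then show ?thesis unfolding D_def using pd[OF i] pint_energy_nonneg[OF lam]
        by (intro mult_mono) auto
    qed
    finally show ?thesis by simp
  qed
  have "E n \<le> exp (2 * (t n - t 0)) * (E 0 + (\<Sum>i=1..n. D i))"
  proof (rule gronwall_steps[where N = N])
    show "0 \<le> D i" if "i \<in> {1..N}" for i
      unfolding D_def using that B mono[of "i - 1" i] by (auto intro!: mult_nonneg_nonneg)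
    show "0 \<le> E 0" using E_pos by (simp add: E_def)
  qed (use Estep lt n in \<open>auto intro: less_imp_le\<close>)
  also have "(\<Sum>i=1..n. D i) = (1 + 4 * T\<^sup>2) * (t n * B)"
  proof -
    have "(\<Sum>i=1..n. t i - t (i - 1)) = t n - t 0" by (induction n) auto
    then show ?thesis unfolding D_def sum_distrib_left[symmetric] sum_distrib_right[symmetric] by (simp add: t0)
  qed
  also have "exp (2 * (t n - t 0)) * (E 0 + (1 + 4 * T\<^sup>2) * (t n * B)) \<le> exp (2 * T) * (B0 + (1 + 4 * T\<^sup>2) * T * B)"
  proof (rule mult_mono)
    have "(1 + 4 * T\<^sup>2) * (t n * B) \<le> (1 + 4 * T\<^sup>2) * (T * B)"
      using tT[of n] n B by (intro mult_left_mono mult_right_mono) auto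
    then show "E 0 + (1 + 4 * T\<^sup>2) * (t n * B) \<le> B0 + (1 + 4 * T\<^sup>2) * T * B"
      using init n by (simp add: E_def mult.assoc)
    show "0 \<le> E 0 + (1 + 4 * T\<^sup>2) * (t n * B)"
      using E_pos n B tT[of n] by (auto simp: E_def intro!: add_nonneg_nonneg mult_nonneg_nonneg)
  qed (use tT[of n] n t0 in auto)
  finally have En: "E n \<le> exp (2 * T) * (B0 + (1 + 4 * T\<^sup>2) * T * B)" .
  then show A: "poly (energy \<kappa> (y0 n) (y1 n)) (t n) \<le> exp (2 * T) * (B0 + (1 + 4 * T\<^sup>2) * T * B)"
    using n by (simp add: E_def)
  have "pint (t n) (t (Suc n)) (energy \<kappa> (y0 n) (y1 n))
     \<le> 2 * (t (Suc n) - t n) * poly (energy \<kappa> (y0 n) (y1 n)) (t n) + 4 * (t (Suc n) - t n)\<^sup>2 * pint (t n) (t (Suc n)) (energy \<kappa> (d0 n) (d1 n))"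
    by (rule galerkin_step.interior[OF step[OF n]])
  also have "\<dots> \<le> 2 * (t (Suc n) - t n) * (exp (2 * T) * (B0 + (1 + 4 * T\<^sup>2) * T * B)) + 4 * (t (Suc n) - t n)\<^sup>2 * ((t (Suc n) - t n) * B)"
    using A pd[OF n] lt[OF n] by (intro add_mono mult_left_mono) auto
  finally show "pint (t n) (t (Suc n)) (energy \<kappa> (y0 n) (y1 n)) \<le> \<dots>" .
qed

lemma pint_increment:
  assumes "a < b" "s \<in> {a..b}"
  shows "(poly q s - poly q a)\<^sup>2 \<le> (b - a) * pint a b (pderiv q * pderiv q)"
proof (cases "s = a")
  case True
  then show ?thesis using pint_nonneg[of a b "pderiv q * pderiv q"] assms by simp
next
  case False
  then have s: "a < s" "s \<le> b" using assms by auto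
  define m where "m = (poly q s - poly q a) / (s - a)"
  let ?p = "pderiv q"
  have "0 \<le> pint a s ((?p - [:m:]) * (?p - [:m:]))" by (rule pint_nonneg) simp
  also have "(?p - [:m:]) * (?p - [:m:]) = ?p * ?p - smult (2 * m) ?p + pderiv [:0, m\<^sup>2:]"
    by (rule poly_eq_by_values) (simp add: pderiv_pCons power2_eq_square algebra_simps)
  also have "pint a s \<dots> = pint a s (?p * ?p) - 2 * m * (poly q s - poly q a) + m\<^sup>2 * (s - a)"
    using s by (simp only: pint_add pint_diff pint_smult pint_pderiv) (simp add: pint_pderiv algebra_simps)
  also have "\<dots> = pint a s (?p * ?p) - (poly q s - poly q a)\<^sup>2 / (s - a)"
  proof -
    define d L where "d = poly q s - poly q a" and "L = s - a"
    have "L \<noteq> 0" using s by (simp add: L_def)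
    then have "- 2 * (d / L) * d + (d / L)\<^sup>2 * L = - d\<^sup>2 / L"
      by (simp add: power_divide power2_eq_square)
    then show ?thesis unfolding m_def d_def[symmetric] L_def[symmetric] by linarith
  qed
  finally have "(poly q s - poly q a)\<^sup>2 \<le> (s - a) * pint a s (?p * ?p)"
    using s by (simp add: field_simps)
  also have "\<dots> \<le> (b - a) * pint a b (?p * ?p)"
  proof (rule mult_mono)
    show "pint a s (?p * ?p) \<le> pint a b (?p * ?p)"
      unfolding pint_def using s by (intro integral_subset_le) auto
  qed (use s pint_nonneg[of a s "?p * ?p"] in auto)
  finally show ?thesis .
qed

context gauss_lobatto_rule
begin

text \<open>The lifting turns the variational equation on one interval into a differential equation. The choice
  of the coefficient makes the residual \<open>D\<close> of degree \<open>k\<close> vanish at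
  \<open>a\<close>, and \<open>\<theta>'\<close> is orthogonal to degree \<open>k - 1\<close>, hence
  so is \<open>D\<close>. Testing with \<open>D / (s - a)\<close> shows \<open>D = 0\<close>.\<close>

lemma lifting_collocation:
  assumes ab: "a < b" and p: "degree p \<le> k" and r: "degree r \<le> k"
    and th: "degree \<theta> \<le> k + 1" "\<And>\<mu>. \<mu> \<le> k \<Longrightarrow> poly \<theta> (node a b \<mu>) = 0" "poly (pderiv \<theta>) a = 1"
    and weak: "\<And>\<psi>. degree \<psi> \<le> k - 1 \<Longrightarrow> pint a b ((pderiv p - r) * \<psi>) = 0"
  shows "pderiv (p - smult (poly (pderiv p) a - poly r a) \<theta>) = r"
proof -
  define D where "D = pderiv (p - smult (poly (pderiv p) a - poly r a) \<theta>) - r"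
  have "poly D a = 0" using th(3) by (simp add: D_def pderiv_diff pderiv_smult)
  then obtain E where E: "D = [:-a, 1:] * E" by (auto simp: poly_eq_0_iff_dvd dvd_def)
  have orth: "pint a b (D * \<psi>) = 0" if "degree \<psi> \<le> k - 1" for \<psi>
  proof -
    have "D * \<psi> = (pderiv p - r) * \<psi> - smult (poly (pderiv p) a - poly r a) (pderiv \<theta> * \<psi>)"
      by (simp add: D_def pderiv_diff pderiv_smult algebra_simps)
    then show ?thesis
      using weak[OF that] pderiv_orthogonal[OF ab th(1,2) that] by (simp add: pint_diff pint_smult)
  qed
  have "D = 0"
  proof (rule ccontr)
    assume "D \<noteq> 0"
    then have E0: "E \<noteq> 0" using E by auto
    have "degree D \<le> k" unfolding D_def pderiv_diff pderiv_smult
      using p r th(1) by (intro degree_diff_le) (auto simp: degree_pderiv intro: order_trans[OF degree_smult_le])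
    moreover have "degree D = 1 + degree E" unfolding E using E0 by (subst degree_mult_eq) auto
    ultimately have "degree E \<le> k - 1" by linarith
    from orth[OF this] have "pint a b ([:-a, 1:] * (E * E)) = 0" by (simp only: E mult.assoc)
    then have "E = 0" by (rule pint_square_eq_0[OF ab, rotated 2]) auto
    with E0 show False by simp
  qed
  then show ?thesis by (simp add: D_def)
qed

lemma legendre_pderiv:
  assumes ab: "a < b"
    and th: "degree \<theta> \<le> k + 1" "\<And>\<mu>. \<mu> \<le> k \<Longrightarrow> poly \<theta> (node a b \<mu>) = 0" "poly (pderiv \<theta>) a = 1"
  shows "legendre k a b (pderiv \<theta>)"
proof
  show "degree (pderiv \<theta>) = k"
  proof (rule ccontr)
    assume "degree (pderiv \<theta>) \<noteq> k"
    then have "degree \<theta> \<le> k" using th(1) by (simp add: degree_pderiv)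
    then have "\<theta> = 0" using th(2) by (intro poly_eq_by_nodes[OF ab]) auto
    then show False using th(3) by simp
  qed
qed (use k ab pderiv_orthogonal[OF ab th(1,2)] in auto)

text \<open>The continuous function with initial value \<open>v\<close> whose derivative on each step is the
  interpolant of \<open>g\<close>. Index \<open>Suc n\<close> stands for the step from \<open>t
  n\<close> to \<open>t (Suc n)\<close>; index \<open>0\<close> only carries the initial value.\<close>

primrec integrated_interp :: "(nat \<Rightarrow> real) \<Rightarrow> (real \<Rightarrow> real) \<Rightarrow> real \<Rightarrow> nat \<Rightarrow> real poly" where
  "integrated_interp t g v 0 = [:v:]"
| "integrated_interp t g v (Suc n) = (SOME q. pderiv q = interp (t n) (t (Suc n)) g \<and>
     degree q \<le> k + 1 \<and> poly q (t n) = poly (integrated_interp t g v n) (t n))"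

lemma integrated_interp:
  "pderiv (integrated_interp t g v (Suc n)) = interp (t n) (t (Suc n)) g"
  "degree (integrated_interp t g v (Suc n)) \<le> k + 1"
  "poly (integrated_interp t g v (Suc n)) (t n) = poly (integrated_interp t g v n) (t n)"
proof -
  have "\<exists>q. pderiv q = interp (t n) (t (Suc n)) g \<and> degree q \<le> k + 1 \<and>
      poly q (t n) = poly (integrated_interp t g v n) (t n)"
    using poly_antiderivative[of "interp (t n) (t (Suc n)) g" "t n" "poly (integrated_interp t g v n) (t n)"]
      degree_interp[of "t n" "t (Suc n)" g] by (meson add_le_mono1 order_trans)
  from someI_ex[OF this] show
    "pderiv (integrated_interp t g v (Suc n)) = interp (t n) (t (Suc n)) g"
    "degree (integrated_interp t g v (Suc n)) \<le> k + 1"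
    "poly (integrated_interp t g v (Suc n)) (t n) = poly (integrated_interp t g v n) (t n)"
    by auto
qed

declare integrated_interp.simps(2) [simp del]

text \<open>The errors over whole steps add up to \<open>T\<close> times the order \<open>k + 2\<close>. To
  this, the error inside the last step is added, which has the same order.\<close>

lemma integrated_interp_global_error:
  assumes mesh: "time_mesh T N t" and tau: "\<And>n. n < N \<Longrightarrow> t (Suc n) - t n \<le> \<tau>"
    and G: "derivs {0..T} (k + 3) G"
    and S: "\<And>s j. s \<in> {0..T} \<Longrightarrow> j \<in> {k + 2, k + 3} \<Longrightarrow> \<bar>G j s\<bar> \<le> S"
    and n: "n < N" and s: "s \<in> {t n..t (Suc n)}"
  shows "\<bar>G 0 s - poly (integrated_interp t (G 1) (G 0 0) (Suc n)) s\<bar> \<le> (1 + \<Lambda>) * (1 + T) * (S * \<tau> ^ (k + 2))"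
proof -
  let ?J = "integrated_interp t (G 1) (G 0 0)"
  have lt: "t i < t (Suc i)" if "i < N" for i using mesh that by (simp add: time_mesh_def)
  have t0: "t 0 = 0" and tN: "t N = T" using mesh by (auto simp: time_mesh_def)
  have mono: "t i \<le> t j" if "i \<le> j" "j \<le> N" for i j
    using that by (induction j) (auto simp: le_Suc_eq Suc_le_eq intro: order_trans less_imp_le lt)
  have tT: "t i \<le> T" "0 \<le> t i" if "i \<le> N" for i using mono[of i N] mono[of 0 i] that t0 tN by auto
  have sub: "{t i..t (Suc i)} \<subseteq> {0..T}" if "i < N" for i using tT[of i] tT[of "Suc i"] that by auto
  have S0: "S \<ge> 0" using S[of 0 "k + 2"] tT[of 0] t0 by auto
  have tau0: "\<tau> \<ge> 0" using tau[of n] lt[of n] n by auto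
  have loc: "x \<in> {t i..t (Suc i)} \<Longrightarrow> \<bar>(G 0 x - poly (?J (Suc i)) x) - (G 0 (t i) - poly (?J (Suc i)) (t i))\<bar>
       \<le> (1 + \<Lambda>) * S * (t (Suc i) - t i) ^ (k + 2)"
    "\<bar>(G 0 (t (Suc i)) - poly (?J (Suc i)) (t (Suc i))) - (G 0 (t i) - poly (?J (Suc i)) (t i))\<bar>
       \<le> (1 + \<Lambda>) * S * (t (Suc i) - t i) ^ (k + 3)" if i: "i < N" for i x
  proof -
    have S': "\<bar>G j y\<bar> \<le> S" if "y \<in> {t i..t (Suc i)}" "j \<in> {k + 2, k + 3}" for y j
      using S sub[OF i] that by blast
    note prems = lt[OF i] derivs_subset[OF G sub[OF i] order.refl]
    show "\<bar>(G 0 x - poly (?J (Suc i)) x) - (G 0 (t i) - poly (?J (Suc i)) (t i))\<bar>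
       \<le> (1 + \<Lambda>) * S * (t (Suc i) - t i) ^ (k + 2)" if "x \<in> {t i..t (Suc i)}"
      by (rule integrated_interp_error(1)[OF prems S' _ that]) (simp_all only: integrated_interp(1) One_nat_def)
    show "\<bar>(G 0 (t (Suc i)) - poly (?J (Suc i)) (t (Suc i))) - (G 0 (t i) - poly (?J (Suc i)) (t i))\<bar>
       \<le> (1 + \<Lambda>) * S * (t (Suc i) - t i) ^ (k + 3)"
      by (rule integrated_interp_error(2)[OF prems S']) (simp_all only: integrated_interp(1) One_nat_def)
  qed
  define c where "c = (1 + \<Lambda>) * S * \<tau> ^ (k + 2)"
  have c0: "c \<ge> 0" unfolding c_def using S0 tau0 \<Lambda>_ge_1 by auto
  have nodes: "\<bar>G 0 (t i) - poly (?J i) (t i)\<bar> \<le> c * t i" if "i \<le> N" for i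
    using that
  proof (induction i)
    case 0
    then show ?case by (simp add: t0)
  next
    case (Suc i)
    then have i: "i < N" by simp
    have "\<bar>(G 0 (t (Suc i)) - poly (?J (Suc i)) (t (Suc i))) - (G 0 (t i) - poly (?J (Suc i)) (t i))\<bar>
       \<le> (1 + \<Lambda>) * S * (t (Suc i) - t i) ^ (k + 3)"
      by (rule loc(2)) (use i in auto)
    also have "\<dots> \<le> c * (t (Suc i) - t i)"
    proof -
      have "(t (Suc i) - t i) ^ (k + 3) = (t (Suc i) - t i) ^ (k + 2) * (t (Suc i) - t i)"
        by (simp add: power_add numeral_eq_Suc)
      also have "\<dots> \<le> \<tau> ^ (k + 2) * (t (Suc i) - t i)"
        using tau[OF i] lt[OF i] by (intro mult_right_mono power_mono) auto
      finally show ?thesis unfolding c_def using S0 \<Lambda>_ge_1 by (simp add: mult.assoc mult_left_mono)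
    qed
    finally have "\<bar>(G 0 (t (Suc i)) - poly (?J (Suc i)) (t (Suc i))) - (G 0 (t i) - poly (?J i) (t i))\<bar> \<le> c * (t (Suc i) - t i)"
      by (simp add: integrated_interp(3))
    then show ?case using Suc by (simp add: right_diff_distrib)
  qed
  have "\<bar>(G 0 s - poly (?J (Suc n)) s) - (G 0 (t n) - poly (?J (Suc n)) (t n))\<bar> \<le> (1 + \<Lambda>) * S * (t (Suc n) - t n) ^ (k + 2)"
    by (rule loc(1)) (use n s in auto)
  also have "\<dots> \<le> c" unfolding c_def using S0 \<Lambda>_ge_1 tau[OF n] lt[OF n]
    by (intro mult_left_mono power_mono) auto
  finally have "\<bar>G 0 s - poly (?J (Suc n)) s\<bar> \<le> c + \<bar>G 0 (t n) - poly (?J n) (t n)\<bar>"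
    by (simp add: integrated_interp(3))
  also have "\<dots> \<le> c + c * T"
    using nodes[of n] n tT[of n] mult_left_mono[OF tT(1)[of n] c0] by fastforce
  finally show ?thesis by (simp add: c_def algebra_simps)
qed

end

text \<open>The lifting of one mode, with steps counted from \<open>0\<close>: \<open>mode_slope\<close> is the
  slope of the lifting at the left end of a step, inherited from the step before.\<close>

primrec mode_slope :: "(nat \<Rightarrow> real) \<Rightarrow> (nat \<Rightarrow> real poly) \<Rightarrow> (nat \<Rightarrow> real poly) \<Rightarrow> real \<Rightarrow> nat \<Rightarrow> real" where
  "mode_slope t \<theta> p d 0 = d"
| "mode_slope t \<theta> p d (Suc n) =
     poly (pderiv (p n - smult (poly (pderiv (p n)) (t n) - mode_slope t \<theta> p d n) (\<theta> n))) (t (Suc n))"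

definition mode_lift :: "(nat \<Rightarrow> real) \<Rightarrow> (nat \<Rightarrow> real poly) \<Rightarrow> (nat \<Rightarrow> real poly) \<Rightarrow> real \<Rightarrow> nat \<Rightarrow> real poly" where
  "mode_lift t \<theta> p d n = p n - smult (poly (pderiv (p n)) (t n) - mode_slope t \<theta> p d n) (\<theta> n)"

text \<open>One mode of the problem, with eigenvalue \<open>\<kappa>\<close>. On the step from \<open>t
  n\<close> to \<open>t (Suc n)\<close> the discrete solution is \<open>(P0 n, P1 n)\<close>. The
  reference solution \<open>(W0 0, W1 0)\<close>, with time derivatives \<open>(W0 j, W1 j)\<close>,
  satisfies the mode equation up to the perturbation \<open>r\<close> of the first component. The
  amplitudes \<open>A\<close> and \<open>R\<close> measure the reference solution and the
  perturbation in norms with one more factor \<open>sqrt \<kappa>\<close> than the square root of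
  the energy, since the high energy below needs this.\<close>

locale galerkin_mode = gauss_lobatto_rule +
  fixes T :: real and N :: nat and t :: "nat \<Rightarrow> real" and \<tau> \<kappa> c A R :: real
    and \<theta> P0 P1 :: "nat \<Rightarrow> real poly" and W0 W1 :: "nat \<Rightarrow> real \<Rightarrow> real" and f r :: "real \<Rightarrow> real"
  assumes mesh: "time_mesh T N t" and tau: "\<And>n. n < N \<Longrightarrow> t (Suc n) - t n \<le> \<tau>"
    and c: "0 < c" "c \<le> \<kappa>"
    and th: "\<And>n. n < N \<Longrightarrow> degree (\<theta> n) \<le> k + 1"
      "\<And>n \<mu>. n < N \<Longrightarrow> \<mu> \<le> k \<Longrightarrow> poly (\<theta> n) (node (t n) (t (Suc n)) \<mu>) = 0"
      "\<And>n. n < N \<Longrightarrow> poly (pderiv (\<theta> n)) (t n) = 1"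
    and degP: "\<And>n. n < N \<Longrightarrow> degree (P0 n) \<le> k" "\<And>n. n < N \<Longrightarrow> degree (P1 n) \<le> k"
    and contP: "\<And>n. Suc n < N \<Longrightarrow> poly (P0 n) (t (Suc n)) = poly (P0 (Suc n)) (t (Suc n))"
      "\<And>n. Suc n < N \<Longrightarrow> poly (P1 n) (t (Suc n)) = poly (P1 (Suc n)) (t (Suc n))"
    and gal0: "\<And>n \<psi>. n < N \<Longrightarrow> degree \<psi> \<le> k - 1 \<Longrightarrow>
      pint (t n) (t (Suc n)) (pderiv (P0 n) * \<psi>) = pint (t n) (t (Suc n)) (P1 n * \<psi>)"
    and gal1: "\<And>n \<psi>. n < N \<Longrightarrow> degree \<psi> \<le> k - 1 \<Longrightarrow>
      pint (t n) (t (Suc n)) (pderiv (P1 n) * \<psi>)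
        = pint (t n) (t (Suc n)) ((interp (t n) (t (Suc n)) f - smult \<kappa> (P0 n)) * \<psi>)"
    and W: "derivs {0..T} (k + 3) W0" "derivs {0..T} (k + 3) W1"
    and eq0: "\<And>s. s \<in> {0..T} \<Longrightarrow> W0 1 s = W1 0 s + r s"
    and eq1: "\<And>s. s \<in> {0..T} \<Longrightarrow> W1 1 s = f s - \<kappa> * W0 0 s"
    and A: "\<And>s j. s \<in> {0..T} \<Longrightarrow> j \<in> {k + 2, k + 3} \<Longrightarrow> \<kappa> * \<bar>W0 j s\<bar> \<le> A"
      "\<And>s j. s \<in> {0..T} \<Longrightarrow> j \<in> {k + 2, k + 3} \<Longrightarrow> sqrt \<kappa> * \<bar>W1 j s\<bar> \<le> A"
    and R: "\<And>s. s \<in> {0..T} \<Longrightarrow> \<kappa> * \<bar>r s\<bar> \<le> R" "\<kappa> * \<bar>W0 0 0 - poly (P0 0) 0\<bar> \<le> R"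
    and init1: "W1 0 0 = poly (P1 0) 0"
begin

lemma lt: "n < N \<Longrightarrow> t n < t (Suc n)" and t0: "t 0 = 0" and N0: "0 < N"
  using mesh by (auto simp: time_mesh_def)

lemma t_mono: "i \<le> j \<Longrightarrow> j \<le> N \<Longrightarrow> t i \<le> t j"
  by (induction j) (auto simp: le_Suc_eq Suc_le_eq intro: order_trans less_imp_le lt)

lemma tT: "i \<le> N \<Longrightarrow> 0 \<le> t i \<and> t i \<le> T"
  using t_mono[of 0 i] t_mono[of i N] mesh by (auto simp: time_mesh_def)

lemma step_subset: "n < N \<Longrightarrow> {t n..t (Suc n)} \<subseteq> {0..T}"
  using tT[of n] tT[of "Suc n"] by auto

lemma T: "0 \<le> T" and kap: "0 < \<kappa>"
  using tT[of 0] c by auto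

lemma AR: "0 \<le> A" "0 \<le> R"
proof -
  have "0 \<le> \<kappa> * \<bar>W0 (k + 2) 0\<bar>" "0 \<le> \<kappa> * \<bar>r 0\<bar>" using kap by auto
  then show "0 \<le> A" "0 \<le> R" using A(1)[of 0 "k + 2"] R(1)[of 0] T by auto
qed

lemma tau0: "0 \<le> \<tau>"
  using tau[OF N0] lt[OF N0] by simp

lemma len: "n < N \<Longrightarrow> t (Suc n) - t n \<le> T"
  using tT[of n] tT[of "Suc n"] by auto

abbreviation (input) "II n \<equiv> interp (t n) (t (Suc n))"

abbreviation (input) "L0 \<equiv> mode_lift t \<theta> P0 (poly (P1 0) 0)"
abbreviation (input) "L1 \<equiv> mode_lift t \<theta> P1 (f 0 - \<kappa> * poly (P0 0) 0)"

lemma interp_cong_step: "n < N \<Longrightarrow> (\<And>s. s \<in> {0..T} \<Longrightarrow> g s = h s) \<Longrightarrow> II n g = II n h"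
proof (rule interp_cong)
  fix \<mu> assume "n < N" "\<And>s. s \<in> {0..T} \<Longrightarrow> g s = h s" "\<mu> \<le> k"
  moreover have "node (t n) (t (Suc n)) \<mu> \<in> {t n..t (Suc n)}"
    using node_range[OF less_imp_le[OF lt[OF \<open>n < N\<close>]] \<open>\<mu> \<le> k\<close>] by simp
  ultimately show "g (node (t n) (t (Suc n)) \<mu>) = h (node (t n) (t (Suc n)) \<mu>)"
    using step_subset by blast
qed

lemma interp_W0': "n < N \<Longrightarrow> II n (W0 1) = II n (W1 0) + II n r"
  unfolding interp_add[symmetric] by (rule interp_cong_step) (use eq0 in auto)

lemma interp_W1': "n < N \<Longrightarrow> II n (W1 1) = II n f - smult \<kappa> (II n (W0 0))"
  unfolding interp_diff[symmetric] interp_cmult[symmetric] by (rule interp_cong_step) (use eq1 in auto)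

text \<open>By induction on the step, the slope of the lifting is the value of the right-hand side at the left
  end, as \<open>lifting_collocation\<close> requires; the right-hand side is continuous across the
  time nodes.\<close>

lemma slopes: "n < N \<Longrightarrow>
   mode_slope t \<theta> P0 (poly (P1 0) 0) n = poly (P1 n) (t n) \<and>
   mode_slope t \<theta> P1 (f 0 - \<kappa> * poly (P0 0) 0) n = poly (II n f - smult \<kappa> (P0 n)) (t n)"
  and lift_ode: "n < N \<Longrightarrow> pderiv (L0 n) = P1 n \<and> pderiv (L1 n) = II n f - smult \<kappa> (P0 n)"
proof -
  have ends: "poly (II n f) (t n) = f (t n)" "poly (II n f) (t (Suc n)) = f (t (Suc n))" if "n < N" for n
    using poly_interp_node[OF lt[OF that], of 0 f] poly_interp_node[OF lt[OF that], of k f]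
    by (auto simp: node_0 node_k)
  have ode: "pderiv (L0 n) = P1 n \<and> pderiv (L1 n) = II n f - smult \<kappa> (P0 n)"
    if n: "n < N" and sl: "mode_slope t \<theta> P0 (poly (P1 0) 0) n = poly (P1 n) (t n)"
      "mode_slope t \<theta> P1 (f 0 - \<kappa> * poly (P0 0) 0) n = poly (II n f - smult \<kappa> (P0 n)) (t n)" for n
  proof
    show "pderiv (L0 n) = P1 n"
      unfolding mode_lift_def sl
      by (rule lifting_collocation[OF lt[OF n]])
         (use n degP th gal0 in \<open>auto simp: left_diff_distrib pint_diff\<close>)
    have "degree (II n f - smult \<kappa> (P0 n)) \<le> k"
      using degP n by (intro degree_diff_le degree_interp) (auto intro: order_trans[OF degree_smult_le])
    then show "pderiv (L1 n) = II n f - smult \<kappa> (P0 n)"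
      unfolding mode_lift_def sl
      by (intro lifting_collocation[OF lt[OF n]])
         (use n degP th gal1 in \<open>auto simp: left_diff_distrib[of "pderiv (P1 n)"] pint_diff\<close>)
  qed
  have slopes: "mode_slope t \<theta> P0 (poly (P1 0) 0) n = poly (P1 n) (t n) \<and>
     mode_slope t \<theta> P1 (f 0 - \<kappa> * poly (P0 0) 0) n = poly (II n f - smult \<kappa> (P0 n)) (t n)" if "n < N" for n
    using that
  proof (induction n)
    case 0
    then show ?case using ends[OF N0] t0 by simp
  next
    case (Suc n)
    then have n: "n < N" by simp
    have "mode_slope t \<theta> p d (Suc n) = poly (pderiv (mode_lift t \<theta> p d n)) (t (Suc n))" for p d
      by (simp add: mode_lift_def)
    then show ?case using ode[OF n] Suc contP[of n] ends[OF n] ends[of "Suc n"] by (simp del: mode_slope.simps)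
  qed
  show "n < N \<Longrightarrow> mode_slope t \<theta> P0 (poly (P1 0) 0) n = poly (P1 n) (t n) \<and>
     mode_slope t \<theta> P1 (f 0 - \<kappa> * poly (P0 0) 0) n = poly (II n f - smult \<kappa> (P0 n)) (t n)"
    using slopes .
  show "n < N \<Longrightarrow> pderiv (L0 n) = P1 n \<and> pderiv (L1 n) = II n f - smult \<kappa> (P0 n)"
    using slopes ode by blast
qed

text \<open>\<open>(J0 n, J1 n)\<close> is the comparison function: it satisfies the equations of the lifting up
  to the interpolated perturbation and interpolated errors of order \<open>k + 2\<close>. The target
  of the estimates is \<open>X\<close>, and \<open>X'\<close> is its analogue with one order less.\<close>

definition "J0 n = integrated_interp t (W0 1) (W0 0 0) (Suc n)"
definition "J1 n = integrated_interp t (W1 1) (W1 0 0) (Suc n)"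
definition "X = A * \<tau> ^ (k + 2) + R"
definition "X' = A * \<tau> ^ (k + 1) + R"

lemma X0: "0 \<le> X" "0 \<le> X'"
  unfolding X_def X'_def using AR tau0 by auto

lemma A_le_X: "A * \<tau> ^ (k + 2) \<le> X" "A * \<tau> ^ (k + 1) \<le> X'" "R \<le> X" "R \<le> X'"
  unfolding X_def X'_def using AR tau0 by auto

text \<open>A factor of the step size turns the lower order into the full one.\<close>

lemma len_X': "n < N \<Longrightarrow> (t (Suc n) - t n) * X' \<le> (1 + T) * X"
proof -
  assume n: "n < N"
  have "(t (Suc n) - t n) * X' = A * \<tau> ^ (k + 1) * (t (Suc n) - t n) + (t (Suc n) - t n) * R"
    by (simp add: X'_def algebra_simps)
  also have "\<dots> \<le> A * \<tau> ^ (k + 1) * \<tau> + T * R"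
    using AR tau0 tau[OF n] len[OF n] by (intro add_mono mult_left_mono mult_right_mono) auto
  also have "\<dots> = A * \<tau> ^ (k + 2) + T * R" by simp
  also have "\<dots> \<le> X + T * X" using A_le_X T by (intro add_mono mult_left_mono) auto
  finally show ?thesis by (simp add: algebra_simps)
qed

definition "C\<eta> = (1 + \<Lambda>) * (1 + T)"

lemma C\<eta>: "0 \<le> C\<eta>"
  unfolding C\<eta>_def using \<Lambda>_ge_1 T by simp

lemma eta0: "n < N \<Longrightarrow> s \<in> {t n..t (Suc n)} \<Longrightarrow> \<kappa> * \<bar>W0 0 s - poly (J0 n) s\<bar> \<le> C\<eta> * X"
proof -
  assume n: "n < N" and s: "s \<in> {t n..t (Suc n)}"
  have "\<bar>W0 0 s - poly (J0 n) s\<bar> \<le> (1 + \<Lambda>) * (1 + T) * (A / \<kappa> * \<tau> ^ (k + 2))"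
    unfolding J0_def
    by (rule integrated_interp_global_error[OF mesh tau W(1) _ n s])
       (use A(1) kap in \<open>auto simp: field_simps\<close>)
  then have "\<kappa> * \<bar>W0 0 s - poly (J0 n) s\<bar> \<le> C\<eta> * (A * \<tau> ^ (k + 2))"
    using kap unfolding C\<eta>_def by (simp add: field_simps)
  also have "\<dots> \<le> C\<eta> * X" using C\<eta> A_le_X by (intro mult_left_mono) auto
  finally show ?thesis .
qed

lemma eta1: "n < N \<Longrightarrow> s \<in> {t n..t (Suc n)} \<Longrightarrow> sqrt \<kappa> * \<bar>W1 0 s - poly (J1 n) s\<bar> \<le> C\<eta> * X"
proof -
  assume n: "n < N" and s: "s \<in> {t n..t (Suc n)}"
  have sk: "sqrt \<kappa> > 0" using kap by simp
  have "\<bar>W1 0 s - poly (J1 n) s\<bar> \<le> (1 + \<Lambda>) * (1 + T) * (A / sqrt \<kappa> * \<tau> ^ (k + 2))"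
    unfolding J1_def
    by (rule integrated_interp_global_error[OF mesh tau W(2) _ n s])
       (use A(2) sk in \<open>auto simp: field_simps\<close>)
  then have "sqrt \<kappa> * \<bar>W1 0 s - poly (J1 n) s\<bar> \<le> C\<eta> * (A * \<tau> ^ (k + 2))"
    using sk unfolding C\<eta>_def by (simp add: field_simps)
  also have "\<dots> \<le> C\<eta> * X" using C\<eta> A_le_X by (intro mult_left_mono) auto
  finally show ?thesis .
qed

lemma sqrt_c: "0 < sqrt c" "sqrt c \<le> sqrt \<kappa>" "sqrt \<kappa> * sqrt \<kappa> = \<kappa>" "0 < sqrt \<kappa>"
  using c kap by auto

lemma sqrt_kappa_le: "\<kappa> * \<bar>x\<bar> \<le> B \<Longrightarrow> sqrt \<kappa> * \<bar>x\<bar> \<le> B / sqrt c"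
proof -
  assume *: "\<kappa> * \<bar>x\<bar> \<le> B"
  have "sqrt c * (sqrt \<kappa> * \<bar>x\<bar>) \<le> sqrt \<kappa> * (sqrt \<kappa> * \<bar>x\<bar>)"
    using sqrt_c by (intro mult_right_mono) auto
  also have "\<dots> \<le> B" using * sqrt_c(3) by (metis mult.assoc)
  finally show ?thesis using sqrt_c(1) by (simp add: field_simps)
qed

definition "K1 = \<Lambda> * (C\<eta> + 1 / sqrt c)"

lemma K1: "0 \<le> K1"
  unfolding K1_def using \<Lambda>_ge_1 C\<eta> sqrt_c(1) by (auto intro!: mult_nonneg_nonneg add_nonneg_nonneg)

lemma interp_scaled:
  assumes "n < N" "0 < a" "\<And>s. s \<in> {t n..t (Suc n)} \<Longrightarrow> a * \<bar>g s\<bar> \<le> B" "s \<in> {t n..t (Suc n)}"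
  shows "a * \<bar>poly (II n g) s\<bar> \<le> \<Lambda> * B"
proof -
  have "\<bar>poly (II n g) s\<bar> \<le> \<Lambda> * (B / a)"
    by (rule \<Lambda>_interp[OF lt[OF assms(1)] _ assms(4)]) (use assms in \<open>auto simp: field_simps\<close>)
  then show ?thesis using assms(2) by (simp add: field_simps)
qed

text \<open>The low energy belongs to the interpolated difference of comparison function and lifting; the
  lifting agrees with the discrete solution at the nodes. The residuals \<open>g0\<close>,
  \<open>g1\<close> are bounded by a multiple of \<open>X\<close>.\<close>

definition "Y0 n = II n (poly (J0 n)) - P0 n"
definition "Y1 n = II n (poly (J1 n)) - P1 n"
definition "g0 n = II n (\<lambda>s. W1 0 s - poly (J1 n) s) + II n r"
definition "g1 n = smult (- \<kappa>) (II n (\<lambda>s. W0 0 s - poly (J0 n) s))"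

lemma J_props: "pderiv (J0 n) = II n (W0 1)" "degree (J0 n) \<le> k + 1"
  "pderiv (J1 n) = II n (W1 1)" "degree (J1 n) \<le> k + 1"
  unfolding J0_def J1_def by (simp_all only: integrated_interp)

lemma J_cont: "poly (J0 (Suc n)) (t (Suc n)) = poly (J0 n) (t (Suc n))"
  "poly (J1 (Suc n)) (t (Suc n)) = poly (J1 n) (t (Suc n))"
  unfolding J0_def J1_def by (simp_all only: integrated_interp(3)[of _ _ _ "Suc n"])

lemma J_start: "poly (J0 0) 0 = W0 0 0" "poly (J1 0) 0 = W1 0 0"
  unfolding J0_def J1_def using integrated_interp(3)[of t _ _ 0] t0 by auto

lemma ends: "n < N \<Longrightarrow> poly (II n g) (t n) = g (t n)" "n < N \<Longrightarrow> poly (II n g) (t (Suc n)) = g (t (Suc n))"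
  using poly_interp_node[OF lt, of n 0 g] poly_interp_node[OF lt, of n k g] by (auto simp: node_0 node_k)

lemma degree_interp_smult: "degree (smult a (II n g)) \<le> k"
  by (rule order_trans[OF degree_smult_le degree_interp])

text \<open>The interpolation error of \<open>J\<close> vanishes at the nodes, so its derivative is orthogonal
  to degree \<open>k - 1\<close>.\<close>

lemma pint_J:
  assumes n: "n < N" and \<psi>: "degree \<psi> \<le> k - 1" and J: "degree J \<le> k + 1"
  shows "pint (t n) (t (Suc n)) (pderiv (II n (poly J)) * \<psi>) = pint (t n) (t (Suc n)) (pderiv J * \<psi>)"
proof -
  have d: "degree (II n (poly J) - J) \<le> k + 1"
    using degree_interp[of "t n" "t (Suc n)" "poly J"] J by (intro degree_diff_le) auto
  have "pint (t n) (t (Suc n)) (pderiv (II n (poly J) - J) * \<psi>) = 0"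
    by (rule pderiv_orthogonal[OF lt[OF n] d _ \<psi>]) (use poly_interp_node lt[OF n] in auto)
  then show ?thesis by (simp add: pderiv_diff left_diff_distrib pint_diff)
qed

lemma low_step: "n < N \<Longrightarrow> galerkin_step k (t n) (t (Suc n)) (pderiv (\<theta> n)) \<kappa> (Y0 n) (Y1 n) (g0 n) (g1 n)"
proof -
  assume n: "n < N"
  interpret legendre k "t n" "t (Suc n)" "pderiv (\<theta> n)"
    by (rule legendre_pderiv[OF lt[OF n]]) (use th n in auto)
  show ?thesis
  proof
    show "0 \<le> \<kappa>" using kap by simp
    show "degree (Y0 n) \<le> k" "degree (Y1 n) \<le> k" "degree (g0 n) \<le> k" "degree (g1 n) \<le> k"
      unfolding Y0_def Y1_def g0_def g1_def using degP n
      by (auto intro!: degree_diff_le degree_add_le degree_interp degree_interp_smult)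
    fix \<psi> :: "real poly" assume \<psi>: "degree \<psi> \<le> k - 1"
    have "Y1 n + g0 n = II n (W0 1) - P1 n"
      unfolding Y1_def g0_def interp_diff interp_W0'[OF n] by simp
    moreover have "pint (t n) (t (Suc n)) (pderiv (Y0 n) * \<psi>) = pint (t n) (t (Suc n)) ((II n (W0 1) - P1 n) * \<psi>)"
      unfolding Y0_def pderiv_diff left_diff_distrib pint_diff pint_J[OF n \<psi> J_props(2)] J_props(1) gal0[OF n \<psi>] ..
    ultimately show "pint (t n) (t (Suc n)) (pderiv (Y0 n) * \<psi>) = pint (t n) (t (Suc n)) ((Y1 n + g0 n) * \<psi>)"
      by simp
    have e: "g1 n - smult \<kappa> (Y0 n) = II n (W1 1) - (II n f - smult \<kappa> (P0 n))"
      unfolding Y0_def g1_def interp_diff interp_W1'[OF n] by (simp add: smult_diff_right)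
    have "pint (t n) (t (Suc n)) (pderiv (Y1 n) * \<psi>) = pint (t n) (t (Suc n)) ((II n (W1 1) - (II n f - smult \<kappa> (P0 n))) * \<psi>)"
      unfolding Y1_def pderiv_diff left_diff_distrib[of "pderiv _"] left_diff_distrib[of "II n (W1 1)"]
        pint_diff pint_J[OF n \<psi> J_props(4)] J_props(3) gal1[OF n \<psi>] ..
    then show "pint (t n) (t (Suc n)) (pderiv (Y1 n) * \<psi>) = pint (t n) (t (Suc n)) ((g1 n - smult \<kappa> (Y0 n)) * \<psi>)"
      unfolding e .
  qed
qed

lemma sq_le: "\<bar>x\<bar> \<le> y \<Longrightarrow> x\<^sup>2 \<le> (y :: real)\<^sup>2"
  using power_mono[of "\<bar>x\<bar>" y 2] by simp

lemma energy_le: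
  assumes "sqrt \<kappa> * \<bar>poly p s\<bar> \<le> B" "\<bar>poly q s\<bar> \<le> B"
  shows "poly (energy \<kappa> p q) s \<le> 2 * B\<^sup>2"
proof -
  have "\<kappa> * (poly p s)\<^sup>2 = (sqrt \<kappa> * \<bar>poly p s\<bar>)\<^sup>2" using kap by (simp add: power_mult_distrib)
  also have "\<dots> \<le> B\<^sup>2" using assms(1) kap by (intro power_mono) auto
  finally show ?thesis using sq_le[OF assms(2)] by (simp add: poly_energy)
qed

lemma R_step: "n < N \<Longrightarrow> s \<in> {t n..t (Suc n)} \<Longrightarrow> \<kappa> * \<bar>r s\<bar> \<le> R"
  using R(1) step_subset by blast

lemma low_bound: "n < N \<Longrightarrow> s \<in> {t n..t (Suc n)} \<Longrightarrow> poly (energy \<kappa> (g0 n) (g1 n)) s \<le> 2 * (K1 * X)\<^sup>2"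
proof (rule energy_le)
  assume n: "n < N" and s: "s \<in> {t n..t (Suc n)}"
  have 1: "sqrt \<kappa> * \<bar>poly (II n (\<lambda>s. W1 0 s - poly (J1 n) s)) s\<bar> \<le> \<Lambda> * (C\<eta> * X)"
    by (rule interp_scaled[OF n sqrt_c(4) eta1[OF n] s])
  have 2: "sqrt \<kappa> * \<bar>poly (II n r) s\<bar> \<le> \<Lambda> * (R / sqrt c)"
    by (rule interp_scaled[OF n sqrt_c(4) _ s], rule sqrt_kappa_le, rule R_step[OF n])
  have "\<Lambda> * (R / sqrt c) \<le> \<Lambda> * (X / sqrt c)"
    using \<Lambda>_ge_1 A_le_X sqrt_c by (intro mult_left_mono divide_right_mono) auto
  then have sum: "\<Lambda> * (C\<eta> * X) + \<Lambda> * (R / sqrt c) \<le> K1 * X"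
    by (simp add: K1_def algebra_simps)
  have "sqrt \<kappa> * \<bar>poly (g0 n) s\<bar> \<le> sqrt \<kappa> * (\<bar>poly (II n (\<lambda>s. W1 0 s - poly (J1 n) s)) s\<bar> + \<bar>poly (II n r) s\<bar>)"
    unfolding g0_def using sqrt_c by (intro mult_left_mono) auto
  then show "sqrt \<kappa> * \<bar>poly (g0 n) s\<bar> \<le> K1 * X" using 1 2 sum unfolding distrib_left by linarith
  have "\<bar>poly (g1 n) s\<bar> = \<kappa> * \<bar>poly (II n (\<lambda>s. W0 0 s - poly (J0 n) s)) s\<bar>"
    unfolding g1_def using kap by (simp add: abs_mult)
  also have "\<dots> \<le> \<Lambda> * (C\<eta> * X)" by (rule interp_scaled[OF n kap eta0[OF n] s])
  also have "\<dots> \<le> K1 * X"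
    unfolding K1_def using \<Lambda>_ge_1 C\<eta> X0 sqrt_c(1) by (simp add: algebra_simps)
  finally show "\<bar>poly (g1 n) s\<bar> \<le> K1 * X" .
qed

definition "K2 = exp (2 * T) * (1 / c + (1 + 4 * T\<^sup>2) * T * (2 * K1\<^sup>2))"

lemma K2: "0 \<le> K2"
  unfolding K2_def using c T by (auto intro!: mult_nonneg_nonneg add_nonneg_nonneg)

lemma low_energy: "n < N \<Longrightarrow> poly (energy \<kappa> (Y0 n) (Y1 n)) (t n) \<le> K2 * X\<^sup>2"
proof -
  assume n: "n < N"
  have init: "poly (energy \<kappa> (Y0 0) (Y1 0)) (t 0) \<le> X\<^sup>2 / c"
  proof -
    have "sqrt \<kappa> * \<bar>W0 0 0 - poly (P0 0) 0\<bar> \<le> R / sqrt c" by (rule sqrt_kappa_le[OF R(2)])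
    also have "\<dots> \<le> X / sqrt c" using A_le_X sqrt_c by (intro divide_right_mono) auto
    finally have "(sqrt \<kappa> * \<bar>W0 0 0 - poly (P0 0) 0\<bar>)\<^sup>2 \<le> (X / sqrt c)\<^sup>2"
      using sqrt_c by (intro power_mono) auto
    then have "\<kappa> * (W0 0 0 - poly (P0 0) 0)\<^sup>2 \<le> X\<^sup>2 / c"
      using kap c by (simp add: power_mult_distrib power_divide)
    moreover have "poly (Y0 0) (t 0) = W0 0 0 - poly (P0 0) 0" "poly (Y1 0) (t 0) = 0"
      unfolding Y0_def Y1_def using ends[OF N0] J_start init1 t0 by auto
    ultimately show ?thesis by (simp add: poly_energy)
  qed
  have "poly (energy \<kappa> (Y0 n) (Y1 n)) (t n) \<le> exp (2 * T) * (X\<^sup>2 / c + (1 + 4 * T\<^sup>2) * T * (2 * (K1 * X)\<^sup>2))"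
  proof (rule mesh_stability(1)[OF mesh _ low_step _ low_bound init n])
    fix n assume "Suc n < N"
    then show "poly (Y0 n) (t (Suc n)) = poly (Y0 (Suc n)) (t (Suc n)) \<and> poly (Y1 n) (t (Suc n)) = poly (Y1 (Suc n)) (t (Suc n))"
      unfolding Y0_def Y1_def using ends[of n] ends[of "Suc n"] contP[of n] J_cont by simp
  qed (use kap in auto)
  also have "\<dots> = K2 * X\<^sup>2" by (simp add: K2_def power_mult_distrib algebra_simps)
  finally show ?thesis .
qed

text \<open>The high energy belongs to the difference of the interpolated reference solution itself and the
  discrete solution. Its residual is, up to the interpolated perturbation, the commutator of
  interpolation and differentiation.\<close>

definition "y0 n = II n (W0 0) - P0 n"
definition "y1 n = II n (W1 0) - P1 n"
definition "K5 = 2 * exp (2 * T) * (1 + (1 + 4 * T\<^sup>2) * T * (18 * \<Lambda>\<^sup>2)) + 72 * T\<^sup>2 * \<Lambda>\<^sup>2"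

lemma K5: "0 \<le> K5"
  unfolding K5_def using T by (auto intro!: mult_nonneg_nonneg add_nonneg_nonneg)

text \<open>This energy has an additional factor \<open>\<kappa>\<close> and one order less. It is used to bound
  the variation of the lifting inside a single step, where integration in time restores the missing
  order.\<close>

lemma high_energy: "n < N \<Longrightarrow>
  \<kappa> * pint (t n) (t (Suc n)) (energy \<kappa> (y0 n) (y1 n)) \<le> (t (Suc n) - t n) * (K5 * X'\<^sup>2)"
proof -
  assume n: "n < N"
  define Q where "Q G a n d \<longleftrightarrow> degree d \<le> k \<and> (\<forall>s\<in>{t n..t (Suc n)}. a * \<bar>poly d s\<bar> \<le> 2 * \<Lambda> * X') \<and>
    (\<forall>\<psi>. degree \<psi> \<le> k - 1 \<longrightarrow>
      pint (t n) (t (Suc n)) ((pderiv (II n (G 0)) - II n (G 1)) * \<psi>) = pint (t n) (t (Suc n)) (d * \<psi>))" for G :: "nat \<Rightarrow> real \<Rightarrow> real" and a n d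
  have comm: "\<exists>d. Q G a n d"
    if n: "n < N" and G: "derivs {0..T} (k + 3) G" and a: "0 < a"
      and GA: "\<And>s. s \<in> {0..T} \<Longrightarrow> a * \<bar>G (k + 2) s\<bar> \<le> A" for n G a
  proof -
    have "\<bar>G (k + 2) s\<bar> \<le> A / a" if "s \<in> {t n..t (Suc n)}" for s
      using GA[of s] a step_subset[OF n] that by (auto simp: field_simps)
    then obtain d where d: "degree d \<le> k" "\<forall>s\<in>{t n..t (Suc n)}. \<bar>poly d s\<bar> \<le> 2 * \<Lambda> * (A / a * (t (Suc n) - t n) ^ (k + 1))"
      "\<forall>\<psi>. degree \<psi> \<le> k - 1 \<longrightarrow>
      pint (t n) (t (Suc n)) ((pderiv (II n (G 0)) - II n (G 1)) * \<psi>) = pint (t n) (t (Suc n)) (d * \<psi>)"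
      using commutator_error[OF lt[OF n] derivs_subset[OF G step_subset[OF n], of "k + 2"], of "A / a"] by auto
    have "a * \<bar>poly d s\<bar> \<le> 2 * \<Lambda> * X'" if "s \<in> {t n..t (Suc n)}" for s
    proof -
      have "a * \<bar>poly d s\<bar> \<le> 2 * \<Lambda> * (A * (t (Suc n) - t n) ^ (k + 1))"
        using d(2)[rule_format, OF that] a by (simp add: field_simps)
      also have "A * (t (Suc n) - t n) ^ (k + 1) \<le> A * \<tau> ^ (k + 1)"
        using AR tau[OF n] lt[OF n] by (intro mult_left_mono power_mono) auto
      also have "\<dots> \<le> X'" by (rule A_le_X)
      finally show ?thesis using \<Lambda>_ge_1 by simp
    qed
    with d show ?thesis unfolding Q_def by blast
  qed
  obtain e0 where e0: "\<And>n. n < N \<Longrightarrow> Q W0 \<kappa> n (e0 n)"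
    using comm[OF _ W(1) kap] A(1) by (metis insertCI)
  obtain e1 where e1: "\<And>n. n < N \<Longrightarrow> Q W1 (sqrt \<kappa>) n (e1 n)"
    using comm[OF _ W(2) sqrt_c(4)] A(2) by (metis insertCI)
  note e = e0[unfolded Q_def, THEN conjunct1] e1[unfolded Q_def, THEN conjunct1]
    e0[unfolded Q_def, THEN conjunct2, THEN conjunct1, rule_format]
    e1[unfolded Q_def, THEN conjunct2, THEN conjunct1, rule_format]
    e0[unfolded Q_def, THEN conjunct2, THEN conjunct2, rule_format]
    e1[unfolded Q_def, THEN conjunct2, THEN conjunct2, rule_format]
  define d0 where "d0 n = e0 n + II n r" for n
  have step: "galerkin_step k (t n) (t (Suc n)) (pderiv (\<theta> n)) \<kappa> (y0 n) (y1 n) (d0 n) (e1 n)" if n: "n < N" for n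
  proof -
    interpret legendre k "t n" "t (Suc n)" "pderiv (\<theta> n)"
      by (rule legendre_pderiv[OF lt[OF n]]) (use th n in auto)
    show ?thesis
    proof
      show "0 \<le> \<kappa>" using kap by simp
      show "degree (y0 n) \<le> k" "degree (y1 n) \<le> k" "degree (d0 n) \<le> k" "degree (e1 n) \<le> k"
        unfolding y0_def y1_def d0_def using degP n e
        by (auto intro!: degree_diff_le degree_add_le degree_interp)
      fix \<psi> :: "real poly" assume \<psi>: "degree \<psi> \<le> k - 1"
      have "pderiv (y0 n) * \<psi> = (pderiv (II n (W0 0)) - II n (W0 1)) * \<psi> + (II n (W0 1) * \<psi> - pderiv (P0 n) * \<psi>)"
        unfolding y0_def pderiv_diff by (simp add: algebra_simps)
      then have "pint (t n) (t (Suc n)) (pderiv (y0 n) * \<psi>) = pint (t n) (t (Suc n)) (e0 n * \<psi> + (II n (W0 1) * \<psi> - P1 n * \<psi>))"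
        by (simp only: pint_add pint_diff e(5)[OF n \<psi>] gal0[OF n \<psi>])
      also have "e0 n * \<psi> + (II n (W0 1) * \<psi> - P1 n * \<psi>) = (y1 n + d0 n) * \<psi>"
        unfolding y1_def d0_def interp_W0'[OF n] by (simp add: algebra_simps)
      finally show "pint (t n) (t (Suc n)) (pderiv (y0 n) * \<psi>) = pint (t n) (t (Suc n)) ((y1 n + d0 n) * \<psi>)" .
      have "pderiv (y1 n) * \<psi> = (pderiv (II n (W1 0)) - II n (W1 1)) * \<psi> + (II n (W1 1) * \<psi> - pderiv (P1 n) * \<psi>)"
        unfolding y1_def pderiv_diff by (simp add: algebra_simps)
      then have "pint (t n) (t (Suc n)) (pderiv (y1 n) * \<psi>) = pint (t n) (t (Suc n)) (e1 n * \<psi> + (II n (W1 1) * \<psi> - (II n f - smult \<kappa> (P0 n)) * \<psi>))"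
        by (simp only: pint_add pint_diff e(6)[OF n \<psi>] gal1[OF n \<psi>])
      also have "e1 n * \<psi> + (II n (W1 1) * \<psi> - (II n f - smult \<kappa> (P0 n)) * \<psi>) = (e1 n - smult \<kappa> (y0 n)) * \<psi>"
        unfolding y0_def interp_W1'[OF n] by (simp add: algebra_simps smult_diff_right)
      finally show "pint (t n) (t (Suc n)) (pderiv (y1 n) * \<psi>) = pint (t n) (t (Suc n)) ((e1 n - smult \<kappa> (y0 n)) * \<psi>)" .
    qed
  qed
  have X'\<Lambda>: "0 \<le> \<Lambda> * X'" using X0 \<Lambda>_ge_1 by simp
  have bound: "poly (energy \<kappa> (d0 n) (e1 n)) s \<le> (18 * (\<Lambda> * X')\<^sup>2) / \<kappa>" if n: "n < N" and s: "s \<in> {t n..t (Suc n)}" for n s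
  proof -
    have "\<kappa> * \<bar>poly (II n r) s\<bar> \<le> \<Lambda> * R" by (rule interp_scaled[OF n kap R_step[OF n] s])
    also have "\<dots> \<le> \<Lambda> * X'" using A_le_X \<Lambda>_ge_1 by (intro mult_left_mono) auto
    finally have i: "\<kappa> * \<bar>poly (II n r) s\<bar> \<le> \<Lambda> * X'" .
    have "\<kappa> * \<bar>poly (d0 n) s\<bar> \<le> \<kappa> * (\<bar>poly (e0 n) s\<bar> + \<bar>poly (II n r) s\<bar>)"
      unfolding d0_def using kap by (intro mult_left_mono) auto
    also have "\<dots> \<le> 3 * (\<Lambda> * X')" using e(3)[OF n s] i unfolding distrib_left by linarith
    finally have 0: "\<kappa> * \<bar>poly (d0 n) s\<bar> \<le> 3 * (\<Lambda> * X')" .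
    have 1: "\<bar>poly (d0 n) s\<bar> \<le> 3 * (\<Lambda> * X') / \<kappa>" using 0 kap by (simp add: field_simps)
    have 2: "sqrt \<kappa> * \<bar>poly (d0 n) s\<bar> \<le> 3 * (\<Lambda> * X') / sqrt \<kappa>"
    proof -
      have "sqrt \<kappa> * (sqrt \<kappa> * \<bar>poly (d0 n) s\<bar>) \<le> 3 * (\<Lambda> * X')" using 0 sqrt_c(3) by (metis mult.assoc)
      then show ?thesis using sqrt_c(4) by (simp add: field_simps)
    qed
    have 3: "\<bar>poly (e1 n) s\<bar> \<le> 3 * (\<Lambda> * X') / sqrt \<kappa>"
    proof -
      have "sqrt \<kappa> * \<bar>poly (e1 n) s\<bar> \<le> 3 * (\<Lambda> * X')" using e(4)[OF n s] X'\<Lambda> by linarith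
      then show ?thesis using sqrt_c(4) by (simp add: field_simps)
    qed
    have "poly (energy \<kappa> (d0 n) (e1 n)) s \<le> 2 * (3 * (\<Lambda> * X') / sqrt \<kappa>)\<^sup>2" by (rule energy_le[OF 2 3])
    then show ?thesis using kap by (simp add: power_divide power_mult_distrib)
  qed
  have init: "poly (energy \<kappa> (y0 0) (y1 0)) (t 0) \<le> X'\<^sup>2 / \<kappa>"
  proof -
    have "(\<kappa> * \<bar>W0 0 0 - poly (P0 0) 0\<bar>)\<^sup>2 \<le> X'\<^sup>2"
      using R(2) A_le_X kap by (intro power_mono) auto
    then have "\<kappa> * (W0 0 0 - poly (P0 0) 0)\<^sup>2 \<le> X'\<^sup>2 / \<kappa>"
      using kap by (simp add: power_mult_distrib field_simps power2_eq_square)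
    moreover have "poly (y0 0) (t 0) = W0 0 0 - poly (P0 0) 0" "poly (y1 0) (t 0) = 0"
      unfolding y0_def y1_def using ends[OF N0] init1 t0 by auto
    ultimately show ?thesis by (simp add: poly_energy)
  qed
  have cont: "poly (y0 n) (t (Suc n)) = poly (y0 (Suc n)) (t (Suc n)) \<and> poly (y1 n) (t (Suc n)) = poly (y1 (Suc n)) (t (Suc n))"
    if "Suc n < N" for n
    unfolding y0_def y1_def using that ends[of n] ends[of "Suc n"] contP[of n] by simp
  let ?h = "t (Suc n) - t n"
  let ?K = "exp (2 * T) * (1 + (1 + 4 * T\<^sup>2) * T * (18 * \<Lambda>\<^sup>2))"
  have alg: "2 * h * (E * (x / \<kappa> + M * T * (18 * (L * X')\<^sup>2 / \<kappa>))) + 4 * h\<^sup>2 * (h * (18 * (L * X')\<^sup>2 / \<kappa>))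
      = h * ((2 * (E * (1 + M * T * (18 * L\<^sup>2))) + 72 * h\<^sup>2 * L\<^sup>2) * x) / \<kappa>"
    if "x = X'\<^sup>2" for h E M x L
    using kap unfolding that by (simp add: power_mult_distrib field_simps)
  have "pint (t n) (t (Suc n)) (energy \<kappa> (y0 n) (y1 n))
     \<le> 2 * ?h * (exp (2 * T) * (X'\<^sup>2 / \<kappa> + (1 + 4 * T\<^sup>2) * T * (18 * (\<Lambda> * X')\<^sup>2 / \<kappa>))) + 4 * ?h\<^sup>2 * (?h * (18 * (\<Lambda> * X')\<^sup>2 / \<kappa>))"
    by (rule mesh_stability(2)[OF mesh _ step cont bound init n]) (use kap in auto)
  also have "\<dots> = ?h * ((2 * ?K + 72 * ?h\<^sup>2 * \<Lambda>\<^sup>2) * X'\<^sup>2) / \<kappa>"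
    by (rule alg[OF refl])
  finally have "\<kappa> * pint (t n) (t (Suc n)) (energy \<kappa> (y0 n) (y1 n)) \<le> ?h * ((2 * ?K + 72 * ?h\<^sup>2 * \<Lambda>\<^sup>2) * X'\<^sup>2)"
    using kap by (simp add: field_simps)
  also have "\<dots> \<le> ?h * (K5 * X'\<^sup>2)"
  proof -
    have "?h\<^sup>2 \<le> T\<^sup>2" using len[OF n] lt[OF n] by (intro power_mono) auto
    then have "2 * ?K + 72 * ?h\<^sup>2 * \<Lambda>\<^sup>2 \<le> K5" unfolding K5_def by (simp add: mult_right_mono mult.assoc)
    then show ?thesis using lt[OF n] by (intro mult_left_mono mult_right_mono) auto
  qed
  finally show ?thesis .
qed

definition "K6 = sqrt K2 + (1 + T) * sqrt K5 + T * \<Lambda> / sqrt c + C\<eta> / sqrt c"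

text \<open>At the left end of the step the error of the lifting is a nodal value, of full order by the low
  energy. From there the difference \<open>Z\<close> of comparison function and lifting is followed
  by its differential equation \<open>Z0' = y1 + I r\<close>, \<open>Z1' = - \<kappa> y0\<close>:
  the right-hand side carries a factor \<open>\<kappa>\<close> that the low energy does not bound
  uniformly in the mode, but the high energy does, and the length of the step supplies the order.\<close>

theorem mode_error:
  assumes n: "n < N" and s: "s \<in> {t n..t (Suc n)}"
  shows "sqrt \<kappa> * \<bar>W0 0 s - poly (L0 n) s\<bar> \<le> K6 * X" "\<bar>W1 0 s - poly (L1 n) s\<bar> \<le> K6 * X"
proof -
  let ?a = "t n" and ?b = "t (Suc n)"
  let ?h = "?b - ?a"
  have h: "0 < ?h" "?h \<le> T" using lt[OF n] len[OF n] by auto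
  define Z0 where "Z0 = J0 n - L0 n"
  define Z1 where "Z1 = J1 n - L1 n"
  have th_a: "poly (\<theta> n) ?a = 0" using th(2)[OF n, of 0] by (simp add: node_0)
  have start: "poly Z0 ?a = poly (Y0 n) ?a" "poly Z1 ?a = poly (Y1 n) ?a"
    by (simp_all add: Z0_def Z1_def Y0_def Y1_def mode_lift_def th_a ends[OF n])
  have e: "poly (energy \<kappa> (Y0 n) (Y1 n)) ?a \<le> (sqrt K2 * X)\<^sup>2"
    using low_energy[OF n] K2 by (simp add: power_mult_distrib)
  have node0: "sqrt \<kappa> * \<bar>poly Z0 ?a\<bar> \<le> sqrt K2 * X"
  proof (rule power2_le_imp_le)
    have "(sqrt \<kappa> * \<bar>poly Z0 ?a\<bar>)\<^sup>2 = \<kappa> * (poly (Y0 n) ?a)\<^sup>2"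
      unfolding start using kap by (simp add: power_mult_distrib)
    then show "(sqrt \<kappa> * \<bar>poly Z0 ?a\<bar>)\<^sup>2 \<le> (sqrt K2 * X)\<^sup>2"
      using e zero_le_power2[of "poly (Y1 n) ?a"] unfolding poly_energy by linarith
  qed (use K2 X0 in simp)
  have node1: "\<bar>poly Z1 ?a\<bar> \<le> sqrt K2 * X"
  proof (rule power2_le_imp_le)
    have "0 \<le> \<kappa> * (poly (Y0 n) ?a)\<^sup>2" using kap by simp
    then show "\<bar>poly Z1 ?a\<bar>\<^sup>2 \<le> (sqrt K2 * X)\<^sup>2"
      unfolding start using e by (simp add: poly_energy)
  qed (use K2 X0 in simp)
  have hX': "?h * (sqrt K5 * X') \<le> (1 + T) * sqrt K5 * X"
    using mult_left_mono[OF len_X'[OF n], of "sqrt K5"] K5 by (simp add: mult_ac)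
  have inc1: "\<bar>poly Z1 s - poly Z1 ?a\<bar> \<le> (1 + T) * sqrt K5 * X"
  proof -
    have "pderiv Z1 = smult (- \<kappa>) (y0 n)"
      unfolding Z1_def pderiv_diff J_props(3) lift_ode[OF n, THEN conjunct2] interp_W1'[OF n] y0_def
      by (simp add: smult_diff_right)
    then have "(poly Z1 s - poly Z1 ?a)\<^sup>2 \<le> ?h * (\<kappa>\<^sup>2 * pint ?a ?b (y0 n * y0 n))"
      using pint_increment[OF lt[OF n] s, of Z1] by (simp add: pint_smult power2_eq_square mult.assoc)
    also have "\<dots> \<le> ?h * (?h * (K5 * X'\<^sup>2))"
    proof (rule mult_left_mono)
      have "\<kappa>\<^sup>2 * pint ?a ?b (y0 n * y0 n) \<le> \<kappa> * pint ?a ?b (energy \<kappa> (y0 n) (y1 n))"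
        using kap pint_nonneg[of ?a ?b "y1 n * y1 n"] by (simp add: pint_energy power2_eq_square mult.assoc)
      also have "\<dots> \<le> ?h * (K5 * X'\<^sup>2)" by (rule high_energy[OF n])
      finally show "\<kappa>\<^sup>2 * pint ?a ?b (y0 n * y0 n) \<le> ?h * (K5 * X'\<^sup>2)" .
    qed (use h in simp)
    also have "\<dots> = (?h * (sqrt K5 * X'))\<^sup>2"
      using K5 by (simp add: power_mult_distrib) (simp add: power2_eq_square mult_ac)
    finally have "\<bar>poly Z1 s - poly Z1 ?a\<bar>\<^sup>2 \<le> (?h * (sqrt K5 * X'))\<^sup>2" by simp
    then have "\<bar>poly Z1 s - poly Z1 ?a\<bar> \<le> ?h * (sqrt K5 * X')"
      by (rule power2_le_imp_le) (use h K5 X0 in simp)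
    then show ?thesis using hX' by simp
  qed
  have inc0: "sqrt \<kappa> * \<bar>poly Z0 s - poly Z0 ?a\<bar> \<le> (1 + T) * sqrt K5 * X + T * \<Lambda> / sqrt c * X"
  proof -
    obtain q where q: "pderiv q = y1 n" using poly_antiderivative by blast
    have Z0': "pderiv Z0 = y1 n + II n r"
      unfolding Z0_def pderiv_diff J_props(1) lift_ode[OF n, THEN conjunct1] interp_W0'[OF n] y1_def by simp
    have "(poly q s - poly q ?a)\<^sup>2 \<le> ?h * pint ?a ?b (y1 n * y1 n)"
      using pint_increment[OF lt[OF n] s, of q] q by simp
    then have "\<kappa> * (poly q s - poly q ?a)\<^sup>2 \<le> \<kappa> * (?h * pint ?a ?b (y1 n * y1 n))"
      using kap by (intro mult_left_mono) auto
    also have "\<dots> = ?h * (\<kappa> * pint ?a ?b (y1 n * y1 n))" by simp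
    also have "\<dots> \<le> ?h * (\<kappa> * pint ?a ?b (energy \<kappa> (y0 n) (y1 n)))"
    proof -
      have "0 \<le> \<kappa> * pint ?a ?b (y0 n * y0 n)" using kap pint_nonneg[of ?a ?b "y0 n * y0 n"] by simp
      then show ?thesis using h kap by (intro mult_left_mono) (auto simp: pint_energy)
    qed
    also have "\<dots> \<le> ?h * (?h * (K5 * X'\<^sup>2))" using h by (intro mult_left_mono high_energy[OF n]) auto
    also have "\<dots> = (?h * (sqrt K5 * X'))\<^sup>2"
      using K5 by (simp add: power_mult_distrib) (simp add: power2_eq_square mult_ac)
    finally have "(sqrt \<kappa> * \<bar>poly q s - poly q ?a\<bar>)\<^sup>2 \<le> (?h * (sqrt K5 * X'))\<^sup>2"
      using kap by (simp add: power_mult_distrib)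
    then have 1: "sqrt \<kappa> * \<bar>poly q s - poly q ?a\<bar> \<le> ?h * (sqrt K5 * X')"
      by (rule power2_le_imp_le) (use h K5 X0 in simp)
    have "\<bar>poly (Z0 - q) s - poly (Z0 - q) ?a\<bar> \<le> \<Lambda> * (R / sqrt c) / sqrt \<kappa> * (s - ?a)"
    proof (rule increment_bound[where b = ?b])
      fix x assume x: "x \<in> {?a..?b}"
      show "(poly (Z0 - q) has_real_derivative poly (pderiv (Z0 - q)) x) (at x within {?a..?b})"
        by (rule DERIV_subset[OF poly_DERIV]) simp
      have "sqrt \<kappa> * \<bar>poly (II n r) x\<bar> \<le> \<Lambda> * (R / sqrt c)"
        by (rule interp_scaled[OF n sqrt_c(4) _ x], rule sqrt_kappa_le, rule R_step[OF n])
      then show "\<bar>poly (pderiv (Z0 - q)) x\<bar> \<le> \<Lambda> * (R / sqrt c) / sqrt \<kappa>"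
        unfolding pderiv_diff Z0' q pos_le_divide_eq[OF sqrt_c(4)] by (simp add: mult.commute)
    qed (rule s)
    then have "sqrt \<kappa> * \<bar>poly (Z0 - q) s - poly (Z0 - q) ?a\<bar> \<le> \<Lambda> * (R / sqrt c) * (s - ?a)"
      using sqrt_c(4) by (simp add: pos_le_divide_eq[OF sqrt_c(4), symmetric] mult.commute[of "sqrt \<kappa>"] del: poly_diff)
    also have "\<dots> \<le> \<Lambda> * (X / sqrt c) * T"
      using \<Lambda>_ge_1 A_le_X sqrt_c X0 AR h s by (intro mult_mono divide_right_mono) auto
    finally have 2: "sqrt \<kappa> * \<bar>poly (Z0 - q) s - poly (Z0 - q) ?a\<bar> \<le> T * \<Lambda> / sqrt c * X" by (simp add: mult_ac)
    have "\<bar>poly Z0 s - poly Z0 ?a\<bar> \<le> \<bar>poly q s - poly q ?a\<bar> + \<bar>poly (Z0 - q) s - poly (Z0 - q) ?a\<bar>"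
      by simp
    then have "sqrt \<kappa> * \<bar>poly Z0 s - poly Z0 ?a\<bar> \<le> sqrt \<kappa> * (\<bar>poly q s - poly q ?a\<bar> + \<bar>poly (Z0 - q) s - poly (Z0 - q) ?a\<bar>)"
      using sqrt_c(4) by (intro mult_left_mono) auto
    then show ?thesis using 1 2 hX' unfolding distrib_left by linarith
  qed
  have "0 \<le> T * \<Lambda> / sqrt c * X" using T \<Lambda>_ge_1 sqrt_c X0 by auto
  have KX: "K6 * X = sqrt K2 * X + (1 + T) * sqrt K5 * X + T * \<Lambda> / sqrt c * X + C\<eta> * X / sqrt c"
    by (simp add: K6_def algebra_simps)
  have "sqrt \<kappa> * \<bar>W0 0 s - poly (L0 n) s\<bar>
     \<le> sqrt \<kappa> * (\<bar>poly Z0 ?a\<bar> + \<bar>poly Z0 s - poly Z0 ?a\<bar> + \<bar>W0 0 s - poly (J0 n) s\<bar>)"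
    using sqrt_c(4) by (intro mult_left_mono) (auto simp: Z0_def)
  also have "\<dots> \<le> K6 * X"
    unfolding KX distrib_left using node0 inc0 sqrt_kappa_le[OF eta0[OF n s]] by linarith
  finally show "sqrt \<kappa> * \<bar>W0 0 s - poly (L0 n) s\<bar> \<le> K6 * X" .
  have "sqrt c * \<bar>W1 0 s - poly (J1 n) s\<bar> \<le> sqrt \<kappa> * \<bar>W1 0 s - poly (J1 n) s\<bar>"
    using sqrt_c by (intro mult_right_mono) auto
  also have "\<dots> \<le> C\<eta> * X" by (rule eta1[OF n s])
  finally have "\<bar>W1 0 s - poly (J1 n) s\<bar> \<le> C\<eta> * X / sqrt c" using sqrt_c(1) by (simp add: field_simps)
  moreover have "\<bar>W1 0 s - poly (L1 n) s\<bar> \<le> \<bar>poly Z1 ?a\<bar> + \<bar>poly Z1 s - poly Z1 ?a\<bar> + \<bar>W1 0 s - poly (J1 n) s\<bar>"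
    by (auto simp: Z1_def)
  ultimately show "\<bar>W1 0 s - poly (L1 n) s\<bar> \<le> K6 * X"
    unfolding KX using node1 inc1 \<open>0 \<le> T * \<Lambda> / sqrt c * X\<close> by linarith
qed

end

section \<open>Test functions\<close>

text \<open>Infinitely differentiable functions of one variable, by the sequence of derivatives.\<close>

definition smooth1 :: "(nat \<Rightarrow> real \<Rightarrow> real) \<Rightarrow> bool" where
  "smooth1 F \<longleftrightarrow> (\<forall>n s. (F n has_real_derivative F (Suc n) s) (at s))"

lemma smooth1_affine:
  assumes "smooth1 F" shows "smooth1 (\<lambda>n s. c ^ n * F n (c * s + d))"
  unfolding smooth1_def
proof (intro allI)
  fix n s
  have "((\<lambda>s. F n (c * s + d)) has_real_derivative F (Suc n) (c * s + d) * c) (at s)"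
    using assms unfolding smooth1_def by (intro DERIV_chain2[where g = "\<lambda>s. c * s + d"]) (auto intro!: derivative_eq_intros)
  then show "((\<lambda>s. c ^ n * F n (c * s + d)) has_real_derivative c ^ Suc n * F (Suc n) (c * s + d)) (at s)"
    by (auto intro!: derivative_eq_intros)
qed

text \<open>Leibniz' rule.\<close>

lemma smooth1_mult:
  assumes F: "smooth1 F" and G: "smooth1 G"
  shows "smooth1 (\<lambda>n s. \<Sum>k\<le>n. real (n choose k) * F k s * G (n - k) s)"
  unfolding smooth1_def
proof (intro allI)
  fix n s
  have "((\<lambda>s. \<Sum>k\<le>n. real (n choose k) * F k s * G (n - k) s) has_real_derivative
     (\<Sum>k\<le>n. real (n choose k) * F (Suc k) s * G (n - k) s + real (n choose k) * F k s * G (Suc (n - k)) s)) (at s)"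
    using F G unfolding smooth1_def
    by (auto intro!: derivative_eq_intros sum.cong simp: algebra_simps)
  also have "(\<Sum>k\<le>n. real (n choose k) * F (Suc k) s * G (n - k) s + real (n choose k) * F k s * G (Suc (n - k)) s)
    = (\<Sum>k\<le>Suc n. real (Suc n choose k) * F k s * G (Suc n - k) s)"
  proof -
    have 1: "(\<Sum>k\<le>Suc n. real (n choose k) * F k s * G (Suc n - k) s) = (\<Sum>k\<le>n. real (n choose k) * F k s * G (Suc (n - k)) s)"
      by (auto simp: Suc_diff_le intro!: sum.cong)
    have "(\<Sum>k\<le>Suc n. real (Suc n choose k) * F k s * G (Suc n - k) s)
       = F 0 s * G (Suc n) s + (\<Sum>k\<le>n. real (Suc n choose Suc k) * F (Suc k) s * G (n - k) s)"
      by (simp add: sum.atMost_Suc_shift del: sum.atMost_Suc binomial_Suc_Suc)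
    also have "\<dots> = (\<Sum>k\<le>n. real (n choose k) * F (Suc k) s * G (n - k) s)
       + (F 0 s * G (Suc n) s + (\<Sum>k\<le>n. real (n choose Suc k) * F (Suc k) s * G (n - k) s))"
      by (simp add: sum.distrib distrib_right algebra_simps)
    also have "F 0 s * G (Suc n) s + (\<Sum>k\<le>n. real (n choose Suc k) * F (Suc k) s * G (n - k) s)
       = (\<Sum>k\<le>Suc n. real (n choose k) * F k s * G (Suc n - k) s)"
      by (simp add: sum.atMost_Suc_shift del: sum.atMost_Suc)
    finally show ?thesis unfolding 1 by (simp add: sum.distrib)
  qed
  finally show "((\<lambda>s. \<Sum>k\<le>n. real (n choose k) * F k s * G (n - k) s) has_real_derivative
     (\<Sum>k\<le>Suc n. real (Suc n choose k) * F k s * G (Suc n - k) s)) (at s)" .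
qed

text \<open>All derivatives of \<open>exp (- 1 / s)\<close>, extended by zero, have the form \<open>p (1 / s)
  exp (- 1 / s)\<close>.\<close>

definition flat :: "real poly \<Rightarrow> real \<Rightarrow> real" where
  "flat p s = (if s > 0 then poly p (1 / s) * exp (- (1 / s)) else 0)"

lemma poly_exp_tendsto_0: "((\<lambda>x. poly p x * exp (- x)) \<longlongrightarrow> (0 :: real)) at_top"
proof -
  have 1: "((\<lambda>x. x ^ i * exp (- x)) \<longlongrightarrow> (0 :: real)) at_top" for i
    using tendsto_power_div_exp_0[of i] by (simp add: exp_minus divide_inverse)
  have "((\<lambda>x. \<Sum>i\<le>degree p. coeff p i * (x ^ i * exp (- x))) \<longlongrightarrow> (\<Sum>i\<le>degree p. coeff p i * 0)) at_top"
    by (intro tendsto_intros 1)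
  then show ?thesis by (simp add: poly_altdef sum_distrib_right mult.assoc)
qed

text \<open>At \<open>s = 0\<close> the difference quotient is again \<open>p (x) exp (- x)\<close> with another
  polynomial \<open>p\<close>, where \<open>x = 1 / s\<close> tends to infinity.\<close>

lemma flat_deriv: "(flat p has_real_derivative flat ([:0, 0, 1:] * (p - pderiv p)) s) (at s)"
proof (cases s "0 :: real" rule: linorder_cases)
  case greater
  have "((\<lambda>s. poly p (1 / s) * exp (- (1 / s))) has_real_derivative flat ([:0, 0, 1:] * (p - pderiv p)) s) (at s)"
    using greater unfolding flat_def
    by (auto intro!: derivative_eq_intros DERIV_chain2[OF poly_DERIV] simp: field_simps power2_eq_square)
  then show ?thesis
    by (rule has_field_derivative_transform_within_open[where S = "{0<..}"]) (use greater in \<open>auto simp: flat_def\<close>)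
next
  case less
  have "((\<lambda>s. 0) has_real_derivative flat ([:0, 0, 1:] * (p - pderiv p)) s) (at s)"
    using less by (simp add: flat_def)
  then show ?thesis
    by (rule has_field_derivative_transform_within_open[where S = "{..<0}"]) (use less in \<open>auto simp: flat_def\<close>)
next
  case equal
  have "((\<lambda>h. flat p h / h) \<longlongrightarrow> 0) (at_right 0)"
  proof (rule Lim_transform_eventually)
    show "((\<lambda>h. poly (pCons 0 p) (inverse h) * exp (- (inverse h))) \<longlongrightarrow> 0) (at_right 0)"
      by (rule filterlim_compose[OF poly_exp_tendsto_0 filterlim_inverse_at_top_right])
    show "\<forall>\<^sub>F h in at_right 0. poly (pCons 0 p) (inverse h) * exp (- (inverse h)) = flat p h / h"
      by (auto simp: eventually_at_filter flat_def divide_inverse)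
  qed
  moreover have "((\<lambda>h. flat p h / h) \<longlongrightarrow> 0) (at_left 0)"
    by (rule Lim_transform_eventually[where f = "\<lambda>_. 0"]) (auto simp: eventually_at_filter flat_def)
  ultimately have "((\<lambda>h. flat p h / h) \<longlongrightarrow> 0) (at 0)" by (simp add: filterlim_split_at)
  then show ?thesis unfolding equal DERIV_def by (simp add: flat_def)
qed

definition bump :: "nat \<Rightarrow> real \<Rightarrow> real" where
  "bump n = flat (((\<lambda>p. [:0, 0, 1:] * (p - pderiv p)) ^^ n) 1)"

lemma smooth1_bump: "smooth1 bump"
  unfolding smooth1_def bump_def using flat_deriv by simp

lemma bump_0: "bump 0 s = (if s > 0 then exp (- (1 / s)) else 0)"
  by (simp add: bump_def flat_def)

definition prodfun :: "('n::finite \<Rightarrow> real \<Rightarrow> real) \<Rightarrow> real^'n \<Rightarrow> real" where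
  "prodfun h x = (\<Prod>i\<in>UNIV. h i (x $ i))"

lemma prodfun_has_derivative:
  assumes "\<And>i s. (h i has_real_derivative h' i s) (at s)"
  shows "(prodfun h has_derivative (\<lambda>v. \<Sum>i\<in>UNIV. (h' i (x $ i) * v $ i) * (\<Prod>j\<in>UNIV - {i}. h j (x $ j)))) (at x)"
  unfolding prodfun_def
proof (rule has_derivative_prod)
  fix i
  have "((\<lambda>x. x $ i) has_derivative (\<lambda>v. v $ i)) (at x)"
    by (rule bounded_linear_imp_has_derivative[OF bounded_linear_vec_nth])
  from has_derivative_compose[OF this assms[of i "x $ i", unfolded has_field_derivative_def]]
  show "((\<lambda>x. h i (x $ i)) has_derivative (\<lambda>v. h' i (x $ i) * v $ i)) (at x)" .
qed

lemma pderivative_prodfun: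
  assumes "\<And>i s. (h i has_real_derivative h' i s) (at s)"
  shows "pderivative j (prodfun h) = prodfun (h(j := h' j))"
proof
  fix x
  have "pderivative j (prodfun h) x = (\<Sum>i\<in>UNIV. (h' i (x $ i) * axis j 1 $ i) * (\<Prod>j\<in>UNIV - {i}. h j (x $ j)))"
    unfolding pderivative_def frechet_derivative_at[OF prodfun_has_derivative[OF assms], symmetric] ..
  also have "\<dots> = (\<Sum>i\<in>UNIV. if i = j then h' i (x $ i) * (\<Prod>j\<in>UNIV - {i}. h j (x $ j)) else 0)"
    by (intro sum.cong) (auto simp: axis_def)
  also have "\<dots> = h' j (x $ j) * (\<Prod>i\<in>UNIV - {j}. h i (x $ i))" by simp
  also have "\<dots> = prodfun (h(j := h' j)) x"
    unfolding prodfun_def by (subst prod.remove[of _ j]) (auto intro!: prod.cong)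
  finally show "pderivative j (prodfun h) x = prodfun (h(j := h' j)) x" .
qed

lemma iter_pderivative_prodfun:
  assumes "\<And>i. smooth1 (F i)"
  shows "iter_pderivative is (prodfun (\<lambda>i. F i 0)) = prodfun (\<lambda>i. F i (count_list is i))"
proof (induction "is")
  case Nil
  then show ?case by (simp add: iter_pderivative_def)
next
  case (Cons j js)
  have "iter_pderivative (j # js) (prodfun (\<lambda>i. F i 0)) = pderivative j (prodfun (\<lambda>i. F i (count_list js i)))"
    using Cons by (simp add: iter_pderivative_def)
  also have "\<dots> = prodfun ((\<lambda>i. F i (count_list js i))(j := F j (Suc (count_list js j))))"
    by (rule pderivative_prodfun[where h' = "\<lambda>i. F i (Suc (count_list js i))"]) (use assms in \<open>auto simp: smooth1_def\<close>)
  also have "(\<lambda>i. F i (count_list js i))(j := F j (Suc (count_list js j))) = (\<lambda>i. F i (count_list (j # js) i))"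
    by auto
  finally show ?case .
qed

lemma prodfun_smooth:
  assumes "\<And>i. smooth1 (F i)"
  shows "iter_pderivative is (prodfun (\<lambda>i. F i 0)) differentiable (at x)"
proof -
  have "(prodfun (\<lambda>i. F i (count_list is i)) has_derivative
     (\<lambda>v. \<Sum>i\<in>UNIV. (F i (Suc (count_list is i)) (x $ i) * v $ i) * (\<Prod>j\<in>UNIV - {i}. F j (count_list is j) (x $ j)))) (at x)"
    by (rule prodfun_has_derivative) (use assms in \<open>auto simp: smooth1_def\<close>)
  then show ?thesis unfolding iter_pderivative_prodfun[OF assms] differentiable_def by blast
qed

text \<open>For \<open>m\<close> tending to infinity, \<open>exp (- 1 / (m s))\<close> tends to \<open>1\<close>
  for every \<open>s > 0\<close>. The products therefore approximate the indicator function of the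
  open box.\<close>

definition box_bump :: "real^'n \<Rightarrow> real^'n \<Rightarrow> nat \<Rightarrow> (real^'n::finite) \<Rightarrow> real" where
  "box_bump a b m = prodfun (\<lambda>i s. bump 0 (real m * (s - a $ i)) * bump 0 (real m * (b $ i - s)))"

lemma box_bump_range: "0 \<le> box_bump a b m x \<and> box_bump a b m x \<le> 1"
  unfolding box_bump_def prodfun_def
  by (auto intro!: prod_nonneg prod_le_1 mult_le_one simp: bump_0)

lemma box_bump_outside: "x \<notin> box a b \<Longrightarrow> box_bump a b m x = 0"
proof -
  assume "x \<notin> box a b"
  then obtain i where "x $ i \<le> a $ i \<or> b $ i \<le> x $ i" by (auto simp: mem_box_cart not_less)
  then have "bump 0 (real m * (x $ i - a $ i)) * bump 0 (real m * (b $ i - x $ i)) = 0"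
    by (auto simp: bump_0 zero_less_mult_iff)
  then show ?thesis unfolding box_bump_def prodfun_def by (intro prod_zero) auto
qed

lemma box_bump_tendsto: "(\<lambda>m. box_bump a b m x) \<longlonglongrightarrow> indicator (box a b) x"
proof (cases "x \<in> box a b")
  case True
  have 1: "(\<lambda>m. bump 0 (real m * y)) \<longlonglongrightarrow> 1" if "y > 0" for y
  proof (rule Lim_transform_eventually)
    have "(\<lambda>m. 1 / real m * (1 / y)) \<longlonglongrightarrow> 0 * (1 / y)" by (intro tendsto_intros lim_1_over_n)
    then have "(\<lambda>m. exp (- (1 / real m * (1 / y)))) \<longlonglongrightarrow> exp (- 0)" by (intro tendsto_intros) simp
    then show "(\<lambda>m. exp (- (1 / real m * (1 / y)))) \<longlonglongrightarrow> 1" by simp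
    show "\<forall>\<^sub>F m in sequentially. exp (- (1 / real m * (1 / y))) = bump 0 (real m * y)"
      using eventually_gt_at_top[of 0] by eventually_elim (use that in \<open>simp add: bump_0\<close>)
  qed
  have "(\<lambda>m. box_bump a b m x) \<longlonglongrightarrow> (\<Prod>i\<in>(UNIV :: 'a set). 1 * 1)"
    unfolding box_bump_def prodfun_def
    by (intro tendsto_prod tendsto_mult 1) (use True in \<open>auto simp: mem_box_cart\<close>)
  then show ?thesis using True by simp
next
  case False
  then show ?thesis by (simp add: box_bump_outside)
qed

lemma box_bump_test: "cbox a b \<subseteq> \<Omega> \<Longrightarrow> box_bump a b m \<in> test_functions \<Omega>"
proof -
  assume sub: "cbox a b \<subseteq> \<Omega>"
  define F where "F i = (\<lambda>n s. \<Sum>k\<le>n. real (n choose k) * (real m ^ k * bump k (real m * s + - real m * a $ i)) *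
    ((- real m) ^ (n - k) * bump (n - k) (- real m * s + real m * b $ i)))" for i
  have "smooth1 (F i)" for i
    unfolding F_def by (rule smooth1_mult smooth1_affine smooth1_bump)+
  moreover have "prodfun (\<lambda>i. F i 0) = box_bump a b m"
    by (auto simp: box_bump_def F_def prodfun_def algebra_simps intro!: ext prod.cong)
  ultimately have "iter_pderivative is (box_bump a b m) differentiable (at x)" for "is" x
    using prodfun_smooth[of F "is" x] by simp
  moreover have "compact (cbox a b)" "\<forall>x. x \<notin> cbox a b \<longrightarrow> box_bump a b m x = 0"
    using box_bump_outside[of _ a b m] box_subset_cbox[of a b] by auto
  ultimately show ?thesis unfolding test_functions_def using sub by blast
qed

section \<open>The fundamental lemma of the calculus of variations\<close>

text \<open>Boxes form a generator of the Borel sets that is stable under intersection, so the integral over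
  every Borel set vanishes. The detour over a Borel measurable representative \<open>g\<close> is
  needed because \<open>h\<close> is only Lebesgue measurable.\<close>

lemma AE_zero_if_box_integrals_zero:
  fixes h :: "real^'n::finite \<Rightarrow> real"
  assumes int: "integrable lebesgue h"
    and zero: "\<And>a b. (LINT x|lebesgue. indicator (box a b) x * h x) = 0" "(LINT x|lebesgue. h x) = 0"
  shows "AE x in lebesgue. h x = 0"
proof -
  obtain g where g: "g \<in> borel_measurable lborel" "AE x in lborel. h x = g x"
    using completion_ex_borel_measurable_real[of h lborel] int by auto
  have ae: "AE x in lebesgue. h x = g x" using g(2) by (rule AE_completion)
  have gm: "g \<in> borel_measurable lebesgue" using g(1) by (rule measurable_completion)
  have gint': "integrable lebesgue g"
    using integrable_cong_AE[of h lebesgue g] int ae gm by auto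
  then have gint: "integrable lborel g" using integrable_completion[OF g(1)] by simp
  have tr: "(LINT x:A|lborel. g x) = (LINT x|lebesgue. indicator A x * h x)" if "A \<in> sets borel" for A
  proof -
    have "(LINT x:A|lborel. g x) = (LINT x|lebesgue. indicator A x * g x)"
      unfolding set_lebesgue_integral_def using that g(1) by (subst integral_completion) auto
    also have "\<dots> = (LINT x|lebesgue. indicator A x * h x)"
    proof (rule integral_cong_AE)
      have [measurable]: "A \<in> sets lebesgue" using that by auto
      show "(\<lambda>x. indicat_real A x * g x) \<in> borel_measurable lebesgue" using gm by measurable
      have [measurable]: "h \<in> borel_measurable lebesgue" using int by auto
      show "(\<lambda>x. indicat_real A x * h x) \<in> borel_measurable lebesgue" by measurable
    qed (use ae in \<open>eventually_elim, auto\<close>)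
    finally show ?thesis .
  qed
  let ?G = "range (\<lambda>(a, b). box a b :: (real^'n) set)"
  have uni: "(LINT x:UNIV|lborel. g x) = 0" using tr[of UNIV] zero(2) by simp
  have si: "set_integrable lborel A g" if "A \<in> sets borel" for A
    using gint that integrable_mult_indicator[of A lborel g] by (auto simp: set_integrable_def)
  have sets: "sets (borel :: (real^'n) measure) = sigma_sets UNIV ?G"
    using arg_cong[OF borel_eq_box, of sets] by simp
  have "Int_stable ?G"
  proof (rule Int_stableI)
    fix A B assume "A \<in> ?G" "B \<in> ?G"
    then obtain a b c d where "A = box a b" "B = box c d" by auto
    moreover obtain e f where "box a b \<inter> box c d = box e f" using box_Int_box by blast
    ultimately show "A \<inter> B \<in> ?G" using rangeI[of "\<lambda>(a, b). box a b" "(e, f)"] by simp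
  qed
  have G_Pow: "?G \<subseteq> Pow UNIV" by simp
  have all: "(LINT x:A|lborel. g x) = 0" if "A \<in> sigma_sets UNIV ?G" for A
    using \<open>Int_stable ?G\<close> G_Pow that
  proof (induction rule: sigma_sets_induct_disjoint)
    case (basic A)
    then show ?case using tr zero(1) by auto
  next
    case empty
    then show ?case by (simp add: set_lebesgue_integral_def)
  next
    case (compl A)
    then have A: "A \<in> sets borel" by (simp add: sets)
    have "(LINT x:A \<union> (UNIV - A)|lborel. g x) = (LINT x:A|lborel. g x) + (LINT x:UNIV - A|lborel. g x)"
      by (rule set_integral_Un) (use A si in auto)
    then show ?case using uni compl by simp
  next
    case (union A)
    then have A: "A i \<in> sets borel" for i using sets by blast
    have "(LINT x:(\<Union>i. A i)|lborel. g x) = (\<Sum>i. LINT x:A i|lborel. g x)"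
      by (rule lebesgue_integral_countable_add) (use A si union in \<open>auto simp: disjoint_family_on_def\<close>)
    then show ?case using union by simp
  qed
  have "AE x in lborel. g x = 0"
    by (rule density_unique_real) (use gint all sets in auto)
  then have "AE x in lebesgue. g x = 0" by (rule AE_completion)
  with ae show ?thesis by eventually_elim simp
qed

text \<open>Approximation of indicator functions by test functions gives a vanishing integral over every box
  whose closure lies in \<open>\<Omega>\<close>; countably many such boxes, with rational corners,
  cover \<open>\<Omega>\<close>.\<close>

lemma fundamental_lemma_variations:
  fixes g :: "real^'n::finite \<Rightarrow> real"
  assumes \<Omega>: "open \<Omega>" and g: "integrable (lebesgue_on \<Omega>) g"
    and zero: "\<And>\<phi>. \<phi> \<in> test_functions \<Omega> \<Longrightarrow> (LINT x|lebesgue_on \<Omega>. g x * \<phi> x) = 0"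
  shows "AE x in lebesgue_on \<Omega>. g x = 0"
proof -
  have m\<Omega>: "\<Omega> \<in> sets lebesgue" using \<Omega> by auto
  have box0: "(LINT x|lebesgue_on \<Omega>. g x * indicator (box a b) x) = 0" if "cbox a b \<subseteq> \<Omega>" for a b
  proof -
    have gm: "g \<in> borel_measurable (lebesgue_on \<Omega>)" using g by auto
    have [measurable]: "box_bump a b m \<in> borel_measurable (lebesgue_on \<Omega>)" for m
    proof -
      have "box_bump a b m differentiable (at x)" for x
        using box_bump_test[OF that, of m] unfolding test_functions_def
        by (auto dest!: spec[of _ "[]"] simp: iter_pderivative_def)
      then have "continuous_on UNIV (box_bump a b m)"
        by (simp add: continuous_at_imp_continuous_on differentiable_imp_continuous_within)
      then have "box_bump a b m \<in> borel_measurable borel" by (rule borel_measurable_continuous_onI)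
      then show ?thesis by (simp add: measurable_completion measurable_restrict_space1)
    qed
    have "(\<lambda>m. LINT x|lebesgue_on \<Omega>. g x * box_bump a b m x) \<longlonglongrightarrow> (LINT x|lebesgue_on \<Omega>. g x * indicator (box a b) x)"
    proof (rule integral_dominated_convergence[where w = "\<lambda>x. \<bar>g x\<bar>"])
      have "box a b \<inter> \<Omega> \<in> sets (lebesgue_on \<Omega>)" using m\<Omega> by (auto simp: sets_restrict_space)
      then show "(\<lambda>x. g x * indicator (box a b) x) \<in> borel_measurable (lebesgue_on \<Omega>)"
        by (intro borel_measurable_times[OF gm] measurable_restrict_space1 borel_measurable_indicator) auto
      show "AE x in lebesgue_on \<Omega>. (\<lambda>m. g x * box_bump a b m x) \<longlonglongrightarrow> g x * indicator (box a b) x"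
        by (intro AE_I2 tendsto_intros box_bump_tendsto)
      show "AE x in lebesgue_on \<Omega>. norm (g x * box_bump a b m x) \<le> \<bar>g x\<bar>" for m
        using box_bump_range[of a b m] by (intro AE_I2) (auto simp: abs_mult mult_left_le)
    qed (use g in auto)
    moreover have "(LINT x|lebesgue_on \<Omega>. g x * box_bump a b m x) = 0" for m
      by (rule zero[OF box_bump_test[OF that]])
    ultimately have "(\<lambda>m. 0) \<longlonglongrightarrow> (LINT x|lebesgue_on \<Omega>. g x * indicator (box a b) x)" by simp
    then show ?thesis by (rule LIMSEQ_unique[OF _ tendsto_const])
  qed
  obtain \<D> where \<D>: "countable \<D>" "\<And>X. X \<in> \<D> \<Longrightarrow> \<exists>a b. X = box a b \<and> cbox a b \<subseteq> \<Omega>" "\<Union>\<D> = \<Omega>"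
  proof -
    define lo hi :: "((real^'n) \<Rightarrow> real \<times> real) \<Rightarrow> real^'n"
      where "lo f = (\<Sum>i\<in>Basis. fst (f i) *\<^sub>R i)" and "hi f = (\<Sum>i\<in>Basis. snd (f i) *\<^sub>R i)" for f
    define I where "I = {f \<in> Basis \<rightarrow>\<^sub>E \<rat> \<times> \<rat>. cbox (lo f) (hi f) \<subseteq> \<Omega>}"
    define D where "D = (\<lambda>f. box (lo f) (hi f)) ` I"
    have "countable I"
      unfolding I_def by (intro countable_Collect countable_PiE) (auto simp: countable_rat)
    then have 1: "countable D" unfolding D_def by simp
    have 2: "\<exists>a b. X = box a b \<and> cbox a b \<subseteq> \<Omega>" if "X \<in> D" for X
      using that unfolding D_def I_def by blast
    have 3: "\<exists>X\<in>D. x \<in> X" if x: "x \<in> \<Omega>" for x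
    proof -
      obtain e where e: "e > 0" "ball x e \<subseteq> \<Omega>" using x \<Omega> openE by blast
      from rational_boxes[of "e / 2" x] e obtain a b where ab: "\<forall>i\<in>Basis. a \<bullet> i \<in> \<rat> \<and> b \<bullet> i \<in> \<rat>"
        "x \<in> box a b" "box a b \<subseteq> ball x (e / 2)" by auto
      have "cbox a b = closure (box a b)" using ab(2) closure_box[of a b] by (metis empty_iff)
      also have "\<dots> \<subseteq> cball x (e / 2)" using ab(3) closure_mono[of "box a b" "ball x (e / 2)"] e by simp
      also have "\<dots> \<subseteq> ball x e" using e(1) by (simp add: cball_subset_ball_iff)
      also have "\<dots> \<subseteq> \<Omega>" by (rule e(2))
      finally have c: "cbox a b \<subseteq> \<Omega>" .
      define f where "f = (\<lambda>i\<in>Basis. (a \<bullet> i, b \<bullet> i))"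
      have fa: "lo f = a" "hi f = b"
        unfolding f_def lo_def hi_def by (simp_all add: euclidean_representation cong: sum.cong)
      have "f \<in> I" using ab(1) c unfolding I_def mem_Collect_eq fa by (auto simp: f_def)
      then have "box a b \<in> D" unfolding D_def by (intro image_eqI[of _ _ f]) (simp_all only: fa)
      then show ?thesis using ab(2) by blast
    qed
    have "\<Union>D = \<Omega>"
    proof
      show "\<Union>D \<subseteq> \<Omega>" using 2 box_subset_cbox by blast
      show "\<Omega> \<subseteq> \<Union>D" using 3 by blast
    qed
    then show ?thesis using that 1 2 by blast
  qed
  have one: "AE x in lebesgue. x \<in> X \<longrightarrow> g x = 0" if "X \<in> \<D>" for X
  proof -
    obtain c d where X: "X = box c d" "cbox c d \<subseteq> \<Omega>" using \<D>(2)[OF \<open>X \<in> \<D>\<close>] by blast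
    define h where "h x = (if x \<in> \<Omega> then g x else 0) * indicator X x" for x
    have ig: "integrable lebesgue (\<lambda>x. if x \<in> \<Omega> then g x else 0)"
      using g Lebesgue_Measure.integrable_restrict_UNIV[OF m\<Omega>] by blast
    have hint: "integrable lebesgue h"
      unfolding h_def using X(1) by (intro integrable_real_mult_indicator ig) auto
    have key: "(LINT x|lebesgue. indicator (box a b) x * h x) = 0" for a b
    proof -
      obtain a' b' where ab': "box a b \<inter> box c d = box a' b'" using box_Int_box by blast
      have "(LINT x|lebesgue. indicator (box a b) x * h x) = (LINT x|lebesgue. (if x \<in> \<Omega> then g x * indicator (box a' b') x else 0))"
        by (intro Bochner_Integration.integral_cong) (auto simp: h_def X(1) ab'[symmetric] indicator_def)
      also have "\<dots> = (LINT x|lebesgue_on \<Omega>. g x * indicator (box a' b') x)"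
        by (rule Lebesgue_Measure.integral_restrict_UNIV[OF m\<Omega>])
      also have "\<dots> = 0"
      proof (cases "box a' b' = {}")
        case False
        have "box a' b' \<subseteq> box c d" using ab' by blast
        then have "cbox a' b' \<subseteq> cbox c d" using False closure_mono[of "box a' b'" "box c d"] by (metis closure_box subset_empty)
        then show ?thesis using X(2) by (intro box0) auto
      qed simp
      finally show ?thesis .
    qed
    have "(LINT x|lebesgue. h x) = (LINT x|lebesgue. indicator (box c d) x * h x)"
      by (intro Bochner_Integration.integral_cong) (auto simp: h_def X(1) indicator_def)
    then have "AE x in lebesgue. h x = 0"
      using key by (intro AE_zero_if_box_integrals_zero hint) auto
    then show ?thesis
      by eventually_elim (use X box_subset_cbox in \<open>auto simp: h_def split: if_splits\<close>)
  qed
  have "AE x in lebesgue. \<forall>X\<in>\<D>. x \<in> X \<longrightarrow> g x = 0"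
    using one \<D>(1) by (subst AE_ball_countable) auto
  then have "AE x in lebesgue. x \<in> \<Omega> \<longrightarrow> g x = 0"
    by eventually_elim (use \<D>(3) in blast)
  then show ?thesis using m\<Omega> by (simp add: AE_restrict_space_iff)
qed

section \<open>Integration by parts for test functions\<close>

lemma pderivative_has_derivative:
  assumes "f differentiable (at x)"
  shows "((\<lambda>s. f (x + s *\<^sub>R axis i 1)) has_real_derivative pderivative i f x) (at 0)"
proof -
  have "(f has_derivative frechet_derivative f (at x)) (at x)"
    using assms frechet_derivative_works by blast
  then have "(f has_derivative frechet_derivative f (at x)) (at (x + 0 *\<^sub>R axis i 1))" by simp
  moreover have "((\<lambda>s :: real. x + s *\<^sub>R axis i 1) has_derivative (\<lambda>s. s *\<^sub>R axis i 1)) (at 0)"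
    by (auto intro!: derivative_eq_intros)
  ultimately have "((\<lambda>s. f (x + s *\<^sub>R axis i 1)) has_derivative (\<lambda>s. frechet_derivative f (at x) (s *\<^sub>R axis i 1))) (at 0)"
    using has_derivative_compose[of "\<lambda>s. x + s *\<^sub>R axis i 1"] by blast
  moreover have "linear (frechet_derivative f (at x))"
    using assms by (rule linear_frechet_derivative)
  ultimately show ?thesis
    unfolding has_field_derivative_def pderivative_def by (simp add: linear_scale mult.commute[of _ "frechet_derivative f (at x) (axis i 1)"])
qed

lemma pderivative_along:
  assumes "\<And>x. f differentiable (at x)"
  shows "((\<lambda>s. f (x + s *\<^sub>R axis i 1)) has_real_derivative pderivative i f (x + s *\<^sub>R axis i 1)) (at s)"
  using pderivative_has_derivative[OF assms, of "x + s *\<^sub>R axis i 1" i] DERIV_shift[of "\<lambda>s. f (x + s *\<^sub>R axis i 1)" _ 0 s]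
  by (simp add: scaleR_add_left add_ac)

lemma pderivative_eqI: "(f has_derivative D) (at x) \<Longrightarrow> pderivative i f x = D (axis i 1)"
  unfolding pderivative_def by (simp add: frechet_derivative_at[symmetric])

text \<open>The integral of a difference quotient in direction \<open>i\<close> vanishes, as Lebesgue measure is
  invariant under translations. By the mean value theorem the quotients are dominated by a constant
  on a ball.\<close>

lemma integral_pderivative_zero:
  fixes f :: "real^'n::finite \<Rightarrow> real"
  assumes diff: "\<And>x. f differentiable (at x)" and cont: "continuous_on UNIV (pderivative i f)"
    and K: "compact K" "\<And>x. x \<notin> K \<Longrightarrow> f x = 0"
  shows "(LINT x|lborel. pderivative i f x) = 0"
proof -
  let ?e = "axis i 1 :: real^'n"
  have ne: "norm ?e = 1" by (simp add: norm_axis_1)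
  have fc: "continuous_on UNIV f"
    using diff by (simp add: continuous_at_imp_continuous_on differentiable_imp_continuous_within)
  have fm [measurable]: "f \<in> borel_measurable borel" by (rule borel_measurable_continuous_onI[OF fc])
  have pz: "pderivative i f x = 0" if "x \<notin> K" for x
  proof -
    have "open (- K)" using K(1) compact_imp_closed by blast
    then have "(f has_derivative (\<lambda>_. 0)) (at x)"
      using has_derivative_transform_within_open[of "\<lambda>_. 0" "\<lambda>_. 0" x UNIV "- K" f] K(2) that by auto
    then show ?thesis by (simp add: pderivative_eqI)
  qed
  obtain B where B: "\<And>x. \<bar>pderivative i f x\<bar> \<le> B"
  proof -
    have "bounded (pderivative i f ` K)"
      by (intro compact_imp_bounded compact_continuous_image continuous_on_subset[OF cont] K) auto
    then obtain B where B: "\<And>x. x \<in> K \<Longrightarrow> \<bar>pderivative i f x\<bar> \<le> B" by (auto simp: bounded_iff)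
    have "\<bar>pderivative i f x\<bar> \<le> max B 0" for x using B[of x] pz[of x] by (cases "x \<in> K") auto
    then show ?thesis using that by blast
  qed
  have B0: "B \<ge> 0" using B[of 0] by linarith
  obtain r where r: "\<And>x. x \<in> K \<Longrightarrow> norm x \<le> r"
    using compact_imp_bounded[OF K(1)] by (auto simp: bounded_iff)
  define q where "q m x = (f (x + (1 / real (Suc m)) *\<^sub>R ?e) - f x) * real (Suc m)" for m x
  have fint: "integrable lborel f"
    by (rule Bochner_Integration.integrable_cong[THEN iffD1, OF refl _ borel_integrable_compact[OF K(1), of f]])
       (use K continuous_on_subset[OF fc] in \<open>auto simp: indicator_def\<close>)
  have shift: "integrable lborel (\<lambda>x. f (x + a))" "(LINT x|lborel. f (x + a)) = (LINT x|lborel. f x)" for a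
  proof -
    have "integrable (distr lborel borel ((+) a)) f" using fint by (simp add: lborel_distr_plus)
    then show "integrable lborel (\<lambda>x. f (x + a))"
      by (subst (asm) integrable_distr_eq) (auto simp: add.commute)
    have "(LINT x|lborel. f x) = (LINT x|distr lborel borel ((+) a). f x)" by (simp add: lborel_distr_plus)
    also have "\<dots> = (LINT x|lborel. f (a + x))" by (rule integral_distr) auto
    finally show "(LINT x|lborel. f (x + a)) = (LINT x|lborel. f x)" by (simp add: add.commute)
  qed
  have q0: "(LINT x|lborel. q m x) = 0" for m
    unfolding q_def using shift fint by simp
  have "(\<lambda>m. LINT x|lborel. q m x) \<longlonglongrightarrow> (LINT x|lborel. pderivative i f x)"
  proof (rule integral_dominated_convergence[where w = "\<lambda>x. indicator (cball 0 (r + 1)) x *\<^sub>R B"])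
    show "pderivative i f \<in> borel_measurable lborel"
      using borel_measurable_continuous_onI[OF cont] by simp
    show "q m \<in> borel_measurable lborel" for m unfolding q_def by measurable
    show "integrable lborel (\<lambda>x. indicator (cball 0 (r + 1)) x *\<^sub>R B)"
      by (rule borel_integrable_compact) auto
    show "AE x in lborel. (\<lambda>m. q m x) \<longlonglongrightarrow> pderivative i f x"
    proof (rule AE_I2)
      fix x
      have "((\<lambda>h. (f (x + h *\<^sub>R ?e) - f x) / h) \<longlongrightarrow> pderivative i f x) (at 0)"
        using pderivative_has_derivative[OF diff, of x i] by (simp add: DERIV_def)
      moreover have "filterlim (\<lambda>m. 1 / real (Suc m)) (at 0) sequentially"
        using LIMSEQ_inverse_real_of_nat unfolding filterlim_at by (simp add: inverse_eq_divide)
      ultimately have "(\<lambda>m. (f (x + (1 / real (Suc m)) *\<^sub>R ?e) - f x) / (1 / real (Suc m))) \<longlonglongrightarrow> pderivative i f x"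
        by (rule filterlim_compose)
      then show "(\<lambda>m. q m x) \<longlonglongrightarrow> pderivative i f x" by (simp add: q_def del: of_nat_Suc)
    qed
    show "AE x in lborel. norm (q m x) \<le> indicator (cball 0 (r + 1)) x *\<^sub>R B" for m
    proof (rule AE_I2)
      fix x
      let ?h = "1 / real (Suc m)"
      have h: "0 < ?h" "?h \<le> 1" by auto
      show "norm (q m x) \<le> indicator (cball 0 (r + 1)) x *\<^sub>R B"
      proof (cases "x \<in> cball 0 (r + 1)")
        case True
        obtain s where "f (x + ?h *\<^sub>R ?e) - f (x + 0 *\<^sub>R ?e) = (?h - 0) * pderivative i f (x + s *\<^sub>R ?e)"
          using MVT2[OF h(1), of "\<lambda>s. f (x + s *\<^sub>R ?e)" "\<lambda>s. pderivative i f (x + s *\<^sub>R ?e)"]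
            pderivative_along[OF diff] by blast
        then have "q m x = pderivative i f (x + s *\<^sub>R ?e)" by (simp add: q_def del: of_nat_Suc)
        then show ?thesis using True B by simp
      next
        case False
        then have nx: "norm x > r + 1" by (simp add: not_le)
        have "norm (x + ?h *\<^sub>R ?e) \<ge> norm x - norm (?h *\<^sub>R ?e)" by (rule norm_diff_ineq)
        moreover have "norm (?h *\<^sub>R ?e) \<le> 1" using ne h by simp
        ultimately have "norm (x + ?h *\<^sub>R ?e) > r" using nx by linarith
        then have "f (x + ?h *\<^sub>R ?e) = 0" "f x = 0" using r K(2) nx by force+
        then show ?thesis using False by (simp add: q_def)
      qed
    qed
  qed
  then have "(\<lambda>m. 0) \<longlonglongrightarrow> (LINT x|lborel. pderivative i f x)" by (simp add: q0)
  then show ?thesis by (rule LIMSEQ_unique[OF _ tendsto_const])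
qed

lemma test_functionsD:
  assumes "\<phi> \<in> test_functions \<Omega>"
  shows "iter_pderivative is \<phi> differentiable (at x)" "\<phi> differentiable (at x)"
    "continuous_on UNIV (iter_pderivative is \<phi>)" "continuous_on UNIV \<phi>"
    "\<exists>K. compact K \<and> K \<subseteq> \<Omega> \<and> (\<forall>x. x \<notin> K \<longrightarrow> \<phi> x = 0)"
proof -
  show d: "iter_pderivative is \<phi> differentiable (at x)" for "is" x using assms by (auto simp: test_functions_def)
  show d': "\<phi> differentiable (at x)" for x using d[of "[]"] by (simp add: iter_pderivative_def)
  show "continuous_on UNIV (iter_pderivative is \<phi>)" "continuous_on UNIV \<phi>"
    using d d' by (simp_all add: continuous_at_imp_continuous_on differentiable_imp_continuous_within)
qed (use assms in \<open>auto simp: test_functions_def\<close>)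

lemma pderivative_test: "\<phi> \<in> test_functions \<Omega> \<Longrightarrow> pderivative i \<phi> \<in> test_functions \<Omega>"
proof -
  assume \<phi>: "\<phi> \<in> test_functions \<Omega>"
  then obtain K where K: "compact K" "K \<subseteq> \<Omega>" "\<And>x. x \<notin> K \<Longrightarrow> \<phi> x = 0" using test_functionsD(5) by blast
  have "pderivative i \<phi> x = 0" if "x \<notin> K" for x
  proof -
    have "open (- K)" using K(1) compact_imp_closed by blast
    then have "(\<phi> has_derivative (\<lambda>_. 0)) (at x)"
      using has_derivative_transform_within_open[of "\<lambda>_. 0" "\<lambda>_. 0" x UNIV "- K" \<phi>] K(3) that by auto
    then show ?thesis by (simp add: pderivative_eqI)
  qed
  moreover have "iter_pderivative is (pderivative i \<phi>) differentiable (at x)" for "is" x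
    using test_functionsD(1)[OF \<phi>, of "is @ [i]"] by (simp add: iter_pderivative_def)
  ultimately show ?thesis unfolding test_functions_def using K by blast
qed

lemma iter_pderivative_test: "\<phi> \<in> test_functions \<Omega> \<Longrightarrow> iter_pderivative is \<phi> \<in> test_functions \<Omega>"
  by (induction "is") (auto simp: iter_pderivative_def intro: pderivative_test)

lemma pderivative_continuous: "\<phi> \<in> test_functions \<Omega> \<Longrightarrow> continuous_on UNIV (pderivative i \<phi>)"
  using test_functionsD(4) pderivative_test by blast

lemma pderivative_lincomb:
  assumes "f differentiable (at x)" "g differentiable (at x)"
  shows "pderivative i (\<lambda>x. a * f x + b * g x) x = a * pderivative i f x + b * pderivative i g x"
  using assms unfolding frechet_derivative_works
  by (intro pderivative_eqI[THEN trans]) (auto intro!: derivative_eq_intros simp: pderivative_def)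

lemma iter_pderivative_lincomb:
  assumes "\<phi> \<in> test_functions \<Omega>" "\<psi> \<in> test_functions \<Omega>"
  shows "iter_pderivative is (\<lambda>x. a * \<phi> x + b * \<psi> x) = (\<lambda>x. a * iter_pderivative is \<phi> x + b * iter_pderivative is \<psi> x)"
proof (induction "is")
  case (Cons i "is")
  have "iter_pderivative (i # is) \<zeta> = pderivative i (iter_pderivative is \<zeta>)" for \<zeta> :: "'a field"
    by (simp add: iter_pderivative_def)
  moreover have "pderivative i (\<lambda>x. a * iter_pderivative is \<phi> x + b * iter_pderivative is \<psi> x) x
     = a * pderivative i (iter_pderivative is \<phi>) x + b * pderivative i (iter_pderivative is \<psi>) x" for x
    by (rule pderivative_lincomb[OF test_functionsD(1)[OF assms(1)] test_functionsD(1)[OF assms(2)]])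
  ultimately show ?case by (intro ext) (simp only: Cons.IH)
qed (simp add: iter_pderivative_def)

lemma test_functions_lincomb:
  assumes "\<phi> \<in> test_functions \<Omega>" "\<psi> \<in> test_functions \<Omega>"
  shows "(\<lambda>x. a * \<phi> x + b * \<psi> x) \<in> test_functions \<Omega>"
proof -
  obtain K where K: "compact K" "K \<subseteq> \<Omega>" "\<And>x. x \<notin> K \<Longrightarrow> \<phi> x = 0" using test_functionsD(5)[OF assms(1)] by blast
  obtain L where L: "compact L" "L \<subseteq> \<Omega>" "\<And>x. x \<notin> L \<Longrightarrow> \<psi> x = 0" using test_functionsD(5)[OF assms(2)] by blast
  have "iter_pderivative is (\<lambda>x. a * \<phi> x + b * \<psi> x) differentiable (at x)" for "is" x
    unfolding iter_pderivative_lincomb[OF assms] using assms by (auto intro!: derivative_intros test_functionsD(1))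
  moreover have "compact (K \<union> L)" "K \<union> L \<subseteq> \<Omega>" "\<forall>x. x \<notin> K \<union> L \<longrightarrow> a * \<phi> x + b * \<psi> x = 0" using K L by auto
  ultimately show ?thesis unfolding test_functions_def by blast
qed

section \<open>The Lebesgue space\<close>

locale bounded_open =
  fixes \<Omega> :: "(real^'n::finite) set"
  assumes opn: "open \<Omega>" and bdd: "bounded \<Omega>"
begin

abbreviation "Mo \<equiv> lebesgue_on \<Omega>"
abbreviation "nrm \<equiv> l2_norm \<Omega>"
abbreviation "ip \<equiv> l2_inner \<Omega>"

lemma sets_\<Omega>: "\<Omega> \<in> sets lebesgue" using opn by auto

lemma fin: "finite_measure Mo"
  by (intro finite_measure_lebesgue_on bounded_set_imp_lmeasurable bdd sets_\<Omega>)

lemma ip_alt: "ip v w = (LINT x|Mo. v x * w x)" for v w :: "'n field"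
  by (simp add: l2_inner_def)

lemma ip_sym: "ip v w = ip w v" for v w :: "'n field"
  by (simp add: ip_alt mult.commute)

lemma L2_measurable: "w \<in> L2 \<Omega> \<Longrightarrow> w \<in> borel_measurable Mo"
  by (simp add: L2_def)

lemma L2_square: "w \<in> L2 \<Omega> \<Longrightarrow> integrable Mo (\<lambda>x. (w x)\<^sup>2)"
  by (simp add: L2_def)

lemma L2_mult: "v \<in> L2 \<Omega> \<Longrightarrow> w \<in> L2 \<Omega> \<Longrightarrow> integrable Mo (\<lambda>x. v x * w x)"
proof (rule Bochner_Integration.integrable_bound)
  assume v: "v \<in> L2 \<Omega>" and w: "w \<in> L2 \<Omega>"
  show "integrable Mo (\<lambda>x. (v x)\<^sup>2 + (w x)\<^sup>2)" using v w L2_square by auto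
  show "(\<lambda>x. v x * w x) \<in> borel_measurable Mo" using v w L2_measurable by auto
  have "\<bar>a * b\<bar> \<le> a\<^sup>2 + b\<^sup>2" for a b :: real
  proof -
    have "2 * \<bar>a\<bar> * \<bar>b\<bar> \<le> \<bar>a\<bar>\<^sup>2 + \<bar>b\<bar>\<^sup>2" by (rule sum_squares_bound)
    moreover have "0 \<le> \<bar>a\<bar> * \<bar>b\<bar>" by simp
    ultimately show ?thesis unfolding abs_mult power2_abs by linarith
  qed
  then show "AE x in Mo. norm (v x * w x) \<le> norm ((v x)\<^sup>2 + (w x)\<^sup>2)" by (intro AE_I2) simp
qed

lemma L2_lincomb: "v \<in> L2 \<Omega> \<Longrightarrow> w \<in> L2 \<Omega> \<Longrightarrow> (\<lambda>x. a * v x + b * w x) \<in> L2 \<Omega>"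
proof -
  assume v: "v \<in> L2 \<Omega>" and w: "w \<in> L2 \<Omega>"
  have "integrable Mo (\<lambda>x. a\<^sup>2 * (v x)\<^sup>2 + 2 * a * b * (v x * w x) + b\<^sup>2 * (w x)\<^sup>2)"
    using v w L2_square L2_mult by auto
  then have "integrable Mo (\<lambda>x. (a * v x + b * w x)\<^sup>2)"
    by (simp add: power2_sum power_mult_distrib algebra_simps)
  then show ?thesis unfolding L2_def using v w L2_measurable by auto
qed

lemma L2_0: "(\<lambda>x. 0) \<in> L2 \<Omega>" by (simp add: L2_def)

lemma L2_add: "v \<in> L2 \<Omega> \<Longrightarrow> w \<in> L2 \<Omega> \<Longrightarrow> (\<lambda>x. v x + w x) \<in> L2 \<Omega>"
  and L2_diff: "v \<in> L2 \<Omega> \<Longrightarrow> w \<in> L2 \<Omega> \<Longrightarrow> (\<lambda>x. v x - w x) \<in> L2 \<Omega>"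
  and L2_cmult: "v \<in> L2 \<Omega> \<Longrightarrow> (\<lambda>x. a * v x) \<in> L2 \<Omega>"
  using L2_lincomb[of v w 1 1] L2_lincomb[of v w 1 "-1"] L2_lincomb[of v v a 0] by auto

lemma L2_sum: "(\<And>i. i \<in> I \<Longrightarrow> w i \<in> L2 \<Omega>) \<Longrightarrow> (\<lambda>x. \<Sum>i\<in>I. w i x) \<in> L2 \<Omega>"
  by (induction I rule: infinite_finite_induct) (auto intro: L2_0 L2_add)

lemma L2_integrable: "w \<in> L2 \<Omega> \<Longrightarrow> integrable Mo w"
proof -
  assume w: "w \<in> L2 \<Omega>"
  interpret finite_measure Mo by (rule fin)
  have "(\<lambda>x. 1) \<in> L2 \<Omega>" by (simp add: L2_def)
  from L2_mult[OF w this] show ?thesis by simp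
qed

lemma L2_bounded: "w \<in> borel_measurable Mo \<Longrightarrow> (\<And>x. x \<in> \<Omega> \<Longrightarrow> \<bar>w x\<bar> \<le> B) \<Longrightarrow> w \<in> L2 \<Omega>"
proof -
  assume w: "w \<in> borel_measurable Mo" and B: "\<And>x. x \<in> \<Omega> \<Longrightarrow> \<bar>w x\<bar> \<le> B"
  interpret finite_measure Mo by (rule fin)
  have "integrable Mo (\<lambda>x. (w x)\<^sup>2)"
  proof (rule integrable_const_bound[where B = "B\<^sup>2"])
    show "AE x in Mo. norm ((w x)\<^sup>2) \<le> B\<^sup>2"
      using B by (intro AE_I2) (simp add: power2_le_iff_abs_le abs_le_square_iff[symmetric], force)
  qed (use w in auto)
  then show ?thesis using w by (simp add: L2_def)
qed

lemma L2_continuous: "continuous_on (closure \<Omega>) w \<Longrightarrow> w \<in> L2 \<Omega>"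
proof -
  assume c: "continuous_on (closure \<Omega>) w"
  have "bounded (w ` closure \<Omega>)" using c bdd by (intro compact_imp_bounded compact_continuous_image) auto
  then obtain B where B: "\<forall>x\<in>closure \<Omega>. norm (w x) \<le> B" by (auto simp: bounded_iff)
  show ?thesis
  proof (rule L2_bounded[where B = B])
    show "w \<in> borel_measurable Mo"
      by (rule continuous_imp_measurable_on_sets_lebesgue[OF continuous_on_subset[OF c closure_subset] sets_\<Omega>])
    show "\<bar>w x\<bar> \<le> B" if "x \<in> \<Omega>" for x using B that closure_subset[of \<Omega>] by auto
  qed
qed

lemma ip_lincomb: "u \<in> L2 \<Omega> \<Longrightarrow> v \<in> L2 \<Omega> \<Longrightarrow> w \<in> L2 \<Omega> \<Longrightarrow>
   ip (\<lambda>x. a * u x + b * v x) w = a * ip u w + b * ip v w"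
  by (simp add: ip_alt distrib_right mult.assoc L2_mult)

lemma ip_diff: "u \<in> L2 \<Omega> \<Longrightarrow> v \<in> L2 \<Omega> \<Longrightarrow> w \<in> L2 \<Omega> \<Longrightarrow> ip (\<lambda>x. u x - v x) w = ip u w - ip v w"
  using ip_lincomb[of u v w 1 "-1"] by simp

lemma ip_add: "u \<in> L2 \<Omega> \<Longrightarrow> v \<in> L2 \<Omega> \<Longrightarrow> w \<in> L2 \<Omega> \<Longrightarrow> ip (\<lambda>x. u x + v x) w = ip u w + ip v w"
  using ip_lincomb[of u v w 1 1] by simp

lemma ip_sum: "(\<And>i. i \<in> I \<Longrightarrow> v i \<in> L2 \<Omega>) \<Longrightarrow> w \<in> L2 \<Omega> \<Longrightarrow>
   ip (\<lambda>x. \<Sum>i\<in>I. v i x) w = (\<Sum>i\<in>I. ip (v i) w)"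
  by (induction I rule: infinite_finite_induct) (auto simp: ip_add L2_sum, simp_all add: ip_alt)

lemma ip_nonneg: "0 \<le> ip w w" for w :: "real^'n \<Rightarrow> 'b::real_inner"
  unfolding l2_inner_def by (rule integral_nonneg_AE) simp

lemma nrm_sq: "(nrm w)\<^sup>2 = ip w w" for w :: "real^'n \<Rightarrow> 'b::real_inner"
  using ip_nonneg[of w] by (simp add: l2_norm_def)

lemma nrm_nonneg: "0 \<le> nrm w" for w :: "real^'n \<Rightarrow> 'b::real_inner"
  using ip_nonneg[of w] by (simp add: l2_norm_def)

lemma nrm_cmult: "w \<in> L2 \<Omega> \<Longrightarrow> nrm (\<lambda>x. a * w x) = \<bar>a\<bar> * nrm w"
  by (simp add: l2_norm_def ip_alt mult.left_commute mult.assoc[symmetric] real_sqrt_mult)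
     (simp add: mult.assoc real_sqrt_mult)

end

text \<open>The Cauchy--Schwarz inequality for a semidefinite form, from the discriminant.\<close>

lemma cauchy_schwarz_form:
  fixes a b c :: real
  assumes "\<And>s. 0 \<le> a + 2 * s * b + s\<^sup>2 * c" "0 \<le> a" "0 \<le> c"
  shows "\<bar>b\<bar> \<le> sqrt a * sqrt c"
proof (cases "c = 0")
  case True
  have "b = 0"
  proof (rule ccontr)
    assume "b \<noteq> 0"
    then show False using assms(1)[of "- (a + 1) / (2 * b)"] True by (simp add: field_simps)
  qed
  then show ?thesis using assms by simp
next
  case False
  then have c: "c > 0" using assms by simp
  have "b\<^sup>2 \<le> a * c"
    using assms(1)[of "- b / c"] c by (simp add: field_simps power2_eq_square)
  then have "sqrt (b\<^sup>2) \<le> sqrt (a * c)" by (rule real_sqrt_le_mono)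
  then show ?thesis by (simp add: real_sqrt_mult)
qed

context bounded_open
begin

lemma ip_cauchy: "v \<in> L2 \<Omega> \<Longrightarrow> w \<in> L2 \<Omega> \<Longrightarrow> \<bar>ip v w\<bar> \<le> nrm v * nrm w"
proof -
  assume v: "v \<in> L2 \<Omega>" and w: "w \<in> L2 \<Omega>"
  have "0 \<le> ip v v + 2 * s * ip v w + s\<^sup>2 * ip w w" for s
  proof -
    have "0 \<le> ip (\<lambda>x. 1 * v x + s * w x) (\<lambda>x. 1 * v x + s * w x)" by (rule ip_nonneg)
    also have "\<dots> = 1 * ip (\<lambda>x. 1 * v x + s * w x) v + s * ip (\<lambda>x. 1 * v x + s * w x) w"
      using ip_lincomb[OF v w L2_lincomb[OF v w, of 1 s], of 1 s]
      by (simp add: ip_sym[of v "\<lambda>x. v x + s * w x"] ip_sym[of w "\<lambda>x. v x + s * w x"])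
    also have "\<dots> = ip v v + 2 * s * ip v w + s\<^sup>2 * ip w w"
      unfolding ip_lincomb[OF v w v] ip_lincomb[OF v w w] by (simp add: ip_sym[of w v] power2_eq_square algebra_simps)
    finally show ?thesis .
  qed
  from cauchy_schwarz_form[OF this ip_nonneg ip_nonneg] show ?thesis by (simp add: l2_norm_def)
qed

lemma nrm_triangle: "v \<in> L2 \<Omega> \<Longrightarrow> w \<in> L2 \<Omega> \<Longrightarrow> nrm (\<lambda>x. v x + w x) \<le> nrm v + nrm w"
proof (rule power2_le_imp_le)
  assume v: "v \<in> L2 \<Omega>" and w: "w \<in> L2 \<Omega>"
  have vw: "(\<lambda>x. v x + w x) \<in> L2 \<Omega>" by (rule L2_add[OF v w])
  have "(nrm (\<lambda>x. v x + w x))\<^sup>2 = ip v (\<lambda>x. v x + w x) + ip w (\<lambda>x. v x + w x)"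
    unfolding nrm_sq by (rule ip_add[OF v w vw])
  also have "\<dots> = ip v v + 2 * ip v w + ip w w"
    using ip_add[OF v w v] ip_add[OF v w w] by (simp add: ip_sym[of _ "\<lambda>x. v x + w x"] ip_sym[of w v])
  also have "\<dots> \<le> (nrm v + nrm w)\<^sup>2"
    using ip_cauchy[OF v w] unfolding power2_sum nrm_sq by linarith
  finally show "(nrm (\<lambda>x. v x + w x))\<^sup>2 \<le> (nrm v + nrm w)\<^sup>2" .
qed (simp add: nrm_nonneg add_nonneg_nonneg)

lemma nrm_triangle_diff: "v \<in> L2 \<Omega> \<Longrightarrow> w \<in> L2 \<Omega> \<Longrightarrow> nrm (\<lambda>x. v x - w x) \<le> nrm v + nrm w"
  using nrm_triangle[of v "\<lambda>x. - 1 * w x"] L2_cmult[of w "-1"] nrm_cmult[of w "-1"] by simp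

lemma nrm_le_diff: "v \<in> L2 \<Omega> \<Longrightarrow> w \<in> L2 \<Omega> \<Longrightarrow> nrm v \<le> nrm w + nrm (\<lambda>x. v x - w x)"
  using nrm_triangle[of w "\<lambda>x. v x - w x"] L2_diff by simp

lemma ip_cong_AE: "(AE x in Mo. v x = v' x) \<Longrightarrow> (AE x in Mo. w x = w' x) \<Longrightarrow> v \<in> L2 \<Omega> \<Longrightarrow> v' \<in> L2 \<Omega> \<Longrightarrow>
   w \<in> L2 \<Omega> \<Longrightarrow> w' \<in> L2 \<Omega> \<Longrightarrow> ip v w = ip v' w'"
  unfolding ip_alt by (rule integral_cong_AE) (auto intro!: borel_measurable_times elim: eventually_elim2 dest!: L2_measurable)

lemma nrm_cong_AE: "(AE x in Mo. v x = v' x) \<Longrightarrow> v \<in> L2 \<Omega> \<Longrightarrow> v' \<in> L2 \<Omega> \<Longrightarrow> nrm v = nrm v'"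
  unfolding l2_norm_def using ip_cong_AE by simp

lemma nrm_zero_AE: "v \<in> L2 \<Omega> \<Longrightarrow> nrm v = 0 \<Longrightarrow> AE x in Mo. v x = 0"
proof -
  assume v: "v \<in> L2 \<Omega>" and 0: "nrm v = 0"
  have "(LINT x|Mo. (v x)\<^sup>2) = 0" using 0 nrm_sq[of v] by (simp add: ip_alt power2_eq_square)
  then have "AE x in Mo. (v x)\<^sup>2 = 0"
    using integral_nonneg_eq_0_iff_AE[OF L2_square[OF v]] by simp
  then show ?thesis by simp
qed

lemma L2_cong_AE: "v \<in> L2 \<Omega> \<Longrightarrow> (AE x in Mo. v x = w x) \<Longrightarrow> w \<in> L2 \<Omega>"
proof -
  assume v: "v \<in> L2 \<Omega>" and ae: "AE x in Mo. v x = w x"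
  have wm: "w \<in> borel_measurable Mo"
  proof -
    have "(\<lambda>x. if x \<in> \<Omega> then v x else 0) \<in> borel_measurable lebesgue"
      using L2_measurable[OF v] borel_measurable_if_I[OF _ sets_\<Omega>] by blast
    moreover have "AE x in lebesgue. (if x \<in> \<Omega> then v x else 0) = (if x \<in> \<Omega> then w x else 0)"
      using ae sets_\<Omega> by (simp add: AE_restrict_space_iff)
    ultimately have "(\<lambda>x. if x \<in> \<Omega> then w x else 0) \<in> borel_measurable lebesgue"
      by (rule borel_measurable_AE)
    then show ?thesis using borel_measurable_if_D by blast
  qed
  have "integrable Mo (\<lambda>x. (w x)\<^sup>2)"
    by (rule integrable_cong_AE_imp[OF L2_square[OF v]]) (use wm ae in \<open>auto elim: eventually_mono\<close>)
  then show ?thesis using wm by (simp add: L2_def)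
qed

lemma integral_\<Omega>_lborel:
  fixes f :: "'n field"
  assumes f: "continuous_on UNIV f" and z: "\<And>x. x \<notin> \<Omega> \<Longrightarrow> f x = 0"
  shows "(LINT x|Mo. f x) = (LINT x|lborel. f x)"
proof -
  have "(LINT x|Mo. f x) = (LINT x|lebesgue. (if x \<in> \<Omega> then f x else 0))"
    by (rule Lebesgue_Measure.integral_restrict_UNIV[OF sets_\<Omega>, symmetric])
  also have "(\<lambda>x. if x \<in> \<Omega> then f x else 0) = f" using z by auto
  also have "(LINT x|lebesgue. f x) = (LINT x|lborel. f x)"
    by (rule integral_completion) (use borel_measurable_continuous_onI[OF f] in simp)
  finally show ?thesis .
qed

lemma test_L2: "\<phi> \<in> test_functions \<Omega> \<Longrightarrow> \<phi> \<in> L2 \<Omega>"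
  by (rule L2_continuous) (use test_functionsD(4) continuous_on_subset in blast)

lemma test_zero: "\<phi> \<in> test_functions \<Omega> \<Longrightarrow> x \<notin> \<Omega> \<Longrightarrow> \<phi> x = 0"
  using test_functionsD(5) by blast

lemma test_integral_pderivative:
  fixes g \<phi> d :: "'n field"
  assumes g: "\<And>x. (g has_derivative D x) (at x)" and D: "\<And>x. D x (axis i 1) = d x"
    and d: "continuous_on UNIV d" and supp: "\<phi> \<in> test_functions \<Omega>" "\<And>x. \<phi> x = 0 \<Longrightarrow> g x = 0"
    "\<And>x. x \<notin> \<Omega> \<Longrightarrow> d x = 0"
  shows "(LINT x|Mo. d x) = 0"
proof -
  obtain K where K: "compact K" "\<And>x. x \<notin> K \<Longrightarrow> \<phi> x = 0" using test_functionsD(5)[OF supp(1)] by blast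
  have p: "pderivative i g = d" using pderivative_eqI[OF g] D by auto
  have "(LINT x|lborel. pderivative i g x) = 0"
    by (rule integral_pderivative_zero[OF _ _ K(1)]) (use g p d K(2) supp(2) in \<open>auto simp: differentiable_def\<close>)
  then show ?thesis using integral_\<Omega>_lborel[OF d] supp(3) p by simp
qed

lemma test_by_parts:
  assumes \<phi>: "\<phi> \<in> test_functions \<Omega>" and \<psi>: "\<psi> \<in> test_functions \<Omega>"
  shows "ip \<phi> (pderivative i \<psi>) = - ip (pderivative i \<phi>) \<psi>"
proof -
  have "(LINT x|Mo. \<phi> x * pderivative i \<psi> x + pderivative i \<phi> x * \<psi> x) = 0"
  proof (rule test_integral_pderivative[where g = "\<lambda>x. \<phi> x * \<psi> x" and \<phi> = \<phi> and i = i])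
    show "((\<lambda>x. \<phi> x * \<psi> x) has_derivative (\<lambda>h. \<phi> x * frechet_derivative \<psi> (at x) h + frechet_derivative \<phi> (at x) h * \<psi> x)) (at x)" for x
      using test_functionsD(2)[OF \<phi>] test_functionsD(2)[OF \<psi>] unfolding frechet_derivative_works
      by (intro has_derivative_mult) auto
    show "continuous_on UNIV (\<lambda>x. \<phi> x * pderivative i \<psi> x + pderivative i \<phi> x * \<psi> x)"
      using \<phi> \<psi> by (intro continuous_intros pderivative_continuous test_functionsD(4))
    show "\<phi> x * pderivative i \<psi> x + pderivative i \<phi> x * \<psi> x = 0" if "x \<notin> \<Omega>" for x
      using test_zero[OF \<phi> that] test_zero[OF \<psi> that] by simp
  qed (use \<phi> in \<open>simp_all add: pderivative_def\<close>)
  then have "ip \<phi> (pderivative i \<psi>) + ip (pderivative i \<phi>) \<psi> = 0"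
    using L2_mult[OF test_L2[OF \<phi>] test_L2[OF pderivative_test[OF \<psi>]], of i]
      L2_mult[OF test_L2[OF pderivative_test[OF \<phi>]] test_L2[OF \<psi>], of i]
    by (simp add: ip_alt)
  then show ?thesis by simp
qed

text \<open>The integral of \<open>\<partial>\<^sub>i (x\<^sub>i \<phi>\<^sup>2) = \<phi>\<^sup>2 + 2 x\<^sub>i
  \<phi> \<partial>\<^sub>i \<phi>\<close> vanishes, and \<open>x\<^sub>i\<close> is bounded by
  \<open>R\<close>.\<close>

lemma test_poincare:
  assumes \<phi>: "\<phi> \<in> test_functions \<Omega>" and R: "\<And>x. x \<in> \<Omega> \<Longrightarrow> norm x \<le> R"
  shows "nrm \<phi> \<le> 2 * R * nrm (pderivative i \<phi>)"
proof -
  let ?\<psi> = "\<lambda>x. x $ i * \<phi> x"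
  have \<psi>: "?\<psi> \<in> L2 \<Omega>"
    by (rule L2_continuous, rule continuous_on_subset[of UNIV],
        rule continuous_on_mult[OF linear_continuous_on[OF bounded_linear_vec_nth] test_functionsD(4)[OF \<phi>]]) simp
  have "(LINT x|Mo. \<phi> x * \<phi> x + 2 * (?\<psi> x * pderivative i \<phi> x)) = 0"
  proof (rule test_integral_pderivative[where g = "\<lambda>x. x $ i * (\<phi> x * \<phi> x)" and \<phi> = \<phi> and i = i])
    fix x :: "real^'n"
    have 1: "((\<lambda>x. x $ i) has_derivative (\<lambda>h. h $ i)) (at x)"
      by (rule bounded_linear_imp_has_derivative[OF bounded_linear_vec_nth])
    have 2: "(\<phi> has_derivative frechet_derivative \<phi> (at x)) (at x)"
      using test_functionsD(2)[OF \<phi>] frechet_derivative_works by blast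
    show "((\<lambda>x. x $ i * (\<phi> x * \<phi> x)) has_derivative (\<lambda>h. x $ i * (\<phi> x * frechet_derivative \<phi> (at x) h + frechet_derivative \<phi> (at x) h * \<phi> x) + h $ i * (\<phi> x * \<phi> x))) (at x)"
      by (intro has_derivative_mult 1 2)
    show "continuous_on UNIV (\<lambda>x. \<phi> x * \<phi> x + 2 * (x $ i * \<phi> x * pderivative i \<phi> x))"
      using \<phi> by (intro continuous_intros pderivative_continuous test_functionsD(4))
    show "\<phi> x * \<phi> x + 2 * (x $ i * \<phi> x * pderivative i \<phi> x) = 0" if "x \<notin> \<Omega>" for x
      using test_zero[OF \<phi> that] by simp
  qed (use \<phi> in \<open>simp_all add: pderivative_def axis_def algebra_simps\<close>)
  then have "ip \<phi> \<phi> + 2 * ip ?\<psi> (pderivative i \<phi>) = 0"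
    using L2_mult[OF test_L2[OF \<phi>] test_L2[OF \<phi>]] L2_mult[OF \<psi> test_L2[OF pderivative_test[OF \<phi>]], of i]
    by (simp add: ip_alt)
  then have "(nrm \<phi>)\<^sup>2 \<le> 2 * \<bar>ip ?\<psi> (pderivative i \<phi>)\<bar>" unfolding nrm_sq by linarith
  also have "\<dots> \<le> 2 * (nrm ?\<psi> * nrm (pderivative i \<phi>))"
    using ip_cauchy[OF \<psi> test_L2[OF pderivative_test[OF \<phi>]]] by (intro mult_left_mono) auto
  also have "nrm ?\<psi> \<le> \<bar>R\<bar> * nrm \<phi>"
  proof (rule power2_le_imp_le)
    have "(nrm ?\<psi>)\<^sup>2 \<le> (LINT x|Mo. R\<^sup>2 * (\<phi> x)\<^sup>2)"
      unfolding nrm_sq ip_alt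
    proof (rule integral_mono)
      show "integrable Mo (\<lambda>x. x $ i * \<phi> x * (x $ i * \<phi> x))" by (rule L2_mult[OF \<psi> \<psi>])
      show "integrable Mo (\<lambda>x. R\<^sup>2 * (\<phi> x)\<^sup>2)" using L2_square[OF test_L2[OF \<phi>]] by simp
      fix x assume "x \<in> space Mo"
      then have "\<bar>x $ i\<bar> \<le> R" using R component_le_norm_cart[of x i] by fastforce
      then have "(x $ i)\<^sup>2 \<le> R\<^sup>2" using power_mono[of "\<bar>x $ i\<bar>" R 2] by simp
      then have "(x $ i)\<^sup>2 * (\<phi> x)\<^sup>2 \<le> R\<^sup>2 * (\<phi> x)\<^sup>2" by (rule mult_right_mono) simp
      then show "x $ i * \<phi> x * (x $ i * \<phi> x) \<le> R\<^sup>2 * (\<phi> x)\<^sup>2" by (simp add: power2_eq_square mult_ac)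
    qed
    also have "\<dots> = R\<^sup>2 * ip \<phi> \<phi>" by (simp add: ip_alt power2_eq_square)
    also have "\<dots> = (\<bar>R\<bar> * nrm \<phi>)\<^sup>2" by (simp add: nrm_sq[symmetric] power_mult_distrib)
    finally show "(nrm ?\<psi>)\<^sup>2 \<le> (\<bar>R\<bar> * nrm \<phi>)\<^sup>2" .
  qed (simp add: nrm_nonneg)
  finally have *: "nrm \<phi> * nrm \<phi> \<le> nrm \<phi> * (2 * \<bar>R\<bar> * nrm (pderivative i \<phi>))"
    using nrm_nonneg[of "pderivative i \<phi>"] by (simp add: power2_eq_square mult_ac mult_left_mono mult_right_mono)
  show ?thesis
  proof (cases "\<Omega> = {}")
    case True
    then show ?thesis by (simp add: l2_norm_def l2_inner_def)
  next
    case False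
    then have "R \<ge> 0" using R norm_ge_zero order_trans by blast
    then have R: "\<bar>R\<bar> = R" by simp
    show ?thesis
    proof (cases "nrm \<phi> = 0")
      case True
      then show ?thesis using \<open>R \<ge> 0\<close> by (simp add: nrm_nonneg)
    next
      case False
      then have "nrm \<phi> > 0" using nrm_nonneg[of \<phi>] by simp
      then show ?thesis using * unfolding R by simp
    qed
  qed
qed

end

section \<open>Weak derivatives and Sobolev spaces\<close>

context bounded_open
begin

abbreviation "wd is w \<equiv> weak_derivative \<Omega> is w"

text \<open>The fundamental lemma of the calculus of variations. It makes the chosen weak derivative linear up
  to null sets.\<close>

lemma weak_derivative_unique:
  assumes "g \<in> L2 \<Omega>" "g' \<in> L2 \<Omega>" "has_weak_derivative \<Omega> is w g" "has_weak_derivative \<Omega> is w g'"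
  shows "AE x in Mo. g x = g' x"
proof -
  have "AE x in Mo. g x - g' x = 0"
  proof (rule fundamental_lemma_variations[OF opn])
    show "integrable Mo (\<lambda>x. g x - g' x)" using assms L2_integrable by auto
    fix \<phi> assume \<phi>: "\<phi> \<in> test_functions \<Omega>"
    have "(-1) ^ length is * ip g \<phi> = (-1) ^ length is * ip g' \<phi>"
      using assms(3,4) \<phi> unfolding has_weak_derivative_def by metis
    then have "ip (\<lambda>x. g x - g' x) \<phi> = 0" using ip_diff[OF assms(1,2) test_L2[OF \<phi>]] by simp
    then show "(LINT x|Mo. (g x - g' x) * \<phi> x) = 0" by (simp add: ip_alt)
  qed
  then show ?thesis by simp
qed

lemma wd_props:
  assumes "w \<in> Sobolev \<Omega> m" "length is \<le> m"
  shows "wd is w \<in> L2 \<Omega>" "has_weak_derivative \<Omega> is w (wd is w)"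
proof -
  have "\<exists>g. g \<in> L2 \<Omega> \<and> has_weak_derivative \<Omega> is w g" using assms unfolding Sobolev_def by blast
  from someI_ex[OF this] show "wd is w \<in> L2 \<Omega>" "has_weak_derivative \<Omega> is w (wd is w)"
    unfolding weak_derivative_def by auto
qed

lemma wd_eqI:
  assumes "g \<in> L2 \<Omega>" "has_weak_derivative \<Omega> is w g"
  shows "AE x in Mo. wd is w x = g x" "wd is w \<in> L2 \<Omega>"
proof -
  have "\<exists>g. g \<in> L2 \<Omega> \<and> has_weak_derivative \<Omega> is w g" using assms by blast
  from someI_ex[OF this] have *: "wd is w \<in> L2 \<Omega>" "has_weak_derivative \<Omega> is w (wd is w)"
    unfolding weak_derivative_def by auto
  show "AE x in Mo. wd is w x = g x" by (rule weak_derivative_unique[OF *(1) assms(1) *(2) assms(2)])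
  show "wd is w \<in> L2 \<Omega>" by (rule *(1))
qed

lemma Sobolev_L2: "w \<in> Sobolev \<Omega> m \<Longrightarrow> w \<in> L2 \<Omega>"
  by (simp add: Sobolev_def)

lemma Sobolev_mono: "m' \<le> m \<Longrightarrow> w \<in> Sobolev \<Omega> m \<Longrightarrow> w \<in> Sobolev \<Omega> m'"
  unfolding Sobolev_def by (auto intro: order_trans)

lemma wd_Nil: "w \<in> L2 \<Omega> \<Longrightarrow> AE x in Mo. wd [] w x = w x" "w \<in> L2 \<Omega> \<Longrightarrow> wd [] w \<in> L2 \<Omega>"
  using wd_eqI[of w "[]" w] by (auto simp: has_weak_derivative_def iter_pderivative_def)

lemma nrm_wd_Nil: "w \<in> L2 \<Omega> \<Longrightarrow> nrm (wd [] w) = nrm w"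
  using nrm_cong_AE wd_Nil by blast

lemma weak_lincomb:
  assumes v: "v \<in> L2 \<Omega>" "g \<in> L2 \<Omega>" "has_weak_derivative \<Omega> is v g"
    and w: "w \<in> L2 \<Omega>" "h \<in> L2 \<Omega>" "has_weak_derivative \<Omega> is w h"
  shows "has_weak_derivative \<Omega> is (\<lambda>x. a * v x + b * w x) (\<lambda>x. a * g x + b * h x)"
  unfolding has_weak_derivative_def
proof
  fix \<phi> assume \<phi>: "\<phi> \<in> test_functions \<Omega>"
  have d: "iter_pderivative is \<phi> \<in> L2 \<Omega>" using test_L2 iter_pderivative_test[OF \<phi>] by blast
  show "ip (\<lambda>x. a * v x + b * w x) (iter_pderivative is \<phi>) = (-1) ^ length is * ip (\<lambda>x. a * g x + b * h x) \<phi>"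
    unfolding ip_lincomb[OF v(1) w(1) d] ip_lincomb[OF v(2) w(2) test_L2[OF \<phi>]]
    using v(3) w(3) \<phi> unfolding has_weak_derivative_def by (simp add: algebra_simps)
qed

lemma Sobolev_lincomb: "v \<in> Sobolev \<Omega> m \<Longrightarrow> w \<in> Sobolev \<Omega> m \<Longrightarrow> (\<lambda>x. a * v x + b * w x) \<in> Sobolev \<Omega> m"
  and wd_lincomb: "v \<in> Sobolev \<Omega> m \<Longrightarrow> w \<in> Sobolev \<Omega> m \<Longrightarrow> length is \<le> m \<Longrightarrow>
     AE x in Mo. wd is (\<lambda>x. a * v x + b * w x) x = a * wd is v x + b * wd is w x"
proof -
  assume v: "v \<in> Sobolev \<Omega> m" and w: "w \<in> Sobolev \<Omega> m"
  have *: "has_weak_derivative \<Omega> is (\<lambda>x. a * v x + b * w x) (\<lambda>x. a * wd is v x + b * wd is w x)"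
     "(\<lambda>x. a * wd is v x + b * wd is w x) \<in> L2 \<Omega>" if "length is \<le> m" for "is"
    using wd_props[OF v that] wd_props[OF w that] Sobolev_L2 v w by (auto intro: weak_lincomb L2_lincomb)
  show "(\<lambda>x. a * v x + b * w x) \<in> Sobolev \<Omega> m"
    using * v w Sobolev_L2 unfolding Sobolev_def by (blast intro: L2_lincomb)
  show "length is \<le> m \<Longrightarrow> AE x in Mo. wd is (\<lambda>x. a * v x + b * w x) x = a * wd is v x + b * wd is w x"
    using wd_eqI(1) * by blast
qed

lemma Sobolev_diff: "v \<in> Sobolev \<Omega> m \<Longrightarrow> w \<in> Sobolev \<Omega> m \<Longrightarrow> (\<lambda>x. v x - w x) \<in> Sobolev \<Omega> m"
  using Sobolev_lincomb[of v m w 1 "-1"] by simp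

lemma wd_diff: "v \<in> Sobolev \<Omega> m \<Longrightarrow> w \<in> Sobolev \<Omega> m \<Longrightarrow> length is \<le> m \<Longrightarrow>
   AE x in Mo. wd is (\<lambda>x. v x - w x) x = wd is v x - wd is w x"
  using wd_lincomb[of v m w "is" 1 "-1"] by simp

text \<open>Equality holds everywhere here: both sides are chosen by the same predicate.\<close>

lemma wd_cong_AE: "v \<in> L2 \<Omega> \<Longrightarrow> AE x in Mo. v x = w x \<Longrightarrow> wd is v = wd is w"
proof -
  assume v: "v \<in> L2 \<Omega>" and ae: "AE x in Mo. v x = w x"
  have w: "w \<in> L2 \<Omega>" using L2_cong_AE[OF v ae] .
  have "ip v (iter_pderivative is \<phi>) = ip w (iter_pderivative is \<phi>)" if "\<phi> \<in> test_functions \<Omega>" for \<phi>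
    using ip_cong_AE[OF ae _ v w] test_L2[OF iter_pderivative_test[OF that]] by auto
  then show ?thesis unfolding weak_derivative_def has_weak_derivative_def by (metis (no_types, lifting))
qed

lemma finite_multiindices: "finite {is :: 'n list. length is \<le> m}"
  using finite_lists_length_le[of "UNIV :: 'n set" m] by simp

lemma nrm_wd_le_Sobolev_norm: "length is \<le> m \<Longrightarrow> nrm (wd is w) \<le> Sobolev_norm \<Omega> m w"
proof -
  assume "length is \<le> m"
  then have "(nrm (wd is w))\<^sup>2 \<le> (\<Sum>is | length is \<le> m. (nrm (wd is w))\<^sup>2)"
    by (intro member_le_sum[where f = "\<lambda>is. (nrm (wd is w))\<^sup>2"] finite_multiindices) auto
  then show ?thesis unfolding Sobolev_norm_def by (rule real_le_rsqrt)
qed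

lemma Sobolev_norm_mono: "m' \<le> m \<Longrightarrow> Sobolev_norm \<Omega> m' w \<le> Sobolev_norm \<Omega> m w"
  unfolding Sobolev_norm_def
  by (intro real_sqrt_le_mono sum_mono2 finite_multiindices) auto

lemma Sobolev_norm_nonneg: "0 \<le> Sobolev_norm \<Omega> m w"
  unfolding Sobolev_norm_def by (intro real_sqrt_ge_zero sum_nonneg) auto

lemma Sobolev_norm_triangle:
  assumes v: "v \<in> Sobolev \<Omega> m" and w: "w \<in> Sobolev \<Omega> m"
  shows "Sobolev_norm \<Omega> m (\<lambda>x. a * v x + b * w x) \<le> \<bar>a\<bar> * Sobolev_norm \<Omega> m v + \<bar>b\<bar> * Sobolev_norm \<Omega> m w"
proof -
  let ?I = "{is :: 'n list. length is \<le> m}"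
  have 1: "nrm (wd is (\<lambda>x. a * v x + b * w x)) \<le> \<bar>a\<bar> * nrm (wd is v) + \<bar>b\<bar> * nrm (wd is w)" if "is \<in> ?I" for "is"
  proof -
    have i: "length is \<le> m" using that by simp
    note pv = wd_props(1)[OF v i] and pw = wd_props(1)[OF w i]
    have "nrm (wd is (\<lambda>x. a * v x + b * w x)) = nrm (\<lambda>x. a * wd is v x + b * wd is w x)"
      by (rule nrm_cong_AE[OF wd_lincomb[OF v w i] wd_props(1)[OF Sobolev_lincomb[OF v w] i] L2_lincomb[OF pv pw]])
    also have "\<dots> \<le> nrm (\<lambda>x. a * wd is v x) + nrm (\<lambda>x. b * wd is w x)"
      by (rule nrm_triangle[OF L2_cmult[OF pv] L2_cmult[OF pw]])
    finally show ?thesis by (simp add: nrm_cmult pv pw)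
  qed
  have "Sobolev_norm \<Omega> m (\<lambda>x. a * v x + b * w x) = L2_set (\<lambda>is. nrm (wd is (\<lambda>x. a * v x + b * w x))) ?I"
    by (simp add: Sobolev_norm_def L2_set_def)
  also have "\<dots> \<le> L2_set (\<lambda>is. \<bar>a\<bar> * nrm (wd is v) + \<bar>b\<bar> * nrm (wd is w)) ?I"
    by (rule L2_set_mono) (use 1 in \<open>auto simp: nrm_nonneg\<close>)
  also have "\<dots> \<le> L2_set (\<lambda>is. \<bar>a\<bar> * nrm (wd is v)) ?I + L2_set (\<lambda>is. \<bar>b\<bar> * nrm (wd is w)) ?I"
    by (rule L2_set_triangle_ineq)
  also have "\<dots> = \<bar>a\<bar> * Sobolev_norm \<Omega> m v + \<bar>b\<bar> * Sobolev_norm \<Omega> m w"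
    by (simp add: Sobolev_norm_def L2_set_def power_mult_distrib sum_distrib_left[symmetric] real_sqrt_mult)
  finally show ?thesis .
qed

text \<open>By integration by parts, the classical derivative of a test function is its weak derivative.\<close>

lemma test_wd:
  assumes \<phi>: "\<phi> \<in> test_functions \<Omega>"
  shows "\<phi> \<in> Sobolev \<Omega> 1" "AE x in Mo. wd [i] \<phi> x = pderivative i \<phi> x"
proof -
  have h: "has_weak_derivative \<Omega> [i] \<phi> (pderivative i \<phi>)" for i
    unfolding has_weak_derivative_def using test_by_parts[OF \<phi>] by (simp add: iter_pderivative_def)
  have h0: "has_weak_derivative \<Omega> [] \<phi> \<phi>"
    unfolding has_weak_derivative_def by (simp add: iter_pderivative_def)
  have "\<exists>g\<in>L2 \<Omega>. has_weak_derivative \<Omega> is \<phi> g" if "length is \<le> 1" for "is"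
  proof (cases "is")
    case Nil
    then show ?thesis using h0 test_L2[OF \<phi>] by blast
  next
    case (Cons i js)
    then have "is = [i]" using that by simp
    then show ?thesis using h test_L2[OF pderivative_test[OF \<phi>]] by blast
  qed
  then show "\<phi> \<in> Sobolev \<Omega> 1" using test_L2[OF \<phi>] by (simp add: Sobolev_def)
  show "AE x in Mo. wd [i] \<phi> x = pderivative i \<phi> x"
    using wd_eqI(1)[OF test_L2[OF pderivative_test[OF \<phi>]] h] .
qed

section \<open>The Dirichlet form\<close>

definition dir :: "'n field \<Rightarrow> 'n field \<Rightarrow> real" where
  "dir v w = ip (grad \<Omega> v) (grad \<Omega> w)"

lemma wd1: "v \<in> Sobolev \<Omega> 1 \<Longrightarrow> wd [i] v \<in> L2 \<Omega>"
  by (rule wd_props(1)) auto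

lemma dir_eq: "v \<in> Sobolev \<Omega> 1 \<Longrightarrow> w \<in> Sobolev \<Omega> 1 \<Longrightarrow> dir v w = (\<Sum>i\<in>UNIV. ip (wd [i] v) (wd [i] w))"
  unfolding dir_def l2_inner_def grad_def inner_vec_def
  by (simp, subst Bochner_Integration.integral_sum) (auto intro: L2_mult wd1[unfolded One_nat_def])

lemma dir_sym: "dir v w = dir w v"
  by (simp add: dir_def l2_inner_def inner_commute)

lemma dir_nonneg: "0 \<le> dir v v"
  unfolding dir_def by (rule ip_nonneg)

lemma dir_lincomb: "u \<in> Sobolev \<Omega> 1 \<Longrightarrow> v \<in> Sobolev \<Omega> 1 \<Longrightarrow> w \<in> Sobolev \<Omega> 1 \<Longrightarrow>
   dir (\<lambda>x. a * u x + b * v x) w = a * dir u w + b * dir v w"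
proof -
  assume u: "u \<in> Sobolev \<Omega> 1" and v: "v \<in> Sobolev \<Omega> 1" and w: "w \<in> Sobolev \<Omega> 1"
  have "ip (wd [i] (\<lambda>x. a * u x + b * v x)) (wd [i] w) = a * ip (wd [i] u) (wd [i] w) + b * ip (wd [i] v) (wd [i] w)" for i
  proof -
    have "ip (wd [i] (\<lambda>x. a * u x + b * v x)) (wd [i] w) = ip (\<lambda>x. a * wd [i] u x + b * wd [i] v x) (wd [i] w)"
      by (rule ip_cong_AE) (use u v w in \<open>auto intro!: wd_lincomb wd1 Sobolev_lincomb L2_lincomb\<close>)
    also have "\<dots> = a * ip (wd [i] u) (wd [i] w) + b * ip (wd [i] v) (wd [i] w)"
      by (rule ip_lincomb) (use u v w wd1 in auto)
    finally show ?thesis .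
  qed
  then show ?thesis using u v w Sobolev_lincomb[OF u v] by (simp add: dir_eq sum.distrib sum_distrib_left)
qed

lemma dir_diff: "u \<in> Sobolev \<Omega> 1 \<Longrightarrow> v \<in> Sobolev \<Omega> 1 \<Longrightarrow> w \<in> Sobolev \<Omega> 1 \<Longrightarrow>
   dir (\<lambda>x. u x - v x) w = dir u w - dir v w"
  using dir_lincomb[of u v w 1 "-1"] by simp

lemma Sobolev_0: "(\<lambda>x. 0) \<in> Sobolev \<Omega> m"
  by (auto simp: Sobolev_def L2_0 has_weak_derivative_def ip_alt intro!: bexI[of _ "\<lambda>x. 0"])

lemma Sobolev_sum: "(\<And>i. i \<in> I \<Longrightarrow> v i \<in> Sobolev \<Omega> m) \<Longrightarrow> (\<lambda>x. \<Sum>i\<in>I. v i x) \<in> Sobolev \<Omega> m"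
proof (induction I rule: infinite_finite_induct)
  case (insert j I)
  then show ?case using Sobolev_lincomb[of "v j" m "\<lambda>x. \<Sum>i\<in>I. v i x" 1 1] by simp
qed (auto simp: Sobolev_0)

lemma Sobolev_cmult: "v \<in> Sobolev \<Omega> m \<Longrightarrow> (\<lambda>x. a * v x) \<in> Sobolev \<Omega> m"
  using Sobolev_lincomb[of v m v a 0] by simp

lemma dir_cmult: "v \<in> Sobolev \<Omega> 1 \<Longrightarrow> w \<in> Sobolev \<Omega> 1 \<Longrightarrow> dir (\<lambda>x. a * v x) w = a * dir v w"
  using dir_lincomb[of v v w a 0] by simp

lemma dir_sum: "(\<And>i. i \<in> I \<Longrightarrow> v i \<in> Sobolev \<Omega> 1) \<Longrightarrow> w \<in> Sobolev \<Omega> 1 \<Longrightarrow>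
   dir (\<lambda>x. \<Sum>i\<in>I. v i x) w = (\<Sum>i\<in>I. dir (v i) w)"
proof (induction I rule: infinite_finite_induct)
  case (insert j I)
  then show ?case using dir_lincomb[of "v j" "\<lambda>x. \<Sum>i\<in>I. v i x" w 1 1] by (simp add: Sobolev_sum)
qed (use dir_cmult[of "\<lambda>x. 0" w 0] Sobolev_0 in auto)

lemma dir_cauchy: "v \<in> Sobolev \<Omega> 1 \<Longrightarrow> w \<in> Sobolev \<Omega> 1 \<Longrightarrow> \<bar>dir v w\<bar> \<le> sqrt (dir v v) * sqrt (dir w w)"
proof -
  assume v: "v \<in> Sobolev \<Omega> 1" and w: "w \<in> Sobolev \<Omega> 1"
  have "0 \<le> dir v v + 2 * s * dir v w + s\<^sup>2 * dir w w" for s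
  proof -
    have "0 \<le> dir (\<lambda>x. 1 * v x + s * w x) (\<lambda>x. 1 * v x + s * w x)" by (rule dir_nonneg)
    also have "\<dots> = 1 * dir (\<lambda>x. 1 * v x + s * w x) v + s * dir (\<lambda>x. 1 * v x + s * w x) w"
      using dir_lincomb[OF v w Sobolev_lincomb[OF v w, of 1 s], of 1 s]
      by (simp add: dir_sym[of v "\<lambda>x. v x + s * w x"] dir_sym[of w "\<lambda>x. v x + s * w x"])
    also have "\<dots> = dir v v + 2 * s * dir v w + s\<^sup>2 * dir w w"
      unfolding dir_lincomb[OF v w v] dir_lincomb[OF v w w] by (simp add: dir_sym[of w v] power2_eq_square algebra_simps)
    finally show ?thesis .
  qed
  from cauchy_schwarz_form[OF this dir_nonneg dir_nonneg] show ?thesis by simp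
qed

lemma nrm_grad: "nrm (grad \<Omega> v) = sqrt (dir v v)"
  by (simp add: l2_norm_def dir_def)

lemma dir_le_Sobolev_norm: "v \<in> Sobolev \<Omega> 1 \<Longrightarrow> sqrt (dir v v) \<le> Sobolev_norm \<Omega> 1 v"
proof -
  assume v: "v \<in> Sobolev \<Omega> 1"
  have "dir v v = (\<Sum>i\<in>UNIV. (nrm (wd [i] v))\<^sup>2)" using v by (simp add: dir_eq nrm_sq)
  also have "\<dots> = (\<Sum>is\<in>range (\<lambda>i. [i]). (nrm (wd is v))\<^sup>2)" by (simp add: sum.reindex inj_on_def)
  also have "\<dots> \<le> (\<Sum>is | length is \<le> 1. (nrm (wd is v))\<^sup>2)"
    by (rule sum_mono2[OF finite_multiindices]) auto
  finally show ?thesis unfolding Sobolev_norm_def by (rule real_sqrt_le_mono)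
qed

lemma grad_triangle: "v \<in> Sobolev \<Omega> 1 \<Longrightarrow> w \<in> Sobolev \<Omega> 1 \<Longrightarrow>
   sqrt (dir (\<lambda>x. v x + w x) (\<lambda>x. v x + w x)) \<le> sqrt (dir v v) + sqrt (dir w w)"
proof (rule real_le_lsqrt)
  assume v: "v \<in> Sobolev \<Omega> 1" and w: "w \<in> Sobolev \<Omega> 1"
  have vw: "(\<lambda>x. v x + w x) \<in> Sobolev \<Omega> 1" using Sobolev_lincomb[OF v w, of 1 1] by simp
  have l: "dir (\<lambda>x. v x + w x) z = dir v z + dir w z" if "z \<in> Sobolev \<Omega> 1" for z
    using dir_lincomb[OF v w that, of 1 1] by simp
  have "dir (\<lambda>x. v x + w x) (\<lambda>x. v x + w x) = dir v (\<lambda>x. v x + w x) + dir w (\<lambda>x. v x + w x)"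
    by (rule l[OF vw])
  also have "\<dots> = dir v v + 2 * dir v w + dir w w"
    using l[OF v] l[OF w] by (simp add: dir_sym[of _ "\<lambda>x. v x + w x"] dir_sym[of w v])
  also have "\<dots> \<le> (sqrt (dir v v) + sqrt (dir w w))\<^sup>2"
    using dir_cauchy[OF v w] dir_nonneg by (simp add: power2_sum)
  finally show "dir (\<lambda>x. v x + w x) (\<lambda>x. v x + w x) \<le> (sqrt (dir v v) + sqrt (dir w w))\<^sup>2" .
qed (simp_all add: dir_nonneg add_nonneg_nonneg)

lemma H10_Sobolev: "v \<in> H10 \<Omega> \<Longrightarrow> v \<in> Sobolev \<Omega> 1"
  by (simp add: H10_def)

lemma H10_approx: "v \<in> H10 \<Omega> \<Longrightarrow> \<epsilon> > 0 \<Longrightarrow> \<exists>\<phi>\<in>test_functions \<Omega>. Sobolev_norm \<Omega> 1 (\<lambda>x. v x - \<phi> x) < \<epsilon>"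
  unfolding H10_def by (auto simp: fun_diff_def)

lemma H10_lincomb:
  assumes v: "v \<in> H10 \<Omega>" and w: "w \<in> H10 \<Omega>"
  shows "(\<lambda>x. a * v x + b * w x) \<in> H10 \<Omega>"
proof -
  have "\<exists>\<phi>\<in>test_functions \<Omega>. Sobolev_norm \<Omega> 1 ((\<lambda>x. a * v x + b * w x) - \<phi>) < \<epsilon>" if e: "\<epsilon> > 0" for \<epsilon>
  proof -
    define d where "d = \<epsilon> / (\<bar>a\<bar> + \<bar>b\<bar> + 1)"
    have d: "d > 0" using e by (simp add: d_def add_nonneg_pos)
    obtain \<phi> where \<phi>: "\<phi> \<in> test_functions \<Omega>" "Sobolev_norm \<Omega> 1 (\<lambda>x. v x - \<phi> x) < d" using H10_approx[OF v d] by blast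
    obtain \<psi> where \<psi>: "\<psi> \<in> test_functions \<Omega>" "Sobolev_norm \<Omega> 1 (\<lambda>x. w x - \<psi> x) < d" using H10_approx[OF w d] by blast
    have "Sobolev_norm \<Omega> 1 (\<lambda>x. a * (v x - \<phi> x) + b * (w x - \<psi> x))
      \<le> \<bar>a\<bar> * Sobolev_norm \<Omega> 1 (\<lambda>x. v x - \<phi> x) + \<bar>b\<bar> * Sobolev_norm \<Omega> 1 (\<lambda>x. w x - \<psi> x)"
      by (intro Sobolev_norm_triangle Sobolev_diff H10_Sobolev v w test_wd(1) \<phi> \<psi>)
    also have "\<dots> \<le> \<bar>a\<bar> * d + \<bar>b\<bar> * d" using \<phi>(2) \<psi>(2) by (intro add_mono mult_left_mono) auto
    also have "\<dots> < \<epsilon>"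
    proof -
      have "(\<bar>a\<bar> + \<bar>b\<bar>) * d < (\<bar>a\<bar> + \<bar>b\<bar> + 1) * d" using d by simp
      also have "\<dots> = \<epsilon>" unfolding d_def by (simp add: add_nonneg_pos[THEN less_imp_neq, symmetric])
      finally show ?thesis by (simp add: distrib_right)
    qed
    finally have "Sobolev_norm \<Omega> 1 ((\<lambda>x. a * v x + b * w x) - (\<lambda>x. a * \<phi> x + b * \<psi> x)) < \<epsilon>"
      by (simp add: fun_diff_def algebra_simps)
    then show ?thesis using test_functions_lincomb[OF \<phi>(1) \<psi>(1)] by blast
  qed
  then show ?thesis unfolding H10_def using Sobolev_lincomb[OF H10_Sobolev[OF v] H10_Sobolev[OF w]] by blast
qed

text \<open>The definition by approximation makes the space closed; with the difference quotients in time this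
  passes the boundary condition on to time derivatives.\<close>

lemma H10_closed:
  assumes v: "v \<in> Sobolev \<Omega> 1" and lim: "\<And>\<epsilon>. \<epsilon> > 0 \<Longrightarrow> \<exists>w\<in>H10 \<Omega>. Sobolev_norm \<Omega> 1 (\<lambda>x. v x - w x) < \<epsilon>"
  shows "v \<in> H10 \<Omega>"
proof -
  have "\<exists>\<phi>\<in>test_functions \<Omega>. Sobolev_norm \<Omega> 1 (v - \<phi>) < \<epsilon>" if e: "\<epsilon> > 0" for \<epsilon>
  proof -
    obtain w where w: "w \<in> H10 \<Omega>" "Sobolev_norm \<Omega> 1 (\<lambda>x. v x - w x) < \<epsilon> / 2" using lim[of "\<epsilon> / 2"] e by auto
    obtain \<phi> where \<phi>: "\<phi> \<in> test_functions \<Omega>" "Sobolev_norm \<Omega> 1 (\<lambda>x. w x - \<phi> x) < \<epsilon> / 2" using H10_approx[OF w(1), of "\<epsilon> / 2"] e by auto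
    have "Sobolev_norm \<Omega> 1 (\<lambda>x. 1 * (v x - w x) + 1 * (w x - \<phi> x)) \<le> \<bar>1\<bar> * Sobolev_norm \<Omega> 1 (\<lambda>x. v x - w x) + \<bar>1\<bar> * Sobolev_norm \<Omega> 1 (\<lambda>x. w x - \<phi> x)"
      by (intro Sobolev_norm_triangle Sobolev_diff v H10_Sobolev w test_wd(1) \<phi>)
    then have "Sobolev_norm \<Omega> 1 (v - \<phi>) < \<epsilon>" using w(2) \<phi>(2) by (simp add: fun_diff_def)
    then show ?thesis using \<phi>(1) by blast
  qed
  then show ?thesis unfolding H10_def using v by blast
qed

text \<open>The Poincare inequality passes from test functions to their closure.\<close>

lemma poincare: "\<exists>c>0. \<forall>v\<in>H10 \<Omega>. c * ip v v \<le> dir v v"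
proof -
  obtain R where R: "R > 0" "\<And>x. x \<in> \<Omega> \<Longrightarrow> norm x \<le> R" using bdd bounded_pos by blast
  have "(1 / (4 * R\<^sup>2)) * ip v v \<le> dir v v" if v: "v \<in> H10 \<Omega>" for v
  proof -
    define i where "i = (undefined :: 'n)"
    note v1 = H10_Sobolev[OF v]
    have "nrm v \<le> 2 * R * nrm (wd [i] v)"
    proof (rule field_le_epsilon)
      fix e :: real assume e: "e > 0"
      define d where "d = e / (1 + 2 * R)"
      have d: "d > 0" using e R by (simp add: d_def)
      obtain \<phi> where \<phi>: "\<phi> \<in> test_functions \<Omega>" "Sobolev_norm \<Omega> 1 (\<lambda>x. v x - \<phi> x) < d" using H10_approx[OF v d] by blast
      have \<phi>1: "\<phi> \<in> Sobolev \<Omega> 1" by (rule test_wd(1)[OF \<phi>(1)])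
      have d0: "nrm (\<lambda>x. v x - \<phi> x) \<le> d"
        using nrm_wd_le_Sobolev_norm[of "[]" 1 "\<lambda>x. v x - \<phi> x"] nrm_wd_Nil[OF Sobolev_L2[OF Sobolev_diff[OF v1 \<phi>1]]] \<phi>(2) by simp
      have d1: "nrm (\<lambda>x. wd [i] v x - pderivative i \<phi> x) \<le> d"
      proof -
        have "AE x in Mo. wd [i] (\<lambda>x. v x - \<phi> x) x = wd [i] v x - pderivative i \<phi> x"
          using wd_diff[OF v1 \<phi>1, of "[i]"] test_wd(2)[OF \<phi>(1), of i] by (auto elim: eventually_elim2)
        then have "nrm (wd [i] (\<lambda>x. v x - \<phi> x)) = nrm (\<lambda>x. wd [i] v x - pderivative i \<phi> x)"
          by (rule nrm_cong_AE) (intro wd1 Sobolev_diff v1 \<phi>1, intro L2_diff wd1 v1 test_L2[OF pderivative_test[OF \<phi>(1)]])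
        then show ?thesis using nrm_wd_le_Sobolev_norm[of "[i]" 1 "\<lambda>x. v x - \<phi> x"] \<phi>(2) by simp
      qed
      have t: "\<phi> \<in> L2 \<Omega>" "pderivative i \<phi> \<in> L2 \<Omega>" using test_L2 pderivative_test \<phi>(1) by auto
      have "nrm v \<le> nrm \<phi> + nrm (\<lambda>x. v x - \<phi> x)" by (rule nrm_le_diff[OF Sobolev_L2[OF v1] t(1)])
      also have "nrm \<phi> \<le> 2 * R * nrm (pderivative i \<phi>)" by (rule test_poincare[OF \<phi>(1) R(2)])
      also have "nrm (pderivative i \<phi>) \<le> nrm (wd [i] v) + d"
      proof -
        have "nrm (pderivative i \<phi>) \<le> nrm (wd [i] v) + nrm (\<lambda>x. pderivative i \<phi> x - wd [i] v x)"
          by (rule nrm_le_diff[OF t(2) wd1[OF v1]])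
        moreover have "nrm (\<lambda>x. pderivative i \<phi> x - wd [i] v x) = nrm (\<lambda>x. wd [i] v x - pderivative i \<phi> x)"
          using nrm_cmult[OF L2_diff[OF wd1[OF v1] t(2)], of "-1"] by simp
        ultimately show ?thesis using d1 by simp
      qed
      finally have "nrm v \<le> 2 * R * (nrm (wd [i] v) + d) + d" using d0 R(1) by simp
      also have "\<dots> = 2 * R * nrm (wd [i] v) + (1 + 2 * R) * d" by (simp add: algebra_simps)
      also have "(1 + 2 * R) * d = e" using R(1) by (simp add: d_def)
      finally show "nrm v \<le> 2 * R * nrm (wd [i] v) + e" .
    qed
    then have "(nrm v)\<^sup>2 \<le> (2 * R * nrm (wd [i] v))\<^sup>2" by (intro power_mono nrm_nonneg)
    also have "\<dots> = 4 * R\<^sup>2 * ip (wd [i] v) (wd [i] v)" by (simp add: power_mult_distrib nrm_sq)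
    also have "ip (wd [i] v) (wd [i] v) \<le> dir v v"
      unfolding dir_eq[OF v1 v1] by (rule member_le_sum) (auto simp: ip_nonneg)
    finally show ?thesis using R(1) by (simp add: nrm_sq field_simps)
  qed
  then show ?thesis using R(1) by (intro exI[of _ "1 / (4 * R\<^sup>2)"]) auto
qed

lemma laplacian_L2: "u \<in> Sobolev \<Omega> 2 \<Longrightarrow> laplacian \<Omega> u \<in> L2 \<Omega>"
  unfolding laplacian_def[abs_def] by (intro L2_sum wd_props(1)) auto

text \<open>For test functions \<open>v\<close> this is the definition of the weak derivatives; both sides are
  continuous in \<open>v\<close> with respect to the norm of \<open>H\<^sup>1\<close>.\<close>

lemma green:
  assumes u: "u \<in> Sobolev \<Omega> 2" and v: "v \<in> H10 \<Omega>"
  shows "dir u v = - ip (laplacian \<Omega> u) v"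
proof -
  note v1 = H10_Sobolev[OF v]
  have u1: "u \<in> Sobolev \<Omega> 1" using Sobolev_mono[OF _ u, of 1] by simp
  have test: "dir u \<phi> = - ip (laplacian \<Omega> u) \<phi>" if \<phi>: "\<phi> \<in> test_functions \<Omega>" for \<phi>
  proof -
    have \<phi>2: "\<phi> \<in> L2 \<Omega>" by (rule test_L2[OF \<phi>])
    have "ip (wd [i] u) (wd [i] \<phi>) = - ip (wd [i, i] u) \<phi>" for i
    proof -
      have "ip (wd [i] u) (wd [i] \<phi>) = ip (wd [i] u) (pderivative i \<phi>)"
        by (rule ip_cong_AE) (use test_wd[OF \<phi>] u1 wd1 test_L2[OF pderivative_test[OF \<phi>]] in auto)
      moreover have "ip u (pderivative i (pderivative i \<phi>)) = - ip (wd [i] u) (pderivative i \<phi>)"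
        using wd_props(2)[OF u1, of "[i]"] pderivative_test[OF \<phi>, of i]
        unfolding has_weak_derivative_def by (force simp: iter_pderivative_def)
      moreover have "ip u (pderivative i (pderivative i \<phi>)) = ip (wd [i, i] u) \<phi>"
        using wd_props(2)[OF u, of "[i, i]"] \<phi>
        unfolding has_weak_derivative_def by (force simp: iter_pderivative_def)
      ultimately show ?thesis by simp
    qed
    moreover have "ip (laplacian \<Omega> u) \<phi> = (\<Sum>i\<in>UNIV. ip (wd [i, i] u) \<phi>)"
      unfolding laplacian_def[abs_def] by (rule ip_sum[OF wd_props(1)[OF u] \<phi>2]) auto
    ultimately show ?thesis by (simp add: dir_eq[OF u1 test_wd(1)[OF \<phi>]] sum_negf)
  qed
  define M where "M = sqrt (dir u u) + nrm (laplacian \<Omega> u)"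
  have M: "0 \<le> M" unfolding M_def by (simp add: dir_nonneg nrm_nonneg)
  have "\<bar>dir u v + ip (laplacian \<Omega> u) v\<bar> \<le> 0 + e" if e: "e > 0" for e
  proof -
    have d: "e / (M + 1) > 0" using e M by simp
    obtain \<phi> where \<phi>: "\<phi> \<in> test_functions \<Omega>" "Sobolev_norm \<Omega> 1 (\<lambda>x. v x - \<phi> x) < e / (M + 1)"
      using H10_approx[OF v d] by blast
    have \<phi>1: "\<phi> \<in> Sobolev \<Omega> 1" by (rule test_wd(1)[OF \<phi>(1)])
    let ?w = "\<lambda>x. v x - \<phi> x"
    have w1: "?w \<in> Sobolev \<Omega> 1" by (rule Sobolev_diff[OF v1 \<phi>1])
    have n0: "nrm ?w \<le> e / (M + 1)"
      using nrm_wd_le_Sobolev_norm[of "[]" 1 ?w] nrm_wd_Nil[OF Sobolev_L2[OF w1]] \<phi>(2) by simp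
    have n1: "sqrt (dir ?w ?w) \<le> e / (M + 1)" using dir_le_Sobolev_norm[OF w1] \<phi>(2) by simp
    have "dir u v + ip (laplacian \<Omega> u) v = dir u ?w + ip (laplacian \<Omega> u) ?w"
      using test[OF \<phi>(1)] dir_diff[OF v1 \<phi>1 u1] ip_diff[OF Sobolev_L2[OF v1] Sobolev_L2[OF \<phi>1] laplacian_L2[OF u]]
      by (simp add: dir_sym[of u] ip_sym[of "laplacian \<Omega> u"])
    also have "\<bar>\<dots>\<bar> \<le> sqrt (dir u u) * sqrt (dir ?w ?w) + nrm (laplacian \<Omega> u) * nrm ?w"
      using dir_cauchy[OF u1 w1] ip_cauchy[OF laplacian_L2[OF u] Sobolev_L2[OF w1]] by linarith
    also have "\<dots> \<le> sqrt (dir u u) * (e / (M + 1)) + nrm (laplacian \<Omega> u) * (e / (M + 1))"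
      using n0 n1 by (intro add_mono mult_left_mono) (auto simp: dir_nonneg nrm_nonneg)
    also have "\<dots> = M * (e / (M + 1))" by (subst distrib_right[symmetric]) (simp add: M_def)
    also have "\<dots> \<le> e" using e M by (simp add: field_simps)
    finally show ?thesis by simp
  qed
  then have "\<bar>dir u v + ip (laplacian \<Omega> u) v\<bar> \<le> 0" by (rule field_le_epsilon)
  then show ?thesis by simp
qed

lemma laplacian_bound: "u \<in> Sobolev \<Omega> 2 \<Longrightarrow> nrm (laplacian \<Omega> u) \<le> real CARD('n) * Sobolev_norm \<Omega> 2 u"
proof -
  assume u: "u \<in> Sobolev \<Omega> 2"
  have "nrm (\<lambda>x. \<Sum>i\<in>I. wd [i, i] u x) \<le> (\<Sum>i\<in>I. nrm (wd [i, i] u))" for I :: "'n set"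
  proof (induction I rule: infinite_finite_induct)
    case (insert j I)
    have "nrm (\<lambda>x. wd [j, j] u x + (\<Sum>i\<in>I. wd [i, i] u x)) \<le> nrm (wd [j, j] u) + nrm (\<lambda>x. \<Sum>i\<in>I. wd [i, i] u x)"
      by (rule nrm_triangle) (auto intro!: L2_sum wd_props(1)[OF u])
    then show ?case using insert by simp
  qed (auto simp: l2_norm_def ip_alt)
  from this[of UNIV] have "nrm (laplacian \<Omega> u) \<le> (\<Sum>i\<in>UNIV. nrm (wd [i, i] u))"
    unfolding laplacian_def[abs_def] .
  also have "\<dots> \<le> (\<Sum>i\<in>(UNIV :: 'n set). Sobolev_norm \<Omega> 2 u)"
    by (intro sum_mono nrm_wd_le_Sobolev_norm) simp
  finally show ?thesis by simp
qed

end

section \<open>Eigenmodes of the discrete Laplacian\<close>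

lemma sum_fun_eq: "(\<Sum>i\<in>J. f i) = (\<lambda>x. \<Sum>i\<in>J. f i x :: real)"
  by (induction J rule: infinite_finite_induct) (simp_all add: fun_eq_iff zero_fun_def plus_fun_def)

text \<open>A finite-dimensional subspace of \<open>H\<^sup>1\<^sub>0\<close>. Definiteness means that an
  element that vanishes almost everywhere is zero as a function, so that expansions in modes are
  equalities of functions.\<close>

locale fe_space = bounded_open \<Omega> for \<Omega> :: "(real^'n::finite) set" +
  fixes V :: "'n field set"
  assumes V_H10: "V \<subseteq> H10 \<Omega>"
    and V_0: "(\<lambda>x. 0) \<in> V"
    and V_lincomb: "\<And>v w a b. v \<in> V \<Longrightarrow> w \<in> V \<Longrightarrow> (\<lambda>x. a * v x + b * w x) \<in> V"
    and V_span: "\<exists>q (\<psi> :: nat \<Rightarrow> 'n field). \<forall>v\<in>V. \<exists>c. v = (\<lambda>x. \<Sum>i<q. c i * \<psi> i x)"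
    and V_definite: "\<And>v. v \<in> V \<Longrightarrow> ip v v = 0 \<Longrightarrow> v = (\<lambda>x. 0)"
begin

lemma V_S1: "v \<in> V \<Longrightarrow> v \<in> Sobolev \<Omega> 1" using V_H10 H10_Sobolev by blast
lemma V_L2: "v \<in> V \<Longrightarrow> v \<in> L2 \<Omega>" using V_S1 Sobolev_L2 by blast

definition comb :: "'n field set \<Rightarrow> ('n field \<Rightarrow> real) \<Rightarrow> 'n field" where
  "comb S c = (\<lambda>x. \<Sum>\<phi>\<in>S. c \<phi> * \<phi> x)"

lemma comb_V: "S \<subseteq> V \<Longrightarrow> comb S c \<in> V"
  unfolding comb_def
proof (induction S rule: infinite_finite_induct)
  case (insert \<phi> S)
  then show ?case using V_lincomb[of \<phi> "\<lambda>x. \<Sum>\<phi>\<in>S. c \<phi> * \<phi> x" "c \<phi>" 1] by simp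
qed (use V_0 in auto)

lemma ip_comb: "S \<subseteq> V \<Longrightarrow> w \<in> L2 \<Omega> \<Longrightarrow> ip (comb S c) w = (\<Sum>\<phi>\<in>S. c \<phi> * ip \<phi> w)"
  unfolding comb_def
proof (subst ip_sum)
  assume "S \<subseteq> V" "w \<in> L2 \<Omega>"
  then show "(\<Sum>\<phi>\<in>S. ip (\<lambda>x. c \<phi> * \<phi> x) w) = (\<Sum>\<phi>\<in>S. c \<phi> * ip \<phi> w)"
    using ip_lincomb[of _ _ w _ 0] V_L2 by (intro sum.cong) (auto simp: subset_iff)
qed (use L2_cmult V_L2 in blast)+

lemma dir_comb: "S \<subseteq> V \<Longrightarrow> w \<in> Sobolev \<Omega> 1 \<Longrightarrow> dir (comb S c) w = (\<Sum>\<phi>\<in>S. c \<phi> * dir \<phi> w)"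
  unfolding comb_def
proof (subst dir_sum)
  assume "S \<subseteq> V" "w \<in> Sobolev \<Omega> 1"
  then show "(\<Sum>\<phi>\<in>S. dir (\<lambda>x. c \<phi> * \<phi> x) w) = (\<Sum>\<phi>\<in>S. c \<phi> * dir \<phi> w)"
    using dir_cmult[of _ w] V_S1 by (intro sum.cong) (auto simp: subset_iff)
qed (use Sobolev_cmult V_S1 in \<open>auto simp: subset_iff\<close>)

definition orthonormal :: "'n field set \<Rightarrow> bool" where
  "orthonormal S \<longleftrightarrow> finite S \<and> S \<subseteq> V \<and> (\<forall>\<phi>\<in>S. \<forall>\<psi>\<in>S. ip \<phi> \<psi> = (if \<phi> = \<psi> then 1 else 0))"

lemma ip_comb_member: "orthonormal S \<Longrightarrow> \<phi> \<in> S \<Longrightarrow> ip (comb S c) \<phi> = c \<phi>"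
proof -
  assume S: "orthonormal S" and \<phi>: "\<phi> \<in> S"
  have "ip (comb S c) \<phi> = (\<Sum>\<psi>\<in>S. c \<psi> * ip \<psi> \<phi>)"
    using S \<phi> V_L2 by (intro ip_comb) (auto simp: orthonormal_def)
  also have "\<dots> = (\<Sum>\<psi>\<in>S. if \<psi> = \<phi> then c \<phi> else 0)"
    using S \<phi> by (intro sum.cong) (auto simp: orthonormal_def)
  finally show ?thesis using S \<phi> by (simp add: orthonormal_def)
qed

text \<open>Orthonormal sets are linearly independent and lie in the span of finitely many functions. This
  replaces a dimension: sets of maximal cardinality exist.\<close>

lemma orthonormal_bound: "\<exists>q. \<forall>S. orthonormal S \<longrightarrow> card S \<le> q"
proof -
  interpret fs: vector_space "\<lambda>c (f :: 'n field) x. c * f x"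
    by unfold_locales (auto simp: fun_eq_iff algebra_simps)
  obtain q and \<psi> :: "nat \<Rightarrow> 'n field" where
    I: "\<And>v. v \<in> V \<Longrightarrow> \<exists>c. v = (\<lambda>x. \<Sum>i<q. c i * \<psi> i x)" using V_span by blast
  define \<Psi> where "\<Psi> = \<psi> ` {..<q}"
  have "v \<in> fs.span \<Psi>" if "v \<in> V" for v
  proof -
    obtain c where v: "v = (\<Sum>i<q. (\<lambda>x. c i * \<psi> i x))" using I[OF \<open>v \<in> V\<close>] unfolding sum_fun_eq by blast
    show ?thesis unfolding v \<Psi>_def by (intro fs.span_sum fs.span_scale fs.span_base) auto
  qed
  then have \<Psi>: "finite \<Psi>" "V \<subseteq> fs.span \<Psi>" by (auto simp: \<Psi>_def)
  have "card S \<le> card \<Psi>" if S: "orthonormal S" for S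
  proof -
    have "fs.independent S"
    proof
      assume "fs.dependent S"
      then obtain u where u: "\<exists>v\<in>S. u v \<noteq> 0" "(\<Sum>v\<in>S. (\<lambda>x. u v * v x)) = 0"
        using fs.dependent_finite[of S] S by (auto simp: orthonormal_def)
      then have z: "comb S u = (\<lambda>x. 0)" by (simp add: comb_def sum_fun_eq fun_eq_iff)
      have "u v = 0" if "v \<in> S" for v using ip_comb_member[OF S that, of u] unfolding z by (simp add: ip_alt)
      then show False using u(1) by blast
    qed
    moreover have "S \<subseteq> fs.span \<Psi>" using S \<Psi>(2) by (auto simp: orthonormal_def)
    ultimately show ?thesis using fs.independent_span_bound[OF \<Psi>(1)] by blast
  qed
  then show ?thesis by blast
qed

lemma maximal_orthonormal:
  assumes "P {}"
  shows "\<exists>S. orthonormal S \<and> P S \<and> (\<forall>S'. orthonormal S' \<longrightarrow> P S' \<longrightarrow> card S' \<le> card S)"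
proof -
  obtain q where q: "\<And>S. orthonormal S \<Longrightarrow> card S \<le> q" using orthonormal_bound by blast
  have "orthonormal {}" by (simp add: orthonormal_def)
  then show ?thesis
    using ex_has_greatest_nat[of "\<lambda>S. orthonormal S \<and> P S" "{}" card "Suc q"] q assms le_imp_less_Suc by blast
qed

definition residual :: "'n field set \<Rightarrow> 'n field \<Rightarrow> 'n field" where
  "residual S w = (\<lambda>x. w x - comb S (ip w) x)"

lemma residual:
  assumes S: "orthonormal S" and w: "w \<in> V"
  shows "residual S w \<in> V" "\<phi> \<in> S \<Longrightarrow> ip (residual S w) \<phi> = 0"
    "v \<in> L2 \<Omega> \<Longrightarrow> ip (residual S w) v = ip w v - (\<Sum>\<psi>\<in>S. ip w \<psi> * ip \<psi> v)"
proof -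
  have SV: "S \<subseteq> V" using S by (simp add: orthonormal_def)
  show "residual S w \<in> V" unfolding residual_def
    using V_lincomb[OF w comb_V[OF SV], of 1 "-1"] by simp
  show r: "ip (residual S w) v = ip w v - (\<Sum>\<psi>\<in>S. ip w \<psi> * ip \<psi> v)" if "v \<in> L2 \<Omega>" for v
    unfolding residual_def using ip_diff[OF V_L2[OF w] V_L2[OF comb_V[OF SV]] that] ip_comb[OF SV that] by simp
  show "ip (residual S w) \<phi> = 0" if "\<phi> \<in> S"
    unfolding residual_def using ip_diff[OF V_L2[OF w] V_L2[OF comb_V[OF SV]] V_L2, of \<phi>] ip_comb_member[OF S that] that SV
    by auto
qed

lemma normalise:
  assumes w: "w \<in> V" "w \<noteq> (\<lambda>x. 0)"
  shows "\<exists>a. a \<noteq> 0 \<and> ip (\<lambda>x. a * w x) (\<lambda>x. a * w x) = 1"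
proof -
  have pos: "ip w w > 0" using V_definite[OF w(1)] w(2) ip_nonneg[of w] by (cases "ip w w = 0") auto
  have sc: "ip (\<lambda>x. a * w x) (\<lambda>x. a * w x) = a\<^sup>2 * ip w w" for a
    by (simp add: ip_alt power2_eq_square mult.assoc mult.left_commute)
  define a where "a = 1 / sqrt (ip w w)"
  have "a \<noteq> 0" "a\<^sup>2 * ip w w = 1" using pos by (simp_all add: a_def power_divide)
  then show ?thesis using sc by metis
qed

lemma orthonormal_insert:
  assumes S: "orthonormal S" and \<psi>: "\<psi> \<in> V" "ip \<psi> \<psi> = 1" "\<And>\<phi>. \<phi> \<in> S \<Longrightarrow> ip \<psi> \<phi> = 0"
  shows "orthonormal (insert \<psi> S)" "\<psi> \<notin> S"
proof -
  show "\<psi> \<notin> S" using \<psi>(2,3) by force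
  moreover have "ip \<phi> \<psi> = 0" if "\<phi> \<in> S" for \<phi> using \<psi>(3)[OF that] ip_sym[of \<phi> \<psi>] by simp
  ultimately show "orthonormal (insert \<psi> S)"
    using S \<psi> by (auto simp: orthonormal_def)
qed

lemma V_cmult: "w \<in> V \<Longrightarrow> (\<lambda>x. a * w x) \<in> V"
  using V_lincomb[of w w a 0] by simp

text \<open>The Rayleigh quotient attains its minimum on a subspace with an orthonormal basis, as the
  coefficient vectors form a compact set.\<close>

lemma rayleigh_minimum:
  assumes B: "orthonormal B" and ne: "B \<noteq> {}"
  shows "\<exists>c. ip (comb B c) (comb B c) = 1 \<and>
    (\<forall>d. dir (comb B c) (comb B c) * ip (comb B d) (comb B d) \<le> dir (comb B d) (comb B d))"
proof -
  have BV: "B \<subseteq> V" and fin: "finite B" using B by (auto simp: orthonormal_def)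
  define Q where "Q c = (\<Sum>\<phi>\<in>B. c \<phi> * (\<Sum>\<psi>\<in>B. c \<psi> * dir \<phi> \<psi>))" for c
  define n2 where "n2 c = (\<Sum>\<phi>\<in>B. (c \<phi>)\<^sup>2)" for c :: "'n field \<Rightarrow> real"
  have Q: "dir (comb B c) (comb B c) = Q c" for c
  proof -
    have "dir \<phi> (comb B c) = (\<Sum>\<psi>\<in>B. c \<psi> * dir \<phi> \<psi>)" if "\<phi> \<in> B" for \<phi>
      using dir_comb[OF BV V_S1, of \<phi> c] that BV by (auto simp: dir_sym[of \<phi>])
    then show ?thesis using dir_comb[OF BV V_S1[OF comb_V[OF BV]], of c c] by (simp add: Q_def)
  qed
  have N: "ip (comb B c) (comb B c) = n2 c" for c
  proof -
    have "ip \<phi> (comb B c) = c \<phi>" if "\<phi> \<in> B" for \<phi>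
      using ip_comb_member[OF B that, of c] by (simp add: ip_sym)
    then show ?thesis using ip_comb[OF BV V_L2[OF comb_V[OF BV]], of c c] by (simp add: n2_def power2_eq_square)
  qed
  define K where "K = PiE UNIV (\<lambda>\<phi>. if \<phi> \<in> B then {-1..1::real} else {0})"
  have "compactin (product_topology (\<lambda>_. euclidean) UNIV) K"
    unfolding K_def compactin_PiE by (auto simp: compactin_euclidean_iff)
  then have "compact K" by (simp add: euclidean_product_topology compactin_euclidean_iff)
  moreover have "closed {c. n2 c = 1}"
    unfolding n2_def by (intro closed_Collect_eq continuous_intros continuous_on_product_coordinates)
  ultimately have comp: "compact (K \<inter> {c. n2 c = 1})" by (rule compact_Int_closed)
  obtain b where b: "b \<in> B" using ne by blast
  have "(\<lambda>\<phi>. if \<phi> = b then 1 else 0) \<in> K \<inter> {c. n2 c = 1}"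
    using b fin by (auto simp: K_def n2_def if_distrib[of "\<lambda>x. x\<^sup>2"] cong: if_cong)
  then have "K \<inter> {c. n2 c = 1} \<noteq> {}" by blast
  moreover have "continuous_on (K \<inter> {c. n2 c = 1}) Q"
    unfolding Q_def by (intro continuous_intros continuous_on_subset[OF continuous_on_product_coordinates]) auto
  ultimately obtain c where c: "c \<in> K" "n2 c = 1" "\<And>d. d \<in> K \<Longrightarrow> n2 d = 1 \<Longrightarrow> Q c \<le> Q d"
    using continuous_attains_inf[OF comp] by blast
  have "Q c * n2 d \<le> Q d" for d
  proof (cases "n2 d = 0")
    case True
    then have "d \<phi> = 0" if "\<phi> \<in> B" for \<phi>
      using that fin by (simp add: n2_def sum_nonneg_eq_0_iff)
    then show ?thesis using True by (simp add: Q_def)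
  next
    case False
    then have pos: "n2 d > 0" unfolding n2_def using sum_nonneg[of B "\<lambda>\<phi>. (d \<phi>)\<^sup>2"] by auto
    define e where "e \<phi> = (if \<phi> \<in> B then d \<phi> / sqrt (n2 d) else 0)" for \<phi>
    have ne: "n2 e = 1"
    proof -
      have "n2 e = (\<Sum>\<phi>\<in>B. (d \<phi>)\<^sup>2 / n2 d)" unfolding n2_def[of e] e_def
        using pos by (intro sum.cong) (auto simp: power_divide)
      then show ?thesis using pos by (simp add: sum_divide_distrib[symmetric] n2_def[symmetric])
    qed
    have "(e \<phi>)\<^sup>2 \<le> 1" if "\<phi> \<in> B" for \<phi>
      using member_le_sum[OF that, of "\<lambda>\<phi>. (e \<phi>)\<^sup>2"] fin ne by (simp add: n2_def)
    then have "e \<phi> \<in> {-1..1}" if "\<phi> \<in> B" for \<phi> using that by (auto simp: abs_square_le_1 abs_le_iff)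
    moreover have "e \<phi> = 0" if "\<phi> \<notin> B" for \<phi> using that by (simp add: e_def)
    ultimately have "e \<in> K" unfolding K_def by (auto simp: PiE_iff)
    then have "Q c \<le> Q e" using c(3) ne by blast
    also have "Q e = Q d / n2 d"
    proof -
      have "Q e = (\<Sum>\<phi>\<in>B. d \<phi> / sqrt (n2 d) * (\<Sum>\<psi>\<in>B. d \<psi> / sqrt (n2 d) * dir \<phi> \<psi>))"
        unfolding Q_def by (intro sum.cong) (auto simp: e_def)
      also have "\<dots> = Q d / (sqrt (n2 d) * sqrt (n2 d))"
        unfolding Q_def by (simp add: sum_distrib_left sum_divide_distrib)
      finally show ?thesis using pos by simp
    qed
    finally show ?thesis using pos by (simp add: field_simps)
  qed
  then show ?thesis using c(2) Q N by auto
qed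

definition eigen :: "'n field set \<Rightarrow> bool" where
  "eigen S \<longleftrightarrow> (\<forall>\<phi>\<in>S. \<forall>v\<in>V. dir \<phi> v = dir \<phi> \<phi> * ip \<phi> v)"

text \<open>A largest orthonormal set \<open>S\<close> of eigenfunctions spans the space. Otherwise its
  orthogonal complement \<open>W\<close> is nonzero, the Rayleigh quotient attains its minimum
  there, and the minimizer is another eigenfunction.\<close>

lemma eigenbasis: "\<exists>S. orthonormal S \<and> eigen S \<and> (\<forall>v\<in>V. v = comb S (ip v))"
proof -
  obtain S where S: "orthonormal S" "eigen S" and maxS: "\<And>S'. orthonormal S' \<Longrightarrow> eigen S' \<Longrightarrow> card S' \<le> card S"
    using maximal_orthonormal[of eigen] by (auto simp: eigen_def)
  have SV: "S \<subseteq> V" and finS: "finite S" using S(1) by (auto simp: orthonormal_def)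
  have "v = comb S (ip v)" if v: "v \<in> V" for v
  proof (rule ccontr)
    assume "v \<noteq> comb S (ip v)"
    then have w0: "residual S v \<noteq> (\<lambda>x. 0)" by (auto simp: residual_def fun_eq_iff)
    define W where "W = {w \<in> V. \<forall>\<phi>\<in>S. ip w \<phi> = 0}"
    obtain B where B: "orthonormal B" "B \<subseteq> W" and maxB: "\<And>B'. orthonormal B' \<Longrightarrow> B' \<subseteq> W \<Longrightarrow> card B' \<le> card B"
      using maximal_orthonormal[of "\<lambda>B. B \<subseteq> W"] by auto
    have finB: "finite B" and BV: "B \<subseteq> V" using B(1) by (auto simp: orthonormal_def)
    have WV: "w \<in> V" if "w \<in> W" for w using that by (simp add: W_def)
    have SL2: "\<phi> \<in> L2 \<Omega>" if "\<phi> \<in> S" for \<phi> using that SV V_L2 by blast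
    have W_cmult: "(\<lambda>x. a * w x) \<in> W" if w: "w \<in> W" for a w
    proof -
      have "ip (\<lambda>x. a * w x) \<phi> = 0" if "\<phi> \<in> S" for \<phi>
        using ip_lincomb[OF V_L2[OF WV[OF w]] V_L2[OF WV[OF w]] SL2[OF that], of a 0] w that by (simp add: W_def)
      then show ?thesis using V_cmult[OF WV[OF w]] by (simp add: W_def)
    qed
    have BW0: "ip \<phi> \<psi> = 0" if "\<phi> \<in> B" "\<psi> \<in> S" for \<phi> \<psi> using B(2) that by (auto simp: W_def)
    have W_comb: "comb B c \<in> W" for c
    proof -
      have "ip (comb B c) \<phi> = 0" if "\<phi> \<in> S" for \<phi>
        using ip_comb[OF BV SL2[OF that], of c] BW0[OF _ that] by simp
      then show ?thesis using comb_V[OF BV] by (simp add: W_def)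
    qed
    have spanB: "w = comb B (ip w)" if w: "w \<in> W" for w
    proof (rule ccontr)
      assume "w \<noteq> comb B (ip w)"
      then have r0: "residual B w \<noteq> (\<lambda>x. 0)" by (auto simp: residual_def fun_eq_iff)
      have wV: "w \<in> V" using w by (simp add: W_def)
      have "ip (residual B w) \<phi> = 0" if "\<phi> \<in> S" for \<phi>
        using residual(3)[OF B(1) wV SL2[OF that]] w that BW0[OF _ that] by (simp add: W_def)
      then have rW: "residual B w \<in> W" using residual(1)[OF B(1) wV] by (simp add: W_def)
      then obtain a where a: "ip (\<lambda>x. a * residual B w x) (\<lambda>x. a * residual B w x) = 1"
        using normalise[OF residual(1)[OF B(1) wV] r0] by blast
      let ?\<psi> = "\<lambda>x. a * residual B w x"
      have rL: "residual B w \<in> L2 \<Omega>" by (rule V_L2[OF residual(1)[OF B(1) wV]])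
      have "ip ?\<psi> \<phi> = 0" if "\<phi> \<in> B" for \<phi>
        using residual(2)[OF B(1) wV that] ip_lincomb[OF rL rL, of \<phi> a 0] V_L2 that BV by (simp add: subset_iff)
      then have "orthonormal (insert ?\<psi> B)" "?\<psi> \<notin> B"
        using orthonormal_insert[OF B(1) V_cmult[OF residual(1)[OF B(1) wV]] a] by auto
      moreover have "insert ?\<psi> B \<subseteq> W" using W_cmult[OF rW] B(2) by blast
      ultimately show False using maxB[of "insert ?\<psi> B"] finB by simp
    qed
    have rS: "residual S v \<in> W" using residual(1,2)[OF S(1) v] by (simp add: W_def)
    have "B \<noteq> {}"
    proof
      assume "B = {}"
      then show False using spanB[OF rS] w0 by (simp add: comb_def)
    qed
    then obtain c where c: "ip (comb B c) (comb B c) = 1"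
      "\<And>d. dir (comb B c) (comb B c) * ip (comb B d) (comb B d) \<le> dir (comb B d) (comb B d)"
      using rayleigh_minimum[OF B(1)] by blast
    define \<psi> where "\<psi> = comb B c"
    define \<mu> where "\<mu> = dir \<psi> \<psi>"
    have \<psi>: "\<psi> \<in> W" "\<psi> \<in> V" "ip \<psi> \<psi> = 1" using W_comb comb_V[OF BV] c(1) by (auto simp: \<psi>_def)
    have min: "\<mu> * ip w w \<le> dir w w" if "w \<in> W" for w
      using c(2)[of "ip w"] spanB[OF that] by (simp add: \<mu>_def \<psi>_def)
    \<comment> \<open>The quadratic form \<open>dir - \<mu> ip\<close> is nonnegative on
      \<open>W\<close> and zero at \<open>\<psi>\<close>, so its polar form vanishes at
      \<open>\<psi>\<close>.\<close>
    have orth: "dir \<psi> w = \<mu> * ip \<psi> w" if w: "w \<in> W" for w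
    proof -
      have wV: "w \<in> V" using w by (simp add: W_def)
      have "0 \<le> 0 + 2 * s * (dir \<psi> w - \<mu> * ip \<psi> w) + s\<^sup>2 * (dir w w - \<mu> * ip w w)" for s
      proof -
        let ?z = "\<lambda>x. 1 * \<psi> x + s * w x"
        have zV: "?z \<in> V" by (rule V_lincomb[OF \<psi>(2) wV])
        have "ip ?z \<phi> = 0" if "\<phi> \<in> S" for \<phi>
          using ip_lincomb[OF V_L2[OF \<psi>(2)] V_L2[OF wV] SL2[OF that], of 1 s] that \<psi>(1) w by (simp add: W_def)
        then have "?z \<in> W" using zV by (simp add: W_def)
        then have "\<mu> * ip ?z ?z \<le> dir ?z ?z" by (rule min)
        moreover have "dir ?z ?z = dir \<psi> \<psi> + 2 * s * dir \<psi> w + s\<^sup>2 * dir w w"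
        proof -
          note l = dir_lincomb[OF V_S1[OF \<psi>(2)] V_S1[OF wV], of _ 1 s]
          have "dir ?z ?z = dir ?z \<psi> + s * dir ?z w"
            using l[OF V_S1[OF zV]] dir_sym[of ?z \<psi>] dir_sym[of ?z w] by simp
          then show ?thesis using l[OF V_S1[OF \<psi>(2)]] l[OF V_S1[OF wV]] dir_sym[of w \<psi>]
            by (simp add: power2_eq_square algebra_simps)
        qed
        moreover have "ip ?z ?z = ip \<psi> \<psi> + 2 * s * ip \<psi> w + s\<^sup>2 * ip w w"
        proof -
          note l = ip_lincomb[OF V_L2[OF \<psi>(2)] V_L2[OF wV], of _ 1 s]
          have "ip ?z ?z = ip ?z \<psi> + s * ip ?z w"
            using l[OF V_L2[OF zV]] ip_sym[of ?z \<psi>] ip_sym[of ?z w] by simp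
          then show ?thesis using l[OF V_L2[OF \<psi>(2)]] l[OF V_L2[OF wV]] ip_sym[of w \<psi>]
            by (simp add: power2_eq_square algebra_simps)
        qed
        ultimately show ?thesis using \<psi>(3) by (simp add: \<mu>_def[symmetric] algebra_simps)
      qed
      from cauchy_schwarz_form[OF this] min[OF w] show ?thesis by simp
    qed
    have eig: "dir \<psi> v = \<mu> * ip \<psi> v" if v: "v \<in> V" for v
    proof -
      let ?r = "residual S v"
      have r: "?r \<in> W" using residual(1,2)[OF S(1) v] by (simp add: W_def)
      have cV: "comb S (ip v) \<in> V" by (rule comb_V[OF SV])
      have veq: "v = (\<lambda>x. 1 * ?r x + 1 * comb S (ip v) x)" by (simp add: residual_def)
      have S0: "ip \<phi> \<psi> = 0" "dir \<phi> \<psi> = 0" if "\<phi> \<in> S" for \<phi>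
      proof -
        show "ip \<phi> \<psi> = 0" using \<psi>(1) that ip_sym[of \<phi> \<psi>] by (simp add: W_def)
        then show "dir \<phi> \<psi> = 0" using S(2) that \<psi>(2) by (simp add: eigen_def)
      qed
      have "dir v \<psi> = dir ?r \<psi> + dir (comb S (ip v)) \<psi>"
        using dir_lincomb[OF V_S1[OF WV[OF r]] V_S1[OF cV] V_S1[OF \<psi>(2)], of 1 1] veq by simp
      also have "dir (comb S (ip v)) \<psi> = 0"
        using dir_comb[OF SV V_S1[OF \<psi>(2)]] S0 by simp
      finally have 1: "dir v \<psi> = dir ?r \<psi>" by simp
      have "ip v \<psi> = ip ?r \<psi> + ip (comb S (ip v)) \<psi>"
        using ip_lincomb[OF V_L2[OF WV[OF r]] V_L2[OF cV] V_L2[OF \<psi>(2)], of 1 1] veq by simp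
      also have "ip (comb S (ip v)) \<psi> = 0"
        using ip_comb[OF SV V_L2[OF \<psi>(2)]] S0 by simp
      finally have 2: "ip v \<psi> = ip ?r \<psi>" by simp
      show ?thesis using orth[OF r] 1 2 by (simp add: dir_sym[of \<psi>] ip_sym[of \<psi>])
    qed
    have "orthonormal (insert \<psi> S)" "\<psi> \<notin> S"
      using orthonormal_insert[OF S(1) \<psi>(2,3)] \<psi>(1) by (auto simp: W_def)
    moreover have "eigen (insert \<psi> S)" using S(2) eig by (auto simp: eigen_def \<mu>_def)
    ultimately show False using maxS[of "insert \<psi> S"] finS by simp
  qed
  then show ?thesis using S by blast
qed

definition modes :: "'n field set" where
  "modes = (SOME S. orthonormal S \<and> eigen S \<and> (\<forall>v\<in>V. v = comb S (ip v)))"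

definition ev :: "'n field \<Rightarrow> real" where
  "ev \<phi> = dir \<phi> \<phi>"

lemma modes: "orthonormal modes" "\<phi> \<in> modes \<Longrightarrow> v \<in> V \<Longrightarrow> dir \<phi> v = ev \<phi> * ip \<phi> v" "v \<in> V \<Longrightarrow> v = comb modes (ip v)"
proof -
  have *: "orthonormal modes \<and> eigen modes \<and> (\<forall>v\<in>V. v = comb modes (ip v))"
    unfolding modes_def by (rule someI_ex[OF eigenbasis])
  then show "orthonormal modes" "\<phi> \<in> modes \<Longrightarrow> v \<in> V \<Longrightarrow> dir \<phi> v = ev \<phi> * ip \<phi> v"
    unfolding ev_def eigen_def by blast+
  show "v \<in> V \<Longrightarrow> v = comb modes (ip v)" using * by blast
qed

lemma modes_V: "modes \<subseteq> V" "finite modes" "\<phi> \<in> modes \<Longrightarrow> \<phi> \<in> V"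
  using modes(1) by (auto simp: orthonormal_def)

lemma V_eqI: "v \<in> V \<Longrightarrow> w \<in> V \<Longrightarrow> (\<And>\<phi>. \<phi> \<in> modes \<Longrightarrow> ip v \<phi> = ip w \<phi>) \<Longrightarrow> v = w"
proof -
  assume v: "v \<in> V" and w: "w \<in> V" and eq: "\<And>\<phi>. \<phi> \<in> modes \<Longrightarrow> ip v \<phi> = ip w \<phi>"
  have "comb modes (ip v) = comb modes (ip w)" unfolding comb_def using eq by simp
  then show ?thesis by (rule trans[OF modes(3)[OF v] trans[OF _ modes(3)[OF w, symmetric]]])
qed

lemma ip_modes: "v \<in> V \<Longrightarrow> w \<in> L2 \<Omega> \<Longrightarrow> ip v w = (\<Sum>\<phi>\<in>modes. ip v \<phi> * ip \<phi> w)"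
  by (rule trans[OF arg_cong[OF modes(3), of v "\<lambda>v. ip v w"] ip_comb[OF modes_V(1)]])

lemma dir_modes: "v \<in> V \<Longrightarrow> w \<in> Sobolev \<Omega> 1 \<Longrightarrow> dir v w = (\<Sum>\<phi>\<in>modes. ip v \<phi> * dir \<phi> w)"
  by (rule trans[OF arg_cong[OF modes(3), of v "\<lambda>v. dir v w"] dir_comb[OF modes_V(1)]])

lemma parseval: "v \<in> V \<Longrightarrow> ip v v = (\<Sum>\<phi>\<in>modes. (ip v \<phi>)\<^sup>2)"
proof -
  assume v: "v \<in> V"
  have "ip v \<phi> * ip \<phi> v = (ip v \<phi>)\<^sup>2" for \<phi> using ip_sym[of \<phi> v] by (simp add: power2_eq_square)
  then show ?thesis using ip_modes[OF v V_L2[OF v]] by simp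
qed

lemma parseval_dir: "v \<in> V \<Longrightarrow> dir v v = (\<Sum>\<phi>\<in>modes. ev \<phi> * (ip v \<phi>)\<^sup>2)"
proof -
  assume v: "v \<in> V"
  have "ip v \<phi> * dir \<phi> v = ev \<phi> * (ip v \<phi>)\<^sup>2" if "\<phi> \<in> modes" for \<phi>
    using ip_sym[of \<phi> v] modes(2)[OF that v] by (simp add: power2_eq_square)
  then show ?thesis using dir_modes[OF v V_S1[OF v]] by simp
qed

text \<open>The expansion of \<open>w\<close> in the modes is its \<open>L\<^sup>2\<close>-projection, which
  does not increase the norm.\<close>

lemma bessel: "w \<in> L2 \<Omega> \<Longrightarrow> (\<Sum>\<phi>\<in>modes. (ip w \<phi>)\<^sup>2) \<le> ip w w"
proof -
  assume w: "w \<in> L2 \<Omega>"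
  let ?p = "comb modes (ip w)"
  have p: "?p \<in> V" by (rule comb_V[OF modes_V(1)])
  have pp: "ip ?p ?p = (\<Sum>\<phi>\<in>modes. (ip w \<phi>)\<^sup>2)"
    using parseval[OF p] ip_comb_member[OF modes(1)] by simp
  have wp: "ip ?p w = (\<Sum>\<phi>\<in>modes. (ip w \<phi>)\<^sup>2)"
    using ip_comb[OF modes_V(1) w] by (simp add: ip_sym[of _ w] power2_eq_square)
  have "0 \<le> ip (\<lambda>x. w x - ?p x) (\<lambda>x. w x - ?p x)" by (rule ip_nonneg)
  also have "\<dots> = ip w w - 2 * ip ?p w + ip ?p ?p"
    using ip_diff[OF w V_L2[OF p] L2_diff[OF w V_L2[OF p]]] ip_diff[OF w V_L2[OF p] w] ip_diff[OF w V_L2[OF p] V_L2[OF p]]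
    by (simp add: ip_sym[of w "\<lambda>x. w x - ?p x"] ip_sym[of ?p "\<lambda>x. w x - ?p x"] ip_sym[of w ?p])
  finally show ?thesis using pp wp by simp
qed

lemma P_h_modes: "w \<in> L2 \<Omega> \<Longrightarrow> P_h \<Omega> V w \<in> V" "w \<in> L2 \<Omega> \<Longrightarrow> \<phi> \<in> modes \<Longrightarrow> ip (P_h \<Omega> V w) \<phi> = ip w \<phi>"
proof -
  assume w: "w \<in> L2 \<Omega>"
  have "comb modes (ip w) \<in> V \<and> (\<forall>v\<in>V. ip (comb modes (ip w)) v = ip w v)"
  proof (intro conjI ballI)
    show "comb modes (ip w) \<in> V" by (rule comb_V[OF modes_V(1)])
    fix v assume v: "v \<in> V"
    have "ip (comb modes (ip w)) v = (\<Sum>\<phi>\<in>modes. ip w \<phi> * ip \<phi> v)"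
      by (rule ip_comb[OF modes_V(1) V_L2[OF v]])
    also have "\<dots> = (\<Sum>\<phi>\<in>modes. ip v \<phi> * ip \<phi> w)"
      by (intro sum.cong refl) (metis ip_sym mult.commute)
    also have "\<dots> = ip w v" using ip_modes[OF v w] ip_sym[of v w] by simp
    finally show "ip (comb modes (ip w)) v = ip w v" .
  qed
  from someI[of "\<lambda>p. p \<in> V \<and> (\<forall>v\<in>V. ip p v = ip w v)", OF this]
  show "P_h \<Omega> V w \<in> V" "\<phi> \<in> modes \<Longrightarrow> ip (P_h \<Omega> V w) \<phi> = ip w \<phi>"
    using modes_V(3) unfolding P_h_def by auto
qed

lemma A_h_modes: "w \<in> Sobolev \<Omega> 1 \<Longrightarrow> A_h \<Omega> V w \<in> V" "w \<in> Sobolev \<Omega> 1 \<Longrightarrow> \<phi> \<in> modes \<Longrightarrow> ip (A_h \<Omega> V w) \<phi> = dir w \<phi>"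
proof -
  assume w: "w \<in> Sobolev \<Omega> 1"
  have "ip (comb modes (dir w)) v = dir w v" if v: "v \<in> V" for v
  proof -
    have "ip (comb modes (dir w)) v = (\<Sum>\<phi>\<in>modes. dir w \<phi> * ip \<phi> v)"
      by (rule ip_comb[OF modes_V(1) V_L2[OF v]])
    also have "\<dots> = (\<Sum>\<phi>\<in>modes. ip v \<phi> * dir \<phi> w)"
      by (intro sum.cong refl) (metis ip_sym dir_sym mult.commute)
    also have "\<dots> = dir w v" using dir_modes[OF v w] dir_sym[of v w] by simp
    finally show ?thesis .
  qed
  then have "comb modes (dir w) \<in> V \<and> (\<forall>v\<in>V. ip (comb modes (dir w)) v = ip (grad \<Omega> w) (grad \<Omega> v))"
    using comb_V[OF modes_V(1)] by (simp add: dir_def)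
  from someI[of "\<lambda>p. p \<in> V \<and> (\<forall>v\<in>V. ip p v = ip (grad \<Omega> w) (grad \<Omega> v))", OF this]
  show "A_h \<Omega> V w \<in> V" "\<phi> \<in> modes \<Longrightarrow> ip (A_h \<Omega> V w) \<phi> = dir w \<phi>"
    using modes_V(3) unfolding A_h_def dir_def by auto
qed

lemma ev_lower: "(\<And>v. v \<in> H10 \<Omega> \<Longrightarrow> c * ip v v \<le> dir v v) \<Longrightarrow> \<phi> \<in> modes \<Longrightarrow> c \<le> ev \<phi>"
proof -
  assume c: "\<And>v. v \<in> H10 \<Omega> \<Longrightarrow> c * ip v v \<le> dir v v" and \<phi>: "\<phi> \<in> modes"
  have "\<phi> \<in> H10 \<Omega>" "ip \<phi> \<phi> = 1" using modes(1) modes_V(3)[OF \<phi>] V_H10 \<phi> by (auto simp: orthonormal_def)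
  then show ?thesis using c[of \<phi>] by (simp add: ev_def)
qed

lemma ev_pos: "\<phi> \<in> modes \<Longrightarrow> 0 < ev \<phi>"
proof -
  assume \<phi>: "\<phi> \<in> modes"
  obtain c where c: "c > 0" "\<forall>v\<in>H10 \<Omega>. c * ip v v \<le> dir v v" using poincare by blast
  then have "c \<le> ev \<phi>" by (intro ev_lower[OF _ \<phi>]) blast
  then show ?thesis using c(1) by simp
qed

text \<open>In the modes the elliptic projection, like the other operators of the discretization, is diagonal.\<close>

lemma R_h_modes: "w \<in> Sobolev \<Omega> 1 \<Longrightarrow> R_h \<Omega> V w \<in> V"
  "w \<in> Sobolev \<Omega> 1 \<Longrightarrow> \<phi> \<in> modes \<Longrightarrow> ip (R_h \<Omega> V w) \<phi> = dir w \<phi> / ev \<phi>"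
proof -
  assume w: "w \<in> Sobolev \<Omega> 1"
  let ?p = "comb modes (\<lambda>\<phi>. dir w \<phi> / ev \<phi>)"
  have "dir ?p v = dir w v" if v: "v \<in> V" for v
  proof -
    have "dir ?p v = (\<Sum>\<phi>\<in>modes. dir w \<phi> / ev \<phi> * dir \<phi> v)"
      by (rule dir_comb[OF modes_V(1) V_S1[OF v]])
    also have "\<dots> = (\<Sum>\<phi>\<in>modes. ip v \<phi> * dir \<phi> w)"
    proof (intro sum.cong refl)
      fix \<phi> assume \<phi>: "\<phi> \<in> modes"
      show "dir w \<phi> / ev \<phi> * dir \<phi> v = ip v \<phi> * dir \<phi> w"
        using modes(2)[OF \<phi> v] ev_pos[OF \<phi>] dir_sym[of w \<phi>] ip_sym[of v \<phi>] by simp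
    qed
    also have "\<dots> = dir w v" using dir_modes[OF v w] dir_sym[of v w] by simp
    finally show "dir ?p v = dir w v" .
  qed
  then have "?p \<in> V \<and> (\<forall>v\<in>V. ip (grad \<Omega> ?p) (grad \<Omega> v) = ip (grad \<Omega> w) (grad \<Omega> v))"
    using comb_V[OF modes_V(1)] by (simp add: dir_def)
  from someI[of "\<lambda>p. p \<in> V \<and> (\<forall>v\<in>V. ip (grad \<Omega> p) (grad \<Omega> v) = ip (grad \<Omega> w) (grad \<Omega> v))", OF this]
  have R: "R_h \<Omega> V w \<in> V" "\<And>v. v \<in> V \<Longrightarrow> dir (R_h \<Omega> V w) v = dir w v"
    unfolding R_h_def dir_def by auto
  show "R_h \<Omega> V w \<in> V" by (rule R(1))
  show "ip (R_h \<Omega> V w) \<phi> = dir w \<phi> / ev \<phi>" if "\<phi> \<in> modes"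
  proof -
    have "ev \<phi> * ip (R_h \<Omega> V w) \<phi> = dir w \<phi>"
      using R(2)[OF modes_V(3)[OF that]] modes(2)[OF that R(1)] dir_sym[of "R_h \<Omega> V w" \<phi>] ip_sym[of "R_h \<Omega> V w" \<phi>] by simp
    then show ?thesis using ev_pos[OF that] by (simp add: field_simps)
  qed
qed

end

section \<open>The finite element space\<close>

context bounded_open
begin

lemma Sobolev_norm_0: "Sobolev_norm \<Omega> m (\<lambda>x. 0) = 0"
  using Sobolev_norm_triangle[OF Sobolev_0 Sobolev_0, of m 0 0] Sobolev_norm_nonneg[of m "\<lambda>x. 0"] by simp

lemma test_H10: "\<phi> \<in> test_functions \<Omega> \<Longrightarrow> \<phi> \<in> H10 \<Omega>"
  unfolding H10_def using test_wd(1)[of \<phi>] Sobolev_norm_0[of 1]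
  by (auto simp: fun_diff_def intro!: bexI[of _ \<phi>])

lemma H10_0: "(\<lambda>x. 0) \<in> H10 \<Omega>"
proof -
  have "cbox (\<chi> i. 1) (0 :: real^'n) = {}" by (simp add: interval_eq_empty_cart)
  then have "box_bump (\<chi> i. 1) 0 0 \<in> test_functions \<Omega>" by (intro box_bump_test) auto
  from H10_lincomb[OF test_H10[OF this] test_H10[OF this], of 0 0] show ?thesis by simp
qed

text \<open>Where a continuous function is nonzero it is so on an open set, which has positive measure.\<close>

lemma continuous_AE_zero:
  fixes w :: "'n field"
  assumes c: "continuous_on (closure \<Omega>) w" and ae: "AE x in Mo. w x = 0" and x: "x \<in> closure \<Omega>"
  shows "w x = 0"
proof -
  define C where "C = {x \<in> closure \<Omega>. w x = 0}"
  have "closed C" unfolding C_def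
    by (rule continuous_closed_preimage_constant[OF c closed_closure])
  moreover have "AE x\<in>\<Omega> in lebesgue. x \<in> C"
    using ae closure_subset[of \<Omega>] sets_\<Omega> by (auto simp: AE_restrict_space_iff C_def elim: eventually_mono)
  ultimately have "\<Omega> \<subseteq> C" using mem_closed_if_AE_lebesgue_open[OF opn] by blast
  then have "closure \<Omega> \<subseteq> C" using \<open>closed C\<close> by (rule closure_minimal)
  then show ?thesis using x by (auto simp: C_def)
qed

end

lemma Q_ref_lincomb: "p \<in> Q_ref r \<Longrightarrow> q \<in> Q_ref r \<Longrightarrow> (\<lambda>y. a * p y + b * q y) \<in> Q_ref r"
proof -
  assume "p \<in> Q_ref r" "q \<in> Q_ref r"
  then obtain c d where "\<forall>x. p x = (\<Sum>\<alpha> | \<forall>i. \<alpha> i \<le> r. c \<alpha> * (\<Prod>i\<in>UNIV. (x $ i) ^ \<alpha> i))"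
    "\<forall>x. q x = (\<Sum>\<alpha> | \<forall>i. \<alpha> i \<le> r. d \<alpha> * (\<Prod>i\<in>UNIV. (x $ i) ^ \<alpha> i))" unfolding Q_ref_def by blast
  then have "\<forall>x. a * p x + b * q x = (\<Sum>\<alpha> | \<forall>i. \<alpha> i \<le> r. (a * c \<alpha> + b * d \<alpha>) * (\<Prod>i\<in>UNIV. (x $ i) ^ \<alpha> i))"
    by (simp add: sum_distrib_left sum.distrib distrib_right mult.assoc)
  then show ?thesis unfolding Q_ref_def mem_Collect_eq by (intro exI[of _ "\<lambda>\<alpha>. a * c \<alpha> + b * d \<alpha>"])
qed

text \<open>An element is continuous on the closure and zero outside, hence determined by its values almost
  everywhere. On each of the finitely many elements it is given by the coefficients of a polynomial
  on the reference cube.\<close>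

lemma V_h_fe_space:
  fixes \<Omega> :: "(real^'n::finite) set"
  assumes \<Omega>: "open \<Omega>" "bounded \<Omega>" and mesh: "mesh \<Omega> \<T>"
  shows "fe_space \<Omega> (V_h \<Omega> \<T> r)"
proof -
  interpret bounded_open \<Omega> using \<Omega> by unfold_locales
  have finT: "finite \<T>" and cover: "(\<Union>F\<in>\<T>. F ` ref_cube) = closure \<Omega>" using mesh by (auto simp: mesh_def)
  show ?thesis
  proof
    show "V_h \<Omega> \<T> r \<subseteq> H10 \<Omega>" by (simp add: V_h_def)
    have "(\<lambda>y. 0) \<in> Q_ref r" unfolding Q_ref_def by (auto intro!: exI[of _ "\<lambda>_. 0"])
    then have "\<exists>q\<in>Q_ref r. \<forall>y\<in>ref_cube. 0 = q y" by (intro bexI) auto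
    then show "(\<lambda>x. 0) \<in> V_h \<Omega> \<T> r" unfolding V_h_def Int_iff mem_Collect_eq
      by (intro conjI allI impI ballI) (simp_all add: H10_0)
  next
    fix v w a b assume v: "v \<in> V_h \<Omega> \<T> r" and w: "w \<in> V_h \<Omega> \<T> r"
    have "\<exists>q\<in>Q_ref r. \<forall>y\<in>ref_cube. a * v (F y) + b * w (F y) = q y" if F: "F \<in> \<T>" for F
    proof -
      obtain p q where p: "p \<in> Q_ref r" "\<forall>y\<in>ref_cube. v (F y) = p y" and q: "q \<in> Q_ref r" "\<forall>y\<in>ref_cube. w (F y) = q y"
        using v w F unfolding V_h_def by blast
      show ?thesis by (rule bexI[OF _ Q_ref_lincomb[OF p(1) q(1), of a b]]) (simp add: p(2) q(2))
    qed
    moreover have "continuous_on (closure \<Omega>) (\<lambda>x. a * v x + b * w x)"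
      using v w unfolding V_h_def by (intro continuous_on_add continuous_on_mult continuous_on_const) auto
    moreover have "(\<lambda>x. a * v x + b * w x) \<in> H10 \<Omega>" using v w H10_lincomb unfolding V_h_def by blast
    moreover have "a * v x + b * w x = 0" if "x \<notin> closure \<Omega>" for x using v w that unfolding V_h_def by simp
    ultimately show "(\<lambda>x. a * v x + b * w x) \<in> V_h \<Omega> \<T> r" unfolding V_h_def by blast
  next
    fix v assume v: "v \<in> V_h \<Omega> \<T> r" and z: "ip v v = 0"
    have c: "continuous_on (closure \<Omega>) v" and out: "\<And>x. x \<notin> closure \<Omega> \<Longrightarrow> v x = 0"
      using v unfolding V_h_def by blast+
    have ae: "AE x in Mo. v x = 0"
      by (rule nrm_zero_AE[OF L2_continuous[OF c]]) (simp add: l2_norm_def z)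
    show "v = (\<lambda>x. 0)" using continuous_AE_zero[OF c ae] out by (intro ext) blast
  next
    define A where "A = {\<alpha> :: 'n \<Rightarrow> nat. \<forall>i. \<alpha> i \<le> r}"
    have "A = PiE UNIV (\<lambda>_. {..r})" by (auto simp: A_def PiE_iff)
    then have finA: "finite A" by (simp add: finite_PiE)
    have "\<forall>x. \<exists>Fy. x \<in> closure \<Omega> \<longrightarrow> fst Fy \<in> \<T> \<and> snd Fy \<in> ref_cube \<and> fst Fy (snd Fy) = x"
    proof
      fix x show "\<exists>Fy. x \<in> closure \<Omega> \<longrightarrow> fst Fy \<in> \<T> \<and> snd Fy \<in> ref_cube \<and> fst Fy (snd Fy) = x"
      proof (cases "x \<in> closure \<Omega>")
        case True
        then obtain F y where "F \<in> \<T>" "y \<in> ref_cube" "x = F y" using cover by blast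
        then show ?thesis by (intro exI[of _ "(F, y)"]) simp
      qed simp
    qed
    then obtain e where e: "\<And>x. x \<in> closure \<Omega> \<Longrightarrow> fst (e x) \<in> \<T> \<and> snd (e x) \<in> ref_cube \<and> fst (e x) (snd (e x)) = x"
      by metis
    \<comment> \<open>Every point is assigned to one element; the spanning set consists of the monomials on the
      elements, extended by zero, and need not lie in the space.\<close>
    define \<psi> where "\<psi> p x = (if x \<in> closure \<Omega> \<and> fst (e x) = fst p then \<Prod>i\<in>UNIV. (snd (e x) $ i) ^ snd p i else 0)"
      for p :: "(real^'n \<Rightarrow> real^'n) \<times> ('n \<Rightarrow> nat)" and x
    have repr: "\<exists>c. v = (\<lambda>x. \<Sum>p\<in>\<T> \<times> A. c p * \<psi> p x)" if v: "v \<in> V_h \<Omega> \<T> r" for v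
    proof -
      have "\<forall>F\<in>\<T>. \<exists>c. \<forall>y\<in>ref_cube. v (F y) = (\<Sum>\<alpha>\<in>A. c \<alpha> * (\<Prod>i\<in>UNIV. (y $ i) ^ \<alpha> i))"
      proof
        fix F assume "F \<in> \<T>"
        then obtain q where q: "q \<in> Q_ref r" "\<forall>y\<in>ref_cube. v (F y) = q y" using v unfolding V_h_def by blast
        then obtain c where "\<forall>y. q y = (\<Sum>\<alpha>\<in>A. c \<alpha> * (\<Prod>i\<in>UNIV. (y $ i) ^ \<alpha> i))"
          unfolding Q_ref_def A_def by blast
        then show "\<exists>c. \<forall>y\<in>ref_cube. v (F y) = (\<Sum>\<alpha>\<in>A. c \<alpha> * (\<Prod>i\<in>UNIV. (y $ i) ^ \<alpha> i))"
          using q(2) by (intro exI[of _ c]) simp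
      qed
      then obtain c where c: "\<And>F y. F \<in> \<T> \<Longrightarrow> y \<in> ref_cube \<Longrightarrow> v (F y) = (\<Sum>\<alpha>\<in>A. c F \<alpha> * (\<Prod>i\<in>UNIV. (y $ i) ^ \<alpha> i))"
        by metis
      have "v x = (\<Sum>p\<in>\<T> \<times> A. c (fst p) (snd p) * \<psi> p x)" for x
      proof (cases "x \<in> closure \<Omega>")
        case True
        have "(\<Sum>p\<in>\<T> \<times> A. c (fst p) (snd p) * \<psi> p x) = (\<Sum>F\<in>\<T>. \<Sum>\<alpha>\<in>A. c F \<alpha> * \<psi> (F, \<alpha>) x)"
          by (simp add: sum.cartesian_product case_prod_beta)
        also have "\<dots> = (\<Sum>F\<in>\<T>. if F = fst (e x) then \<Sum>\<alpha>\<in>A. c F \<alpha> * (\<Prod>i\<in>UNIV. (snd (e x) $ i) ^ \<alpha> i) else 0)"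
          using True by (intro sum.cong) (auto simp: \<psi>_def)
        also have "\<dots> = v x" using e[OF True] c[of "fst (e x)" "snd (e x)"] finT by (simp add: sum.delta)
        finally show ?thesis by simp
      next
        case False
        then have "v x = 0" using v unfolding V_h_def by blast
        then show ?thesis using False by (simp add: \<psi>_def)
      qed
      then show ?thesis by (intro exI[of _ "\<lambda>p. c (fst p) (snd p)"]) blast
    qed
    obtain h where h: "bij_betw h {..<card (\<T> \<times> A)} (\<T> \<times> A)"
      using ex_bij_betw_nat_finite[of "\<T> \<times> A"] finT finA by (auto simp: atLeast0LessThan)
    have fin_repr: "\<exists>c. v = (\<lambda>x. \<Sum>i<card (\<T> \<times> A). c i * \<psi> (h i) x)" if v: "v \<in> V_h \<Omega> \<T> r" for v
    proof -
      obtain c where c: "v = (\<lambda>x. \<Sum>p\<in>\<T> \<times> A. c p * \<psi> p x)" using repr[OF v] by blast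
      have "(\<Sum>p\<in>\<T> \<times> A. c p * \<psi> p x) = (\<Sum>i<card (\<T> \<times> A). c (h i) * \<psi> (h i) x)" for x
        using sum.reindex_bij_betw[OF h, of "\<lambda>p. c p * \<psi> p x"] by simp
      then show ?thesis unfolding c by (intro exI[of _ "c \<circ> h"]) simp
    qed
    show "\<exists>(q :: nat) \<psi>. \<forall>v\<in>V_h \<Omega> \<T> r. \<exists>c. v = (\<lambda>x. \<Sum>i<q. c i * \<psi> i x)"
      by (rule exI[of _ "card (\<T> \<times> A)"], rule exI[of _ "\<lambda>i. \<psi> (h i)"], rule ballI, rule fin_repr)
  qed
qed

section \<open>The modes of the discrete solution and of its lifting\<close>

lemma integral_eq_on_interior:
  fixes f g :: "real \<Rightarrow> real"
  assumes "\<And>s. s \<in> {a<..<b} \<Longrightarrow> f s = g s"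
  shows "integral {a..b} f = integral {a..b} g"
  by (rule integral_spike[of "{a, b}"]) (use assms in auto)

context fe_space
begin

lemma comb_sub: "comb S c x - comb S d x * a = comb S (\<lambda>\<phi>. c \<phi> - d \<phi> * a) x"
  by (simp add: comb_def sum_distrib_left sum_distrib_right left_diff_distrib right_diff_distrib sum_subtractf mult_ac)

lemma comb_diff: "(\<lambda>x. comb S c x - comb S d x) = comb S (\<lambda>\<phi>. c \<phi> - d \<phi>)"
  by (auto simp: comb_def sum_subtractf left_diff_distrib)

lemma comb_diff': "comb S c - comb S d = comb S (\<lambda>\<phi>. c \<phi> - d \<phi>)"
  unfolding fun_diff_def by (rule comb_diff)

lemma ip_comb_modes: "\<phi> \<in> modes \<Longrightarrow> ip (comb modes c) \<phi> = c \<phi>"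
  by (rule ip_comb_member[OF modes(1)])

lemma dir_comb_modes: "\<phi> \<in> modes \<Longrightarrow> dir (comb modes c) \<phi> = ev \<phi> * c \<phi>"
  using modes(2)[of \<phi> "comb modes c"] comb_V[OF modes_V(1), of c] ip_comb_modes[of \<phi> c]
    dir_sym[of "comb modes c" \<phi>] ip_sym[of "comb modes c" \<phi>] by simp

lemma time_polys_modes:
  assumes p: "p \<in> time_polys k V"
  shows "\<exists>P. (\<forall>\<phi>. degree (P \<phi>) \<le> k) \<and> (\<forall>s. p s = comb modes (\<lambda>\<phi>. poly (P \<phi>) s))"
proof -
  obtain c where c: "\<And>j. j \<le> k \<Longrightarrow> c j \<in> V" "\<And>s x. p s x = (\<Sum>j\<le>k. s ^ j * c j x)"
    using p unfolding time_polys_def by blast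
  define P where "P \<phi> = (\<Sum>j\<le>k. monom (ip (c j) \<phi>) j)" for \<phi>
  have "degree (P \<phi>) \<le> k" for \<phi>
    unfolding P_def by (intro degree_sum_le) (auto intro: order_trans[OF degree_monom_le])
  moreover have "p s x = comb modes (\<lambda>\<phi>. poly (P \<phi>) s) x" for s x
  proof -
    have "c j x = (\<Sum>\<phi>\<in>modes. ip (c j) \<phi> * \<phi> x)" if "j \<le> k" for j
      using fun_cong[OF modes(3)[OF c(1)[OF that]], of x] by (simp add: comb_def)
    then have "p s x = (\<Sum>j\<le>k. \<Sum>\<phi>\<in>modes. s ^ j * (ip (c j) \<phi> * \<phi> x))"
      unfolding c(2) by (simp add: sum_distrib_left)
    also have "\<dots> = (\<Sum>\<phi>\<in>modes. \<Sum>j\<le>k. s ^ j * (ip (c j) \<phi> * \<phi> x))" by (rule sum.swap)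
    finally show ?thesis
      by (simp add: comb_def P_def poly_sum poly_monom sum_distrib_right sum_distrib_left mult_ac)
  qed
  ultimately show ?thesis by blast
qed

lemma mode_time_poly:
  assumes "\<phi> \<in> modes" "degree \<psi> \<le> k"
  shows "(\<lambda>s x. poly \<psi> s * \<phi> x) \<in> time_polys k V"
  unfolding time_polys_def mem_Collect_eq
proof (intro exI conjI allI impI)
  show "(\<lambda>x. coeff \<psi> j * \<phi> x) \<in> V" for j using V_cmult modes_V(3)[OF assms(1)] by blast
  have "poly \<psi> s = (\<Sum>j\<le>k. coeff \<psi> j * s ^ j)" for s
    unfolding poly_altdef by (rule sum.mono_neutral_left) (use assms(2) in \<open>auto simp: coeff_eq_0\<close>)
  then show "poly \<psi> s * \<phi> x = (\<Sum>j\<le>k. s ^ j * (coeff \<psi> j * \<phi> x))" for s x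
    by (simp add: sum_distrib_right sum_distrib_left mult_ac)
qed

lemma zero_time_poly: "(\<lambda>s x. 0) \<in> time_polys k V"
  unfolding time_polys_def mem_Collect_eq by (intro exI[of _ "\<lambda>_ _. 0"]) (simp add: V_0)

text \<open>On each closed time step an element of the trial space is a polynomial in every mode; the
  left endpoint is reached by continuity.\<close>

lemma X_tau_modes:
  assumes w: "w \<in> X_tau \<Omega> T N t k V" and mesh: "time_mesh T N t"
  shows "\<exists>P. \<forall>n<N. (\<forall>\<phi>. degree (P n \<phi>) \<le> k) \<and> (\<forall>s\<in>{t n..t (Suc n)}. w s = comb modes (\<lambda>\<phi>. poly (P n \<phi>) s))"
proof -
  have lt: "t n < t (Suc n)" if "n < N" for n using mesh that by (simp add: time_mesh_def)
  have mono: "t i \<le> t j" if "i \<le> j" "j \<le> N" for i j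
    using that by (induction j) (auto simp: le_Suc_eq Suc_le_eq intro: order_trans less_imp_le lt)
  have sub: "{t n..t (Suc n)} \<subseteq> {0..T}" if "n < N" for n
    using mono[of 0 n] mono[of "Suc n" N] that mesh by (auto simp: time_mesh_def)
  have cont: "w s \<in> V" "((\<lambda>r. nrm (w r - w s)) \<longlongrightarrow> 0) (at s within {0..T})" if "s \<in> {0..T}" for s
    using w that by (auto simp: X_tau_def continuous_in_def)
  have "\<exists>P. (\<forall>\<phi>. degree (P \<phi>) \<le> k) \<and> (\<forall>s\<in>{t n..t (Suc n)}. w s = comb modes (\<lambda>\<phi>. poly (P \<phi>) s))" if n: "n < N" for n
  proof -
    have "\<exists>p\<in>time_polys k V. \<forall>s\<in>{t n<..t (Suc n)}. w s = p s"
      using w n unfolding X_tau_def by (auto dest!: bspec[of _ _ "Suc n"])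
    then obtain P where P: "\<And>\<phi>. degree (P \<phi>) \<le> k" "\<And>s. s \<in> {t n<..t (Suc n)} \<Longrightarrow> w s = comb modes (\<lambda>\<phi>. poly (P \<phi>) s)"
      using time_polys_modes by metis
    have a: "t n \<in> {0..T}" using sub[OF n] lt[OF n] by auto
    have "w (t n) = comb modes (\<lambda>\<phi>. poly (P \<phi>) (t n))"
    proof (rule V_eqI[OF cont(1)[OF a] comb_V[OF modes_V(1)]])
      fix \<phi> assume \<phi>: "\<phi> \<in> modes"
      note \<phi>L = V_L2[OF modes_V(3)[OF \<phi>]] and wL = V_L2[OF cont(1)[OF a]]
      have lim0: "((\<lambda>r. nrm (w r - w (t n)) * nrm \<phi>) \<longlongrightarrow> 0 * nrm \<phi>) (at_right (t n))"
      proof (intro tendsto_mult tendsto_const)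
        have "at_right (t n) = at (t n) within {t n<..t (Suc n)}"
          by (rule at_within_nhd[of _ "{..<t (Suc n)}"]) (use lt[OF n] in auto)
        also have "\<dots> \<le> at (t n) within {0..T}" by (rule at_le) (use sub[OF n] in auto)
        finally show "((\<lambda>r. nrm (w r - w (t n))) \<longlongrightarrow> 0) (at_right (t n))"
          using cont(2)[OF a] tendsto_mono by blast
      qed
      have ev: "\<forall>\<^sub>F r in at_right (t n). r \<in> {t n<..t (Suc n)}"
        using lt[OF n] by (auto simp: eventually_at_right intro!: exI[of _ "t (Suc n)"])
      have "((\<lambda>r. poly (P \<phi>) r - ip (w (t n)) \<phi>) \<longlongrightarrow> 0) (at_right (t n))"
      proof (rule Lim_null_comparison)
        show "((\<lambda>r. nrm (w r - w (t n)) * nrm \<phi>) \<longlongrightarrow> 0) (at_right (t n))" using lim0 by simp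
        show "\<forall>\<^sub>F r in at_right (t n). norm (poly (P \<phi>) r - ip (w (t n)) \<phi>) \<le> nrm (w r - w (t n)) * nrm \<phi>"
          using ev
        proof eventually_elim
          fix r assume r: "r \<in> {t n<..t (Suc n)}"
          have rV: "w r \<in> V" using cont(1)[of r] sub[OF n] r by auto
          have "poly (P \<phi>) r = ip (w r) \<phi>" using P(2)[OF r] ip_comb_modes[OF \<phi>] by simp
          then have "poly (P \<phi>) r - ip (w (t n)) \<phi> = ip (\<lambda>x. w r x - w (t n) x) \<phi>"
            using ip_diff[OF V_L2[OF rV] wL \<phi>L] by simp
          then show "norm (poly (P \<phi>) r - ip (w (t n)) \<phi>) \<le> nrm (w r - w (t n)) * nrm \<phi>"
            using ip_cauchy[OF L2_diff[OF V_L2[OF rV] wL] \<phi>L] by (simp add: fun_diff_def)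
        qed
      qed
      moreover have "((\<lambda>r. poly (P \<phi>) r - ip (w (t n)) \<phi>) \<longlongrightarrow> poly (P \<phi>) (t n) - ip (w (t n)) \<phi>) (at_right (t n))"
        by (intro tendsto_intros)
      ultimately have "poly (P \<phi>) (t n) - ip (w (t n)) \<phi> = 0"
        using tendsto_unique[OF trivial_limit_at_right_real] by blast
      then show "ip (w (t n)) \<phi> = ip (comb modes (\<lambda>\<phi>. poly (P \<phi>) (t n))) \<phi>" using ip_comb_modes[OF \<phi>] by simp
    qed
    then have "w s = comb modes (\<lambda>\<phi>. poly (P \<phi>) s)" if "s \<in> {t n..t (Suc n)}" for s
      using P(2)[of s] that by (cases "s = t n") auto
    then show ?thesis using P(1) by blast
  qed
  then have "\<forall>n. \<exists>P. n < N \<longrightarrow> (\<forall>\<phi>. degree (P \<phi>) \<le> k) \<and> (\<forall>s\<in>{t n..t (Suc n)}. w s = comb modes (\<lambda>\<phi>. poly (P \<phi>) s))"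
    by blast
  from choice[OF this] show ?thesis by blast
qed

lemma dt_modes:
  assumes "\<And>s. s \<in> {a<..<b} \<Longrightarrow> w s = comb modes (\<lambda>\<phi>. poly (P \<phi>) s)" "s \<in> {a<..<b}"
  shows "dt w s = comb modes (\<lambda>\<phi>. poly (pderiv (P \<phi>)) s)"
proof
  fix x
  have "((\<lambda>s. comb modes (\<lambda>\<phi>. poly (P \<phi>) s) x) has_real_derivative comb modes (\<lambda>\<phi>. poly (pderiv (P \<phi>)) s) x) (at s)"
    unfolding comb_def by (auto intro!: derivative_eq_intros)
  then have "((\<lambda>s. w s x) has_real_derivative comb modes (\<lambda>\<phi>. poly (pderiv (P \<phi>)) s) x) (at s)"
    by (rule has_field_derivative_transform_within_open[where S = "{a<..<b}"]) (use assms in auto)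
  then show "dt w s x = comb modes (\<lambda>\<phi>. poly (pderiv (P \<phi>)) s) x"
    unfolding dt_def by (rule DERIV_imp_deriv)
qed

lemma dt_limits:
  assumes w: "\<And>s. s \<in> {a<..<b} \<Longrightarrow> w s = comb modes (\<lambda>\<phi>. poly (P \<phi>) s)" and ab: "a < b"
  shows "dt_right w a = comb modes (\<lambda>\<phi>. poly (pderiv (P \<phi>)) a)"
    and "dt_left w b = comb modes (\<lambda>\<phi>. poly (pderiv (P \<phi>)) b)"
proof -
  note d = dt_modes[OF w]
  have lim: "((\<lambda>s. comb modes (\<lambda>\<phi>. poly (pderiv (P \<phi>)) s) x) \<longlongrightarrow> comb modes (\<lambda>\<phi>. poly (pderiv (P \<phi>)) c) x) (at c within S)" for x c S
    unfolding comb_def by (intro tendsto_intros)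
  show "dt_right w a = comb modes (\<lambda>\<phi>. poly (pderiv (P \<phi>)) a)"
  proof
    fix x
    have "\<forall>\<^sub>F s in at_right a. comb modes (\<lambda>\<phi>. poly (pderiv (P \<phi>)) s) x = dt w s x"
      using ab d by (auto simp: eventually_at_right intro!: exI[of _ b])
    then have "((\<lambda>s. dt w s x) \<longlongrightarrow> comb modes (\<lambda>\<phi>. poly (pderiv (P \<phi>)) a) x) (at_right a)"
      by (rule Lim_transform_eventually[OF lim])
    then show "dt_right w a x = comb modes (\<lambda>\<phi>. poly (pderiv (P \<phi>)) a) x"
      unfolding dt_right_def by (intro tendsto_Lim) auto
  qed
  show "dt_left w b = comb modes (\<lambda>\<phi>. poly (pderiv (P \<phi>)) b)"
  proof
    fix x
    have "\<forall>\<^sub>F s in at_left b. comb modes (\<lambda>\<phi>. poly (pderiv (P \<phi>)) s) x = dt w s x"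
      using ab d by (auto simp: eventually_at_left intro!: exI[of _ a])
    then have "((\<lambda>s. dt w s x) \<longlongrightarrow> comb modes (\<lambda>\<phi>. poly (pderiv (P \<phi>)) b) x) (at_left b)"
      by (rule Lim_transform_eventually[OF lim])
    then show "dt_left w b x = comb modes (\<lambda>\<phi>. poly (pderiv (P \<phi>)) b) x"
      unfolding dt_left_def by (intro tendsto_Lim) auto
  qed
qed

text \<open>The recursion for the lifting acts on coefficients, so it reduces to the scalar recursion in every
  mode.\<close>

lemma lift_slope_modes:
  assumes mesh: "time_mesh T N t"
    and P: "\<And>n s. n < N \<Longrightarrow> s \<in> {t n..t (Suc n)} \<Longrightarrow> w s = comb modes (\<lambda>\<phi>. poly (P n \<phi>) s)"
    and d: "d = comb modes \<delta>" and n: "n \<le> N"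
  shows "lift_slope t \<theta> w d n = comb modes (\<lambda>\<phi>. mode_slope t (\<lambda>n. \<theta> (Suc n)) (\<lambda>n. P n \<phi>) (\<delta> \<phi>) n)"
    and "n < N \<Longrightarrow> lift_coeff t \<theta> w d n = comb modes (\<lambda>\<phi>. poly (pderiv (P n \<phi>)) (t n) - mode_slope t (\<lambda>n. \<theta> (Suc n)) (\<lambda>n. P n \<phi>) (\<delta> \<phi>) n)"
proof -
  have lt: "t n < t (Suc n)" if "n < N" for n using mesh that by (simp add: time_mesh_def)
  let ?\<sigma> = "\<lambda>n \<phi>. mode_slope t (\<lambda>n. \<theta> (Suc n)) (\<lambda>n. P n \<phi>) (\<delta> \<phi>) n"
  have coeff: "dt_right w (t n) - comb modes (?\<sigma> n) = comb modes (\<lambda>\<phi>. poly (pderiv (P n \<phi>)) (t n) - ?\<sigma> n \<phi>)" if n: "n < N" for n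
    using dt_limits(1)[of "t n" "t (Suc n)" w "P n"] P[OF n] lt[OF n] by (simp add: comb_diff')
  have slope: "lift_slope t \<theta> w d n = comb modes (?\<sigma> n)" if "n \<le> N" for n
    using that
  proof (induction n)
    case 0
    then show ?case by (simp add: d)
  next
    case (Suc n)
    then have n: "n < N" by simp
    let ?c = "\<lambda>\<phi>. poly (pderiv (P n \<phi>)) (t n) - ?\<sigma> n \<phi>"
    have "lift_slope t \<theta> w d (Suc n) = dt_left (\<lambda>s x. w s x - comb modes ?c x * poly (\<theta> (Suc n)) s) (t (Suc n))"
      using Suc coeff[OF n] by simp
    also have "\<dots> = comb modes (\<lambda>\<phi>. poly (pderiv (P n \<phi> - smult (?c \<phi>) (\<theta> (Suc n)))) (t (Suc n)))"
    proof (rule dt_limits(2)[OF _ lt[OF n]])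
      fix s assume "s \<in> {t n<..<t (Suc n)}"
      then have "w s = comb modes (\<lambda>\<phi>. poly (P n \<phi>) s)" using P[OF n, of s] by simp
      then show "(\<lambda>x. w s x - comb modes ?c x * poly (\<theta> (Suc n)) s) = comb modes (\<lambda>\<phi>. poly (P n \<phi> - smult (?c \<phi>) (\<theta> (Suc n))) s)"
        by (simp add: comb_sub)
    qed
    finally show ?case by simp
  qed
  show "lift_slope t \<theta> w d n = comb modes (?\<sigma> n)" by (rule slope[OF n])
  show "n < N \<Longrightarrow> lift_coeff t \<theta> w d n = comb modes (\<lambda>\<phi>. poly (pderiv (P n \<phi>)) (t n) - ?\<sigma> n \<phi>)"
    unfolding lift_coeff_def using slope[OF n] coeff by simp
qed

text \<open>At the left end of a step the definition uses the polynomial of the step before. This makes no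
  difference, since the lifting polynomials vanish at the ends of the steps.\<close>

lemma lift_comp_modes:
  assumes mesh: "time_mesh T N t"
    and P: "\<And>n s. n < N \<Longrightarrow> s \<in> {t n..t (Suc n)} \<Longrightarrow> w s = comb modes (\<lambda>\<phi>. poly (P n \<phi>) s)"
    and d: "d = comb modes \<delta>" and \<theta>: "\<And>n. n < N \<Longrightarrow> poly (\<theta> (Suc n)) (t n) = 0" "\<And>n. n < N \<Longrightarrow> poly (\<theta> (Suc n)) (t (Suc n)) = 0"
    and n: "n < N" and s: "s \<in> {t n..t (Suc n)}"
  shows "lift_comp t \<theta> w d s = comb modes (\<lambda>\<phi>. poly (mode_lift t (\<lambda>n. \<theta> (Suc n)) (\<lambda>n. P n \<phi>) (\<delta> \<phi>) n) s)"
proof -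
  have lt: "t n < t (Suc n)" if "n < N" for n using mesh that by (simp add: time_mesh_def)
  have mono: "t i \<le> t j" if "i \<le> j" "j \<le> N" for i j
    using that by (induction j) (auto simp: le_Suc_eq Suc_le_eq intro: order_trans less_imp_le lt)
  let ?\<sigma> = "\<lambda>n \<phi>. mode_slope t (\<lambda>n. \<theta> (Suc n)) (\<lambda>n. P n \<phi>) (\<delta> \<phi>) n"
  let ?L = "\<lambda>n s. comb modes (\<lambda>\<phi>. poly (mode_lift t (\<lambda>n. \<theta> (Suc n)) (\<lambda>n. P n \<phi>) (\<delta> \<phi>) n) s)"
  have inner: "lift_comp t \<theta> w d s = ?L n s" if n: "n < N" and s: "s \<in> {t n<..t (Suc n)}" for n s
  proof -
    have s0: "\<not> s \<le> 0" using mono[of 0 n] n s mesh by (auto simp: time_mesh_def)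
    have L: "(LEAST n. s \<le> t n) = Suc n"
    proof (rule Least_equality)
      fix i assume i: "s \<le> t i"
      show "Suc n \<le> i"
      proof (rule ccontr)
        assume "\<not> Suc n \<le> i"
        then have "t i \<le> t n" using mono[of i n] n by simp
        then show False using i s by simp
      qed
    qed (use s in simp)
    have "lift_coeff t \<theta> w d n = comb modes (\<lambda>\<phi>. poly (pderiv (P n \<phi>)) (t n) - ?\<sigma> n \<phi>)"
      by (rule lift_slope_modes(2)[OF mesh P d _ n]) (use n in auto)
    then show ?thesis unfolding lift_comp_def using s0 L P[OF n, of s] s
      by (simp add: Let_def comb_sub mode_lift_def)
  qed
  have node: "?L n (t n) = w (t n)" if "n < N" for n
    using \<theta>(1)[OF that] P[OF that, of "t n"] lt[OF that] by (simp add: mode_lift_def)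
  show ?thesis
  proof (cases "s = t n")
    case True
    show ?thesis
    proof (cases n)
      case 0
      then show ?thesis using True node[OF n] mesh by (simp add: lift_comp_def time_mesh_def)
    next
      case (Suc i)
      then have i: "i < N" using n by simp
      have "lift_comp t \<theta> w d s = ?L i (t (Suc i))" using inner[OF i, of s] lt[OF i] True Suc by simp
      also have "\<dots> = w (t (Suc i))" using \<theta>(2)[OF i] P[OF i, of "t (Suc i)"] lt[OF i] by (simp add: mode_lift_def)
      finally show ?thesis using node[OF n] True Suc by simp
    qed
  next
    case False
    then show ?thesis using inner[OF n, of s] s by simp
  qed
qed

text \<open>Test functions \<open>\<psi>(s) \<phi>(x)\<close> in one component single out the mode
  \<open>\<phi>\<close>, because the discrete Laplacian is diagonal.\<close>

lemma galerkin_modes: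
  assumes sol: "fully_discrete_solution \<Omega> T V k \<xi> \<omega> N t f U0h U"
    and f: "\<And>s. s \<in> {0..T} \<Longrightarrow> f s \<in> L2 \<Omega>"
    and mesh: "time_mesh T N t"
    and P0: "\<And>n s. n < N \<Longrightarrow> s \<in> {t n..t (Suc n)} \<Longrightarrow> fst (U s) = comb modes (\<lambda>\<phi>. poly (P0 n \<phi>) s)"
    and P1: "\<And>n s. n < N \<Longrightarrow> s \<in> {t n..t (Suc n)} \<Longrightarrow> snd (U s) = comb modes (\<lambda>\<phi>. poly (P1 n \<phi>) s)"
    and n: "n < N" and \<phi>: "\<phi> \<in> modes" and \<psi>: "degree \<psi> \<le> k - 1"
  shows "pint (t n) (t (Suc n)) (pderiv (P0 n \<phi>) * \<psi>) = pint (t n) (t (Suc n)) (P1 n \<phi> * \<psi>)"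
    and "pint (t n) (t (Suc n)) ((pderiv (P1 n \<phi>) + smult (ev \<phi>) (P0 n \<phi>)) * \<psi>)
      = Q_n k \<xi> \<omega> t (Suc n) (\<lambda>s. ip (f s) \<phi> * poly \<psi> s)"
proof -
  let ?a = "t n" and ?b = "t (Suc n)"
  let ?V = "\<lambda>s x. poly \<psi> s * \<phi> x" and ?Z = "\<lambda>(s :: real) (x :: real^'n). 0 :: real"
  note \<phi>L = V_L2[OF modes_V(3)[OF \<phi>]]
  have test: "ip w (\<lambda>x. poly \<psi> s * \<phi> x) = poly \<psi> s * ip w \<phi>" for w s
    by (simp add: ip_alt mult.left_commute[of _ "poly \<psi> s"])
  have zero: "ip w (\<lambda>x. 0) = 0" "ip (\<lambda>x. 0) w = 0" for w :: "'n field" by (simp_all add: ip_alt)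
  have eq: "integral {?a..?b} (\<lambda>s.
            l2_inner2 \<Omega> (dt (\<lambda>s. fst (U s)) s, dt (\<lambda>s. snd (U s)) s) (V0 s, V1 s)
          + l2_inner2 \<Omega> (A_h2 \<Omega> V (U s)) (V0 s, V1 s))
        = Q_n k \<xi> \<omega> t (Suc n) (\<lambda>s. l2_inner2 \<Omega> (\<lambda>x. 0, f s) (V0 s, V1 s))"
    if "V0 \<in> time_polys (k - 1) V" "V1 \<in> time_polys (k - 1) V" for V0 V1
    using sol that n unfolding fully_discrete_solution_def by (auto dest!: bspec[of _ _ "Suc n"])
  have d0: "dt (\<lambda>s. fst (U s)) s = comb modes (\<lambda>\<phi>. poly (pderiv (P0 n \<phi>)) s)" if "s \<in> {?a<..<?b}" for s
    by (rule dt_modes[OF _ that]) (use P0[OF n] in auto)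
  have d1: "dt (\<lambda>s. snd (U s)) s = comb modes (\<lambda>\<phi>. poly (pderiv (P1 n \<phi>)) s)" if "s \<in> {?a<..<?b}" for s
    by (rule dt_modes[OF _ that]) (use P1[OF n] in auto)
  have A: "ip (A_h \<Omega> V (fst (U s))) \<phi> = ev \<phi> * poly (P0 n \<phi>) s" if "s \<in> {?a<..<?b}" for s
    using A_h_modes(2)[OF V_S1[OF comb_V[OF modes_V(1)]] \<phi>] dir_comb_modes[OF \<phi>] P0[OF n, of s] that by simp
  have neg: "ip (- snd (U s)) \<phi> = - poly (P1 n \<phi>) s" if "s \<in> {?a<..<?b}" for s
  proof -
    have "ip (- snd (U s)) \<phi> = - ip (snd (U s)) \<phi>" by (simp add: ip_alt)
    then show ?thesis using ip_comb_modes[OF \<phi>] P1[OF n, of s] that by simp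
  qed
  have "pint ?a ?b ((pderiv (P0 n \<phi>) - P1 n \<phi>) * \<psi>) = 0"
  proof -
    have "pint ?a ?b ((pderiv (P0 n \<phi>) - P1 n \<phi>) * \<psi>) = integral {?a..?b} (\<lambda>s.
            l2_inner2 \<Omega> (dt (\<lambda>s. fst (U s)) s, dt (\<lambda>s. snd (U s)) s) (?V s, ?Z s)
          + l2_inner2 \<Omega> (A_h2 \<Omega> V (U s)) (?V s, ?Z s))"
      unfolding pint_def
      by (rule integral_eq_on_interior)
         (simp add: l2_inner2_def A_h2_def test zero d0 neg ip_comb_modes[OF \<phi>], simp add: algebra_simps)
    also have "\<dots> = Q_n k \<xi> \<omega> t (Suc n) (\<lambda>s. l2_inner2 \<Omega> (\<lambda>x. 0, f s) (?V s, ?Z s))"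
      by (rule eq[OF mode_time_poly[OF \<phi> \<psi>] zero_time_poly])
    also have "\<dots> = 0" by (simp add: Q_n_def l2_inner2_def zero)
    finally show ?thesis .
  qed
  then show "pint ?a ?b (pderiv (P0 n \<phi>) * \<psi>) = pint ?a ?b (P1 n \<phi> * \<psi>)"
    by (simp add: left_diff_distrib pint_diff)
  have "pint ?a ?b ((pderiv (P1 n \<phi>) + smult (ev \<phi>) (P0 n \<phi>)) * \<psi>) = integral {?a..?b} (\<lambda>s.
            l2_inner2 \<Omega> (dt (\<lambda>s. fst (U s)) s, dt (\<lambda>s. snd (U s)) s) (?Z s, ?V s)
          + l2_inner2 \<Omega> (A_h2 \<Omega> V (U s)) (?Z s, ?V s))"
    unfolding pint_def
    by (rule integral_eq_on_interior)
       (simp add: l2_inner2_def A_h2_def test zero d1 A ip_comb_modes[OF \<phi>], simp add: algebra_simps)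
  also have "\<dots> = Q_n k \<xi> \<omega> t (Suc n) (\<lambda>s. l2_inner2 \<Omega> (\<lambda>x. 0, f s) (?Z s, ?V s))"
    by (rule eq[OF zero_time_poly mode_time_poly[OF \<phi> \<psi>]])
  also have "\<dots> = Q_n k \<xi> \<omega> t (Suc n) (\<lambda>s. ip (f s) \<phi> * poly \<psi> s)"
    by (simp add: l2_inner2_def zero test) (simp add: mult.commute)
  finally show "pint ?a ?b ((pderiv (P1 n \<phi>) + smult (ev \<phi>) (P0 n \<phi>)) * \<psi>)
      = Q_n k \<xi> \<omega> t (Suc n) (\<lambda>s. ip (f s) \<phi> * poly \<psi> s)" .
qed

end

section \<open>Regularity in time\<close>

lemma C_in_derivatives:
  "C_in B nr S m w \<Longrightarrow> \<exists>D. D 0 = w \<and> (\<forall>j<m. has_time_derivative B nr S (D j) (D (Suc j)))"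
proof (induction m arbitrary: w)
  case 0
  show ?case by (rule exI[of _ "\<lambda>_. w"]) simp
next
  case (Suc m)
  then obtain w' where w': "has_time_derivative B nr S w w'" "C_in B nr S m w'" by auto
  obtain D where D: "D 0 = w'" "\<forall>j<m. has_time_derivative B nr S (D j) (D (Suc j))"
    using Suc.IH[OF w'(2)] by blast
  show ?case
    by (rule exI[of _ "case_nat w D"]) (use w'(1) D in \<open>auto simp: less_Suc_eq_0_disj split: nat.split\<close>)
qed

text \<open>A bounded linear functional commutes with the derivative in time. This turns regularity in a
  function space into differentiability of the coefficients of the modes.\<close>

lemma functional_derivative:
  fixes l :: "'n::finite field \<Rightarrow> real"
  assumes d: "has_time_derivative B nr S w w'"
    and B: "\<And>v w a b. v \<in> B \<Longrightarrow> w \<in> B \<Longrightarrow> (\<lambda>x. a * v x + b * w x) \<in> B"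
    and l: "\<And>v w a b. v \<in> B \<Longrightarrow> w \<in> B \<Longrightarrow> l (\<lambda>x. a * v x + b * w x) = a * l v + b * l w"
    and bound: "\<And>v. v \<in> B \<Longrightarrow> \<bar>l v\<bar> \<le> K * nr v" and t: "t \<in> S"
  shows "((\<lambda>s. l (w s)) has_real_derivative l (w' t)) (at t within S)"
proof -
  have w: "w s \<in> B" "w' s \<in> B" if "s \<in> S" for s using d that by (auto simp: has_time_derivative_def)
  have lim: "((\<lambda>s. K * nr (\<lambda>x. (w s x - w t x) / (s - t) - w' t x)) \<longlongrightarrow> K * 0) (at t within S)"
    using d t by (intro tendsto_mult tendsto_const) (auto simp: has_time_derivative_def)
  have "((\<lambda>s. (l (w s) - l (w t)) / (s - t) - l (w' t)) \<longlongrightarrow> 0) (at t within S)"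
  proof (rule Lim_null_comparison)
    show "((\<lambda>s. K * nr (\<lambda>x. (w s x - w t x) / (s - t) - w' t x)) \<longlongrightarrow> 0) (at t within S)" using lim by simp
    show "\<forall>\<^sub>F s in at t within S. norm ((l (w s) - l (w t)) / (s - t) - l (w' t)) \<le> K * nr (\<lambda>x. (w s x - w t x) / (s - t) - w' t x)"
      unfolding eventually_at_filter
    proof (rule always_eventually, intro allI impI)
      fix s assume s: "s \<noteq> t" "s \<in> S"
      let ?q = "\<lambda>x. 1 / (s - t) * w s x + (- 1 / (s - t)) * w t x"
      have q: "?q \<in> B" by (rule B[OF w(1)[OF s(2)] w(1)[OF t]])
      have e: "(\<lambda>x. (w s x - w t x) / (s - t) - w' t x) = (\<lambda>x. 1 * ?q x + (-1) * w' t x)"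
        by (auto simp: diff_divide_distrib)
      have "l (\<lambda>x. (w s x - w t x) / (s - t) - w' t x) = l ?q - l (w' t)"
        unfolding e l[OF q w(2)[OF t]] by simp
      also have "l ?q = (l (w s) - l (w t)) / (s - t)"
        unfolding l[OF w(1)[OF s(2)] w(1)[OF t]] by (simp add: diff_divide_distrib)
      finally have "(l (w s) - l (w t)) / (s - t) - l (w' t) = l (\<lambda>x. (w s x - w t x) / (s - t) - w' t x)" by simp
      moreover have "(\<lambda>x. (w s x - w t x) / (s - t) - w' t x) \<in> B" unfolding e by (rule B[OF q w(2)[OF t]])
      ultimately show "norm ((l (w s) - l (w t)) / (s - t) - l (w' t)) \<le> K * nr (\<lambda>x. (w s x - w t x) / (s - t) - w' t x)"
        using bound by simp
    qed
  qed
  then have "((\<lambda>s. (l (w s) - l (w t)) / (s - t)) \<longlongrightarrow> l (w' t)) (at t within S)"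
    using Lim_null by blast
  then show ?thesis by (simp add: has_field_derivative_iff)
qed

context bounded_open
begin

lemma has_time_derivative_mono:
  assumes d: "has_time_derivative (Sobolev \<Omega> m) (Sobolev_norm \<Omega> m) S w w'"
  shows "m' \<le> m \<Longrightarrow> has_time_derivative (Sobolev \<Omega> m') (Sobolev_norm \<Omega> m') S w w'"
    and "has_time_derivative (L2 \<Omega>) nrm S w w'"
proof -
  have w: "w s \<in> Sobolev \<Omega> m" "w' s \<in> Sobolev \<Omega> m" if "s \<in> S" for s
    using d that by (auto simp: has_time_derivative_def)
  have lim: "((\<lambda>s. Sobolev_norm \<Omega> m (\<lambda>x. (w s x - w t x) / (s - t) - w' t x)) \<longlongrightarrow> 0) (at t within S)" if "t \<in> S" for t
    using d that by (auto simp: has_time_derivative_def)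
  have q: "(\<lambda>x. (w s x - w t x) / (s - t) - w' t x) \<in> Sobolev \<Omega> m" if "s \<in> S" "t \<in> S" for s t
    using Sobolev_diff[OF Sobolev_cmult[OF Sobolev_diff[OF w(1)[OF that(1)] w(1)[OF that(2)]], of "1 / (s - t)"] w(2)[OF that(2)]]
    by simp
  show "m' \<le> m \<Longrightarrow> has_time_derivative (Sobolev \<Omega> m') (Sobolev_norm \<Omega> m') S w w'"
    unfolding has_time_derivative_def
  proof (intro ballI conjI)
    assume m: "m' \<le> m" fix t assume t: "t \<in> S"
    show "w t \<in> Sobolev \<Omega> m'" "w' t \<in> Sobolev \<Omega> m'" using w[OF t] Sobolev_mono[OF m] by auto
    show "((\<lambda>s. Sobolev_norm \<Omega> m' (\<lambda>x. (w s x - w t x) / (s - t) - w' t x)) \<longlongrightarrow> 0) (at t within S)"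
      by (rule Lim_null_comparison[OF _ lim[OF t]])
         (simp add: Sobolev_norm_mono[OF m] Sobolev_norm_nonneg)
  qed
  show "has_time_derivative (L2 \<Omega>) nrm S w w'"
    unfolding has_time_derivative_def
  proof (intro ballI conjI)
    fix t assume t: "t \<in> S"
    show "w t \<in> L2 \<Omega>" "w' t \<in> L2 \<Omega>" using w[OF t] Sobolev_L2 by auto
    show "((\<lambda>s. nrm (\<lambda>x. (w s x - w t x) / (s - t) - w' t x)) \<longlongrightarrow> 0) (at t within S)"
    proof (rule Lim_null_comparison[OF _ lim[OF t]])
      show "\<forall>\<^sub>F s in at t within S. norm (nrm (\<lambda>x. (w s x - w t x) / (s - t) - w' t x)) \<le> Sobolev_norm \<Omega> m (\<lambda>x. (w s x - w t x) / (s - t) - w' t x)"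
        unfolding eventually_at_filter
      proof (rule always_eventually, intro allI impI)
        fix s assume s: "s \<in> S"
        then show "norm (nrm (\<lambda>x. (w s x - w t x) / (s - t) - w' t x)) \<le> Sobolev_norm \<Omega> m (\<lambda>x. (w s x - w t x) / (s - t) - w' t x)"
          using nrm_wd_le_Sobolev_norm[of "[]" m "\<lambda>x. (w s x - w t x) / (s - t) - w' t x"]
            nrm_wd_Nil[OF Sobolev_L2[OF q[OF s t]]] by (simp add: nrm_nonneg)
      qed
    qed
  qed
qed

text \<open>It identifies the derivatives required of a solution, which are taken in \<open>L\<^sup>2\<close>,
  with those of the regularity assumption, which are taken in a Sobolev space.\<close>

lemma L2_derivative_unique:
  assumes w: "has_time_derivative (L2 \<Omega>) nrm {0..T} w w'" and z: "has_time_derivative (L2 \<Omega>) nrm {0..T} z z'"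
    and eq: "\<And>s. s \<in> {0..T} \<Longrightarrow> AE x in Mo. w s x = z s x" and T: "T > 0" and t: "t \<in> {0..T}"
  shows "AE x in Mo. w' t x = z' t x"
proof -
  have wL: "w s \<in> L2 \<Omega>" "w' s \<in> L2 \<Omega>" "z s \<in> L2 \<Omega>" "z' s \<in> L2 \<Omega>" if "s \<in> {0..T}" for s
    using w z that by (auto simp: has_time_derivative_def)
  let ?q = "\<lambda>w s x. (w s x - w t x) / (s - t)"
  have qL: "?q w s \<in> L2 \<Omega>" "?q z s \<in> L2 \<Omega>" if "s \<in> {0..T}" for s
    using L2_cmult[OF L2_diff[OF wL(1)[OF that] wL(1)[OF t]], of "1 / (s - t)"]
      L2_cmult[OF L2_diff[OF wL(3)[OF that] wL(3)[OF t]], of "1 / (s - t)"] by auto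
  have "((\<lambda>s. nrm (\<lambda>x. ?q w s x - w' t x) + nrm (\<lambda>x. ?q z s x - z' t x)) \<longlongrightarrow> 0 + 0) (at t within {0..T})"
    using w z t by (intro tendsto_add) (auto simp: has_time_derivative_def)
  then have lim: "((\<lambda>s. nrm (\<lambda>x. ?q w s x - w' t x) + nrm (\<lambda>x. ?q z s x - z' t x)) \<longlongrightarrow> 0) (at t within {0..T})" by simp
  have nz: "at t within {0..T} \<noteq> bot" using T t by (simp add: trivial_limit_within islimpt_Icc)
  have "nrm (\<lambda>x. w' t x - z' t x) \<le> 0"
  proof (rule tendsto_lowerbound[OF lim _ nz])
    show "\<forall>\<^sub>F s in at t within {0..T}. nrm (\<lambda>x. w' t x - z' t x) \<le> nrm (\<lambda>x. ?q w s x - w' t x) + nrm (\<lambda>x. ?q z s x - z' t x)"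
      unfolding eventually_at_filter
    proof (rule always_eventually, intro allI impI)
      fix s assume s: "s \<in> {0..T}"
      have A: "(\<lambda>x. ?q z s x - z' t x) \<in> L2 \<Omega>" "(\<lambda>x. ?q w s x - w' t x) \<in> L2 \<Omega>"
        using L2_diff[OF qL(2)[OF s] wL(4)[OF t]] L2_diff[OF qL(1)[OF s] wL(2)[OF t]] .
      have "nrm (\<lambda>x. w' t x - z' t x) = nrm (\<lambda>x. (?q z s x - z' t x) - (?q w s x - w' t x))"
      proof (rule nrm_cong_AE)
        show "AE x in Mo. w' t x - z' t x = (?q z s x - z' t x) - (?q w s x - w' t x)"
          using eq[OF s] eq[OF t] by eventually_elim simp
      qed (intro L2_diff[OF wL(2)[OF t] wL(4)[OF t]] L2_diff[OF A])+
      also have "\<dots> \<le> nrm (\<lambda>x. ?q z s x - z' t x) + nrm (\<lambda>x. ?q w s x - w' t x)" by (rule nrm_triangle_diff[OF A])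
      finally show "nrm (\<lambda>x. w' t x - z' t x) \<le> nrm (\<lambda>x. ?q w s x - w' t x) + nrm (\<lambda>x. ?q z s x - z' t x)" by simp
    qed
  qed
  then have "nrm (\<lambda>x. w' t x - z' t x) = 0" using nrm_nonneg[of "\<lambda>x. w' t x - z' t x"] by linarith
  from nrm_zero_AE[OF L2_diff[OF wL(2)[OF t] wL(4)[OF t]] this] show ?thesis by simp
qed

lemma time_derivative_continuous:
  assumes d: "has_time_derivative (Sobolev \<Omega> m) (Sobolev_norm \<Omega> m) S w w'" and t: "t \<in> S"
  shows "((\<lambda>s. Sobolev_norm \<Omega> m (\<lambda>x. w s x - w t x)) \<longlongrightarrow> 0) (at t within S)"
proof -
  have w: "w s \<in> Sobolev \<Omega> m" "w' s \<in> Sobolev \<Omega> m" if "s \<in> S" for s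
    using d that by (auto simp: has_time_derivative_def)
  let ?N = "Sobolev_norm \<Omega> m"
  let ?q = "\<lambda>s x. (w s x - w t x) / (s - t) - w' t x"
  have "((\<lambda>s. \<bar>s - t\<bar> * ?N (?q s) + \<bar>s - t\<bar> * ?N (w' t)) \<longlongrightarrow> \<bar>t - t\<bar> * 0 + \<bar>t - t\<bar> * ?N (w' t)) (at t within S)"
    using d t by (intro tendsto_intros) (auto simp: has_time_derivative_def)
  then have lim: "((\<lambda>s. \<bar>s - t\<bar> * ?N (?q s) + \<bar>s - t\<bar> * ?N (w' t)) \<longlongrightarrow> 0) (at t within S)" by simp
  show ?thesis
  proof (rule Lim_null_comparison[OF _ lim])
    show "\<forall>\<^sub>F s in at t within S. norm (?N (\<lambda>x. w s x - w t x)) \<le> \<bar>s - t\<bar> * ?N (?q s) + \<bar>s - t\<bar> * ?N (w' t)"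
      unfolding eventually_at_filter
    proof (rule always_eventually, intro allI impI)
      fix s assume s: "s \<noteq> t" "s \<in> S"
      have q: "?q s \<in> Sobolev \<Omega> m"
        using Sobolev_diff[OF Sobolev_cmult[OF Sobolev_diff[OF w(1)[OF s(2)] w(1)[OF t]], of "1 / (s - t)"] w(2)[OF t]] by simp
      have "(\<lambda>x. w s x - w t x) = (\<lambda>x. (s - t) * ?q s x + (s - t) * w' t x)"
        using s by (auto simp: field_simps)
      then show "norm (?N (\<lambda>x. w s x - w t x)) \<le> \<bar>s - t\<bar> * ?N (?q s) + \<bar>s - t\<bar> * ?N (w' t)"
        using Sobolev_norm_triangle[OF q w(2)[OF t], of "s - t" "s - t"] Sobolev_norm_nonneg by simp
    qed
  qed
qed

lemma time_derivative_bounded: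
  assumes d: "has_time_derivative (Sobolev \<Omega> m) (Sobolev_norm \<Omega> m) {0..T} w w'"
  shows "\<exists>K. \<forall>t\<in>{0..T}. Sobolev_norm \<Omega> m (w t) \<le> K"
proof -
  have w: "w s \<in> Sobolev \<Omega> m" if "s \<in> {0..T}" for s
    using d that by (auto simp: has_time_derivative_def)
  let ?N = "Sobolev_norm \<Omega> m"
  have "continuous_on {0..T} (\<lambda>t. ?N (w t))"
    unfolding continuous_on_def
  proof
    fix t assume t: "t \<in> {0..T}"
    have "((\<lambda>s. ?N (w s) - ?N (w t)) \<longlongrightarrow> 0) (at t within {0..T})"
    proof (rule Lim_null_comparison[OF _ time_derivative_continuous[OF d t]])
      show "\<forall>\<^sub>F s in at t within {0..T}. norm (?N (w s) - ?N (w t)) \<le> ?N (\<lambda>x. w s x - w t x)"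
        unfolding eventually_at_filter
      proof (rule always_eventually, intro allI impI)
        fix s assume s: "s \<in> {0..T}"
        have "?N (w s) \<le> ?N (w t) + ?N (\<lambda>x. w s x - w t x)"
          using Sobolev_norm_triangle[OF w[OF t] Sobolev_diff[OF w[OF s] w[OF t]], of 1 1] by simp
        moreover have "?N (w t) \<le> ?N (w s) + ?N (\<lambda>x. w s x - w t x)"
          using Sobolev_norm_triangle[OF w[OF s] Sobolev_diff[OF w[OF s] w[OF t]], of 1 "-1"] by simp
        ultimately show "norm (?N (w s) - ?N (w t)) \<le> ?N (\<lambda>x. w s x - w t x)" by simp
      qed
    qed
    then show "((\<lambda>t. ?N (w t)) \<longlongrightarrow> ?N (w t)) (at t within {0..T})" using Lim_null by blast
  qed
  then have "compact ((\<lambda>t. ?N (w t)) ` {0..T})" by (intro compact_continuous_image) auto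
  then have "bounded ((\<lambda>t. ?N (w t)) ` {0..T})" by (rule compact_imp_bounded)
  then show ?thesis unfolding bounded_iff by (auto simp: abs_le_iff)
qed

text \<open>The space \<open>H\<^sup>1\<^sub>0\<close> is closed, hence the time derivatives satisfy the
  boundary condition, too.\<close>

lemma time_derivative_H10:
  assumes d: "has_time_derivative (Sobolev \<Omega> m) (Sobolev_norm \<Omega> m) {0..T} w w'" and m: "1 \<le> m" and T: "T > 0"
    and w0: "\<And>s. s \<in> {0<..T} \<Longrightarrow> w s \<in> H10 \<Omega>" and t: "t \<in> {0..T}"
  shows "w t \<in> H10 \<Omega>" "w' t \<in> H10 \<Omega>"
proof -
  note d1 = has_time_derivative_mono(1)[OF d m]
  have S1: "w s \<in> Sobolev \<Omega> 1" "w' s \<in> Sobolev \<Omega> 1" if "s \<in> {0..T}" for s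
    using d1 that by (auto simp: has_time_derivative_def)
  have ex: "\<exists>s\<in>{0<..T}. s \<noteq> t \<and> f s < e" if lim: "(f \<longlongrightarrow> 0) (at t within {0..T})" and e: "e > 0" and t: "t \<in> {0..T}" for f :: "real \<Rightarrow> real" and e t
  proof -
    have "\<forall>\<^sub>F s in at t within {0..T}. f s < e" using order_tendstoD(2)[OF lim e] .
    moreover have "at t within {0<..T} \<le> at t within {0..T}" by (rule at_le) auto
    ultimately have "\<forall>\<^sub>F s in at t within {0<..T}. f s < e" by (rule filter_leD[rotated])
    then have "\<forall>\<^sub>F s in at t within {0<..T}. f s < e \<and> s \<noteq> t \<and> s \<in> {0<..T}"
      by (auto simp: eventually_at_filter elim: eventually_mono)
    moreover have "at t within {0<..T} \<noteq> bot"
    proof -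
      have "t islimpt {0<..T}" using T t by (simp add: islimpt_Ioc)
      then show ?thesis by (simp add: trivial_limit_within)
    qed
    ultimately have "\<exists>s. f s < e \<and> s \<noteq> t \<and> s \<in> {0<..T}" using eventually_happens by blast
    then show ?thesis by blast
  qed
  have wH: "w t \<in> H10 \<Omega>" if t: "t \<in> {0..T}" for t
  proof (rule H10_closed[OF S1(1)[OF t]])
    fix e :: real assume e: "e > 0"
    obtain s where s: "s \<in> {0<..T}" "Sobolev_norm \<Omega> 1 (\<lambda>x. w s x - w t x) < e"
      using ex[OF time_derivative_continuous[OF d1 t] e t] by blast
    have "Sobolev_norm \<Omega> 1 (\<lambda>x. w t x - w s x) \<le> Sobolev_norm \<Omega> 1 (\<lambda>x. w s x - w t x)"
      using Sobolev_norm_triangle[OF Sobolev_diff[OF S1(1)[of s] S1(1)[OF t]] Sobolev_0, of "-1" 0] s by simp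
    then show "\<exists>w'\<in>H10 \<Omega>. Sobolev_norm \<Omega> 1 (\<lambda>x. w t x - w' x) < e"
      using s w0[OF s(1)] by (intro bexI[of _ "w s"]) auto
  qed
  then show "w t \<in> H10 \<Omega>" using t .
  show "w' t \<in> H10 \<Omega>"
  proof (rule H10_closed[OF S1(2)[OF t]])
    fix e :: real assume e: "e > 0"
    have "((\<lambda>s. Sobolev_norm \<Omega> 1 (\<lambda>x. (w s x - w t x) / (s - t) - w' t x)) \<longlongrightarrow> 0) (at t within {0..T})"
      using d1 t by (auto simp: has_time_derivative_def)
    from ex[OF this e t] obtain s where s: "s \<in> {0<..T}" "s \<noteq> t" "Sobolev_norm \<Omega> 1 (\<lambda>x. (w s x - w t x) / (s - t) - w' t x) < e"
      by blast
    let ?q = "\<lambda>x. (w s x - w t x) / (s - t)"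
    have q: "?q \<in> H10 \<Omega>"
      using H10_lincomb[OF wH[of s] wH[OF t], of "1 / (s - t)" "- 1 / (s - t)"] s by (simp add: diff_divide_distrib)
    have "Sobolev_norm \<Omega> 1 (\<lambda>x. w' t x - ?q x) \<le> Sobolev_norm \<Omega> 1 (\<lambda>x. ?q x - w' t x)"
      using Sobolev_norm_triangle[OF Sobolev_diff[OF H10_Sobolev[OF q] S1(2)[OF t]] Sobolev_0, of "-1" 0] by simp
    then show "\<exists>z\<in>H10 \<Omega>. Sobolev_norm \<Omega> 1 (\<lambda>x. w' t x - z x) < e"
      using s q by (intro bexI[of _ ?q]) auto
  qed
qed

end

text \<open>A supremum over time cannot be exchanged with the sum over the modes. The Sobolev embedding in time,
  \<open>\<bar>g s\<bar>\<^sup>2 \<le> 2 \<bar>g 0\<bar>\<^sup>2 + 2 T \<integral>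
  \<bar>g'\<bar>\<^sup>2\<close>, bounds every function by a quantity that can be summed.\<close>

lemma family_sup_bound:
  fixes g g' :: "'a \<Rightarrow> real \<Rightarrow> real"
  assumes T: "0 \<le> T"
    and d: "\<And>i s. i \<in> I \<Longrightarrow> s \<in> {0..T} \<Longrightarrow> (g i has_real_derivative g' i s) (at s within {0..T})"
    and c: "\<And>i. i \<in> I \<Longrightarrow> continuous_on {0..T} (g' i)"
    and K: "\<And>s. s \<in> {0..T} \<Longrightarrow> (\<Sum>i\<in>I. (g i s)\<^sup>2) \<le> K\<^sup>2" "\<And>s. s \<in> {0..T} \<Longrightarrow> (\<Sum>i\<in>I. (g' i s)\<^sup>2) \<le> K\<^sup>2"
  shows "\<exists>B. (\<forall>i\<in>I. 0 \<le> B i \<and> (\<forall>s\<in>{0..T}. \<bar>g i s\<bar> \<le> B i)) \<and> (\<Sum>i\<in>I. (B i)\<^sup>2) \<le> (2 + 2 * T\<^sup>2) * K\<^sup>2"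
proof -
  define b where "b i = 2 * (g i 0)\<^sup>2 + 2 * T * integral {0..T} (\<lambda>s. (g' i s)\<^sup>2)" for i
  have int: "(\<lambda>s. (g' i s)\<^sup>2) integrable_on {0..T}" if "i \<in> I" for i
    using c[OF that] by (intro integrable_continuous_real continuous_intros)
  have nn: "0 \<le> integral {0..T} (\<lambda>s. (g' i s)\<^sup>2)" if "i \<in> I" for i
    using int[OF that] by (intro integral_nonneg) auto
  have b0: "0 \<le> b i" if "i \<in> I" for i using nn[OF that] T by (simp add: b_def)
  have sq: "(g i s)\<^sup>2 \<le> b i" if i: "i \<in> I" and s: "s \<in> {0..T}" for i s
  proof -
    have ftc: "(g' i has_integral g i s - g i 0) {0..s}"
    proof (rule fundamental_theorem_of_calculus)
      show "0 \<le> s" using s by simp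
      fix x assume "x \<in> {0..s}"
      then have "(g i has_real_derivative g' i x) (at x within {0..T})" using d[OF i, of x] s by auto
      then have "(g i has_real_derivative g' i x) (at x within {0..s})" by (rule DERIV_subset) (use s in auto)
      then show "(g i has_vector_derivative g' i x) (at x within {0..s})"
        by (simp add: has_real_derivative_iff_has_vector_derivative)
    qed
    define m where "m = g i s - g i 0"
    have cs: "continuous_on {0..s} (g' i)" using c[OF i] s continuous_on_subset by fastforce
    have "m\<^sup>2 \<le> s * integral {0..s} (\<lambda>s. (g' i s)\<^sup>2)"
    proof (cases "s = 0")
      case True
      then show ?thesis by (simp add: m_def)
    next
      case False
      then have s0: "s > 0" using s by simp
      define a where "a = m / s"
      have i1: "(\<lambda>x. (g' i x)\<^sup>2) integrable_on {0..s}" using cs by (intro integrable_continuous_real continuous_intros)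
      have i2: "(\<lambda>x. 2 * a * g' i x) integrable_on {0..s}" using cs by (intro integrable_continuous_real continuous_intros)
      have "0 \<le> integral {0..s} (\<lambda>x. (g' i x - a)\<^sup>2)"
        using cs by (intro integral_nonneg integrable_continuous_real continuous_intros) auto
      also have "(\<lambda>x. (g' i x - a)\<^sup>2) = (\<lambda>x. (g' i x)\<^sup>2 - 2 * a * g' i x + a\<^sup>2)"
        by (auto simp: power2_diff algebra_simps)
      also have "integral {0..s} \<dots> = integral {0..s} (\<lambda>x. (g' i x)\<^sup>2) - integral {0..s} (\<lambda>x. 2 * a * g' i x) + integral {0..s} (\<lambda>x. a\<^sup>2)"
        using i1 i2 by (subst integral_add, (intro integrable_diff i1 i2 integrable_const_ivl)+, subst integral_diff) auto
      also have "integral {0..s} (\<lambda>x. 2 * a * g' i x) = 2 * a * m"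
        using integral_unique[OF ftc] by (simp add: m_def)
      also have "integral {0..s} (\<lambda>x. a\<^sup>2) = a\<^sup>2 * s" using s0 by simp
      also have "integral {0..s} (\<lambda>x. (g' i x)\<^sup>2) - 2 * a * m + a\<^sup>2 * s = integral {0..s} (\<lambda>x. (g' i x)\<^sup>2) - m\<^sup>2 / s"
        using s0 by (simp add: a_def power2_eq_square)
      finally show ?thesis using s0 by (simp add: field_simps)
    qed
    also have "\<dots> \<le> T * integral {0..T} (\<lambda>s. (g' i s)\<^sup>2)"
    proof (rule mult_mono)
      show "integral {0..s} (\<lambda>s. (g' i s)\<^sup>2) \<le> integral {0..T} (\<lambda>s. (g' i s)\<^sup>2)"
        using c[OF i] s cs by (intro integral_subset_le integrable_continuous_real continuous_intros) auto
      show "0 \<le> integral {0..s} (\<lambda>s. (g' i s)\<^sup>2)" using cs by (intro integral_nonneg integrable_continuous_real continuous_intros) auto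
    qed (use s in auto)
    finally have m: "m\<^sup>2 \<le> T * integral {0..T} (\<lambda>s. (g' i s)\<^sup>2)" .
    have "(g i s)\<^sup>2 = (g i 0 + m)\<^sup>2" by (simp add: m_def)
    also have "\<dots> \<le> 2 * (g i 0)\<^sup>2 + 2 * m\<^sup>2"
      using zero_le_power2[of "g i 0 - m"] unfolding power2_sum power2_diff by linarith
    finally show ?thesis using m by (simp add: b_def)
  qed
  have "(\<Sum>i\<in>I. (sqrt (b i))\<^sup>2) = (\<Sum>i\<in>I. b i)" using b0 by (intro sum.cong) auto
  also have "\<dots> = 2 * (\<Sum>i\<in>I. (g i 0)\<^sup>2) + 2 * T * (\<Sum>i\<in>I. integral {0..T} (\<lambda>s. (g' i s)\<^sup>2))"
    by (simp add: b_def sum.distrib sum_distrib_left)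
  also have "\<dots> \<le> 2 * K\<^sup>2 + 2 * T * (T * K\<^sup>2)"
  proof (intro add_mono mult_left_mono)
    show "(\<Sum>i\<in>I. (g i 0)\<^sup>2) \<le> K\<^sup>2" using K(1) T by simp
    show "(\<Sum>i\<in>I. integral {0..T} (\<lambda>s. (g' i s)\<^sup>2)) \<le> T * K\<^sup>2"
    proof (cases "finite I")
      case True
      have "(\<Sum>i\<in>I. integral {0..T} (\<lambda>s. (g' i s)\<^sup>2)) = integral {0..T} (\<lambda>s. \<Sum>i\<in>I. (g' i s)\<^sup>2)"
        using True int by (subst integral_sum) auto
      also have "\<dots> \<le> integral {0..T} (\<lambda>s. K\<^sup>2)"
        using True int K(2) by (intro integral_le integrable_sum) auto
      finally show ?thesis using T by simp
    qed (use T in simp)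
  qed (use T in auto)
  also have "\<dots> = (2 + 2 * T\<^sup>2) * K\<^sup>2" by (simp add: power2_eq_square algebra_simps)
  finally have sum: "(\<Sum>i\<in>I. (sqrt (b i))\<^sup>2) \<le> (2 + 2 * T\<^sup>2) * K\<^sup>2" .
  have "\<bar>g i s\<bar> \<le> sqrt (b i)" if "i \<in> I" "s \<in> {0..T}" for i s
    using sq[OF that] real_sqrt_le_mono[of "(g i s)\<^sup>2" "b i"] by simp
  then show ?thesis using sum b0 by (intro exI[of _ "\<lambda>i. sqrt (b i)"]) auto
qed

section \<open>The wave problem in modes\<close>

text \<open>In time, derivatives up to order \<open>k + 7\<close> enter: coefficients are differentiated up to
  \<open>k + 3\<close> times, the residual of the elliptic projection takes two more, and the bounds
  by integrals over time another two. In space, order \<open>r + 1\<close> is taken by the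
  projection and \<open>2\<close> by the Laplacian.\<close>

definition smoothness :: "nat \<Rightarrow> nat \<Rightarrow> nat" where
  "smoothness k r = k + r + 10"

text \<open>The data of the continuous problem, on which the constants may depend: \<open>D j\<close> is the
  \<open>j\<close>-th time derivative of \<open>u\<close>, \<open>K\<close> bounds them all, and
  \<open>c\<close> is the constant of the Poincare inequality.\<close>

locale wave_data = bounded_open \<Omega> + gauss_lobatto_rule k \<xi> \<omega>
  for \<Omega> :: "(real^'n::finite) set" and k \<xi> \<omega> +
  fixes r :: nat and T :: real and f f' u v :: "real \<Rightarrow> 'n field" and u0 u1 :: "'n field"
    and D :: "nat \<Rightarrow> real \<Rightarrow> 'n field" and K c :: real
  assumes T: "0 < T"
    and f: "has_time_derivative (L2 \<Omega>) nrm {0..T} f f'"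
    and sol: "wave_solution \<Omega> T f u0 u1 u v"
    and D0: "D 0 = u"
    and D: "\<And>j. j < smoothness k r \<Longrightarrow>
      has_time_derivative (Sobolev \<Omega> (smoothness k r)) (Sobolev_norm \<Omega> (smoothness k r)) {0..T} (D j) (D (Suc j))"
    and K: "\<And>j t. j < smoothness k r \<Longrightarrow> t \<in> {0..T} \<Longrightarrow> Sobolev_norm \<Omega> (smoothness k r) (D j t) \<le> K"
    and c: "0 < c" "\<And>v. v \<in> H10 \<Omega> \<Longrightarrow> c * ip v v \<le> dir v v"
begin

lemma K0: "0 \<le> K"
  using K[of 0 0] T Sobolev_norm_nonneg[of "smoothness k r" "D 0 0"] by (simp add: smoothness_def)

lemma D_mono: "j < k + 8 \<Longrightarrow> m \<le> k + r + 10 \<Longrightarrow> has_time_derivative (Sobolev \<Omega> m) (Sobolev_norm \<Omega> m) {0..T} (D j) (D (Suc j))"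
  using has_time_derivative_mono(1)[OF D[of j], of m] by (simp add: smoothness_def)

lemma D_L2: "j < k + 8 \<Longrightarrow> has_time_derivative (L2 \<Omega>) nrm {0..T} (D j) (D (Suc j))"
  using has_time_derivative_mono(2)[OF D[of j]] by (simp add: smoothness_def)

lemma D_Sobolev: "j < k + 8 \<Longrightarrow> m \<le> k + r + 10 \<Longrightarrow> t \<in> {0..T} \<Longrightarrow> D j t \<in> Sobolev \<Omega> m"
  using D_mono[of j m] by (simp add: has_time_derivative_def)

lemma D_bound: "j < k + 8 \<Longrightarrow> m \<le> k + r + 10 \<Longrightarrow> t \<in> {0..T} \<Longrightarrow> Sobolev_norm \<Omega> m (D j t) \<le> K"
  using K[of j t] Sobolev_norm_mono[of m "k + r + 10" "D j t"] by (simp add: smoothness_def)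

lemma D_H10: "j < k + 8 \<Longrightarrow> t \<in> {0..T} \<Longrightarrow> D j t \<in> H10 \<Omega>"
proof (induction j arbitrary: t)
  case 0
  have "u s \<in> H10 \<Omega>" if "s \<in> {0<..T}" for s using sol that by (auto simp: wave_solution_def)
  then show ?case using time_derivative_H10(1)[OF D_mono[of 0 1] _ T _ 0(2)] D0 by simp
next
  case (Suc j)
  have "D j s \<in> H10 \<Omega>" if "s \<in> {0<..T}" for s using Suc.IH[of s] Suc.prems that by simp
  then show ?case using time_derivative_H10(2)[OF D_mono[of j 1] _ T _ Suc.prems(2)] Suc.prems(1) by simp
qed

lemma v_eq: "t \<in> {0..T} \<Longrightarrow> AE x in Mo. v t x = D 1 t x"
proof (rule L2_derivative_unique[OF _ _ _ T])
  show "has_time_derivative (L2 \<Omega>) nrm {0..T} u v" using sol by (simp add: wave_solution_def)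
  show "has_time_derivative (L2 \<Omega>) nrm {0..T} u (D 1)" using D_L2[of 0] D0 by simp
qed auto

lemma v_L2: "t \<in> {0..T} \<Longrightarrow> v t \<in> L2 \<Omega>"
  using sol by (simp add: wave_solution_def has_time_derivative_def)

lemma u0_eq: "AE x in Mo. D 0 0 x = u0 x" and u1_eq: "AE x in Mo. D 1 0 x = u1 x"
proof -
  show "AE x in Mo. D 0 0 x = u0 x" using sol D0 by (simp add: wave_solution_def)
  have "AE x in Mo. v 0 x = u1 x" using sol by (simp add: wave_solution_def)
  then show "AE x in Mo. D 1 0 x = u1 x" using v_eq[of 0] T by (auto elim: eventually_elim2)
qed

text \<open>The initial values are prescribed almost everywhere only, but the elliptic projection does not see
  null sets.\<close>

lemma R_h_initial: "R_h \<Omega> V u0 = R_h \<Omega> V (D 0 0)" "R_h \<Omega> V u1 = R_h \<Omega> V (D 1 0)"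
proof -
  have *: "R_h \<Omega> V w = R_h \<Omega> V z" if "z \<in> L2 \<Omega>" "AE x in Mo. z x = w x" for z w
  proof -
    have "grad \<Omega> w = grad \<Omega> z" unfolding grad_def[abs_def] using wd_cong_AE[OF that] by simp
    then show ?thesis by (simp add: R_h_def)
  qed
  show "R_h \<Omega> V u0 = R_h \<Omega> V (D 0 0)" "R_h \<Omega> V u1 = R_h \<Omega> V (D 1 0)"
    using *[OF Sobolev_L2[OF D_Sobolev[of 0 0 0]] u0_eq] *[OF Sobolev_L2[OF D_Sobolev[of 1 0 0]] u1_eq] T by auto
qed

lemma dir_D_derivative:
  assumes "j < k + 8" "\<phi> \<in> H10 \<Omega>" "t \<in> {0..T}"
  shows "((\<lambda>s. dir (D j s) \<phi>) has_real_derivative dir (D (Suc j) t) \<phi>) (at t within {0..T})"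
proof (rule functional_derivative[OF D_mono[of j 1], where l = "\<lambda>w. dir w \<phi>" and K = "sqrt (dir \<phi> \<phi>)"])
  note \<phi> = H10_Sobolev[OF assms(2)]
  show "\<bar>dir w \<phi>\<bar> \<le> sqrt (dir \<phi> \<phi>) * Sobolev_norm \<Omega> 1 w" if w: "w \<in> Sobolev \<Omega> 1" for w
    using order_trans[OF dir_cauchy[OF w \<phi>] mult_right_mono[OF dir_le_Sobolev_norm[OF w]], of ] dir_nonneg[of \<phi>]
    by (simp add: mult.commute)
qed (use assms H10_Sobolev in \<open>auto intro!: Sobolev_lincomb dir_lincomb\<close>)

lemma ip_derivative:
  assumes "has_time_derivative (L2 \<Omega>) nrm {0..T} w w'" "\<phi> \<in> L2 \<Omega>" "t \<in> {0..T}"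
  shows "((\<lambda>s. ip (w s) \<phi>) has_real_derivative ip (w' t) \<phi>) (at t within {0..T})"
proof (rule functional_derivative[OF assms(1), where l = "\<lambda>w. ip w \<phi>" and K = "nrm \<phi>"])
  show "\<bar>ip w \<phi>\<bar> \<le> nrm \<phi> * nrm w" if w: "w \<in> L2 \<Omega>" for w
    using ip_cauchy[OF w assms(2)] by (simp add: mult.commute)
qed (use assms in \<open>auto intro!: L2_lincomb ip_lincomb\<close>)

text \<open>For positive times this is Green's formula. At \<open>t = 0\<close>, where the equation is not
  assumed, it follows by continuity of all three terms.\<close>

lemma weak_equation:
  assumes \<phi>: "\<phi> \<in> H10 \<Omega>" and t: "t \<in> {0..T}"
  shows "ip (f t) \<phi> = ip (D 2 t) \<phi> + dir (D 0 t) \<phi>"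
proof -
  note \<phi>L = Sobolev_L2[OF H10_Sobolev[OF \<phi>]]
  obtain a where a: "has_time_derivative (L2 \<Omega>) nrm {0..T} v a"
    "\<And>t. t \<in> {0<..T} \<Longrightarrow> u t \<in> Sobolev \<Omega> 2 \<and> (AE x in Mo. a t x - laplacian \<Omega> (u t) x = f t x)"
    using sol by (auto simp: wave_solution_def)
  have a_eq: "AE x in Mo. a t x = D 2 t x" if "t \<in> {0..T}" for t
    using L2_derivative_unique[OF a(1) D_L2[of 1] v_eq T that] by (simp add: numeral_2_eq_2)
  define g where "g t = ip (f t) \<phi> - ip (D 2 t) \<phi> - dir (D 0 t) \<phi>" for t
  have pos: "g t = 0" if t: "t \<in> {0<..T}" for t
  proof -
    have t': "t \<in> {0..T}" using t by auto
    have u2: "D 0 t \<in> Sobolev \<Omega> 2" using a(2)[OF t] D0 by simp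
    have aL: "a t \<in> L2 \<Omega>" using a(1) t' by (simp add: has_time_derivative_def)
    have DL: "D 2 t \<in> L2 \<Omega>" using Sobolev_L2[OF D_Sobolev[of 2 0 t]] t' by simp
    have fL: "f t \<in> L2 \<Omega>" using f t' by (simp add: has_time_derivative_def)
    have "AE x in Mo. f t x = D 2 t x - laplacian \<Omega> (D 0 t) x"
      using a(2)[OF t] a_eq[OF t'] D0 by (auto elim: eventually_elim2)
    then have "ip (f t) \<phi> = ip (\<lambda>x. D 2 t x - laplacian \<Omega> (D 0 t) x) \<phi>"
      by (rule ip_cong_AE) (use \<phi>L fL L2_diff[OF DL laplacian_L2[OF u2]] in auto)
    also have "\<dots> = ip (D 2 t) \<phi> - ip (laplacian \<Omega> (D 0 t)) \<phi>" by (rule ip_diff[OF DL laplacian_L2[OF u2] \<phi>L])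
    finally show ?thesis using green[OF u2 \<phi>] by (simp add: g_def)
  qed
  have "g t = 0"
  proof (cases "t = 0")
    case True
    have "((\<lambda>s. g s) has_real_derivative ip (f' 0) \<phi> - ip (D 3 0) \<phi> - dir (D 1 0) \<phi>) (at 0 within {0..T})"
      unfolding g_def using T ip_derivative[OF f \<phi>L, of 0] ip_derivative[OF D_L2[of 2] \<phi>L, of 0] dir_D_derivative[OF _ \<phi>, of 0 0]
      by (intro DERIV_diff) (simp_all add: numeral_3_eq_3 numeral_2_eq_2)
    then have "(g \<longlongrightarrow> g 0) (at 0 within {0..T})"
      using DERIV_continuous continuous_within by blast
    moreover have "\<forall>\<^sub>F s in at 0 within {0..T}. g s = 0"
      unfolding eventually_at_filter by (rule always_eventually) (use pos in auto)
    then have "(g \<longlongrightarrow> 0) (at 0 within {0..T})" by (rule tendsto_eventually)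
    moreover have "at 0 within {0..T} \<noteq> bot" using T by (simp add: trivial_limit_within islimpt_Icc)
    ultimately show ?thesis using True tendsto_unique by blast
  next
    case False
    then show ?thesis using pos t by simp
  qed
  then show ?thesis by (simp add: g_def)
qed

lemma sobolev_continuous:
  assumes "j < k + 8"
  shows "continuous_on {0..T} (\<lambda>s. nrm (D j s))" "continuous_on {0..T} (\<lambda>s. sqrt (dir (D j s) (D j s)))"
proof -
  have S1: "D j s \<in> Sobolev \<Omega> 1" if "s \<in> {0..T}" for s using D_Sobolev[OF assms, of 1 s] that by simp
  have lim: "((\<lambda>s. Sobolev_norm \<Omega> 1 (\<lambda>x. D j s x - D j t x)) \<longlongrightarrow> 0) (at t within {0..T})" if "t \<in> {0..T}" for t
    by (rule time_derivative_continuous[OF D_mono[OF assms] that]) simp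
  have main: "continuous_on {0..T} (\<lambda>s. F (D j s))"
    if F: "\<And>w z. w \<in> Sobolev \<Omega> 1 \<Longrightarrow> z \<in> Sobolev \<Omega> 1 \<Longrightarrow> F w \<le> F z + Sobolev_norm \<Omega> 1 (\<lambda>x. w x - z x)" for F :: "'n field \<Rightarrow> real"
    unfolding continuous_on_def
  proof
    fix t assume t: "t \<in> {0..T}"
    have "((\<lambda>s. F (D j s) - F (D j t)) \<longlongrightarrow> 0) (at t within {0..T})"
    proof (rule Lim_null_comparison[OF _ lim[OF t]])
      show "\<forall>\<^sub>F s in at t within {0..T}. norm (F (D j s) - F (D j t)) \<le> Sobolev_norm \<Omega> 1 (\<lambda>x. D j s x - D j t x)"
        unfolding eventually_at_filter
      proof (rule always_eventually, intro allI impI)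
        fix s assume s: "s \<in> {0..T}"
        have "Sobolev_norm \<Omega> 1 (\<lambda>x. D j t x - D j s x) \<le> Sobolev_norm \<Omega> 1 (\<lambda>x. D j s x - D j t x)"
          using Sobolev_norm_triangle[OF Sobolev_diff[OF S1[OF s] S1[OF t]] Sobolev_0, of "-1" 0] by simp
        then show "norm (F (D j s) - F (D j t)) \<le> Sobolev_norm \<Omega> 1 (\<lambda>x. D j s x - D j t x)"
          using F[OF S1[OF s] S1[OF t]] F[OF S1[OF t] S1[OF s]] by simp
      qed
    qed
    then show "((\<lambda>s. F (D j s)) \<longlongrightarrow> F (D j t)) (at t within {0..T})" using Lim_null by blast
  qed
  show "continuous_on {0..T} (\<lambda>s. nrm (D j s))"
  proof (rule main)
    fix w z assume w: "w \<in> Sobolev \<Omega> 1" and z: "z \<in> Sobolev \<Omega> 1"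
    show "nrm w \<le> nrm z + Sobolev_norm \<Omega> 1 (\<lambda>x. w x - z x)"
      using nrm_le_diff[OF Sobolev_L2[OF w] Sobolev_L2[OF z]] nrm_wd_le_Sobolev_norm[of "[]" 1 "\<lambda>x. w x - z x"]
        nrm_wd_Nil[OF Sobolev_L2[OF Sobolev_diff[OF w z]]] by simp
  qed
  show "continuous_on {0..T} (\<lambda>s. sqrt (dir (D j s) (D j s)))"
  proof (rule main)
    fix w z assume w: "w \<in> Sobolev \<Omega> 1" and z: "z \<in> Sobolev \<Omega> 1"
    show "sqrt (dir w w) \<le> sqrt (dir z z) + Sobolev_norm \<Omega> 1 (\<lambda>x. w x - z x)"
      using grad_triangle[OF z Sobolev_diff[OF w z]] dir_le_Sobolev_norm[OF Sobolev_diff[OF w z]] by simp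
  qed
qed

end

section \<open>Summation of the modes\<close>

locale discrete_wave = wave_data \<Omega> k \<xi> \<omega> r T f f' u v u0 u1 D K c + fe_space \<Omega> V
  for \<Omega> :: "(real^'n::finite) set" and k \<xi> \<omega> r T f f' u v u0 u1 D K c V +
  fixes h \<delta> C\<^sub>R :: real
  assumes h: "0 \<le> h" "h \<le> \<delta>" and CR: "0 \<le> C\<^sub>R"
    and approx: "\<And>w. w \<in> H10 \<Omega> \<Longrightarrow> w \<in> Sobolev \<Omega> (r + 1) \<Longrightarrow>
        nrm (\<lambda>x. w x - R_h \<Omega> V w x) \<le> C\<^sub>R * h ^ (r + 1) * Sobolev_norm \<Omega> (r + 1) w"
      "\<And>w. w \<in> H10 \<Omega> \<Longrightarrow> w \<in> Sobolev \<Omega> (r + 1) \<Longrightarrow>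
        sqrt (dir (\<lambda>x. w x - R_h \<Omega> V w x) (\<lambda>x. w x - R_h \<Omega> V w x)) \<le> C\<^sub>R * h ^ r * Sobolev_norm \<Omega> (r + 1) w"
begin

text \<open>The coefficient of the elliptic projection of \<open>D j\<close> in the mode \<open>\<phi>\<close>
  is \<open>\<alpha> j \<phi> / ev \<phi>\<close>, and that of the residual \<open>R_h w - w\<close>
  with \<open>w = D (j + 2)\<close> is \<open>\<rho> j \<phi>\<close>.\<close>

definition "\<alpha> j \<phi> t = dir (D j t) \<phi>"
definition "\<rho> j \<phi> t = \<alpha> (j + 2) \<phi> t / ev \<phi> - ip (D (j + 2) t) \<phi>"

lemma modes_H10: "\<phi> \<in> modes \<Longrightarrow> \<phi> \<in> H10 \<Omega>"
  using modes_V(3) V_H10 by blast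

lemma ev_c: "\<phi> \<in> modes \<Longrightarrow> c \<le> ev \<phi>"
  using ev_lower[OF c(2)] .

lemma \<alpha>_deriv: "j < k + 8 \<Longrightarrow> \<phi> \<in> modes \<Longrightarrow> t \<in> {0..T} \<Longrightarrow>
   (\<alpha> j \<phi> has_real_derivative \<alpha> (Suc j) \<phi> t) (at t within {0..T})"
  using dir_D_derivative[OF _ modes_H10] by (simp add: \<alpha>_def[abs_def])

lemma \<rho>_deriv: "j < k + 6 \<Longrightarrow> \<phi> \<in> modes \<Longrightarrow> t \<in> {0..T} \<Longrightarrow>
   (\<rho> j \<phi> has_real_derivative \<rho> (Suc j) \<phi> t) (at t within {0..T})"
  unfolding \<rho>_def[abs_def]
  using \<alpha>_deriv[of "j + 2" \<phi> t] ip_derivative[OF D_L2[of "j + 2"] V_L2[OF modes_V(3)], of \<phi> t]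
  by (intro DERIV_diff DERIV_cdivide) auto

text \<open>By Green's formula the numbers \<open>\<alpha> j \<phi>\<close> are, up to sign, coefficients of the Laplacian of
  \<open>D j\<close>, so Bessel's inequality applies. Here the eigenvalue in the amplitudes is paid
  by regularity in space.\<close>

lemma \<alpha>_sum: "j < k + 8 \<Longrightarrow> t \<in> {0..T} \<Longrightarrow> (\<Sum>\<phi>\<in>modes. (\<alpha> j \<phi> t)\<^sup>2) \<le> (real CARD('n) * K)\<^sup>2"
proof -
  assume j: "j < k + 8" and t: "t \<in> {0..T}"
  have D2: "D j t \<in> Sobolev \<Omega> 2" using D_Sobolev[OF j _ t, of 2] by simp
  have "(\<Sum>\<phi>\<in>modes. (\<alpha> j \<phi> t)\<^sup>2) = (\<Sum>\<phi>\<in>modes. (ip (laplacian \<Omega> (D j t)) \<phi>)\<^sup>2)"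
    using green[OF D2 modes_H10] by (simp add: \<alpha>_def)
  also have "\<dots> \<le> (nrm (laplacian \<Omega> (D j t)))\<^sup>2" unfolding nrm_sq by (rule bessel[OF laplacian_L2[OF D2]])
  also have "\<dots> \<le> (real CARD('n) * K)\<^sup>2"
    using order_trans[OF laplacian_bound[OF D2] mult_left_mono[OF D_bound[OF j _ t, of 2]]]
    by (intro power_mono nrm_nonneg) auto
  finally show ?thesis .
qed

lemma R_h_D: "j < k + 8 \<Longrightarrow> t \<in> {0..T} \<Longrightarrow>
    nrm (\<lambda>x. D j t x - R_h \<Omega> V (D j t) x) \<le> C\<^sub>R * K * h ^ (r + 1)"
  "j < k + 8 \<Longrightarrow> t \<in> {0..T} \<Longrightarrow>
    sqrt (dir (\<lambda>x. D j t x - R_h \<Omega> V (D j t) x) (\<lambda>x. D j t x - R_h \<Omega> V (D j t) x)) \<le> C\<^sub>R * K * h ^ r"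
proof -
  assume j: "j < k + 8" and t: "t \<in> {0..T}"
  have S: "D j t \<in> Sobolev \<Omega> (r + 1)" "Sobolev_norm \<Omega> (r + 1) (D j t) \<le> K"
    using D_Sobolev[OF j _ t] D_bound[OF j _ t] by auto
  have "C\<^sub>R * h ^ (r + 1) * Sobolev_norm \<Omega> (r + 1) (D j t) \<le> C\<^sub>R * h ^ (r + 1) * K"
    "C\<^sub>R * h ^ r * Sobolev_norm \<Omega> (r + 1) (D j t) \<le> C\<^sub>R * h ^ r * K"
    using S(2) CR h by (intro mult_left_mono mult_nonneg_nonneg zero_le_power; simp)+
  then show "nrm (\<lambda>x. D j t x - R_h \<Omega> V (D j t) x) \<le> C\<^sub>R * K * h ^ (r + 1)"
    "sqrt (dir (\<lambda>x. D j t x - R_h \<Omega> V (D j t) x) (\<lambda>x. D j t x - R_h \<Omega> V (D j t) x)) \<le> C\<^sub>R * K * h ^ r"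
    using approx[OF D_H10[OF j t] S(1)] by (simp_all add: mult_ac)
qed

lemma R_h_D_modes: "j < k + 8 \<Longrightarrow> t \<in> {0..T} \<Longrightarrow> R_h \<Omega> V (D j t) = comb modes (\<lambda>\<phi>. \<alpha> j \<phi> t / ev \<phi>)"
proof -
  assume j: "j < k + 8" and t: "t \<in> {0..T}"
  have S: "D j t \<in> Sobolev \<Omega> 1" using D_Sobolev[OF j _ t, of 1] by simp
  show ?thesis
    by (rule V_eqI[OF R_h_modes(1)[OF S] comb_V[OF modes_V(1)]])
       (simp add: R_h_modes(2)[OF S] ip_comb_modes \<alpha>_def)
qed

lemma \<rho>_sum: "j < k + 6 \<Longrightarrow> t \<in> {0..T} \<Longrightarrow> (\<Sum>\<phi>\<in>modes. (\<rho> j \<phi> t)\<^sup>2) \<le> (C\<^sub>R * K * h ^ (r + 1))\<^sup>2"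
proof -
  assume j: "j < k + 6" and t: "t \<in> {0..T}"
  then have j2: "j + 2 < k + 8" by simp
  let ?w = "D (j + 2) t"
  have S: "?w \<in> Sobolev \<Omega> 1" using D_Sobolev[OF j2 _ t, of 1] by simp
  note RV = R_h_modes(1)[OF S]
  have "(\<rho> j \<phi> t)\<^sup>2 = (ip (\<lambda>x. ?w x - R_h \<Omega> V ?w x) \<phi>)\<^sup>2" if "\<phi> \<in> modes" for \<phi>
    using ip_diff[OF Sobolev_L2[OF S] V_L2[OF RV] V_L2[OF modes_V(3)[OF that]]] R_h_modes(2)[OF S that]
    by (simp add: \<rho>_def \<alpha>_def power2_commute)
  then have "(\<Sum>\<phi>\<in>modes. (\<rho> j \<phi> t)\<^sup>2) = (\<Sum>\<phi>\<in>modes. (ip (\<lambda>x. ?w x - R_h \<Omega> V ?w x) \<phi>)\<^sup>2)" by simp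
  also have "\<dots> \<le> (nrm (\<lambda>x. ?w x - R_h \<Omega> V ?w x))\<^sup>2"
    unfolding nrm_sq by (rule bessel[OF L2_diff[OF Sobolev_L2[OF S] V_L2[OF RV]]])
  also have "\<dots> \<le> (C\<^sub>R * K * h ^ (r + 1))\<^sup>2"
    by (intro power_mono nrm_nonneg R_h_D(1)[OF j2 t])
  finally show ?thesis .
qed

definition "\<sigma> = sqrt (2 + 2 * T\<^sup>2)"

lemma \<alpha>_sup: "j < k + 6 \<Longrightarrow> \<exists>B. (\<forall>\<phi>\<in>modes. 0 \<le> B \<phi> \<and> (\<forall>s\<in>{0..T}. \<bar>\<alpha> j \<phi> s\<bar> \<le> B \<phi>)) \<and> L2_set B modes \<le> \<sigma> * (real CARD('n) * K)"
proof -
  assume j: "j < k + 6"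
  have "\<exists>B. (\<forall>\<phi>\<in>modes. 0 \<le> B \<phi> \<and> (\<forall>s\<in>{0..T}. \<bar>\<alpha> j \<phi> s\<bar> \<le> B \<phi>)) \<and> (\<Sum>\<phi>\<in>modes. (B \<phi>)\<^sup>2) \<le> (2 + 2 * T\<^sup>2) * (real CARD('n) * K)\<^sup>2"
  proof (rule family_sup_bound[where g' = "\<alpha> (Suc j)"])
    show "continuous_on {0..T} (\<alpha> (Suc j) \<phi>)" if "\<phi> \<in> modes" for \<phi>
      by (rule DERIV_continuous_on[OF \<alpha>_deriv[of "Suc j"]]) (use j that in auto)
  qed (use T j \<alpha>_deriv \<alpha>_sum in auto)
  then obtain B where B: "\<forall>\<phi>\<in>modes. 0 \<le> B \<phi> \<and> (\<forall>s\<in>{0..T}. \<bar>\<alpha> j \<phi> s\<bar> \<le> B \<phi>)"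
    "(\<Sum>\<phi>\<in>modes. (B \<phi>)\<^sup>2) \<le> (2 + 2 * T\<^sup>2) * (real CARD('n) * K)\<^sup>2" by blast
  have "L2_set B modes \<le> sqrt ((2 + 2 * T\<^sup>2) * (real CARD('n) * K)\<^sup>2)"
    unfolding L2_set_def by (rule real_sqrt_le_mono[OF B(2)])
  also have "\<dots> = \<sigma> * (real CARD('n) * K)" using K0 by (simp add: real_sqrt_mult \<sigma>_def)
  finally show ?thesis using B(1) by blast
qed

lemma \<rho>_sup: "j < k + 5 \<Longrightarrow> \<exists>B. (\<forall>\<phi>\<in>modes. 0 \<le> B \<phi> \<and> (\<forall>s\<in>{0..T}. \<bar>\<rho> j \<phi> s\<bar> \<le> B \<phi>)) \<and> L2_set B modes \<le> \<sigma> * (C\<^sub>R * K * h ^ (r + 1))"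
proof -
  assume j: "j < k + 5"
  have "\<exists>B. (\<forall>\<phi>\<in>modes. 0 \<le> B \<phi> \<and> (\<forall>s\<in>{0..T}. \<bar>\<rho> j \<phi> s\<bar> \<le> B \<phi>)) \<and> (\<Sum>\<phi>\<in>modes. (B \<phi>)\<^sup>2) \<le> (2 + 2 * T\<^sup>2) * (C\<^sub>R * K * h ^ (r + 1))\<^sup>2"
  proof (rule family_sup_bound[where g' = "\<rho> (Suc j)"])
    show "continuous_on {0..T} (\<rho> (Suc j) \<phi>)" if "\<phi> \<in> modes" for \<phi>
      by (rule DERIV_continuous_on[OF \<rho>_deriv[of "Suc j"]]) (use j that in auto)
  qed (use T j \<rho>_deriv \<rho>_sum in auto)
  then obtain B where B: "\<forall>\<phi>\<in>modes. 0 \<le> B \<phi> \<and> (\<forall>s\<in>{0..T}. \<bar>\<rho> j \<phi> s\<bar> \<le> B \<phi>)"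
    "(\<Sum>\<phi>\<in>modes. (B \<phi>)\<^sup>2) \<le> (2 + 2 * T\<^sup>2) * (C\<^sub>R * K * h ^ (r + 1))\<^sup>2" by blast
  have "L2_set B modes \<le> sqrt ((2 + 2 * T\<^sup>2) * (C\<^sub>R * K * h ^ (r + 1))\<^sup>2)"
    unfolding L2_set_def by (rule real_sqrt_le_mono[OF B(2)])
  also have "\<dots> = \<sigma> * (C\<^sub>R * K * h ^ (r + 1))" using K0 CR h(1) by (simp add: real_sqrt_mult \<sigma>_def)
  finally show ?thesis using B(1) by blast
qed

end

context discrete_wave
begin

text \<open>Constants of the estimates below; they depend on the polynomial degrees, on the data of the
  continuous problem, on \<open>C\<^sub>R\<close> and on the bound \<open>\<delta>\<close> for the
  mesh size, but on no mesh.\<close>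

definition "K6 = galerkin_mode.K6 k \<xi> T c"
definition "C\<^sub>A = (1 + 1 / sqrt c) * (3 * (\<sigma> * (real CARD('n) * K))) + 2 * (\<sigma> * (C\<^sub>R * K * \<delta> ^ (r + 1)))"
definition "C\<^sub>X = C\<^sub>A + 2 * (\<sigma> * (C\<^sub>R * K))"

text \<open>These are the amplitudes that enter \<open>galerkin_mode\<close>. They are square summable over the
  modes, uniformly in the meshes.\<close>

lemma mode_amplitudes:
  "\<exists>A R. (\<forall>\<phi>\<in>modes. \<forall>s\<in>{0..T}.
      (\<forall>j\<in>{k + 2, k + 3}. \<bar>\<alpha> j \<phi> s\<bar> + \<bar>\<rho> j \<phi> s\<bar> \<le> A \<phi> \<and> \<bar>\<alpha> (j + 1) \<phi> s\<bar> / sqrt c \<le> A \<phi>)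
      \<and> (\<forall>j\<in>{0, 1}. \<bar>\<rho> j \<phi> s\<bar> \<le> R \<phi>)) \<and>
    L2_set A modes \<le> C\<^sub>A \<and> L2_set R modes \<le> 2 * (\<sigma> * (C\<^sub>R * K)) * h ^ (r + 1)"
proof -
  have "\<forall>j. \<exists>B. j < k + 6 \<longrightarrow> (\<forall>\<phi>\<in>modes. 0 \<le> B \<phi> \<and> (\<forall>s\<in>{0..T}. \<bar>\<alpha> j \<phi> s\<bar> \<le> B \<phi>)) \<and> L2_set B modes \<le> \<sigma> * (real CARD('n) * K)"
    using \<alpha>_sup by blast
  from choice[OF this] obtain a where a: "\<And>j \<phi>. j < k + 6 \<Longrightarrow> \<phi> \<in> modes \<Longrightarrow> 0 \<le> a j \<phi>"
    "\<And>j \<phi> s. j < k + 6 \<Longrightarrow> \<phi> \<in> modes \<Longrightarrow> s \<in> {0..T} \<Longrightarrow> \<bar>\<alpha> j \<phi> s\<bar> \<le> a j \<phi>"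
    "\<And>j. j < k + 6 \<Longrightarrow> L2_set (a j) modes \<le> \<sigma> * (real CARD('n) * K)" by blast
  have "\<forall>j. \<exists>B. j < k + 5 \<longrightarrow> (\<forall>\<phi>\<in>modes. 0 \<le> B \<phi> \<and> (\<forall>s\<in>{0..T}. \<bar>\<rho> j \<phi> s\<bar> \<le> B \<phi>)) \<and> L2_set B modes \<le> \<sigma> * (C\<^sub>R * K * h ^ (r + 1))"
    using \<rho>_sup by blast
  from choice[OF this] obtain b where b: "\<And>j \<phi>. j < k + 5 \<Longrightarrow> \<phi> \<in> modes \<Longrightarrow> 0 \<le> b j \<phi>"
    "\<And>j \<phi> s. j < k + 5 \<Longrightarrow> \<phi> \<in> modes \<Longrightarrow> s \<in> {0..T} \<Longrightarrow> \<bar>\<rho> j \<phi> s\<bar> \<le> b j \<phi>"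
    "\<And>j. j < k + 5 \<Longrightarrow> L2_set (b j) modes \<le> \<sigma> * (C\<^sub>R * K * h ^ (r + 1))" by blast
  define S where "S \<phi> = a (k + 2) \<phi> + a (k + 3) \<phi> + a (k + 4) \<phi>" for \<phi>
  define A where "A \<phi> = (1 + 1 / sqrt c) * S \<phi> + (b (k + 2) \<phi> + b (k + 3) \<phi>)" for \<phi>
  define R where "R \<phi> = b 0 \<phi> + b 1 \<phi>" for \<phi>
  have sc: "0 < sqrt c" using c by simp
  have "\<bar>\<alpha> j \<phi> s\<bar> + \<bar>\<rho> j \<phi> s\<bar> \<le> A \<phi> \<and> \<bar>\<alpha> (j + 1) \<phi> s\<bar> / sqrt c \<le> A \<phi>"
    if "\<phi> \<in> modes" "s \<in> {0..T}" "j \<in> {k + 2, k + 3}" for j \<phi> s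
  proof -
    have S: "\<bar>\<alpha> j \<phi> s\<bar> \<le> S \<phi>" "\<bar>\<alpha> (j + 1) \<phi> s\<bar> \<le> S \<phi>" "0 \<le> S \<phi>"
      using that a(1)[of "k + 2" \<phi>] a(1)[of "k + 3" \<phi>] a(1)[of "k + 4" \<phi>]
        a(2)[of "k + 2" \<phi> s] a(2)[of "k + 3" \<phi> s] a(2)[of "k + 4" \<phi> s] by (auto simp: S_def numeral_eq_Suc)
    have B: "\<bar>\<rho> j \<phi> s\<bar> \<le> b (k + 2) \<phi> + b (k + 3) \<phi>"
      using that b(1)[of "k + 2" \<phi>] b(1)[of "k + 3" \<phi>] b(2)[of "k + 2" \<phi> s] b(2)[of "k + 3" \<phi> s] by auto
    have "A \<phi> = S \<phi> + S \<phi> / sqrt c + (b (k + 2) \<phi> + b (k + 3) \<phi>)" by (simp add: A_def algebra_simps)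
    moreover have "0 \<le> S \<phi> / sqrt c" "\<bar>\<alpha> (j + 1) \<phi> s\<bar> / sqrt c \<le> S \<phi> / sqrt c"
      using S sc by (auto intro!: divide_right_mono)
    ultimately show ?thesis using S B by linarith
  qed
  moreover have "\<bar>\<rho> j \<phi> s\<bar> \<le> R \<phi>" if "\<phi> \<in> modes" "s \<in> {0..T}" "j \<in> {0, 1}" for j \<phi> s
    using that b(1)[of 0 \<phi>] b(1)[of 1 \<phi>] b(2)[of 0 \<phi> s] b(2)[of 1 \<phi> s] by (auto simp: R_def)
  moreover have "L2_set A modes \<le> C\<^sub>A"
  proof -
    have "L2_set A modes \<le> L2_set (\<lambda>\<phi>. (1 + 1 / sqrt c) * S \<phi>) modes + L2_set (\<lambda>\<phi>. b (k + 2) \<phi> + b (k + 3) \<phi>) modes"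
      unfolding A_def[abs_def] by (rule L2_set_triangle_ineq)
    also have "L2_set (\<lambda>\<phi>. (1 + 1 / sqrt c) * S \<phi>) modes = (1 + 1 / sqrt c) * L2_set S modes"
      using sc by (intro L2_set_right_distrib[symmetric]) simp
    also have "\<dots> \<le> (1 + 1 / sqrt c) * (3 * (\<sigma> * (real CARD('n) * K)))"
    proof (rule mult_left_mono)
      have "L2_set S modes \<le> L2_set (\<lambda>\<phi>. a (k + 2) \<phi> + a (k + 3) \<phi>) modes + L2_set (a (k + 4)) modes"
        unfolding S_def[abs_def] by (rule L2_set_triangle_ineq)
      also have "L2_set (\<lambda>\<phi>. a (k + 2) \<phi> + a (k + 3) \<phi>) modes \<le> L2_set (a (k + 2)) modes + L2_set (a (k + 3)) modes"
        by (rule L2_set_triangle_ineq)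
      finally show "L2_set S modes \<le> 3 * (\<sigma> * (real CARD('n) * K))"
        using a(3)[of "k + 2"] a(3)[of "k + 3"] a(3)[of "k + 4"] by simp
    qed (use sc in simp)
    also have "L2_set (\<lambda>\<phi>. b (k + 2) \<phi> + b (k + 3) \<phi>) modes \<le> L2_set (b (k + 2)) modes + L2_set (b (k + 3)) modes"
      by (rule L2_set_triangle_ineq)
    also have "\<dots> \<le> 2 * (\<sigma> * (C\<^sub>R * K * h ^ (r + 1)))" using b(3)[of "k + 2"] b(3)[of "k + 3"] by simp
    also have "\<dots> \<le> 2 * (\<sigma> * (C\<^sub>R * K * \<delta> ^ (r + 1)))"
      using h CR K0 by (intro mult_left_mono power_mono mult_nonneg_nonneg) (auto simp: \<sigma>_def)
    finally show ?thesis by (simp add: C\<^sub>A_def)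
  qed
  moreover have "L2_set R modes \<le> 2 * (\<sigma> * (C\<^sub>R * K)) * h ^ (r + 1)"
  proof -
    have "L2_set R modes \<le> L2_set (b 0) modes + L2_set (b 1) modes"
      unfolding R_def[abs_def] by (rule L2_set_triangle_ineq)
    then show ?thesis using b(3)[of 0] b(3)[of 1] by simp
  qed
  ultimately show ?thesis by blast
qed

text \<open>The reference solution of a mode is the elliptic projection, corrected in its first component by the
  residual \<open>\<rho> 0 / ev\<close>. The correction moves the residual from the second equation
  to the first, where it appears differentiated in time and divided by the eigenvalue, as
  \<open>galerkin_mode\<close> demands. The correction itself is of the order of the residual.\<close>

lemma lifting_error_modes:
  assumes mesh: "time_mesh T N t"
    and U: "fully_discrete_solution \<Omega> T V k \<xi> \<omega> N t f (R_h \<Omega> V u0, R_h \<Omega> V u1) U"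
    and th: "lifting_polys k \<xi> N t \<theta>"
  defines "\<epsilon> \<equiv> step_size N t ^ (k + 2)"
  shows "\<exists>L0 L1 Y. (\<forall>n<N. \<forall>s\<in>{t n..t (Suc n)}.
      lifting \<Omega> V t \<theta> f U s = (comb modes (\<lambda>\<phi>. poly (L0 \<phi> n) s), comb modes (\<lambda>\<phi>. poly (L1 \<phi> n) s)) \<and>
      (\<forall>\<phi>\<in>modes. sqrt (ev \<phi>) * \<bar>\<alpha> 0 \<phi> s / ev \<phi> - poly (L0 \<phi> n) s\<bar> \<le> (K6 + 1 / sqrt c) * Y \<phi> \<and>
         \<bar>\<alpha> 1 \<phi> s / ev \<phi> - poly (L1 \<phi> n) s\<bar> \<le> K6 * Y \<phi>)) \<and>
    L2_set Y modes \<le> C\<^sub>X * (\<epsilon> + h ^ (r + 1))"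
proof -
  let ?\<tau> = "step_size N t" and ?\<theta> = "\<lambda>n. \<theta> (Suc n)"
  have lt: "t n < t (Suc n)" if "n < N" for n using mesh that by (simp add: time_mesh_def)
  have t0: "t 0 = 0" and N: "0 < N" using mesh by (auto simp: time_mesh_def)
  have tau: "t (Suc n) - t n \<le> ?\<tau>" if "n < N" for n
    unfolding step_size_def using that by (intro Max_ge) (auto intro!: image_eqI[of _ _ "Suc n"])
  have tau0: "0 \<le> ?\<tau>" using tau[OF N] lt[OF N] by simp
  have fL: "f s \<in> L2 \<Omega>" if "s \<in> {0..T}" for s using f that by (simp add: has_time_derivative_def)
  have U0: "U 0 = (R_h \<Omega> V u0, R_h \<Omega> V u1)" using U by (simp add: fully_discrete_solution_def)
  obtain P0 where P0: "\<And>n \<phi>. n < N \<Longrightarrow> degree (P0 n \<phi>) \<le> k"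
    "\<And>n s. n < N \<Longrightarrow> s \<in> {t n..t (Suc n)} \<Longrightarrow> fst (U s) = comb modes (\<lambda>\<phi>. poly (P0 n \<phi>) s)"
    using X_tau_modes[of "\<lambda>s. fst (U s)" T N t k] U mesh unfolding fully_discrete_solution_def by blast
  obtain P1 where P1: "\<And>n \<phi>. n < N \<Longrightarrow> degree (P1 n \<phi>) \<le> k"
    "\<And>n s. n < N \<Longrightarrow> s \<in> {t n..t (Suc n)} \<Longrightarrow> snd (U s) = comb modes (\<lambda>\<phi>. poly (P1 n \<phi>) s)"
    using X_tau_modes[of "\<lambda>s. snd (U s)" T N t k] U mesh unfolding fully_discrete_solution_def by blast
  have start: "poly (P0 0 \<phi>) 0 = \<alpha> 0 \<phi> 0 / ev \<phi>" "poly (P1 0 \<phi>) 0 = \<alpha> 1 \<phi> 0 / ev \<phi>" if "\<phi> \<in> modes" for \<phi>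
  proof -
    have "comb modes (\<lambda>\<phi>. poly (P0 0 \<phi>) 0) = comb modes (\<lambda>\<phi>. \<alpha> 0 \<phi> 0 / ev \<phi>)"
      using P0(2)[OF N, of 0] lt[OF N] t0 U0 R_h_D_modes[of 0 0] R_h_initial(1)[of V] T by simp
    from arg_cong[OF this, of "\<lambda>w. ip w \<phi>"] show "poly (P0 0 \<phi>) 0 = \<alpha> 0 \<phi> 0 / ev \<phi>"
      by (simp add: ip_comb_modes that)
    have "comb modes (\<lambda>\<phi>. poly (P1 0 \<phi>) 0) = comb modes (\<lambda>\<phi>. \<alpha> 1 \<phi> 0 / ev \<phi>)"
      using P1(2)[OF N, of 0] lt[OF N] t0 U0 R_h_D_modes[of 1 0] R_h_initial(2)[of V] T by simp
    from arg_cong[OF this, of "\<lambda>w. ip w \<phi>"] show "poly (P1 0 \<phi>) 0 = \<alpha> 1 \<phi> 0 / ev \<phi>"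
      by (simp add: ip_comb_modes that)
  qed
  have cont: "poly (P0 n \<phi>) (t (Suc n)) = poly (P0 (Suc n) \<phi>) (t (Suc n))"
    "poly (P1 n \<phi>) (t (Suc n)) = poly (P1 (Suc n) \<phi>) (t (Suc n))" if "Suc n < N" "\<phi> \<in> modes" for n \<phi>
  proof -
    have n: "n < N" using that by simp
    have "comb modes (\<lambda>\<phi>. poly (P0 n \<phi>) (t (Suc n))) = comb modes (\<lambda>\<phi>. poly (P0 (Suc n) \<phi>) (t (Suc n)))"
      using P0(2)[OF n, of "t (Suc n)"] P0(2)[OF that(1), of "t (Suc n)"] lt[OF n] lt[OF that(1)] by simp
    from arg_cong[OF this, of "\<lambda>w. ip w \<phi>"] show "poly (P0 n \<phi>) (t (Suc n)) = poly (P0 (Suc n) \<phi>) (t (Suc n))"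
      by (simp add: ip_comb_modes that)
    have "comb modes (\<lambda>\<phi>. poly (P1 n \<phi>) (t (Suc n))) = comb modes (\<lambda>\<phi>. poly (P1 (Suc n) \<phi>) (t (Suc n)))"
      using P1(2)[OF n, of "t (Suc n)"] P1(2)[OF that(1), of "t (Suc n)"] lt[OF n] lt[OF that(1)] by simp
    from arg_cong[OF this, of "\<lambda>w. ip w \<phi>"] show "poly (P1 n \<phi>) (t (Suc n)) = poly (P1 (Suc n) \<phi>) (t (Suc n))"
      by (simp add: ip_comb_modes that)
  qed
  have \<theta>: "degree (?\<theta> n) \<le> k + 1" "\<And>\<mu>. \<mu> \<le> k \<Longrightarrow> poly (?\<theta> n) (node (t n) (t (Suc n)) \<mu>) = 0"
    "poly (pderiv (?\<theta> n)) (t n) = 1" if "n < N" for n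
    using th that unfolding lifting_polys_def gl_point_def node_def by (auto dest!: bspec[of _ _ "Suc n"])
  have \<theta>_ends: "poly (?\<theta> n) (t n) = 0" "poly (?\<theta> n) (t (Suc n)) = 0" if "n < N" for n
    using \<theta>(2)[OF that, of 0] \<theta>(2)[OF that, of k] by (simp_all add: node_0 node_k)
  define L0 where "L0 \<phi> = mode_lift t ?\<theta> (\<lambda>n. P0 n \<phi>) (poly (P1 0 \<phi>) 0)" for \<phi>
  define L1 where "L1 \<phi> = mode_lift t ?\<theta> (\<lambda>n. P1 n \<phi>) (ip (f 0) \<phi> - ev \<phi> * poly (P0 0 \<phi>) 0)" for \<phi>
  obtain A R where AR: "\<And>\<phi> s j. \<phi> \<in> modes \<Longrightarrow> s \<in> {0..T} \<Longrightarrow> j \<in> {k + 2, k + 3} \<Longrightarrow> \<bar>\<alpha> j \<phi> s\<bar> + \<bar>\<rho> j \<phi> s\<bar> \<le> A \<phi>"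
    "\<And>\<phi> s j. \<phi> \<in> modes \<Longrightarrow> s \<in> {0..T} \<Longrightarrow> j \<in> {k + 2, k + 3} \<Longrightarrow> \<bar>\<alpha> (j + 1) \<phi> s\<bar> / sqrt c \<le> A \<phi>"
    "\<And>\<phi> s j. \<phi> \<in> modes \<Longrightarrow> s \<in> {0..T} \<Longrightarrow> j \<in> {0, 1} \<Longrightarrow> \<bar>\<rho> j \<phi> s\<bar> \<le> R \<phi>"
    "L2_set A modes \<le> C\<^sub>A" "L2_set R modes \<le> 2 * (\<sigma> * (C\<^sub>R * K)) * h ^ (r + 1)"
    using mode_amplitudes by blast
  define Y where "Y \<phi> = A \<phi> * \<epsilon> + R \<phi>" for \<phi>
  have lift: "lifting \<Omega> V t \<theta> f U s = (comb modes (\<lambda>\<phi>. poly (L0 \<phi> n) s), comb modes (\<lambda>\<phi>. poly (L1 \<phi> n) s))"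
    if n: "n < N" and s: "s \<in> {t n..t (Suc n)}" for n s
  proof -
    define d where "d = P_h2 \<Omega> V (\<lambda>x. 0, f 0) - A_h2 \<Omega> V (U 0)"
    have w0: "fst (U 0) = comb modes (\<lambda>\<phi>. poly (P0 0 \<phi>) 0)" "snd (U 0) = comb modes (\<lambda>\<phi>. poly (P1 0 \<phi>) 0)"
      using P0(2)[OF N, of 0] P1(2)[OF N, of 0] lt[OF N] t0 by auto
    have f0: "f 0 \<in> L2 \<Omega>" using fL[of 0] T by simp
    have V0: "fst (U 0) \<in> V" "snd (U 0) \<in> V" unfolding w0 by (auto intro: comb_V[OF modes_V(1)])
    note ph0 = P_h_modes[OF L2_0] and phf = P_h_modes[OF f0] and ah = A_h_modes[OF V_S1[OF V0(1)]]
    have d0: "fst d = comb modes (\<lambda>\<phi>. poly (P1 0 \<phi>) 0)"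
    proof (rule V_eqI[OF _ comb_V[OF modes_V(1)]])
      have e: "fst d = (\<lambda>x. 1 * P_h \<Omega> V (\<lambda>x. 0) x + 1 * snd (U 0) x)"
        by (simp add: d_def P_h2_def A_h2_def fun_diff_def)
      show "fst d \<in> V" unfolding e by (rule V_lincomb[OF ph0(1) V0(2)])
      fix \<phi> assume \<phi>: "\<phi> \<in> modes"
      have "ip (fst d) \<phi> = 1 * ip (P_h \<Omega> V (\<lambda>x. 0)) \<phi> + 1 * ip (snd (U 0)) \<phi>"
        unfolding e by (rule ip_lincomb[OF V_L2[OF ph0(1)] V_L2[OF V0(2)] V_L2[OF modes_V(3)[OF \<phi>]]])
      then show "ip (fst d) \<phi> = ip (comb modes (\<lambda>\<phi>. poly (P1 0 \<phi>) 0)) \<phi>"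
        using ph0(2)[OF \<phi>] w0(2) by (simp add: ip_alt)
    qed
    have d1: "snd d = comb modes (\<lambda>\<phi>. ip (f 0) \<phi> - ev \<phi> * poly (P0 0 \<phi>) 0)"
    proof (rule V_eqI[OF _ comb_V[OF modes_V(1)]])
      have e: "snd d = (\<lambda>x. 1 * P_h \<Omega> V (f 0) x + (-1) * A_h \<Omega> V (fst (U 0)) x)"
        by (simp add: d_def P_h2_def A_h2_def fun_diff_def)
      show "snd d \<in> V" unfolding e by (rule V_lincomb[OF phf(1) ah(1)])
      fix \<phi> assume \<phi>: "\<phi> \<in> modes"
      have "ip (snd d) \<phi> = 1 * ip (P_h \<Omega> V (f 0)) \<phi> + (-1) * ip (A_h \<Omega> V (fst (U 0))) \<phi>"
        unfolding e by (rule ip_lincomb[OF V_L2[OF phf(1)] V_L2[OF ah(1)] V_L2[OF modes_V(3)[OF \<phi>]]])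
      then show "ip (snd d) \<phi> = ip (comb modes (\<lambda>\<phi>. ip (f 0) \<phi> - ev \<phi> * poly (P0 0 \<phi>) 0)) \<phi>"
        using phf(2)[OF \<phi>] ah(2)[OF \<phi>] by (simp add: w0(1) dir_comb_modes[OF \<phi>] ip_comb_modes[OF \<phi>])
    qed
    have "lifting \<Omega> V t \<theta> f U s = (lift_comp t \<theta> (\<lambda>s. fst (U s)) (fst d) s, lift_comp t \<theta> (\<lambda>s. snd (U s)) (snd d) s)"
      unfolding lifting_def d_def Let_def ..
    also have "lift_comp t \<theta> (\<lambda>s. fst (U s)) (fst d) s = comb modes (\<lambda>\<phi>. poly (L0 \<phi> n) s)"
      unfolding L0_def by (rule lift_comp_modes[OF mesh P0(2) d0 \<theta>_ends n s])
    also have "lift_comp t \<theta> (\<lambda>s. snd (U s)) (snd d) s = comb modes (\<lambda>\<phi>. poly (L1 \<phi> n) s)"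
      unfolding L1_def by (rule lift_comp_modes[OF mesh P1(2) d1 \<theta>_ends n s])
    finally show ?thesis .
  qed
  have err: "sqrt (ev \<phi>) * \<bar>\<alpha> 0 \<phi> s / ev \<phi> - poly (L0 \<phi> n) s\<bar> \<le> (K6 + 1 / sqrt c) * Y \<phi>"
    "\<bar>\<alpha> 1 \<phi> s / ev \<phi> - poly (L1 \<phi> n) s\<bar> \<le> K6 * Y \<phi>"
    if \<phi>: "\<phi> \<in> modes" and n: "n < N" and s: "s \<in> {t n..t (Suc n)}" for \<phi> n s
  proof -
    define W0 where "W0 j x = \<alpha> j \<phi> x / ev \<phi> - \<rho> j \<phi> x / ev \<phi>" for j x
    define W1 where "W1 j x = \<alpha> (j + 1) \<phi> x / ev \<phi>" for j x
    have pos: "0 < ev \<phi>" and cev: "c \<le> ev \<phi>" using ev_pos[OF \<phi>] ev_c[OF \<phi>] by auto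
    have sc: "0 < sqrt c" "sqrt c \<le> sqrt (ev \<phi>)" using c(1) cev by auto
    interpret gm: galerkin_mode k \<xi> \<omega> T N t ?\<tau> "ev \<phi>" c "A \<phi>" "R \<phi>" ?\<theta> "\<lambda>n. P0 n \<phi>" "\<lambda>n. P1 n \<phi>" W0 W1
      "\<lambda>s. ip (f s) \<phi>" "\<lambda>s. - (\<rho> 1 \<phi> s / ev \<phi>)"
    proof
      show "time_mesh T N t" by (rule mesh)
      show "n < N \<Longrightarrow> t (Suc n) - t n \<le> ?\<tau>" for n by (rule tau)
      show "0 < c" "c \<le> ev \<phi>" using c(1) cev by auto
      show "n < N \<Longrightarrow> degree (?\<theta> n) \<le> k + 1" for n by (rule \<theta>(1))
      show "n < N \<Longrightarrow> \<mu> \<le> k \<Longrightarrow> poly (?\<theta> n) (node (t n) (t (Suc n)) \<mu>) = 0" for n \<mu> by (rule \<theta>(2))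
      show "n < N \<Longrightarrow> poly (pderiv (?\<theta> n)) (t n) = 1" for n by (rule \<theta>(3))
      show "n < N \<Longrightarrow> degree (P0 n \<phi>) \<le> k" "n < N \<Longrightarrow> degree (P1 n \<phi>) \<le> k" for n
        by (rule P0(1), assumption, rule P1(1))
      show "Suc n < N \<Longrightarrow> poly (P0 n \<phi>) (t (Suc n)) = poly (P0 (Suc n) \<phi>) (t (Suc n))"
        "Suc n < N \<Longrightarrow> poly (P1 n \<phi>) (t (Suc n)) = poly (P1 (Suc n) \<phi>) (t (Suc n))" for n
        using cont \<phi> by auto
    next
      fix n and \<psi> :: "real poly" assume n: "n < N" and \<psi>: "degree \<psi> \<le> k - 1"
      note g = galerkin_modes[where ?P0.0 = P0 and ?P1.0 = P1 and n = n, OF U fL mesh P0(2) P1(2) n \<phi> \<psi>]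
      show "pint (t n) (t (Suc n)) (pderiv (P0 n \<phi>) * \<psi>) = pint (t n) (t (Suc n)) (P1 n \<phi> * \<psi>)" by (rule g(1))
      have "Q_n k \<xi> \<omega> t (Suc n) (\<lambda>s. ip (f s) \<phi> * poly \<psi> s) = quad (t n) (t (Suc n)) (\<lambda>s. ip (f s) \<phi> * poly \<psi> s)"
        by (simp add: Q_n_def quad_def gl_point_def node_def)
      also have "\<dots> = pint (t n) (t (Suc n)) (interp (t n) (t (Suc n)) (\<lambda>s. ip (f s) \<phi>) * \<psi>)"
        by (rule quad_interp[OF lt[OF n] \<psi>])
      finally show "pint (t n) (t (Suc n)) (pderiv (P1 n \<phi>) * \<psi>)
        = pint (t n) (t (Suc n)) ((interp (t n) (t (Suc n)) (\<lambda>s. ip (f s) \<phi>) - smult (ev \<phi>) (P0 n \<phi>)) * \<psi>)"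
        using g(2) by (simp add: distrib_right left_diff_distrib pint_add pint_diff)
    next
      show "derivs {0..T} (k + 3) W0" unfolding derivs_def W0_def[abs_def]
        using \<alpha>_deriv[OF _ \<phi>] \<rho>_deriv[OF _ \<phi>] pos by (auto intro!: DERIV_diff DERIV_cdivide)
      show "derivs {0..T} (k + 3) W1" unfolding derivs_def W1_def[abs_def]
        using \<alpha>_deriv[OF _ \<phi>] pos by (auto intro!: DERIV_cdivide)
    next
      fix x assume x: "x \<in> {0..T}"
      show "W0 1 x = W1 0 x + - (\<rho> 1 \<phi> x / ev \<phi>)" by (simp add: W0_def W1_def)
      show "W1 1 x = ip (f x) \<phi> - ev \<phi> * W0 0 x"
        using weak_equation[OF modes_H10[OF \<phi>] x] pos
        by (simp add: W0_def W1_def \<rho>_def \<alpha>_def right_diff_distrib diff_divide_distrib numeral_2_eq_2)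
      show "ev \<phi> * \<bar>- (\<rho> 1 \<phi> x / ev \<phi>)\<bar> \<le> R \<phi>" using AR(3)[OF \<phi> x, of 1] pos by (simp add: abs_divide)
      fix j assume j: "j \<in> {k + 2, k + 3}"
      have "ev \<phi> * \<bar>W0 j x\<bar> = \<bar>\<alpha> j \<phi> x - \<rho> j \<phi> x\<bar>"
        using pos by (simp add: W0_def diff_divide_distrib[symmetric] abs_divide)
      then show "ev \<phi> * \<bar>W0 j x\<bar> \<le> A \<phi>" using AR(1)[OF \<phi> x j] by linarith
      have "sqrt (ev \<phi>) * \<bar>W1 j x\<bar> = \<bar>\<alpha> (j + 1) \<phi> x\<bar> / sqrt (ev \<phi>)"
        using pos by (simp add: W1_def abs_divide field_simps flip: real_sqrt_mult)
      also have "\<dots> \<le> \<bar>\<alpha> (j + 1) \<phi> x\<bar> / sqrt c" using sc by (intro divide_left_mono) auto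
      finally show "sqrt (ev \<phi>) * \<bar>W1 j x\<bar> \<le> A \<phi>" using AR(2)[OF \<phi> x j] by linarith
    next
      show "ev \<phi> * \<bar>W0 0 0 - poly (P0 0 \<phi>) 0\<bar> \<le> R \<phi>"
        using AR(3)[OF \<phi>, of 0 0] T pos start(1)[OF \<phi>] by (simp add: W0_def abs_divide)
      show "W1 0 0 = poly (P1 0 \<phi>) 0" using start(2)[OF \<phi>] by (simp add: W1_def)
    qed
    have X: "gm.X = Y \<phi>" by (simp add: gm.X_def Y_def \<epsilon>_def)
    have K6: "gm.K6 = K6" by (simp add: K6_def)
    have sT: "s \<in> {0..T}" using gm.step_subset[OF n] s by blast
    have RY: "R \<phi> \<le> Y \<phi>" using gm.A_le_X(3) X by simp
    note me = gm.mode_error[OF n s, unfolded X K6]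
    have "sqrt (ev \<phi>) * \<bar>\<rho> 0 \<phi> s / ev \<phi>\<bar> = \<bar>\<rho> 0 \<phi> s\<bar> / sqrt (ev \<phi>)"
      using pos by (simp add: abs_divide field_simps flip: real_sqrt_mult)
    also have "\<dots> \<le> \<bar>\<rho> 0 \<phi> s\<bar> / sqrt c" using sc by (intro divide_left_mono) auto
    also have "\<dots> \<le> Y \<phi> / sqrt c" using AR(3)[OF \<phi> sT, of 0] RY sc by (intro divide_right_mono) auto
    finally have r0: "sqrt (ev \<phi>) * \<bar>\<rho> 0 \<phi> s / ev \<phi>\<bar> \<le> Y \<phi> / sqrt c" .
    have "\<bar>\<alpha> 0 \<phi> s / ev \<phi> - poly (L0 \<phi> n) s\<bar> \<le> \<bar>W0 0 s - poly (L0 \<phi> n) s\<bar> + \<bar>\<rho> 0 \<phi> s / ev \<phi>\<bar>"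
      unfolding W0_def by linarith
    then have "sqrt (ev \<phi>) * \<bar>\<alpha> 0 \<phi> s / ev \<phi> - poly (L0 \<phi> n) s\<bar> \<le> sqrt (ev \<phi>) * (\<bar>W0 0 s - poly (L0 \<phi> n) s\<bar> + \<bar>\<rho> 0 \<phi> s / ev \<phi>\<bar>)"
      using pos by (intro mult_left_mono) auto
    also have "\<dots> \<le> K6 * Y \<phi> + Y \<phi> / sqrt c"
      unfolding distrib_left by (intro add_mono r0 me(1)[folded L0_def])
    finally show "sqrt (ev \<phi>) * \<bar>\<alpha> 0 \<phi> s / ev \<phi> - poly (L0 \<phi> n) s\<bar> \<le> (K6 + 1 / sqrt c) * Y \<phi>"
      by (simp add: algebra_simps)
    show "\<bar>\<alpha> 1 \<phi> s / ev \<phi> - poly (L1 \<phi> n) s\<bar> \<le> K6 * Y \<phi>"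
      using me(2)[folded L1_def] by (simp add: W1_def)
  qed
  have "L2_set Y modes \<le> L2_set (\<lambda>\<phi>. A \<phi> * \<epsilon>) modes + L2_set R modes"
    unfolding Y_def[abs_def] by (rule L2_set_triangle_ineq)
  also have "L2_set (\<lambda>\<phi>. A \<phi> * \<epsilon>) modes = L2_set A modes * \<epsilon>"
    using tau0 by (intro L2_set_left_distrib[symmetric]) (simp add: \<epsilon>_def)
  also have "\<dots> \<le> C\<^sub>A * \<epsilon>" using AR(4) tau0 by (intro mult_right_mono) (auto simp: \<epsilon>_def)
  also have "C\<^sub>A * \<epsilon> + L2_set R modes \<le> C\<^sub>X * (\<epsilon> + h ^ (r + 1))"
  proof -
    have "0 \<le> C\<^sub>A" using order_trans[OF L2_set_nonneg AR(4)] .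
    then have "0 \<le> C\<^sub>A * h ^ (r + 1)" using h by simp
    moreover have "0 \<le> 2 * (\<sigma> * (C\<^sub>R * K)) * \<epsilon>"
      using CR K0 tau0 by (auto simp: \<sigma>_def \<epsilon>_def intro!: mult_nonneg_nonneg)
    ultimately show ?thesis using AR(5) by (simp add: C\<^sub>X_def algebra_simps)
  qed
  finally have "L2_set Y modes \<le> C\<^sub>X * (\<epsilon> + h ^ (r + 1))" by simp
  then show ?thesis using lift err by (intro exI[of _ L0] exI[of _ L1] exI[of _ Y]) blast
qed

end

section \<open>Errors at all times and in the mean over time\<close>

lemma time_mesh_mono:
  assumes mesh: "time_mesh T N t" and l: "m \<le> l" "l \<le> N"
  shows "t m \<le> t l"
  using l
proof (induction l rule: dec_induct)
  case (step l)
  then have "t m \<le> t l" "t l < t (Suc l)" using mesh by (auto simp: time_mesh_def)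
  then show ?case by simp
qed simp

lemma time_mesh_cover:
  assumes mesh: "time_mesh T N t" and s: "s \<in> {0..T}"
  shows "\<exists>n<N. s \<in> {t n..t (Suc n)}"
proof -
  have "m \<le> N \<Longrightarrow> s \<le> t m \<Longrightarrow> 0 < m \<Longrightarrow> \<exists>n<m. s \<in> {t n..t (Suc n)}" for m
  proof (induction m)
    case (Suc m)
    show ?case
    proof (cases "s \<le> t m \<and> 0 < m")
      case True
      then show ?thesis using Suc.IH Suc.prems by (auto intro: less_SucI)
    next
      case False
      then have "t m \<le> s" using s mesh by (cases "m = 0") (auto simp: time_mesh_def)
      then show ?thesis using Suc.prems by auto
    qed
  qed simp
  then show ?thesis using mesh s by (auto simp: time_mesh_def)
qed

lemma time_mesh_continuous:
  fixes g :: "real \<Rightarrow> real"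
  assumes mesh: "time_mesh T N t" and c: "\<And>n. n < N \<Longrightarrow> continuous_on {t n..t (Suc n)} g"
  shows "continuous_on {0..T} g"
proof -
  have "m \<le> N \<Longrightarrow> continuous_on {0..t m} g" for m
  proof (induction m)
    case 0
    then show ?case using mesh by (simp add: time_mesh_def)
  next
    case (Suc m)
    have "t m < t (Suc m)" "0 \<le> t m" using mesh Suc.prems time_mesh_mono[OF mesh, of 0 m] by (auto simp: time_mesh_def)
    then have "{0..t (Suc m)} = {0..t m} \<union> {t m..t (Suc m)}" by auto
    then show ?case using Suc c[of m] by (auto intro: continuous_on_closed_Un)
  qed
  then show ?thesis using mesh by (auto simp: time_mesh_def)
qed

lemma step_size_pos: "time_mesh T N t \<Longrightarrow> 0 < step_size N t"
proof -
  assume mesh: "time_mesh T N t"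
  then have N: "0 < N" by (simp add: time_mesh_def)
  have "t 1 - t 0 \<le> step_size N t"
    unfolding step_size_def using N by (intro Max_ge) (auto intro!: image_eqI[of _ _ 1])
  then show ?thesis using mesh N by (auto simp: time_mesh_def)
qed

text \<open>Continuity supplies measurability, and the norm in time is at most \<open>sqrt T\<close> times a
  uniform bound.\<close>

lemma L2_time_continuous:
  fixes w :: "real \<Rightarrow> real^'n::finite \<Rightarrow> 'b::real_inner"
  assumes T: "0 < T" and c: "continuous_on {0..T} (\<lambda>s. (l2_norm \<Omega> (w s))\<^sup>2)"
    and B: "\<And>s. s \<in> {0..T} \<Longrightarrow> l2_norm \<Omega> (w s) \<le> B" and nn: "\<And>s. 0 \<le> l2_norm \<Omega> (w s)"
  shows "L2_time \<Omega> T w" "L2_time_norm \<Omega> T w \<le> sqrt T * B"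
proof -
  let ?M = "lebesgue_on {0<..T}" and ?g = "\<lambda>s. (l2_norm \<Omega> (w s))\<^sup>2"
  have "set_integrable lebesgue {0<..T} ?g"
    by (rule set_integrable_subset[OF absolutely_integrable_continuous_real[OF c]]) auto
  then have int: "integrable ?M ?g" by (simp add: set_integrable_def integrable_restrict_space)
  then show "L2_time \<Omega> T w" by (simp add: L2_time_def)
  have meas: "emeasure lebesgue {0<..T} = ennreal T"
    using T by (simp add: emeasure_lborel_Ioc)
  have B0: "0 \<le> B" using order_trans[OF nn B[of 0]] T by simp
  have "(LINT s|?M. ?g s) \<le> (LINT s|?M. B\<^sup>2)"
  proof (rule integral_mono[OF int])
    show "integrable ?M (\<lambda>s. B\<^sup>2)"
      by (rule finite_measure.integrable_const) (auto intro!: finite_measureI simp: emeasure_restrict_space meas)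
    show "?g s \<le> B\<^sup>2" if "s \<in> space ?M" for s
      using that by (intro power_mono B nn) auto
  qed
  also have "\<dots> = T * B\<^sup>2" using T meas by (simp add: measure_def emeasure_restrict_space)
  finally have "L2_time_norm \<Omega> T w \<le> sqrt (T * B\<^sup>2)" unfolding L2_time_norm_def by (rule real_sqrt_le_mono)
  then show "L2_time_norm \<Omega> T w \<le> sqrt T * B" using B0 by (simp add: real_sqrt_mult)
qed

context fe_space
begin

lemma nrm_comb: "nrm (comb modes e) = L2_set e modes"
  using parseval[OF comb_V[OF modes_V(1)], of e] by (simp add: l2_norm_def L2_set_def ip_comb_modes)

lemma dir_comb_sqrt: "sqrt (dir (comb modes e) (comb modes e)) = L2_set (\<lambda>\<phi>. sqrt (ev \<phi>) * e \<phi>) modes"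
  using parseval_dir[OF comb_V[OF modes_V(1)], of e]
  by (simp add: L2_set_def ip_comb_modes power_mult_distrib ev_pos less_imp_le)

text \<open>Expanding the square shows the error as a continuous function of time on each closed step.\<close>

lemma ip_minus_comb: "w \<in> L2 \<Omega> \<Longrightarrow> ip (\<lambda>x. w x - comb modes e x) (\<lambda>x. w x - comb modes e x)
   = ip w w - 2 * (\<Sum>\<phi>\<in>modes. e \<phi> * ip w \<phi>) + (\<Sum>\<phi>\<in>modes. (e \<phi>)\<^sup>2)"
proof -
  assume w: "w \<in> L2 \<Omega>"
  let ?c = "comb modes e"
  have c: "?c \<in> V" by (rule comb_V[OF modes_V(1)])
  have d: "(\<lambda>x. w x - ?c x) \<in> L2 \<Omega>" by (rule L2_diff[OF w V_L2[OF c]])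
  have "ip ?c w = (\<Sum>\<phi>\<in>modes. e \<phi> * ip w \<phi>)"
    using ip_comb[OF modes_V(1) w, of e] by (simp add: ip_sym[of _ w])
  moreover have "ip ?c ?c = (\<Sum>\<phi>\<in>modes. (e \<phi>)\<^sup>2)" using parseval[OF c] by (simp add: ip_comb_modes)
  moreover have "ip (\<lambda>x. w x - ?c x) (\<lambda>x. w x - ?c x) = ip w (\<lambda>x. w x - ?c x) - ip ?c (\<lambda>x. w x - ?c x)"
    by (rule ip_diff[OF w V_L2[OF c] d])
  ultimately show ?thesis
    using ip_diff[OF w V_L2[OF c] w] ip_diff[OF w V_L2[OF c] V_L2[OF c]]
    by (simp add: ip_sym[of w "\<lambda>x. w x - ?c x"] ip_sym[of ?c "\<lambda>x. w x - ?c x"] ip_sym[of w ?c])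
qed

lemma dir_minus_comb: "w \<in> Sobolev \<Omega> 1 \<Longrightarrow> dir (\<lambda>x. w x - comb modes e x) (\<lambda>x. w x - comb modes e x)
   = dir w w - 2 * (\<Sum>\<phi>\<in>modes. e \<phi> * dir w \<phi>) + (\<Sum>\<phi>\<in>modes. ev \<phi> * (e \<phi>)\<^sup>2)"
proof -
  assume w: "w \<in> Sobolev \<Omega> 1"
  let ?c = "comb modes e"
  have c: "?c \<in> V" by (rule comb_V[OF modes_V(1)])
  have d: "(\<lambda>x. w x - ?c x) \<in> Sobolev \<Omega> 1" by (rule Sobolev_diff[OF w V_S1[OF c]])
  have "dir ?c w = (\<Sum>\<phi>\<in>modes. e \<phi> * dir w \<phi>)"
    using dir_comb[OF modes_V(1) w, of e] by (simp add: dir_sym[of _ w])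
  moreover have "dir ?c ?c = (\<Sum>\<phi>\<in>modes. ev \<phi> * (e \<phi>)\<^sup>2)" using parseval_dir[OF c] by (simp add: ip_comb_modes)
  moreover have "dir (\<lambda>x. w x - ?c x) (\<lambda>x. w x - ?c x) = dir w (\<lambda>x. w x - ?c x) - dir ?c (\<lambda>x. w x - ?c x)"
    by (rule dir_diff[OF w V_S1[OF c] d])
  ultimately show ?thesis
    using dir_diff[OF w V_S1[OF c] w] dir_diff[OF w V_S1[OF c] V_S1[OF c]]
    by (simp add: dir_sym[of w "\<lambda>x. w x - ?c x"] dir_sym[of ?c "\<lambda>x. w x - ?c x"] dir_sym[of w ?c])
qed

end

context discrete_wave
begin

definition "C\<^sub>6 = \<bar>K6\<bar> + 1 / sqrt c"
definition "C\<^sub>0 = C\<^sub>R * K + C\<^sub>6 * C\<^sub>X * (1 + 1 / sqrt c)"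
definition "C\<^sub>1 = C\<^sub>R * K + C\<^sub>6 * C\<^sub>X * (1 + \<delta>)"

lemma C_nonneg: "0 \<le> C\<^sub>6" "0 \<le> C\<^sub>X" "0 \<le> C\<^sub>0" "0 \<le> C\<^sub>1"
proof -
  show C6: "0 \<le> C\<^sub>6" using c by (simp add: C\<^sub>6_def)
  show CX: "0 \<le> C\<^sub>X" unfolding C\<^sub>X_def C\<^sub>A_def
    using c CR K0 h by (intro add_nonneg_nonneg mult_nonneg_nonneg zero_le_power) (auto simp: \<sigma>_def)
  show "0 \<le> C\<^sub>0" "0 \<le> C\<^sub>1" unfolding C\<^sub>0_def C\<^sub>1_def
    using c CR K0 h C6 CX by (intro add_nonneg_nonneg mult_nonneg_nonneg; simp)+
qed

text \<open>The error is split at the elliptic projection. The projection error is estimated by assumption; the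
  remaining part lies in the finite element space, where the estimates of the modes are summed by
  Parseval's identity. For the gradient the eigenvalues enter as weights, for the norm in
  \<open>L\<^sup>2\<close> they are bounded below by \<open>c\<close>.\<close>

lemma error_norms:
  assumes mesh: "time_mesh T N t"
    and U: "fully_discrete_solution \<Omega> T V k \<xi> \<omega> N t f (R_h \<Omega> V u0, R_h \<Omega> V u1) U"
    and th: "lifting_polys k \<xi> N t \<theta>"
    and E: "E = (\<lambda>s. (u s, v s) - lifting \<Omega> V t \<theta> f U s)"
  defines "\<epsilon> \<equiv> step_size N t ^ (k + 2)"
  shows "s \<in> {0..T} \<Longrightarrow> nrm (fst (E s)) \<le> C\<^sub>0 * (\<epsilon> + h ^ (r + 1))"
    "s \<in> {0..T} \<Longrightarrow> nrm (snd (E s)) \<le> C\<^sub>0 * (\<epsilon> + h ^ (r + 1))"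
    "s \<in> {0..T} \<Longrightarrow> nrm (grad \<Omega> (fst (E s))) \<le> C\<^sub>1 * (\<epsilon> + h ^ r)"
    "continuous_on {0..T} (\<lambda>s. (nrm (fst (E s)))\<^sup>2)"
    "continuous_on {0..T} (\<lambda>s. (nrm (snd (E s)))\<^sup>2)"
    "continuous_on {0..T} (\<lambda>s. (nrm (grad \<Omega> (fst (E s))))\<^sup>2)"
proof -
  obtain L0 L1 Y where
    lift: "\<And>n s. n < N \<Longrightarrow> s \<in> {t n..t (Suc n)} \<Longrightarrow> lifting \<Omega> V t \<theta> f U s = (comb modes (\<lambda>\<phi>. poly (L0 \<phi> n) s), comb modes (\<lambda>\<phi>. poly (L1 \<phi> n) s))"
    and err: "\<And>n s \<phi>. n < N \<Longrightarrow> s \<in> {t n..t (Suc n)} \<Longrightarrow> \<phi> \<in> modes \<Longrightarrow> sqrt (ev \<phi>) * \<bar>\<alpha> 0 \<phi> s / ev \<phi> - poly (L0 \<phi> n) s\<bar> \<le> (K6 + 1 / sqrt c) * Y \<phi>"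
      "\<And>n s \<phi>. n < N \<Longrightarrow> s \<in> {t n..t (Suc n)} \<Longrightarrow> \<phi> \<in> modes \<Longrightarrow> \<bar>\<alpha> 1 \<phi> s / ev \<phi> - poly (L1 \<phi> n) s\<bar> \<le> K6 * Y \<phi>"
    and Y: "L2_set Y modes \<le> C\<^sub>X * (\<epsilon> + h ^ (r + 1))"
    using lifting_error_modes[OF mesh U th] unfolding \<epsilon>_def by blast
  have steps: "{t n..t (Suc n)} \<subseteq> {0..T}" if n: "n < N" for n
    using time_mesh_mono[OF mesh, of 0 n] time_mesh_mono[OF mesh, of "Suc n" N] n mesh by (auto simp: time_mesh_def)
  have \<epsilon>: "0 \<le> \<epsilon>" using step_size_pos[OF mesh] by (simp add: \<epsilon>_def)
  have hp: "0 \<le> h ^ (r + 1)" "0 \<le> h ^ r" using h by auto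
  have sc: "0 < sqrt c" using c by simp
  define Z where "Z = C\<^sub>6 * (C\<^sub>X * (\<epsilon> + h ^ (r + 1)))"
  have Z0: "0 \<le> Z" using C_nonneg \<epsilon> hp by (simp add: Z_def)
  have weighted: "L2_set e modes \<le> Z" if e: "\<And>\<phi>. \<phi> \<in> modes \<Longrightarrow> \<bar>e \<phi>\<bar> \<le> a * Y \<phi>" and a: "\<bar>a\<bar> \<le> C\<^sub>6" for e a
  proof -
    have "L2_set e modes = L2_set (\<lambda>\<phi>. \<bar>e \<phi>\<bar>) modes" by (simp add: L2_set_def)
    also have "\<dots> \<le> L2_set (\<lambda>\<phi>. a * Y \<phi>) modes" by (rule L2_set_mono[OF e]) auto
    also have "\<dots> = \<bar>a\<bar> * L2_set Y modes"
      by (simp add: L2_set_def power_mult_distrib real_sqrt_mult flip: sum_distrib_left)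
    also have "\<dots> \<le> Z" unfolding Z_def using C_nonneg(1) by (intro mult_mono a Y) auto
    finally show ?thesis .
  qed
  have Dj: "D j s \<in> Sobolev \<Omega> 1" if "s \<in> {0..T}" "j \<in> {0, 1}" for j s
    using D_Sobolev[of j 1 s] that by auto
  have DL: "D j s \<in> L2 \<Omega>" if "s \<in> {0..T}" "j \<in> {0, 1}" for j s
    using Sobolev_L2[OF Dj[OF that]] .
  have cV: "comb modes e \<in> V" for e by (rule comb_V[OF modes_V(1)])
  note cL = V_L2[OF cV] and cS = V_S1[OF cV]
  have fstE: "fst (E s) = (\<lambda>x. D 0 s x - comb modes (\<lambda>\<phi>. poly (L0 \<phi> n) s) x)"
    and sndE: "nrm (snd (E s)) = nrm (\<lambda>x. D 1 s x - comb modes (\<lambda>\<phi>. poly (L1 \<phi> n) s) x)"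
    if n: "n < N" and s: "s \<in> {t n..t (Suc n)}" for n s
  proof -
    have sT: "s \<in> {0..T}" using steps[OF n] s by auto
    show "fst (E s) = (\<lambda>x. D 0 s x - comb modes (\<lambda>\<phi>. poly (L0 \<phi> n) s) x)"
      by (simp add: E lift[OF n s] D0 fun_diff_def)
    have "snd (E s) = (\<lambda>x. v s x - comb modes (\<lambda>\<phi>. poly (L1 \<phi> n) s) x)"
      by (simp add: E lift[OF n s] fun_diff_def)
    then show "nrm (snd (E s)) = nrm (\<lambda>x. D 1 s x - comb modes (\<lambda>\<phi>. poly (L1 \<phi> n) s) x)"
      using v_eq[OF sT] L2_diff[OF v_L2[OF sT] cL] L2_diff[OF DL[OF sT, of 1] cL]
      by (auto intro!: nrm_cong_AE)
  qed
  have split: "(\<lambda>x. D j s x - comb modes e x)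
      = (\<lambda>x. (D j s x - R_h \<Omega> V (D j s) x) + comb modes (\<lambda>\<phi>. \<alpha> j \<phi> s / ev \<phi> - e \<phi>) x)"
    if "s \<in> {0..T}" "j \<in> {0, 1}" for j s e
  proof -
    have R: "R_h \<Omega> V (D j s) = comb modes (\<lambda>\<phi>. \<alpha> j \<phi> s / ev \<phi>)" using R_h_D_modes[of j s] that by auto
    show ?thesis unfolding R comb_diff[symmetric] by auto
  qed
  have RV: "R_h \<Omega> V (D j s) \<in> V" if "s \<in> {0..T}" "j \<in> {0, 1}" for j s
    by (rule R_h_modes(1)[OF Dj[OF that]])
  have RD: "nrm (\<lambda>x. D j s x - R_h \<Omega> V (D j s) x) \<le> C\<^sub>R * K * h ^ (r + 1)"
    "sqrt (dir (\<lambda>x. D j s x - R_h \<Omega> V (D j s) x) (\<lambda>x. D j s x - R_h \<Omega> V (D j s) x)) \<le> C\<^sub>R * K * h ^ r"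
    if "s \<in> {0..T}" "j \<in> {0, 1}" for j s
    using R_h_D[of j s] that by auto
  have L2_split: "nrm (\<lambda>x. D j s x - comb modes e x) \<le> C\<^sub>R * K * h ^ (r + 1) + L2_set (\<lambda>\<phi>. \<alpha> j \<phi> s / ev \<phi> - e \<phi>) modes"
    if sj: "s \<in> {0..T}" "j \<in> {0, 1}" for j s e
    using order_trans[OF nrm_triangle[OF L2_diff[OF DL[OF sj] V_L2[OF RV[OF sj]]] cL] add_right_mono[OF RD(1)[OF sj]]]
    unfolding split[OF sj] nrm_comb .
  have CRK: "0 \<le> C\<^sub>R * K" using CR K0 by simp
  have final: "C\<^sub>R * K * h ^ (r + 1) + Z * q \<le> C\<^sub>0 * (\<epsilon> + h ^ (r + 1))" if "q \<le> 1 + 1 / sqrt c" for q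
  proof -
    have "Z * q \<le> Z * (1 + 1 / sqrt c)" using Z0 that by (rule mult_left_mono[rotated])
    also have "\<dots> = C\<^sub>6 * C\<^sub>X * (1 + 1 / sqrt c) * (\<epsilon> + h ^ (r + 1))" by (simp add: Z_def mult_ac)
    finally have "Z * q \<le> \<dots>" .
    moreover have "C\<^sub>R * K * h ^ (r + 1) \<le> C\<^sub>R * K * (\<epsilon> + h ^ (r + 1))"
      using CRK \<epsilon> by (intro mult_left_mono) auto
    ultimately show ?thesis unfolding C\<^sub>0_def distrib_right[of "C\<^sub>R * K"] by linarith
  qed
  show "nrm (fst (E s)) \<le> C\<^sub>0 * (\<epsilon> + h ^ (r + 1))" "nrm (snd (E s)) \<le> C\<^sub>0 * (\<epsilon> + h ^ (r + 1))"
    "nrm (grad \<Omega> (fst (E s))) \<le> C\<^sub>1 * (\<epsilon> + h ^ r)" if s: "s \<in> {0..T}" for s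
  proof -
    obtain n where n: "n < N" "s \<in> {t n..t (Suc n)}" using time_mesh_cover[OF mesh s] by blast
    define e0 where "e0 \<phi> = \<alpha> 0 \<phi> s / ev \<phi> - poly (L0 \<phi> n) s" for \<phi>
    define e1 where "e1 \<phi> = \<alpha> 1 \<phi> s / ev \<phi> - poly (L1 \<phi> n) s" for \<phi>
    have K6: "\<bar>K6 + 1 / sqrt c\<bar> \<le> C\<^sub>6"
      using abs_triangle_ineq[of K6 "1 / sqrt c"] sc by (simp add: C\<^sub>6_def)
    have g0: "L2_set (\<lambda>\<phi>. sqrt (ev \<phi>) * e0 \<phi>) modes \<le> Z"
      by (rule weighted[of _ "K6 + 1 / sqrt c"])
        (use err(1)[OF n] K6 in \<open>auto simp: e0_def abs_mult ev_pos less_imp_le\<close>)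
    have g1: "L2_set e1 modes \<le> Z"
      by (rule weighted[of _ K6]) (use err(2)[OF n] sc in \<open>auto simp: e1_def C\<^sub>6_def\<close>)
    have "L2_set (\<lambda>\<phi>. sqrt c * e0 \<phi>) modes \<le> L2_set (\<lambda>\<phi>. sqrt (ev \<phi>) * e0 \<phi>) modes"
      unfolding L2_set_def power_mult_distrib
      using c ev_c by (intro real_sqrt_le_mono sum_mono mult_right_mono) (auto simp: ev_pos less_imp_le)
    then have "sqrt c * L2_set e0 modes \<le> Z"
      using g0 L2_set_right_distrib[of "sqrt c" e0 modes] c by simp
    then have g2: "L2_set e0 modes \<le> Z * (1 / sqrt c)" using sc by (simp add: field_simps)
    have "nrm (fst (E s)) \<le> C\<^sub>R * K * h ^ (r + 1) + Z * (1 / sqrt c)"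
      using L2_split[OF s, of 0 "\<lambda>\<phi>. poly (L0 \<phi> n) s"] g2 unfolding fstE[OF n] by (simp add: e0_def[abs_def])
    also have "\<dots> \<le> C\<^sub>0 * (\<epsilon> + h ^ (r + 1))" by (rule final) simp
    finally show "nrm (fst (E s)) \<le> C\<^sub>0 * (\<epsilon> + h ^ (r + 1))" .
    have "nrm (snd (E s)) \<le> C\<^sub>R * K * h ^ (r + 1) + Z * 1"
      using L2_split[OF s, of 1 "\<lambda>\<phi>. poly (L1 \<phi> n) s"] g1 unfolding sndE[OF n] by (simp add: e1_def[abs_def])
    also have "\<dots> \<le> C\<^sub>0 * (\<epsilon> + h ^ (r + 1))" by (rule final) (use sc in simp)
    finally show "nrm (snd (E s)) \<le> C\<^sub>0 * (\<epsilon> + h ^ (r + 1))" .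
    have s0: "s \<in> {0..T}" "0 \<in> {0, 1 :: nat}" using s by auto
    have "nrm (grad \<Omega> (fst (E s))) = sqrt (dir (\<lambda>x. (D 0 s x - R_h \<Omega> V (D 0 s) x) + comb modes e0 x) (\<lambda>x. (D 0 s x - R_h \<Omega> V (D 0 s) x) + comb modes e0 x))"
      unfolding nrm_grad fstE[OF n] split[OF s0] e0_def[abs_def] ..
    also have "\<dots> \<le> C\<^sub>R * K * h ^ r + Z"
      using grad_triangle[OF Sobolev_diff[OF Dj[OF s0] V_S1[OF RV[OF s0]]] cS[of e0]] RD(2)[OF s0] g0
      unfolding dir_comb_sqrt by linarith
    also have "\<dots> \<le> C\<^sub>1 * (\<epsilon> + h ^ r)"
    proof -
      have "h ^ (r + 1) \<le> \<delta> * h ^ r" using h hp by (simp add: mult_right_mono)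
      moreover have "0 \<le> \<delta> * \<epsilon>" using h \<epsilon> by simp
      ultimately have "\<epsilon> + h ^ (r + 1) \<le> (1 + \<delta>) * (\<epsilon> + h ^ r)"
        using hp \<epsilon> unfolding distrib_left distrib_right by linarith
      then have "Z \<le> C\<^sub>6 * (C\<^sub>X * ((1 + \<delta>) * (\<epsilon> + h ^ r)))"
        unfolding Z_def using C_nonneg by (intro mult_left_mono) auto
      moreover have "C\<^sub>R * K * h ^ r \<le> C\<^sub>R * K * (\<epsilon> + h ^ r)" using CRK \<epsilon> by (intro mult_left_mono) auto
      ultimately show ?thesis unfolding C\<^sub>1_def distrib_right[of "C\<^sub>R * K"] by (simp add: mult.assoc)
    qed
    finally show "nrm (grad \<Omega> (fst (E s))) \<le> C\<^sub>1 * (\<epsilon> + h ^ r)" .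
  qed
  have ipc: "continuous_on {0..T} (\<lambda>s. ip (D j s) \<phi>)" "continuous_on {0..T} (\<lambda>s. dir (D j s) \<phi>)"
    if "j \<in> {0, 1}" "\<phi> \<in> modes" for j \<phi>
  proof -
    have j: "j < k + 8" using that by auto
    show "continuous_on {0..T} (\<lambda>s. ip (D j s) \<phi>)"
      by (rule DERIV_continuous_on[OF ip_derivative[OF D_L2[OF j] V_L2[OF modes_V(3)[OF that(2)]]]])
    show "continuous_on {0..T} (\<lambda>s. dir (D j s) \<phi>)"
      by (rule DERIV_continuous_on[OF dir_D_derivative[OF j modes_H10[OF that(2)]]])
  qed
  have ipD: "continuous_on {0..T} (\<lambda>s. ip (D j s) (D j s))" "continuous_on {0..T} (\<lambda>s. dir (D j s) (D j s))"
    if "j \<in> {0, 1}" for j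
    using continuous_on_power[OF sobolev_continuous(1)[of j], of 2] continuous_on_power[OF sobolev_continuous(2)[of j], of 2] that
    by (auto simp: nrm_sq dir_nonneg)
  show "continuous_on {0..T} (\<lambda>s. (nrm (fst (E s)))\<^sup>2)"
  proof (rule time_mesh_continuous[OF mesh])
    fix n assume n: "n < N"
    note sub = continuous_on_subset[OF _ steps[OF n]]
    have "continuous_on {t n..t (Suc n)} (\<lambda>s. ip (D 0 s) (D 0 s) - 2 * (\<Sum>\<phi>\<in>modes. poly (L0 \<phi> n) s * ip (D 0 s) \<phi>) + (\<Sum>\<phi>\<in>modes. (poly (L0 \<phi> n) s)\<^sup>2))"
      by (intro continuous_intros sub[OF ipc(1)] sub[OF ipD(1)]) auto
    then show "continuous_on {t n..t (Suc n)} (\<lambda>s. (nrm (fst (E s)))\<^sup>2)"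
      by (rule continuous_on_eq) (use steps[OF n] DL[of _ 0] in \<open>auto simp: nrm_sq fstE[OF n] ip_minus_comb\<close>)
  qed
  show "continuous_on {0..T} (\<lambda>s. (nrm (snd (E s)))\<^sup>2)"
  proof (rule time_mesh_continuous[OF mesh])
    fix n assume n: "n < N"
    note sub = continuous_on_subset[OF _ steps[OF n]]
    have "continuous_on {t n..t (Suc n)} (\<lambda>s. ip (D 1 s) (D 1 s) - 2 * (\<Sum>\<phi>\<in>modes. poly (L1 \<phi> n) s * ip (D 1 s) \<phi>) + (\<Sum>\<phi>\<in>modes. (poly (L1 \<phi> n) s)\<^sup>2))"
      by (intro continuous_intros sub[OF ipc(1)] sub[OF ipD(1)]) auto
    then show "continuous_on {t n..t (Suc n)} (\<lambda>s. (nrm (snd (E s)))\<^sup>2)"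
    proof (rule continuous_on_eq)
      fix s assume s: "s \<in> {t n..t (Suc n)}"
      have "D 1 s \<in> L2 \<Omega>" using steps[OF n] s by (intro DL) auto
      then show "ip (D 1 s) (D 1 s) - 2 * (\<Sum>\<phi>\<in>modes. poly (L1 \<phi> n) s * ip (D 1 s) \<phi>) + (\<Sum>\<phi>\<in>modes. (poly (L1 \<phi> n) s)\<^sup>2) = (nrm (snd (E s)))\<^sup>2"
        unfolding sndE[OF n s] nrm_sq by (simp only: ip_minus_comb)
    qed
  qed
  show "continuous_on {0..T} (\<lambda>s. (nrm (grad \<Omega> (fst (E s))))\<^sup>2)"
  proof (rule time_mesh_continuous[OF mesh])
    fix n assume n: "n < N"
    note sub = continuous_on_subset[OF _ steps[OF n]]
    have "continuous_on {t n..t (Suc n)} (\<lambda>s. dir (D 0 s) (D 0 s) - 2 * (\<Sum>\<phi>\<in>modes. poly (L0 \<phi> n) s * dir (D 0 s) \<phi>) + (\<Sum>\<phi>\<in>modes. ev \<phi> * (poly (L0 \<phi> n) s)\<^sup>2))"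
      by (intro continuous_intros sub[OF ipc(2)] sub[OF ipD(2)]) auto
    then show "continuous_on {t n..t (Suc n)} (\<lambda>s. (nrm (grad \<Omega> (fst (E s))))\<^sup>2)"
    proof (rule continuous_on_eq)
      fix s assume s: "s \<in> {t n..t (Suc n)}"
      have "D 0 s \<in> Sobolev \<Omega> 1" using steps[OF n] s by (intro Dj) auto
      from dir_minus_comb[OF this]
      show "dir (D 0 s) (D 0 s) - 2 * (\<Sum>\<phi>\<in>modes. poly (L0 \<phi> n) s * dir (D 0 s) \<phi>) + (\<Sum>\<phi>\<in>modes. ev \<phi> * (poly (L0 \<phi> n) s)\<^sup>2) = (nrm (grad \<Omega> (fst (E s))))\<^sup>2"
        unfolding fstE[OF n s] nrm_grad real_sqrt_pow2[OF dir_nonneg] by simp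
    qed
  qed
qed

end

lemma (in bounded_open) derivatives_bounded:
  assumes "C_in (Sobolev \<Omega> m) (Sobolev_norm \<Omega> m) {0..T} m u"
  shows "\<exists>D K. D 0 = u \<and> (\<forall>j<m. has_time_derivative (Sobolev \<Omega> m) (Sobolev_norm \<Omega> m) {0..T} (D j) (D (Suc j))) \<and>
    (\<forall>j<m. \<forall>t\<in>{0..T}. Sobolev_norm \<Omega> m (D j t) \<le> K)"
proof -
  obtain D where D: "D 0 = u" "\<And>j. j < m \<Longrightarrow> has_time_derivative (Sobolev \<Omega> m) (Sobolev_norm \<Omega> m) {0..T} (D j) (D (Suc j))"
    using C_in_derivatives[OF assms] by blast
  have "\<forall>j. \<exists>K. j < m \<longrightarrow> (\<forall>t\<in>{0..T}. Sobolev_norm \<Omega> m (D j t) \<le> K)"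
    using time_derivative_bounded[OF D(2)] by blast
  from choice[OF this] obtain K where K: "\<And>j t. j < m \<Longrightarrow> t \<in> {0..T} \<Longrightarrow> Sobolev_norm \<Omega> m (D j t) \<le> K j" by blast
  have "Sobolev_norm \<Omega> m (D j t) \<le> (\<Sum>j<m. \<bar>K j\<bar>)" if "j < m" "t \<in> {0..T}" for j t
  proof -
    have "\<bar>K j\<bar> \<le> (\<Sum>j<m. \<bar>K j\<bar>)" using that by (intro member_le_sum) auto
    then show ?thesis using K[OF that] by linarith
  qed
  then show ?thesis using D by blast
qed

text \<open>The mesh size is bounded by the diameter of the domain, so that \<open>h\<^bsup>r+1\<^esup>\<close>
  is dominated by \<open>h\<^sup>r\<close> with a constant independent of the mesh.\<close>

lemma mesh_size_bounds:
  fixes \<Omega> :: "(real^'n::finite) set"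
  assumes "bounded \<Omega>" "mesh \<Omega> \<T>"
  shows "0 \<le> mesh_size \<T>" "mesh_size \<T> \<le> diameter (closure \<Omega>)"
proof -
  have fin: "finite \<T>" "\<T> \<noteq> {}" and cover: "(\<Union>F\<in>\<T>. F ` ref_cube) = closure \<Omega>"
    using assms(2) by (auto simp: mesh_def)
  have b: "bounded (closure \<Omega>)" using assms(1) by (rule bounded_closure)
  have sub: "F ` ref_cube \<subseteq> closure \<Omega>" if "F \<in> \<T>" for F using cover that by blast
  show "mesh_size \<T> \<le> diameter (closure \<Omega>)"
    unfolding mesh_size_def using fin sub b by (auto intro!: diameter_subset)
  obtain F where F: "F \<in> \<T>" using fin by blast
  have "0 \<le> diameter (F ` ref_cube)" by (rule diameter_ge_0[OF bounded_subset[OF b sub[OF F]]])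
  also have "\<dots> \<le> mesh_size \<T>" unfolding mesh_size_def using fin F by (intro Max_ge) auto
  finally show "0 \<le> mesh_size \<T>" .
qed

lemma (in fe_space) elliptic_approximation_norms:
  assumes V: "V = V_h \<Omega> \<T> r" and ea: "elliptic_approximation \<Omega> \<T> r C" and h: "0 \<le> mesh_size \<T>"
    and w: "w \<in> H10 \<Omega>" "w \<in> Sobolev \<Omega> (r + 1)"
  shows "nrm (\<lambda>x. w x - R_h \<Omega> V w x) \<le> \<bar>C\<bar> * mesh_size \<T> ^ (r + 1) * Sobolev_norm \<Omega> (r + 1) w"
    "sqrt (dir (\<lambda>x. w x - R_h \<Omega> V w x) (\<lambda>x. w x - R_h \<Omega> V w x)) \<le> \<bar>C\<bar> * mesh_size \<T> ^ r * Sobolev_norm \<Omega> (r + 1) w"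
proof -
  let ?e = "\<lambda>x. w x - R_h \<Omega> V w x"
  have S: "?e \<in> Sobolev \<Omega> 1" by (intro Sobolev_diff H10_Sobolev[OF w(1)] V_S1 R_h_modes(1))
  have abs: "Sobolev_norm \<Omega> m ?e \<le> \<bar>C\<bar> * mesh_size \<T> ^ (r + 1 - m) * Sobolev_norm \<Omega> (r + 1) w" if "m \<in> {0, 1}" for m
  proof -
    have "Sobolev_norm \<Omega> m ?e \<le> C * mesh_size \<T> ^ (r + 1 - m) * Sobolev_norm \<Omega> (r + 1) w"
      using ea w that unfolding elliptic_approximation_def V by (auto simp: fun_diff_def)
    also have "\<dots> \<le> \<bar>C\<bar> * mesh_size \<T> ^ (r + 1 - m) * Sobolev_norm \<Omega> (r + 1) w"
      using h by (intro mult_right_mono Sobolev_norm_nonneg) auto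
    finally show ?thesis .
  qed
  have "nrm ?e \<le> Sobolev_norm \<Omega> 0 ?e"
    using nrm_wd_le_Sobolev_norm[of "[]" 0 ?e] nrm_wd_Nil[OF Sobolev_L2[OF S]] by simp
  then show "nrm ?e \<le> \<bar>C\<bar> * mesh_size \<T> ^ (r + 1) * Sobolev_norm \<Omega> (r + 1) w" using abs[of 0] by simp
  show "sqrt (dir ?e ?e) \<le> \<bar>C\<bar> * mesh_size \<T> ^ r * Sobolev_norm \<Omega> (r + 1) w"
    using dir_le_Sobolev_norm[OF S] abs[of 1] by simp
qed

section \<open>The error estimate\<close>

theorem theorem5p13:
  fixes k r :: nat and \<xi> \<omega> :: "nat \<Rightarrow> real"
  assumes dim: "CARD('n::finite) \<in> {2, 3}"
    and k: "k \<ge> 2"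
    and gl: "gauss_lobatto k \<xi> \<omega>"
  shows "\<exists>m. \<forall>(\<Omega> :: (real^'n) set) T f u0 u1 u v \<sigma> C\<^sub>R.
    polyhedral_domain \<Omega> \<and> T > 0 \<and>
    C_in (L2 \<Omega>) (l2_norm \<Omega>) {0..T} 1 f \<and>
    wave_solution \<Omega> T f u0 u1 u v \<and>
    C_in (Sobolev \<Omega> m) (Sobolev_norm \<Omega> m) {0..T} m u
    \<longrightarrow> (\<exists>C. \<forall>\<T> N t \<theta> U h \<tau> Vh E.
      mesh \<Omega> \<T> \<and> shape_regular \<sigma> \<T> \<and> elliptic_approximation \<Omega> \<T> r C\<^sub>R \<and>
      time_mesh T N t \<and>
      h = mesh_size \<T> \<and> \<tau> = step_size N t \<and> Vh = V_h \<Omega> \<T> r \<and>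
      fully_discrete_solution \<Omega> T Vh k \<xi> \<omega> N t f (R_h \<Omega> Vh u0, R_h \<Omega> Vh u1) U \<and>
      lifting_polys k \<xi> N t \<theta> \<and>
      E = (\<lambda>s. (u s, v s) - lifting \<Omega> Vh t \<theta> f U s)
      \<longrightarrow>
        (\<forall>s\<in>{0..T}. l2_norm \<Omega> (fst (E s)) + l2_norm \<Omega> (snd (E s)) \<le> C * (\<tau> ^ (k + 2) + h ^ (r + 1))) \<and>
        (\<forall>s\<in>{0..T}. l2_norm \<Omega> (grad \<Omega> (fst (E s))) \<le> C * (\<tau> ^ (k + 2) + h ^ r)) \<and>
        L2_time \<Omega> T (\<lambda>s. fst (E s)) \<and> L2_time \<Omega> T (\<lambda>s. snd (E s)) \<and>
        L2_time \<Omega> T (\<lambda>s. grad \<Omega> (fst (E s))) \<and>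
        L2_time_norm \<Omega> T (\<lambda>s. fst (E s)) + L2_time_norm \<Omega> T (\<lambda>s. snd (E s))
          \<le> C * (\<tau> ^ (k + 2) + h ^ (r + 1)) \<and>
        L2_time_norm \<Omega> T (\<lambda>s. grad \<Omega> (fst (E s))) \<le> C * (\<tau> ^ (k + 2) + h ^ r))"
proof (rule exI[of _ "smoothness k r"], intro allI impI, elim conjE)
  fix \<Omega> :: "(real^'n) set" and T :: real and f u v :: "real \<Rightarrow> 'n field" and u0 u1 :: "'n field" and \<sigma> C\<^sub>R :: real
  let ?m = "smoothness k r"
  assume poly: "polyhedral_domain \<Omega>" and T: "0 < T"
    and f: "C_in (L2 \<Omega>) (l2_norm \<Omega>) {0..T} 1 f"
    and sol: "wave_solution \<Omega> T f u0 u1 u v"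
    and u: "C_in (Sobolev \<Omega> ?m) (Sobolev_norm \<Omega> ?m) {0..T} ?m u"
  have \<Omega>: "open \<Omega>" "bounded \<Omega>" using poly by (auto simp: polyhedral_domain_def)
  interpret bounded_open \<Omega> by unfold_locales (rule \<Omega>)+
  obtain f' where f': "has_time_derivative (L2 \<Omega>) nrm {0..T} f f'" using f by auto
  obtain D K where D: "D 0 = u" "\<And>j. j < ?m \<Longrightarrow> has_time_derivative (Sobolev \<Omega> ?m) (Sobolev_norm \<Omega> ?m) {0..T} (D j) (D (Suc j))"
    "\<And>j t. j < ?m \<Longrightarrow> t \<in> {0..T} \<Longrightarrow> Sobolev_norm \<Omega> ?m (D j t) \<le> K"
    using derivatives_bounded[OF u] by blast
  obtain c where c: "0 < c" "\<And>v. v \<in> H10 \<Omega> \<Longrightarrow> c * ip v v \<le> dir v v" using poincare by blast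
  interpret wave_data \<Omega> k \<xi> \<omega> r T f f' u v u0 u1 D K c
    by unfold_locales (use k gl T f' sol D c in auto)
  let ?\<delta> = "diameter (closure \<Omega>)"
  \<comment> \<open>The constant \<open>C\<^sub>R\<close> may be negative, hence the absolute
    value.\<close>
  have dw: "discrete_wave \<Omega> k \<xi> \<omega> r T f f' u v u0 u1 D K c (V_h \<Omega> \<T> r) (mesh_size \<T>) ?\<delta> \<bar>C\<^sub>R\<bar>"
    if mesh: "mesh \<Omega> \<T>" and ea: "elliptic_approximation \<Omega> \<T> r C\<^sub>R" for \<T>
  proof -
    interpret fe: fe_space \<Omega> "V_h \<Omega> \<T> r" by (rule V_h_fe_space[OF \<Omega> mesh])
    note h = mesh_size_bounds[OF \<Omega>(2) mesh]
    show ?thesis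
      by unfold_locales (use h fe.elliptic_approximation_norms[OF refl ea h(1)] in auto)
  qed
  define C0 where "C0 = discrete_wave.C\<^sub>0 TYPE('n) k \<xi> r T K c ?\<delta> \<bar>C\<^sub>R\<bar>"
  define C1 where "C1 = discrete_wave.C\<^sub>1 TYPE('n) k \<xi> r T K c ?\<delta> \<bar>C\<^sub>R\<bar>"
  \<comment> \<open>The factor \<open>1 + sqrt T\<close> covers both the uniform norm and the norm
    in time.\<close>
  define C where "C = max (2 * C0 * (1 + sqrt T)) (C1 * (1 + sqrt T))"
  show "\<exists>C. \<forall>\<T> N t \<theta> U h \<tau> Vh E.
      mesh \<Omega> \<T> \<and> shape_regular \<sigma> \<T> \<and> elliptic_approximation \<Omega> \<T> r C\<^sub>R \<and>
      time_mesh T N t \<and>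
      h = mesh_size \<T> \<and> \<tau> = step_size N t \<and> Vh = V_h \<Omega> \<T> r \<and>
      fully_discrete_solution \<Omega> T Vh k \<xi> \<omega> N t f (R_h \<Omega> Vh u0, R_h \<Omega> Vh u1) U \<and>
      lifting_polys k \<xi> N t \<theta> \<and>
      E = (\<lambda>s. (u s, v s) - lifting \<Omega> Vh t \<theta> f U s)
      \<longrightarrow>
        (\<forall>s\<in>{0..T}. nrm (fst (E s)) + nrm (snd (E s)) \<le> C * (\<tau> ^ (k + 2) + h ^ (r + 1))) \<and>
        (\<forall>s\<in>{0..T}. nrm (grad \<Omega> (fst (E s))) \<le> C * (\<tau> ^ (k + 2) + h ^ r)) \<and>
        L2_time \<Omega> T (\<lambda>s. fst (E s)) \<and> L2_time \<Omega> T (\<lambda>s. snd (E s)) \<and>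
        L2_time \<Omega> T (\<lambda>s. grad \<Omega> (fst (E s))) \<and>
        L2_time_norm \<Omega> T (\<lambda>s. fst (E s)) + L2_time_norm \<Omega> T (\<lambda>s. snd (E s))
          \<le> C * (\<tau> ^ (k + 2) + h ^ (r + 1)) \<and>
        L2_time_norm \<Omega> T (\<lambda>s. grad \<Omega> (fst (E s))) \<le> C * (\<tau> ^ (k + 2) + h ^ r)"
  proof (rule exI[of _ C], intro allI impI, elim conjE)
    fix \<T> N t \<theta> U and h \<tau> :: real and Vh E
    assume mesh: "mesh \<Omega> \<T>" and ea: "elliptic_approximation \<Omega> \<T> r C\<^sub>R" and tm: "time_mesh T N t"
      and h: "h = mesh_size \<T>" and \<tau>: "\<tau> = step_size N t" and Vh: "Vh = V_h \<Omega> \<T> r"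
      and U: "fully_discrete_solution \<Omega> T Vh k \<xi> \<omega> N t f (R_h \<Omega> Vh u0, R_h \<Omega> Vh u1) U"
      and th: "lifting_polys k \<xi> N t \<theta>"
      and E: "E = (\<lambda>s. (u s, v s) - lifting \<Omega> Vh t \<theta> f U s)"
    interpret dw: discrete_wave \<Omega> k \<xi> \<omega> r T f f' u v u0 u1 D K c Vh h ?\<delta> "\<bar>C\<^sub>R\<bar>"
      unfolding Vh h by (rule dw[OF mesh ea])
    let ?a = "\<tau> ^ (k + 2) + h ^ (r + 1)" and ?b = "\<tau> ^ (k + 2) + h ^ r"
    note e = dw.error_norms[OF tm U th E, folded C0_def C1_def \<tau>]
    have C: "0 \<le> C0" "0 \<le> C1" using dw.C_nonneg by (simp_all add: C0_def C1_def)
    have sT: "0 \<le> sqrt T" using T by simp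
    have \<tau>0: "0 \<le> \<tau>" unfolding \<tau> by (rule less_imp_le[OF step_size_pos[OF tm]])
    have ab: "0 \<le> ?a" "0 \<le> ?b" using \<tau>0 dw.h(1) by auto
    have Ca: "2 * C0 * (1 + sqrt T) * ?a \<le> C * ?a" and Cb: "C1 * (1 + sqrt T) * ?b \<le> C * ?b"
      unfolding C_def using ab by (auto intro!: mult_right_mono)
    have pos: "0 \<le> C0 * ?a" "0 \<le> C1 * ?b" "0 \<le> sqrt T * (C0 * ?a)" "0 \<le> sqrt T * (C1 * ?b)"
      using C ab sT by (auto intro!: mult_nonneg_nonneg)
    have Ca': "2 * (C0 * ?a) + 2 * (sqrt T * (C0 * ?a)) \<le> C * ?a"
      by (rule order_trans[OF eq_refl Ca]) algebra
    have Cb': "C1 * ?b + sqrt T * (C1 * ?b) \<le> C * ?b"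
      by (rule order_trans[OF eq_refl Cb]) algebra
    note i0 = L2_time_continuous[OF T e(4) e(1) nrm_nonneg]
      and i1 = L2_time_continuous[OF T e(5) e(2) nrm_nonneg]
      and ig = L2_time_continuous[OF T e(6) e(3) nrm_nonneg]
    show "(\<forall>s\<in>{0..T}. nrm (fst (E s)) + nrm (snd (E s)) \<le> C * ?a) \<and>
        (\<forall>s\<in>{0..T}. nrm (grad \<Omega> (fst (E s))) \<le> C * ?b) \<and>
        L2_time \<Omega> T (\<lambda>s. fst (E s)) \<and> L2_time \<Omega> T (\<lambda>s. snd (E s)) \<and>
        L2_time \<Omega> T (\<lambda>s. grad \<Omega> (fst (E s))) \<and>
        L2_time_norm \<Omega> T (\<lambda>s. fst (E s)) + L2_time_norm \<Omega> T (\<lambda>s. snd (E s)) \<le> C * ?a \<and>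
        L2_time_norm \<Omega> T (\<lambda>s. grad \<Omega> (fst (E s))) \<le> C * ?b"
    proof (intro conjI ballI)
      show "nrm (fst (E s)) + nrm (snd (E s)) \<le> C * ?a" if "s \<in> {0..T}" for s
        using e(1)[OF that] e(2)[OF that] Ca' pos by linarith
      show "nrm (grad \<Omega> (fst (E s))) \<le> C * ?b" if "s \<in> {0..T}" for s
        using e(3)[OF that] Cb' pos by linarith
      show "L2_time_norm \<Omega> T (\<lambda>s. fst (E s)) + L2_time_norm \<Omega> T (\<lambda>s. snd (E s)) \<le> C * ?a"
        using i0(2) i1(2) Ca' pos by linarith
      show "L2_time_norm \<Omega> T (\<lambda>s. grad \<Omega> (fst (E s))) \<le> C * ?b"
        using ig(2) Cb' pos by linarith
    qed (use i0(1) i1(1) ig(1) in auto)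
  qed
qed

end
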